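(* Let $p(\cdot)\in\mathcal{P}\cap{\rm LH}_0\cap{\rm LH}_\infty$, let $w\in A^{\rm loc}_{p(\cdot)}$, and let $N\in\mathbb{N}$ satisfy $N\ge N_{p(\cdot),w}$. Then $h^{p(\cdot)}(w)=L^{p(\cdot)}(w)$ with equivalence of norms.
   Context: Variable exponents: a variable exponent is a measurable function $p(\cdot):\mathbb{R}^n\to(0,\infty)$; $p_-={\rm ess\,inf}\,p$, $p_+={\rm ess\,sup}\,p$. $\mathcal{P}$ is the set of those with $1<p_-\le p_+<\infty$; for these $p'(\cdot)=p(\cdot)/(p(\cdot)-1)$. $p(\cdot)\in{\rm LH}_0$ if there is $c_*>0$ with $|p(x)-p(y)|\le c_*/\log(|x-y|^{-1})$ for $|x-y|\le 1/2$; $p(\cdot)\in{\rm LH}_\infty$ if there are $c^*,p_\infty>0$ with $|p(x)-p_\infty|\le c^*/\log(e+|x|)$ for all $x$. Weights: a weight is a locally integrable function $w$ with $0<w<\infty$ a.e. $\|f\|_{L^{p(\cdot)}(w)}=\inf\{\lambda>0: \int_{\mathbb{R}^n}(|f(x)|/\lambda)^{p(x)}w(x)\,dx\le 1\}$ and $L^{p(\cdot)}(w)$ is the space of measurable $f$ for which this is finite. $\mathcal{Q}$ is the set of compact cubes with edges parallel to the axes; $m_Q(g)=|Q|^{-1}\int_Q g$. $w\in A^{\rm loc}_{p(\cdot)}$ means $\sup_{Q\in\mathcal{Q},|Q|\le1}|Q|^{-1}\|\chi_Q\|_{L^{p(\cdot)}(w)}\|\chi_Q\|_{L^{p'(\cdot)}(\sigma)}<\infty$,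 where $\sigma=w^{-1/(p(\cdot)-1)}$. $w\in A^{\rm loc}_\infty$ means $\sup_{Q\in\mathcal{Q},|Q|\le1} m_Q(w)\exp(-m_Q(\log w))<\infty$; weights in $A^{\rm loc}_{p(\cdot)}$ belong to $A^{\rm loc}_\infty$. For constant $1<u<\infty$, $w\in A^{\rm loc}_u$ means $\sup_{Q\in\mathcal{Q},|Q|\le1} m_Q(w)\,m_Q(w^{-1/(u-1)})^{u-1}<\infty$; $w \in A^{\rm loc}_1$ means $M^{\rm loc}w\le Cw$ a.e. for some $C$, where $M^{\rm loc}f(x)=\sup_{Q\in\mathcal{Q},|Q|\le1}\frac{\chi_Q(x)}{|Q|}\int_Q|f|$. $q_w=\inf\{u\in[1,\infty): w\in A^{\rm loc}_u\}$. With $[\cdot]$ the integer part, $N_{p(\cdot),w}=2+\left[n\left(\frac{q_w}{\min(1,p_-)}-1\right)\right]$. Local Hardy space: $\varphi_t=t^{-n}\varphi(t^{-1}\cdot)$; $\mathcal{D}_N(\mathbb{R}^n)$ is the set of $\varphi\in C^\infty_{\rm c}(\mathbb{R}^n)$ with $\int\varphi\ne0$ and $|\partial^\alpha\varphi|\le\chi_{B(2^{3n+30})}$ for all $|\alpha|\le N+1$ ($B(r)$ is the open ball of radius $r$ centered at $0$). For $f\in\mathcal{D}'(\mathbb{R}^n)$, $\mathcal{M}_Nf(x)=\sup\{|\varphi_t*f(z)|:|z-x|<t<1,\varphi\in\mathcal{D}_N(\mathbb{R}^n)\}$. $h^{p(\cdot)}(w)$ is the set of $f\in\mathcal{D}'(\mathbb{R}^n)$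 with $\|f\|_{h^{p(\cdot)}(w)}=\|\mathcal{M}_Nf\|_{L^{p(\cdot)}(w)}<\infty$. Locally integrable functions are identified with distributions in the usual way. *)

theory Defs
  imports "HOL-Analysis.Analysis" "HOL-Probability.Essential_Supremum"
begin

section \<open>Variable exponents\<close>

text \<open>Throughout, \<open>\<real>\<^sup>n\<close> is \<^typ>\<open>real^'n\<close>, and measurability refers to Lebesgue measurability.\<close>

definition variable_exponent :: "(real^'n \<Rightarrow> real) \<Rightarrow> bool" where
  "variable_exponent p \<longleftrightarrow> p \<in> borel_measurable lebesgue \<and> (\<forall>x. 0 < p x)"

definition exponent_plus :: "(real^'n \<Rightarrow> real) \<Rightarrow> ereal" where
  "exponent_plus p = esssup lebesgue (\<lambda>x. ereal (p x))"

definition exponent_minus :: "(real^'n \<Rightarrow> real) \<Rightarrow> ereal" where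
  "exponent_minus p = - esssup lebesgue (\<lambda>x. - ereal (p x))"

definition exponents_P :: "(real^'n \<Rightarrow> real) set" where
  "exponents_P = {p. variable_exponent p \<and> 1 < exponent_minus p
     \<and> exponent_minus p \<le> exponent_plus p \<and> exponent_plus p < \<infinity>}"

definition conj_exponent :: "(real^'n \<Rightarrow> real) \<Rightarrow> real^'n \<Rightarrow> real" where
  "conj_exponent p x = p x / (p x - 1)"

text \<open>For \<open>x = y\<close> the right-hand side in \<open>LH0\<close> is read as \<open>0\<close>; this agrees with
  the HOL conventions \<open>1 / 0 = 0\<close> and \<open>ln 0 = 0\<close>.\<close>

definition LH0 :: "(real^'n \<Rightarrow> real) set" where
  "LH0 = {p. \<exists>c>0. \<forall>x y. norm (x - y) \<le> 1/2 \<longrightarrow>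
     \<bar>p x - p y\<bar> \<le> c / ln (1 / norm (x - y))}"

definition LHinf :: "(real^'n \<Rightarrow> real) set" where
  "LHinf = {p. \<exists>c>0. \<exists>pinf>0. \<forall>x. \<bar>p x - pinf\<bar> \<le> c / ln (exp 1 + norm x)}"

section \<open>Weighted variable Lebesgue spaces\<close>

definition loc_integrable :: "(real^'n \<Rightarrow> 'b::euclidean_space) \<Rightarrow> bool" where
  "loc_integrable f \<longleftrightarrow> (\<forall>K. compact K \<longrightarrow> f absolutely_integrable_on K)"

definition weight :: "(real^'n \<Rightarrow> real) \<Rightarrow> bool" where
  "weight w \<longleftrightarrow> loc_integrable w \<and> (AE x in lebesgue. 0 < w x)"

text \<open>Powers on \<open>[0,\<infinity>]\<close>, only meant for positive exponents.\<close>

definition epowr :: "ennreal \<Rightarrow> real \<Rightarrow> ennreal" where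
  "epowr a r = (if a = \<infinity> then \<infinity> else ennreal (enn2real a powr r))"

text \<open>The quasi-norm is defined for \<open>[0,\<infinity>]\<close>-valued functions because it is also applied to
  maximal functions; the infimum of the empty set is \<open>\<infinity>\<close>.\<close>

definition Lp_enorm :: "(real^'n \<Rightarrow> real) \<Rightarrow> (real^'n \<Rightarrow> real) \<Rightarrow> (real^'n \<Rightarrow> ennreal) \<Rightarrow> ennreal" where
  "Lp_enorm p w g = Inf {ennreal r | r. 0 < r \<and>
     (\<integral>\<^sup>+x. epowr (g x / ennreal r) (p x) * ennreal (w x) \<partial>lebesgue) \<le> 1}"

definition Lp_norm :: "(real^'n \<Rightarrow> real) \<Rightarrow> (real^'n \<Rightarrow> real) \<Rightarrow> (real^'n \<Rightarrow> complex) \<Rightarrow> ennreal" where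
  "Lp_norm p w f = Lp_enorm p w (\<lambda>x. ennreal (cmod (f x)))"

definition Lp_space :: "(real^'n \<Rightarrow> real) \<Rightarrow> (real^'n \<Rightarrow> real) \<Rightarrow> (real^'n \<Rightarrow> complex) set" where
  "Lp_space p w = {f \<in> borel_measurable lebesgue. Lp_norm p w f < \<infinity>}"

section \<open>Local Muckenhoupt classes\<close>

definition small_cubes :: "(real^'n) set set" where
  "small_cubes = {Q. (\<exists>a l. 0 < l \<and> Q = cbox a (\<chi> i. a $ i + l)) \<and> emeasure lebesgue Q \<le> 1}"

definition cube_mean :: "(real^'n) set \<Rightarrow> (real^'n \<Rightarrow> ennreal) \<Rightarrow> ennreal" where
  "cube_mean Q g = (\<integral>\<^sup>+x\<in>Q. g x \<partial>lebesgue) / emeasure lebesgue Q"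

definition A_loc_var :: "(real^'n \<Rightarrow> real) \<Rightarrow> (real^'n \<Rightarrow> real) set" where
  "A_loc_var p = {w. weight w \<and>
     (SUP Q\<in>small_cubes.
        Lp_enorm p w (indicator Q)
        * Lp_enorm (conj_exponent p) (\<lambda>x. w x powr (- 1 / (p x - 1))) (indicator Q)
        / emeasure lebesgue Q) < \<infinity>}"

definition max_loc :: "(real^'n \<Rightarrow> real) \<Rightarrow> real^'n \<Rightarrow> ennreal" where
  "max_loc f x = (SUP Q\<in>small_cubes. indicator Q x * cube_mean Q (\<lambda>y. ennreal \<bar>f y\<bar>))"

definition A_loc_one :: "(real^'n \<Rightarrow> real) set" where
  "A_loc_one = {w. weight w \<and>
     (\<exists>C::real. AE x in lebesgue. max_loc w x \<le> ennreal C * ennreal (w x))}"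

text \<open>Only meant for \<open>1 \<le> u\<close>.\<close>

definition A_loc :: "real \<Rightarrow> (real^'n \<Rightarrow> real) set" where
  "A_loc u = (if u = 1 then A_loc_one else {w. weight w \<and>
     (SUP Q\<in>small_cubes.
        cube_mean Q (\<lambda>x. ennreal (w x))
        * epowr (cube_mean Q (\<lambda>x. ennreal (w x powr (- 1 / (u - 1))))) (u - 1)) < \<infinity>})"

text \<open>The infimum is over a nonempty set whenever \<open>w\<close> is in some \<open>A_loc_var p\<close>
  with \<open>p \<in> exponents_P\<close>, since then \<open>w\<close> is a local \<open>A\<^sub>\<infinity>\<close> weight.\<close>

definition critical_index :: "(real^'n \<Rightarrow> real) \<Rightarrow> real" where
  "critical_index w = Inf {u. 1 \<le> u \<and> w \<in> A_loc u}"

definition N_index :: "(real^'n \<Rightarrow> real) \<Rightarrow> (real^'n \<Rightarrow> real) \<Rightarrow> int" where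
  "N_index p w = 2 + \<lfloor>real CARD('n) *
     (critical_index w / min 1 (real_of_ereal (exponent_minus p)) - 1)\<rfloor>"

section \<open>Test functions and distributions\<close>

definition partial :: "'n \<Rightarrow> (real^'n \<Rightarrow> complex) \<Rightarrow> real^'n \<Rightarrow> complex" where
  "partial i f x = frechet_derivative f (at x) (axis i 1)"

text \<open>Multi-indices of order \<open>k\<close> are represented by lists of \<open>k\<close> coordinate directions.  For
  smooth functions the order of the list is irrelevant, so that ranging over lists of
  length \<open>k\<close> is the same as ranging over multi-indices of order \<open>k\<close>.\<close>

fun partials :: "'n list \<Rightarrow> (real^'n \<Rightarrow> complex) \<Rightarrow> real^'n \<Rightarrow> complex" where
  "partials [] f = f"
| "partials (i # is) f = partial i (partials is f)"

definition smooth :: "(real^'n \<Rightarrow> complex) \<Rightarrow> bool" where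
  "smooth f \<longleftrightarrow> (\<forall>\<alpha> x. partials \<alpha> f differentiable (at x))"

definition test_functions :: "(real^'n \<Rightarrow> complex) set" where
  "test_functions = {\<phi>. smooth \<phi> \<and> compact (closure {x. \<phi> x \<noteq> 0})}"

text \<open>Continuity is expressed by the usual seminorm estimates.  Distributions
  are made extensional, so that equality is equality on test functions.\<close>

definition distributions :: "((real^'n \<Rightarrow> complex) \<Rightarrow> complex) set" where
  "distributions = {f \<in> extensional test_functions.
     (\<forall>\<phi>\<in>test_functions. \<forall>\<psi>\<in>test_functions. f (\<lambda>x. \<phi> x + \<psi> x) = f \<phi> + f \<psi>) \<and>
     (\<forall>c. \<forall>\<phi>\<in>test_functions. f (\<lambda>x. c * \<phi> x) = c * f \<phi>) \<and>
     (\<forall>K. compact K \<longrightarrow> (\<exists>C m. \<forall>\<phi>\<in>test_functions. {x. \<phi> x \<noteq> 0} \<subseteq> K \<longrightarrow>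
        cmod (f \<phi>) \<le> C * (\<Sum>\<alpha> | length \<alpha> \<le> m. SUP x. cmod (partials \<alpha> \<phi> x))))}"

definition distr_of :: "(real^'n \<Rightarrow> complex) \<Rightarrow> (real^'n \<Rightarrow> complex) \<Rightarrow> complex" where
  "distr_of g = restrict (\<lambda>\<phi>. \<integral>x. g x * \<phi> x \<partial>lebesgue) test_functions"

section \<open>Local Hardy spaces\<close>

definition dilate :: "real \<Rightarrow> (real^'n \<Rightarrow> complex) \<Rightarrow> real^'n \<Rightarrow> complex" where
  "dilate t \<phi> x = (1 / t ^ CARD('n)) *\<^sub>R \<phi> ((1 / t) *\<^sub>R x)"

definition distr_conv :: "(real^'n \<Rightarrow> complex) \<Rightarrow> ((real^'n \<Rightarrow> complex) \<Rightarrow> complex) \<Rightarrow> real^'n \<Rightarrow> complex" where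
  "distr_conv \<phi> f z = f (\<lambda>y. \<phi> (z - y))"

definition D_class :: "nat \<Rightarrow> (real^'n \<Rightarrow> complex) set" where
  "D_class N = {\<phi> \<in> test_functions. (\<integral>x. \<phi> x \<partial>lebesgue) \<noteq> 0 \<and>
     (\<forall>\<alpha> x. length \<alpha> \<le> N + 1 \<longrightarrow>
        cmod (partials \<alpha> \<phi> x) \<le> indicator (ball 0 (2 ^ (3 * CARD('n) + 30))) x)}"

definition grand_max :: "nat \<Rightarrow> ((real^'n \<Rightarrow> complex) \<Rightarrow> complex) \<Rightarrow> real^'n \<Rightarrow> ennreal" where
  "grand_max N f x = Sup {ennreal (cmod (distr_conv (dilate t \<phi>) f z)) | \<phi> t z.
     \<phi> \<in> D_class N \<and> norm (z - x) < t \<and> t < 1}"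

definition hardy_norm ::
  "nat \<Rightarrow> (real^'n \<Rightarrow> real) \<Rightarrow> (real^'n \<Rightarrow> real) \<Rightarrow> ((real^'n \<Rightarrow> complex) \<Rightarrow> complex) \<Rightarrow> ennreal" where
  "hardy_norm N p w f = Lp_enorm p w (grand_max N f)"

definition hardy_space ::
  "nat \<Rightarrow> (real^'n \<Rightarrow> real) \<Rightarrow> (real^'n \<Rightarrow> real) \<Rightarrow> ((real^'n \<Rightarrow> complex) \<Rightarrow> complex) set" where
  "hardy_space N p w = {f \<in> distributions. hardy_norm N p w f < \<infinity>}"

end

theory Submission
  imports Defs
begin

text \<open>For \<open>L\<^sup>p \<subseteq> h\<^sup>p\<close> the grand maximal function is dominated by the local maximal function, which by
  the one third trick reduces to dyadic maximal functions on unit cells.  On a cell, stopping-time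
  (principal) cells turn the dyadic maximal function into a sum of means to which the \<open>A\<^sub>p\<close> condition
  applies; log-Hoelder continuity makes \<open>p\<close> constant on small cells up to a bounded factor, and Doob's
  inequality for the dual weight closes the estimate.  The cells are summed with the decay of \<open>p\<close> at
  infinity.  Conversely, the mollifications of \<open>f\<close> converge to a multiple of \<open>f\<close> and are dominated by its
  grand maximal function, so a weak limit of them is a function representing \<open>f\<close> with the same bound.\<close>

section \<open>Martingale estimates on trees of nested partitions\<close>

text \<open>The modular is not homogeneous, and Jensen's inequality fails for a variable exponent.
  Norms are therefore never computed: bounds are proved for functions of modular at most 1, and the
  two norms of an indicator are replaced by numbers r and s that make the corresponding modulars at
  most 1 (\<open>ap_pair\<close>). Moving the exponent from one point of a cell to another costs a
  factor t^(p(y) - p(z)), which log-Hoelder continuity controls only if t lies between powers of the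
  volume of the cell. For this reason the weight is rescaled on each unit cell until the dual number
  of that cell is 1, and f is replaced by max 1 (f / \<sigma>); both s and the means of the new
  function then have bounds of the required kind. A constant q with 1 < q < p_- is kept throughout:
  the power p/q of the modified function lies in L^q(\<sigma>), so the maximal inequality is needed
  for a constant exponent only. The bound on unit cells is uniform, but the exponent still varies
  from cell to cell; the sum over the cells succeeds at the price of a summable error of size (e +
  |x|)^(-n-2).\<close>

lemma Youngs_inequality_simple:
  fixes a b :: real
  assumes "p > 1" "a \<ge> 0" "b \<ge> 0"
  shows "a * b \<le> a powr p + b powr (p / (p - 1))"
proof -
  have *: "x / t \<le> x" if "x \<ge> 0" "t \<ge> 1" for x t :: real
    using mult_left_mono[OF that(2,1)] that by (simp add: divide_le_eq)
  have "a * b \<le> a powr p / p + b powr (p / (p - 1)) / (p / (p - 1))"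
    by (rule Youngs_inequality) (use assms in \<open>auto simp: field_simps\<close>)
  also have "\<dots> \<le> a powr p + b powr (p / (p - 1))"
    by (intro add_mono *) (use assms in \<open>auto simp: field_simps\<close>)
  finally show ?thesis .
qed

section \<open>Running maxima and stopping indices of a nonnegative sequence\<close>

primrec running_max :: "(nat \<Rightarrow> real) \<Rightarrow> nat \<Rightarrow> real" where
  "running_max s 0 = s 0"
| "running_max s (Suc k) = max (running_max s k) (s (Suc k))"

lemma le_running_max: "j \<le> k \<Longrightarrow> s j \<le> running_max s k"
  by (induction k) (auto simp: le_Suc_eq le_max_iff_disj)

lemma running_max_le: "(\<And>j. j \<le> k \<Longrightarrow> s j \<le> c) \<Longrightarrow> running_max s k \<le> c"
  by (induction k) auto

lemma running_max_nonneg: "(\<And>j. 0 \<le> s j) \<Longrightarrow> 0 \<le> running_max s k"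
  by (induction k) (auto simp: le_max_iff_disj)

lemma running_max_cong: "(\<And>j. j \<le> k \<Longrightarrow> s j = t j) \<Longrightarrow> running_max s k = running_max t k"
  by (induction k) auto

lemma running_max_scale: "0 \<le> c \<Longrightarrow> running_max (\<lambda>j. c * s j) k = c * running_max s k"
  by (induction k) (auto simp: max_mult_distrib_left)

text \<open>The last stopping time up to k: a new one is declared when the value exceeds twice the
  value at the previous one. For the means over the cells around a point, it is the generation of
  the smallest principal cell that contains the point, among the generations up to k.\<close>

primrec principal_index :: "(nat \<Rightarrow> real) \<Rightarrow> nat \<Rightarrow> nat" where
  "principal_index s 0 = 0"
| "principal_index s (Suc k) =
     (if s (Suc k) > 2 * s (principal_index s k) then Suc k else principal_index s k)"

lemma principal_index_le: "principal_index s k \<le> k"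
  by (induction k) auto

lemma principal_index_cong:
  "(\<And>j. j \<le> k \<Longrightarrow> s j = t j) \<Longrightarrow> principal_index s k = principal_index t k"
proof (induction k)
  case (Suc k)
  then show ?case using principal_index_le[of t k] by (auto simp: le_SucI)
qed auto

text \<open>Values after the last stopping time are at most twice the value there, and each new
  stopping time raises that value, so earlier indices remain controlled.\<close>

lemma le_principal_index:
  assumes "\<And>j. 0 \<le> s j" "j \<le> k"
  shows "s j \<le> 2 * s (principal_index s k)"
  using assms(2)
proof (induction k)
  case 0 then show ?case using assms(1)[of 0] by auto
next
  case (Suc k)
  then show ?case using assms(1)[of "Suc k"] assms(1)[of "principal_index s k"]
    by (fastforce simp: le_Suc_eq)
qed

lemma principal_index_mono:
  assumes "\<And>j. 0 \<le> s j" shows "s 0 \<le> s (principal_index s k)"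
proof (induction k)
  case (Suc k) then show ?case using assms[of "principal_index s k"] assms[of 0] by auto
qed auto

lemma principal_index_idem: "principal_index s (principal_index s k) = principal_index s k"
  by (induction k) auto

text \<open>Criterion for a point of a principal cell of generation m to lie in no later principal
  cell up to generation k.\<close>

lemma principal_index_stable:
  assumes "principal_index s m = m" "m \<le> k" "\<And>j. m < j \<Longrightarrow> j \<le> k \<Longrightarrow> s j \<le> 2 * s m"
  shows "principal_index s k = m"
  using assms(2,3)
proof (induction k)
  case 0 then show ?case by auto
next
  case (Suc k)
  show ?case
  proof (cases "m = Suc k")
    case True then show ?thesis using assms(1) by simp
  next
    case False
    then have "principal_index s k = m" using Suc by auto
    then show ?thesis using Suc.prems(2)[of "Suc k"] False Suc.prems(1) by auto
  qed
qed

text \<open>A real number in every case: an infinite integral is sent to 0 by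
  \<open>enn2real\<close>, and division by a vanishing measure gives 0. It is a genuine mean under
  the finiteness hypotheses of \<open>ennreal_mean_mult\<close>.\<close>

definition mean :: "'a measure \<Rightarrow> ('a \<Rightarrow> real) \<Rightarrow> 'a set \<Rightarrow> real" where
  "mean N h Q = enn2real (\<integral>\<^sup>+x\<in>Q. ennreal (h x) \<partial>N) / measure N Q"

lemma mean_nonneg: "0 \<le> mean N h Q"
  by (simp add: mean_def)

lemma ennreal_mean_mult:
  assumes "Q \<in> sets N" "emeasure N Q < \<infinity>" "(\<integral>\<^sup>+x\<in>Q. ennreal (h x) \<partial>N) < \<infinity>"
    "h \<in> borel_measurable N"
  shows "ennreal (mean N h Q) * emeasure N Q = (\<integral>\<^sup>+x\<in>Q. ennreal (h x) \<partial>N)"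
proof (cases "measure N Q = 0")
  case True
  then have z: "emeasure N Q = 0" using assms(2) by (simp add: emeasure_eq_ennreal_measure)
  then have "(\<integral>\<^sup>+x\<in>Q. ennreal (h x) \<partial>N) = 0"
    using assms(1) by (intro nn_integral_null_set) auto
  then show ?thesis using z by simp
next
  case False
  have "ennreal (mean N h Q) * emeasure N Q = ennreal (mean N h Q * measure N Q)"
    using assms(2) by (simp add: emeasure_eq_ennreal_measure ennreal_mult mean_nonneg)
  also have "\<dots> = ennreal (enn2real (\<integral>\<^sup>+x\<in>Q. ennreal (h x) \<partial>N))"
    using False by (simp add: mean_def)
  finally show ?thesis using assms(3) by simp
qed

text \<open>A nested sequence of partitions, encoded by the map that sends a point to its cell of
  generation k. \<open>cell_self\<close> and \<open>cell_eq\<close> make the cells of one generation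
  the classes of an equivalence relation, so no enumeration of the cells is needed.\<close>

locale dyadic_tree =
  fixes c :: "nat \<Rightarrow> 'a \<Rightarrow> 'a set" and X :: "'a set"
  assumes cell_0: "x \<in> X \<Longrightarrow> c 0 x = X"
    and cell_self: "x \<in> c k x"
    and cell_eq: "y \<in> c k x \<Longrightarrow> c k y = c k x"
    and cell_Suc: "c (Suc k) x \<subseteq> c k x"
    and finite_cells: "finite (c k ` X)"
begin

lemma cell_mono: "j \<le> k \<Longrightarrow> c k x \<subseteq> c j x"
  by (induction k) (use cell_Suc le_Suc_eq in blast)+

lemma cell_subset: "x \<in> X \<Longrightarrow> c k x \<subseteq> X"
  using cell_mono[of 0 k x] cell_0 by auto

lemma cell_eq': "y \<in> c k x \<Longrightarrow> j \<le> k \<Longrightarrow> c j y = c j x"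
  using cell_eq cell_mono by blast

lemma cell_unique: "Q \<in> c k ` A \<Longrightarrow> x \<in> Q \<Longrightarrow> Q = c k x"
  using cell_eq by blast

lemma indicator_cells:
  assumes "D \<subseteq> X" "\<And>x. x \<in> D \<Longrightarrow> c k x \<subseteq> D"
  shows "(\<Sum>Q\<in>c k ` D. indicator Q y) = (indicator D y :: ennreal)"
proof -
  have fin: "finite (c k ` D)" by (rule finite_subset[OF image_mono[OF assms(1)] finite_cells])
  show ?thesis
  proof (cases "y \<in> D")
    case True
    have "(\<Sum>Q\<in>c k ` D. indicator Q y :: ennreal) = (\<Sum>Q\<in>{c k y}. indicator Q y)"
      by (rule sum.mono_neutral_right)
        (use fin True cell_self cell_eq in \<open>auto simp: indicator_def\<close>)
    then show ?thesis using True cell_self by auto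
  next
    case False
    then show ?thesis using assms by (force simp: indicator_def intro!: sum.neutral)
  qed
qed

lemma nn_integral_cells:
  assumes "D \<subseteq> X" "\<And>x. x \<in> D \<Longrightarrow> c k x \<subseteq> D"
    and "\<And>x. x \<in> X \<Longrightarrow> (\<lambda>y. u y * indicator (c k x) y) \<in> borel_measurable N"
  shows "(\<integral>\<^sup>+x\<in>D. u x \<partial>N) = (\<Sum>Q\<in>c k ` D. \<integral>\<^sup>+x\<in>Q. u x \<partial>N)"
proof -
  have "(\<integral>\<^sup>+x\<in>D. u x \<partial>N) = (\<integral>\<^sup>+x. (\<Sum>Q\<in>c k ` D. u x * indicator Q x) \<partial>N)"
    by (simp add: sum_distrib_left[symmetric] indicator_cells[OF assms(1,2)])
  also have "\<dots> = (\<Sum>Q\<in>c k ` D. \<integral>\<^sup>+x\<in>Q. u x \<partial>N)"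
    by (rule nn_integral_sum) (use assms in auto)
  finally show ?thesis .
qed

lemma measurable_cellwise:
  fixes u :: "'a \<Rightarrow> real"
  assumes "\<And>x k. x \<in> X \<Longrightarrow> c k x \<in> sets N"
    and "\<And>x y. x \<in> X \<Longrightarrow> y \<in> c k x \<Longrightarrow> u y = u x"
  shows "(\<lambda>x. indicator X x * u x) \<in> borel_measurable N"
proof -
  have fin: "finite (c k ` X)" by (rule finite_cells)
  \<comment> \<open>The value on a cell Q is read off at an arbitrary point of Q; the choice is
    immaterial because u is constant on Q.\<close>
  have "(\<lambda>x. indicator X x * u x) = (\<lambda>x. \<Sum>Q\<in>c k ` X. indicator Q x * u (SOME y. y \<in> Q))"
  proof
    fix x
    show "indicator X x * u x = (\<Sum>Q\<in>c k ` X. indicator Q x * u (SOME y. y \<in> Q))"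
    proof (cases "x \<in> X")
      case True
      have "(\<Sum>Q\<in>c k ` X. indicator Q x * u (SOME y. y \<in> Q))
          = (\<Sum>Q\<in>{c k x}. indicator Q x * u (SOME y. y \<in> Q))"
      proof (rule sum.mono_neutral_right[OF fin])
        show "{c k x} \<subseteq> c k ` X" using True by simp
        show "\<forall>Q\<in>c k ` X - {c k x}. indicator Q x * u (SOME y. y \<in> Q) = 0"
        proof
          fix Q assume "Q \<in> c k ` X - {c k x}"
          then have "x \<notin> Q" using cell_unique[of Q k X x] by auto
          then show "indicator Q x * u (SOME y. y \<in> Q) = 0" by simp
        qed
      qed
      moreover have "u (SOME y. y \<in> c k x) = u x"
        by (rule assms(2)[OF True]) (rule someI, rule cell_self)
      ultimately show ?thesis using True cell_self by simp
    next
      case False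
      have "indicator Q x * u (SOME y. y \<in> Q) = 0" if "Q \<in> c k ` X" for Q
        using that False cell_subset by (auto simp: indicator_def)
      then show ?thesis using False by (simp add: sum.neutral)
    qed
  qed
  also have "\<dots> \<in> borel_measurable N" 
    by (rule borel_measurable_sum) (use assms(1) in \<open>auto intro!: borel_measurable_times\<close>)
  finally show ?thesis .
qed

lemma sets_cellwise:
  assumes "\<And>x. x \<in> X \<Longrightarrow> c k x \<in> sets N" "D \<subseteq> X" "\<And>x. x \<in> D \<Longrightarrow> c k x \<subseteq> D"
  shows "D \<in> sets N"
proof -
  have "D = \<Union> (c k ` D)"
  proof
    show "D \<subseteq> \<Union> (c k ` D)" using cell_self by auto
    show "\<Union> (c k ` D) \<subseteq> D" using assms(3) by (intro UN_least)
  qed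
  moreover have "finite (c k ` D)" by (rule finite_subset[OF image_mono[OF assms(2)] finite_cells])
  moreover have "c k ` D \<subseteq> sets N" using assms(1,2) by blast
  ultimately show ?thesis using sets.finite_Union[of "c k ` D" N] by simp
qed

end

section \<open>Maximal and stopping-time estimates for the means of a function\<close>

locale dyadic_tree_measure = dyadic_tree c X for c :: "nat \<Rightarrow> 'a \<Rightarrow> 'a set" and X +
  fixes N :: "'a measure" and h :: "'a \<Rightarrow> real"
  assumes sets_cell: "x \<in> X \<Longrightarrow> c k x \<in> sets N"
    and finite_X: "emeasure N X < \<infinity>"
    and h_meas[measurable]: "h \<in> borel_measurable N"
    and h_nonneg: "\<And>x. 0 \<le> h x"
    and h_int: "(\<integral>\<^sup>+x\<in>X. ennreal (h x) \<partial>N) < \<infinity>"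
begin

abbreviation "m k x \<equiv> mean N h (c k x)"
abbreviation "S k x \<equiv> running_max (\<lambda>j. m j x) k"

lemma X_sets: "X \<noteq> {} \<Longrightarrow> X \<in> sets N"
  using sets_cell[of _ 0] cell_0 by fastforce

lemma finite_subset_X: "D \<subseteq> X \<Longrightarrow> emeasure N D < \<infinity>"
proof (cases "D = {}")
  case False
  assume "D \<subseteq> X"
  with False have "emeasure N D \<le> emeasure N X" by (intro emeasure_mono X_sets) auto
  then show ?thesis using finite_X by (simp add: le_less_trans)
qed simp

lemma int_subset_X: "D \<subseteq> X \<Longrightarrow> (\<integral>\<^sup>+x\<in>D. ennreal (h x) \<partial>N) < \<infinity>"
  by (rule le_less_trans[OF _ h_int], rule nn_integral_mono) (auto simp: indicator_def)

lemma mean_mult_cell: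
  "x \<in> X \<Longrightarrow> ennreal (m k x) * emeasure N (c k x) = (\<integral>\<^sup>+y\<in>c k x. ennreal (h y) \<partial>N)"
  by (intro ennreal_mean_mult sets_cell finite_subset_X int_subset_X cell_subset) auto

lemma S_nonneg: "0 \<le> S k x"
  by (intro running_max_nonneg mean_nonneg)

lemma S_cong: "y \<in> c k x \<Longrightarrow> S k y = S k x"
  by (intro running_max_cong) (simp add: cell_eq')

text \<open>The tower property: \<open>m k\<close> is the conditional expectation of h with respect
  to the finite algebra generated by the cells of generation k, and G is measurable for this
  algebra.\<close>

lemma tower:
  fixes G :: "'a \<Rightarrow> real"
  assumes G: "\<And>x y. x \<in> X \<Longrightarrow> y \<in> c k x \<Longrightarrow> G y = G x"
  shows "(\<integral>\<^sup>+x\<in>X. ennreal (G x) * ennreal (m k x) \<partial>N) = (\<integral>\<^sup>+x\<in>X. ennreal (G x) * ennreal (h x) \<partial>N)"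
proof -
  have ind: "ennreal (G y) * f y * indicator (c k x) y = ennreal (G x) * (f y * indicator (c k x) y)"
    if "x \<in> X" for x y f using G[OF that] by (auto simp: indicator_def)
  note ind = ind[where f="\<lambda>y. ennreal (h y)"] ind[where f="\<lambda>y. ennreal (m k y)"]
  have ind2: "ennreal (m k y) * indicator (c k x) y = ennreal (m k x) * indicator (c k x) y"
    for x y using cell_eq by (auto simp: indicator_def)
  have "(\<integral>\<^sup>+x\<in>X. ennreal (G x) * ennreal (m k x) \<partial>N)
      = (\<Sum>Q\<in>c k ` X. \<integral>\<^sup>+x\<in>Q. ennreal (G x) * ennreal (m k x) \<partial>N)"
    by (rule nn_integral_cells) (use sets_cell in \<open>auto simp: cell_subset ind ind2\<close>)
  also have "\<dots> = (\<Sum>Q\<in>c k ` X. \<integral>\<^sup>+x\<in>Q. ennreal (G x) * ennreal (h x) \<partial>N)"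
  proof (rule sum.cong, rule refl)
    fix Q assume "Q \<in> c k ` X"
    then obtain x where x: "x \<in> X" "Q = c k x" by auto
    have "(\<integral>\<^sup>+y\<in>Q. ennreal (G y) * ennreal (m k y) \<partial>N) = ennreal (G x) * (ennreal (m k x) * emeasure N Q)"
      unfolding x ind[OF x(1)] unfolding ind2[of _ x] mult.assoc[symmetric]
      using sets_cell[OF x(1), of k] by (simp add: nn_integral_cmult_indicator ennreal_mult' mean_nonneg flip: ennreal_mult)
    also have "\<dots> = ennreal (G x) * (\<integral>\<^sup>+y\<in>Q. ennreal (h y) \<partial>N)"
      using mean_mult_cell[OF x(1)] x(2) by simp
    also have "\<dots> = (\<integral>\<^sup>+y\<in>Q. ennreal (G y) * ennreal (h y) \<partial>N)"
      using sets_cell[OF x(1), of k] by (simp add: x ind nn_integral_cmult)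
    finally show "(\<integral>\<^sup>+y\<in>Q. ennreal (G y) * ennreal (m k y) \<partial>N) = (\<integral>\<^sup>+y\<in>Q. ennreal (G y) * ennreal (h y) \<partial>N)" .
  qed
  also have "\<dots> = (\<integral>\<^sup>+x\<in>X. ennreal (G x) * ennreal (h x) \<partial>N)"
    by (rule nn_integral_cells[symmetric]) (use sets_cell in \<open>auto simp: cell_subset ind\<close>)
  finally show ?thesis .
qed

text \<open>A pathwise proof of Doob's inequality. With A_k the integral of S_k^q and B_k that of
  S_k^(q-1) h, the quantity (q - 1) A_k - q B_k does not increase with k and is not positive for k =
  0. Hence (q - 1) A_T \<le> q B_T, and Young's inequality lets half of the left side be
  absorbed.\<close>

lemma doob:
  assumes q: "q > 1"
  shows "(\<integral>\<^sup>+x\<in>X. ennreal (S T x powr q) \<partial>N)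
    \<le> ennreal (2 powr q / (q - 1)) * (\<integral>\<^sup>+x\<in>X. ennreal (h x powr q) \<partial>N)"
proof (cases "X = {}")
  case False
  define A where "A k = (\<integral>\<^sup>+x\<in>X. ennreal (S k x powr q) \<partial>N)" for k
  define B where "B k = (\<integral>\<^sup>+x\<in>X. ennreal (S k x powr (q - 1)) * ennreal (h x) \<partial>N)" for k
  have B_tower: "B j = (\<integral>\<^sup>+x\<in>X. ennreal (S j x powr (q - 1)) * ennreal (m k x) \<partial>N)" if "j \<le> k" for j k
    unfolding B_def using that
    by (intro tower[symmetric]) (metis S_cong cell_mono subsetD)
  obtain x0 where x0: "x0 \<in> X" using False by auto
  have Xs[measurable]: "X \<in> sets N" using X_sets False .
  have bdd: "\<exists>b\<ge>0. \<forall>x\<in>X. S k x \<le> b" for k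
  proof -
    have "finite (S k ` X)"
    proof (rule finite_subset)
      show "S k ` X \<subseteq> (\<lambda>Q. S k (SOME y. y \<in> Q)) ` (c k ` X)"
      proof
        fix v assume "v \<in> S k ` X"
        then obtain x where x: "x \<in> X" "v = S k x" by auto
        have "S k (SOME y. y \<in> c k x) = S k x" by (rule S_cong, rule someI, rule cell_self)
        then show "v \<in> (\<lambda>Q. S k (SOME y. y \<in> Q)) ` (c k ` X)"
          unfolding x(2) by (intro image_eqI[of _ _ "c k x"]) (use x in auto)
      qed
    qed (use finite_cells in auto)
    then have f: "finite (insert 0 (S k ` X))" by simp
    show ?thesis
      by (rule exI[of _ "Max (insert 0 (S k ` X))"]) (use f in \<open>auto intro: Max_ge\<close>)
  qed
  \<comment> \<open>Cancellation in \<open>ennreal\<close> requires A and B to be finite. They are,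
    because S k takes finitely many values and h is integrable.\<close>
  have A_fin: "A k < \<infinity>" for k
  proof -
    obtain b where b: "b \<ge> 0" "\<And>x. x \<in> X \<Longrightarrow> S k x \<le> b" using bdd by blast
    have "A k \<le> (\<integral>\<^sup>+x. ennreal (b powr q) * indicator X x \<partial>N)"
      unfolding A_def using b S_nonneg q
      by (intro nn_integral_mono) (auto simp: indicator_def intro!: ennreal_leI powr_mono2)
    also have "\<dots> = ennreal (b powr q) * emeasure N X" by (simp add: nn_integral_cmult_indicator)
    also have "\<dots> < \<infinity>" using finite_X by (simp add: ennreal_mult_less_top)
    finally show ?thesis .
  qed
  have B_fin: "B k < \<infinity>" for k
  proof -
    obtain b where b: "b \<ge> 0" "\<And>x. x \<in> X \<Longrightarrow> S k x \<le> b" using bdd by blast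
    have "B k \<le> (\<integral>\<^sup>+x. ennreal (b powr (q - 1)) * (ennreal (h x) * indicator X x) \<partial>N)"
      unfolding B_def using b S_nonneg q
      by (intro nn_integral_mono)
        (auto simp: indicator_def intro!: mult_right_mono ennreal_leI powr_mono2)
    also have "\<dots> = ennreal (b powr (q - 1)) * (\<integral>\<^sup>+x\<in>X. ennreal (h x) \<partial>N)"
      by (simp add: nn_integral_cmult)
    also have "\<dots> < \<infinity>" using h_int by (simp add: ennreal_mult_less_top)
    finally show ?thesis .
  qed
  have SXm: "(\<lambda>x. f (S k x) * indicator X x) \<in> borel_measurable N" for k and f :: "real \<Rightarrow> real"
  proof -
    have "(\<lambda>x. indicator X x * f (S k x)) \<in> borel_measurable N"
      by (rule measurable_cellwise[where k=k]) (use sets_cell S_cong in auto)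
    then show ?thesis by (simp add: mult.commute)
  qed
  have SXe[measurable]: "(\<lambda>x. ennreal (f (S k x)) * indicator X x) \<in> borel_measurable N" for k and f :: "real \<Rightarrow> real"
  proof -
    have "(\<lambda>x. ennreal (f (S k x) * indicator X x)) \<in> borel_measurable N"
      using SXm by measurable
    moreover have "ennreal (f (S k x) * indicator X x) = ennreal (f (S k x)) * indicator X x" for x
      by (auto simp: indicator_def)
    ultimately show ?thesis by simp
  qed
  have mXm[measurable]: "(\<lambda>x. ennreal (m k x) * indicator X x) \<in> borel_measurable N" for k
  proof -
    have "(\<lambda>x. indicator X x * m k x) \<in> borel_measurable N"
      by (rule measurable_cellwise[where k=k]) (use sets_cell cell_eq in auto)
    then have "(\<lambda>x. ennreal (indicator X x * m k x)) \<in> borel_measurable N" by measurable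
    moreover have "ennreal (indicator X x * m k x) = ennreal (m k x) * indicator X x" for x
      by (auto simp: indicator_def)
    ultimately show ?thesis by simp
  qed
  \<comment> \<open>By the tower property h may be replaced by \<open>m (Suc k)\<close> in B k and
    in B (Suc k). The claim then is the pointwise inequality \<open>pt\<close> with s = S k and t =
    m (Suc k), where max s t is S (Suc k). For t > s it is Young's inequality for s^(q-1) and
    t.\<close>
  have step: "ennreal (q - 1) * A (Suc k) + ennreal q * B k \<le> ennreal (q - 1) * A k + ennreal q * B (Suc k)" for k
  proof -
    have pt: "(q - 1) * max s t powr q + q * (s powr (q - 1) * t)
        \<le> (q - 1) * s powr q + q * (max s t powr (q - 1) * t)" if "s \<ge> 0" "t \<ge> 0" for s t :: real
    proof (cases "t \<le> s")
      case True then show ?thesis by (simp add: max_def)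
    next
      case False
      have "s powr (q - 1) * t \<le> (s powr (q - 1)) powr (q / (q - 1)) / (q / (q - 1)) + t powr q / q"
        by (rule Youngs_inequality) (use q that in \<open>auto simp: field_simps\<close>)
      then have "q * (s powr (q - 1) * t) \<le> q * (s powr q / (q / (q - 1)) + t powr q / q)"
        using q by (intro mult_left_mono) (auto simp: powr_powr)
      also have "\<dots> = (q - 1) * s powr q + t powr q" using q by (simp add: field_simps)
      finally have "q * (s powr (q - 1) * t) \<le> (q - 1) * s powr q + t powr q" .
      moreover have "t powr (q - 1) * t = t powr q" using False that by (simp add: powr_diff)
      ultimately show ?thesis using False by (simp add: max_def algebra_simps)
    qed
    have i1: "ennreal (q - 1) * A j = (\<integral>\<^sup>+x. ennreal (q - 1) * (ennreal (S j x powr q) * indicator X x) \<partial>N)" for j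
      unfolding A_def using SXe[of "\<lambda>x. x powr q"] by (subst nn_integral_cmult) auto
    have meas2: "(\<lambda>x. ennreal (S j x powr (q - 1)) * ennreal (m i x) * indicator X x) \<in> borel_measurable N" for i j
    proof -
      have "(\<lambda>x. (ennreal (S j x powr (q - 1)) * indicator X x) * (ennreal (m i x) * indicator X x)) \<in> borel_measurable N"
        using SXe[of "\<lambda>x. x powr (q - 1)" j] mXm by (rule borel_measurable_times_ennreal)
      moreover have "(ennreal (S j x powr (q - 1)) * indicator X x) * (ennreal (m i x) * indicator X x) = ennreal (S j x powr (q - 1)) * ennreal (m i x) * indicator X x" for x
        by (auto simp: indicator_def)
      ultimately show ?thesis by simp
    qed
    have i2: "ennreal q * B j = (\<integral>\<^sup>+x. ennreal q * (ennreal (S j x powr (q - 1)) * ennreal (m (Suc k) x) * indicator X x) \<partial>N)" if "j \<le> Suc k" for j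
      unfolding B_tower[OF that] using meas2 by (subst nn_integral_cmult) auto
    have "ennreal (q - 1) * A (Suc k) + ennreal q * B k
       = (\<integral>\<^sup>+x. ennreal (q - 1) * (ennreal (S (Suc k) x powr q) * indicator X x) + ennreal q * (ennreal (S k x powr (q - 1)) * ennreal (m (Suc k) x) * indicator X x) \<partial>N)"
      unfolding i1 i2[OF le_SucI[OF le_refl]]
      by (rule nn_integral_add[symmetric]; intro borel_measurable_times_ennreal borel_measurable_const SXe[of "\<lambda>x. x powr q"] meas2)
    also have "\<dots> \<le> (\<integral>\<^sup>+x. ennreal (q - 1) * (ennreal (S k x powr q) * indicator X x) + ennreal q * (ennreal (S (Suc k) x powr (q - 1)) * ennreal (m (Suc k) x) * indicator X x) \<partial>N)"
    proof (rule nn_integral_mono)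
      fix x
      show "ennreal (q - 1) * (ennreal (S (Suc k) x powr q) * indicator X x) + ennreal q * (ennreal (S k x powr (q - 1)) * ennreal (m (Suc k) x) * indicator X x) \<le> ennreal (q - 1) * (ennreal (S k x powr q) * indicator X x) + ennreal q * (ennreal (S (Suc k) x powr (q - 1)) * ennreal (m (Suc k) x) * indicator X x)"
      proof (cases "x \<in> X")
        case True
        show ?thesis
          using pt[of "S k x" "m (Suc k) x"] S_nonneg[of x k] q True
          by (simp add: mean_nonneg flip: ennreal_mult ennreal_plus)
      qed simp
    qed
    also have "\<dots> = ennreal (q - 1) * A k + ennreal q * B (Suc k)"
      unfolding i1 i2[OF le_refl]
      by (rule nn_integral_add; intro borel_measurable_times_ennreal borel_measurable_const SXe[of "\<lambda>x. x powr q"] meas2)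
    finally show ?thesis .
  qed
  have key: "ennreal (q - 1) * A T \<le> ennreal q * B T"
  proof (induction T)
    case 0
    have "A 0 = B 0"
      unfolding B_tower[OF le_refl] A_def
      by (intro nn_integral_cong)
        (use mean_nonneg[of N h] in \<open>auto simp: indicator_def powr_diff simp flip: ennreal_mult split: if_splits\<close>)
    then show ?case using q by (auto intro!: mult_right_mono ennreal_leI)
  next
    case (Suc T)
    have "ennreal (q - 1) * A (Suc T) + ennreal q * B T \<le> ennreal q * B T + ennreal q * B (Suc T)"
      by (rule order_trans[OF step]) (use Suc in \<open>auto intro: add_right_mono\<close>)
    then have "ennreal q * B T + ennreal (q - 1) * A (Suc T) \<le> ennreal q * B T + ennreal q * B (Suc T)"
      by (simp add: add.commute)
    then show ?case using B_fin[of T]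
      by (subst (asm) ennreal_add_left_cancel_le) (auto simp: ennreal_mult_eq_top_iff)
  qed
  define H where "H = (\<integral>\<^sup>+x\<in>X. ennreal (h x powr q) \<partial>N)"
  \<comment> \<open>Young's inequality with a weight d such that d^(q/(q-1)) = 1/2. The term s^q
    receives the factor (q - 1) / 2, half of the factor on the left of \<open>key\<close>.\<close>
  have pt: "q * (s powr (q - 1) * t) \<le> (q - 1) / 2 * s powr q + 2 powr (q - 1) * t powr q"
    if "s \<ge> 0" "t \<ge> 0" for s t :: real
  proof -
    define d where "d = (1/2::real) powr ((q - 1) / q)"
    have d: "d > 0" by (simp add: d_def)
    have "s powr (q - 1) * t = (d * s powr (q - 1)) * (t / d)" using d by simp
    also have "\<dots> \<le> (d * s powr (q - 1)) powr (q / (q - 1)) / (q / (q - 1)) + (t / d) powr q / q"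
      by (rule Youngs_inequality) (use q that d in \<open>auto simp: field_simps\<close>)
    also have "(d * s powr (q - 1)) powr (q / (q - 1)) = s powr q / 2"
      using q d by (simp add: powr_mult powr_powr d_def)
    also have "(t / d) powr q = 2 powr (q - 1) * t powr q"
      using q that by (simp add: powr_divide powr_mult powr_powr d_def)
    finally have "q * (s powr (q - 1) * t) \<le> q * (s powr q / 2 / (q / (q - 1)) + 2 powr (q - 1) * t powr q / q)"
      using q by (intro mult_left_mono) auto
    also have "\<dots> = (q - 1) / 2 * s powr q + 2 powr (q - 1) * t powr q" using q by (simp add: field_simps)
    finally show ?thesis .
  qed
  have "ennreal q * B T = (\<integral>\<^sup>+x. ennreal q * (ennreal (S T x powr (q - 1)) * indicator X x * ennreal (h x)) \<partial>N)"
  proof -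
    have [measurable]: "(\<lambda>x. ennreal (S T x powr (q - 1)) * indicator X x * ennreal (h x)) \<in> borel_measurable N"
      using SXe[of "\<lambda>x. x powr (q - 1)" T] by measurable
    show ?thesis unfolding B_def
      by (subst nn_integral_cmult) (measurable, auto intro!: arg_cong2[where f="(*)"] nn_integral_cong simp: mult_ac)
  qed
  also have "\<dots> \<le> (\<integral>\<^sup>+x. ennreal ((q - 1) / 2) * (ennreal (S T x powr q) * indicator X x) + ennreal (2 powr (q - 1)) * (ennreal (h x powr q) * indicator X x) \<partial>N)"
  proof (rule nn_integral_mono)
    fix x
    show "ennreal q * (ennreal (S T x powr (q - 1)) * indicator X x * ennreal (h x)) \<le> ennreal ((q - 1) / 2) * (ennreal (S T x powr q) * indicator X x) + ennreal (2 powr (q - 1)) * (ennreal (h x powr q) * indicator X x)"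
    proof (cases "x \<in> X")
      case True
      show ?thesis
        using pt[of "S T x" "h x"] S_nonneg[of x T] q True
        by (simp add: h_nonneg del: ennreal_plus ennreal_mult flip: ennreal_mult ennreal_plus)
    qed simp
  qed
  also have "\<dots> = ennreal ((q - 1) / 2) * A T + ennreal (2 powr (q - 1)) * H"
    unfolding A_def H_def using SXe[of "\<lambda>x. x powr q" T]
    by (subst nn_integral_add) (auto simp: nn_integral_cmult)
  finally have "ennreal (q - 1) * A T \<le> ennreal ((q - 1) / 2) * A T + ennreal (2 powr (q - 1)) * H"
    using key by (rule order_trans[rotated])
  moreover have "ennreal (q - 1) * A T = ennreal ((q - 1) / 2) * A T + ennreal ((q - 1) / 2) * A T"
    using q by (simp add: distrib_right[symmetric] flip: ennreal_plus)
  ultimately have le: "ennreal ((q - 1) / 2) * A T \<le> ennreal (2 powr (q - 1)) * H"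
    using A_fin[of T]
    by (auto simp: ennreal_add_left_cancel_le ennreal_mult_eq_top_iff)
  have "A T = ennreal (2 / (q - 1)) * (ennreal ((q - 1) / 2) * A T)"
  proof -
    have "2 / (q - 1) * ((q - 1) / 2) = 1" using q by simp
    then have "ennreal (2 / (q - 1)) * ennreal ((q - 1) / 2) = 1"
      using q by (metis ennreal_1 ennreal_mult divide_nonneg_nonneg diff_ge_0_iff_ge less_imp_le zero_le_numeral)
    then show ?thesis by (simp add: mult.assoc[symmetric])
  qed
  also have "\<dots> \<le> ennreal (2 / (q - 1)) * (ennreal (2 powr (q - 1)) * H)"
    by (rule mult_left_mono[OF le]) simp
  also have "\<dots> = ennreal (2 powr q / (q - 1)) * H"
  proof -
    have e: "2 * 2 powr (q - 1) = 2 powr q" by (simp add: powr_diff)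
    have "2 / (q - 1) * 2 powr (q - 1) = 2 powr q / (q - 1)" by (simp only: times_divide_eq_left e)
    then show ?thesis using q by (simp add: mult.assoc[symmetric] flip: ennreal_mult del: times_divide_eq_left)
  qed
  finally show ?thesis by (simp add: A_def H_def)
qed simp

lemma weak_type_cells:
  assumes D: "D \<subseteq> X" "\<And>x. x \<in> D \<Longrightarrow> c k x \<subseteq> D" and l: "\<And>x. x \<in> D \<Longrightarrow> l \<le> m k x"
  shows "ennreal l * emeasure N D \<le> (\<integral>\<^sup>+x\<in>D. ennreal (h x) \<partial>N)"
proof -
  have Ds[measurable]: "D \<in> sets N" by (rule sets_cellwise[OF sets_cell D])
  have "ennreal l * emeasure N D = (\<integral>\<^sup>+x\<in>D. ennreal l \<partial>N)" by (simp add: nn_integral_cmult_indicator)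
  also have "\<dots> = (\<Sum>Q\<in>c k ` D. \<integral>\<^sup>+x\<in>Q. ennreal l \<partial>N)"
    by (rule nn_integral_cells[OF D]) (use sets_cell in auto)
  also have "\<dots> \<le> (\<Sum>Q\<in>c k ` D. \<integral>\<^sup>+x\<in>Q. ennreal (h x) \<partial>N)"
  proof (rule sum_mono)
    fix Q assume "Q \<in> c k ` D"
    then obtain x where x: "x \<in> D" "Q = c k x" by auto
    then have xX: "x \<in> X" using D by auto
    have "(\<integral>\<^sup>+x\<in>Q. ennreal l \<partial>N) = ennreal l * emeasure N (c k x)"
      using sets_cell[OF xX, of k] x(2) by (simp add: nn_integral_cmult_indicator)
    also have "\<dots> \<le> ennreal (m k x) * emeasure N (c k x)"
      using l[OF x(1)] by (intro mult_right_mono ennreal_leI) auto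
    finally show "(\<integral>\<^sup>+x\<in>Q. ennreal l \<partial>N) \<le> (\<integral>\<^sup>+x\<in>Q. ennreal (h x) \<partial>N)"
      using mean_mult_cell[OF xX] x(2) by simp
  qed
  also have "\<dots> = (\<integral>\<^sup>+x\<in>D. ennreal (h x) \<partial>N)"
    by (rule nn_integral_cells[OF D, symmetric]) (use sets_cell in auto)
  finally show ?thesis .
qed

text \<open>Induction on T: the points where the mean exceeds l for the first time at generation T +
  1 form a union of cells of that generation, disjoint from the set already treated, and
  \<open>weak_type_cells\<close> applies to this union.\<close>

lemma weak_type:
  fixes l :: real and k :: nat
  assumes x0: "x0 \<in> X"
  defines "B \<equiv> \<lambda>T. {y \<in> c k x0. \<exists>j. k < j \<and> j \<le> T \<and> l < m j y}"
  shows "B T \<in> sets N \<and> ennreal l * emeasure N (B T) \<le> (\<integral>\<^sup>+x\<in>B T. ennreal (h x) \<partial>N)"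
proof (induction T)
  case 0
  then show ?case by (simp add: B_def)
next
  case (Suc T)
  show ?case
  proof (cases "k \<le> T")
    case False
    then have "B (Suc T) = {}" by (auto simp: B_def)
    then show ?thesis by simp
  next
    case True
    define D where "D = {y \<in> c k x0. y \<notin> B T \<and> l < m (Suc T) y}"
    have BD: "B (Suc T) = B T \<union> D" "B T \<inter> D = {}"
    proof -
      have "(\<exists>j. k < j \<and> j \<le> Suc T \<and> l < m j y) \<longleftrightarrow> (\<exists>j. k < j \<and> j \<le> T \<and> l < m j y) \<or> l < m (Suc T) y" for y
        using True unfolding le_Suc_eq by (metis le_imp_less_Suc)
      then show "B (Suc T) = B T \<union> D" "B T \<inter> D = {}" unfolding B_def D_def by blast+
    qed
    have DX: "D \<subseteq> X" using cell_subset[OF x0] by (auto simp: D_def)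
    have Dc: "c (Suc T) y \<subseteq> D" if y: "y \<in> D" for y
    proof
      fix z assume z: "z \<in> c (Suc T) y"
      have e: "c j z = c j y" if "j \<le> Suc T" for j using cell_eq'[OF z that] .
      have "c k y = c k x0" using y cell_eq by (auto simp: D_def)
      then have "c k z = c k x0" using e[of k] True by simp
      then have "z \<in> c k x0" using cell_self by metis
      moreover have "m j z = m j y" if "j \<le> Suc T" for j using e[OF that] by simp
      ultimately show "z \<in> D" using y unfolding D_def B_def by (auto simp: le_SucI)
    qed
    have Ds: "D \<in> sets N" by (rule sets_cellwise[OF sets_cell DX Dc])
    have "ennreal l * emeasure N (B (Suc T)) = ennreal l * emeasure N (B T) + ennreal l * emeasure N D"
      unfolding BD(1) using Suc Ds BD(2) by (simp add: plus_emeasure[symmetric] distrib_left)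
    also have "\<dots> \<le> (\<integral>\<^sup>+x\<in>B T. ennreal (h x) \<partial>N) + (\<integral>\<^sup>+x\<in>D. ennreal (h x) \<partial>N)"
      by (intro add_mono weak_type_cells[OF DX Dc]) (use Suc in \<open>auto simp: D_def\<close>)
    also have "\<dots> = (\<integral>\<^sup>+x\<in>B (Suc T). ennreal (h x) \<partial>N)"
      unfolding BD(1) using Suc Ds BD(2) by (intro nn_integral_disjoint_pair[symmetric]) auto
    finally show ?thesis using Suc Ds by (auto simp: BD(1))
  qed
qed

text \<open>Sparseness of the principal cells. A point of \<open>c i x0\<close> outside E lies in a
  later cell whose mean exceeds twice the mean over \<open>c i x0\<close>; by the weak-type bound
  such points fill at most half of the cell. Positivity of the mean allows the division.\<close>

lemma principal_large:
  fixes i :: nat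
  assumes x0: "x0 \<in> X" and pos: "m 0 x0 > 0" and i: "principal_index (\<lambda>j. m j x0) T = i"
  defines "E \<equiv> {y \<in> X. principal_index (\<lambda>j. m j y) T = i \<and> c i y = c i x0}"
  shows "E \<in> sets N" "E \<subseteq> c i x0" "emeasure N (c i x0) \<le> 2 * emeasure N E"
proof -
  have iT: "i \<le> T" using i principal_index_le by metis
  show Es: "E \<in> sets N"
  proof (rule sets_cellwise[where k = T, OF sets_cell])
    show "E \<subseteq> X" by (auto simp: E_def)
    fix y assume y: "y \<in> E"
    show "c T y \<subseteq> E"
    proof
      fix z assume z: "z \<in> c T y"
      have e: "c j z = c j y" if "j \<le> T" for j using cell_eq'[OF z that] .
      have "principal_index (\<lambda>j. m j z) T = principal_index (\<lambda>j. m j y) T"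
        by (rule principal_index_cong) (simp add: e)
      moreover have "z \<in> X" using z y cell_subset unfolding E_def by blast
      ultimately show "z \<in> E" using y e[OF iT] by (simp add: E_def)
    qed
  qed
  show Esub: "E \<subseteq> c i x0" unfolding E_def using cell_self by fastforce
  define B where "B = {y \<in> c i x0. \<exists>j. i < j \<and> j \<le> T \<and> 2 * m i x0 < m j y}"
  have B: "B \<in> sets N" "ennreal (2 * m i x0) * emeasure N B \<le> (\<integral>\<^sup>+x\<in>B. ennreal (h x) \<partial>N)"
    unfolding B_def using weak_type[OF x0, where k=i and l="2 * m i x0" and T=T]
    by (rule conjunct1, rule conjunct2)
  have mpos: "m i x0 > 0"
    using principal_index_mono[of "\<lambda>j. m j x0" T] pos i mean_nonneg[of N h] by fastforce
  have idem: "principal_index (\<lambda>j. m j x0) i = i" using i principal_index_idem by metis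
  have cov: "c i x0 \<subseteq> E \<union> B"
  proof
    fix y assume y: "y \<in> c i x0"
    show "y \<in> E \<union> B"
    proof (cases "y \<in> B")
      case False
      have e: "c j y = c j x0" if "j \<le> i" for j using cell_eq'[OF y that] .
      have "principal_index (\<lambda>j. m j y) T = i"
      proof (rule principal_index_stable)
        show "principal_index (\<lambda>j. m j y) i = i"
          using idem principal_index_cong[of i "\<lambda>j. m j y" "\<lambda>j. m j x0"] e by simp
        show "m j y \<le> 2 * m i y" if "i < j" "j \<le> T" for j
          using that False y e[of i] by (force simp: B_def not_less)
      qed (rule iT)
      then show ?thesis using y cell_subset[OF x0] e[of i] by (auto simp: E_def)
    qed simp
  qed
  have "ennreal (m i x0) * (2 * emeasure N B) = ennreal (2 * m i x0) * emeasure N B"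
    using mpos by (simp add: ennreal_mult mult_ac)
  also have "\<dots> \<le> (\<integral>\<^sup>+x\<in>c i x0. ennreal (h x) \<partial>N)"
    by (rule order_trans[OF B(2)], rule nn_integral_mono) (auto simp: B_def indicator_def)
  also have "\<dots> = ennreal (m i x0) * emeasure N (c i x0)" using mean_mult_cell[OF x0] by simp
  finally have "2 * emeasure N B \<le> emeasure N (c i x0)"
    using mpos by (simp add: ennreal_mult_le_mult_iff)
  moreover
  have "emeasure N (c i x0) \<le> emeasure N E + emeasure N B"
    by (rule order_trans[OF emeasure_mono[OF cov] emeasure_subadditive]) (use Es B in auto)
  then have "2 * emeasure N (c i x0) \<le> 2 * (emeasure N E + emeasure N B)"
    by (rule mult_left_mono) simp
  ultimately have "2 * emeasure N (c i x0) \<le> 2 * emeasure N E + emeasure N (c i x0)"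
    unfolding distrib_left by (meson add_left_mono order_trans)
  then have "emeasure N (c i x0) + emeasure N (c i x0) \<le> emeasure N (c i x0) + 2 * emeasure N E"
    unfolding mult_2[of "emeasure N (c i x0)"] by (simp only: add.commute)
  then show "emeasure N (c i x0) \<le> 2 * emeasure N E"
    using finite_subset_X[OF cell_subset[OF x0], of i]
    by (subst (asm) ennreal_add_left_cancel_le) auto
qed

text \<open>The points are distributed according to the last principal cell of the stopping-time
  construction containing them; there the maximal function is at most twice the mean over
  that cell.\<close>

lemma principal_bound:
  fixes W :: "'a \<Rightarrow> real \<Rightarrow> ennreal" and V :: "'a \<Rightarrow> ennreal"
  assumes pos: "\<And>x. x \<in> X \<Longrightarrow> m 0 x > 0"
    and W_mono: "\<And>x a b. 0 \<le> a \<Longrightarrow> a \<le> b \<Longrightarrow> W x a \<le> W x b"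
    and W_meas: "\<And>a. (\<lambda>x. W x a) \<in> borel_measurable N"
    and V_meas: "V \<in> borel_measurable N"
    and step: "\<And>x0 i E. x0 \<in> X \<Longrightarrow> i \<le> T \<Longrightarrow> E \<in> sets N \<Longrightarrow> E \<subseteq> c i x0 \<Longrightarrow>
       emeasure N (c i x0) \<le> 2 * emeasure N E \<Longrightarrow>
       (\<integral>\<^sup>+x\<in>E. W x (2 * m i x0) \<partial>N) \<le> (\<integral>\<^sup>+x\<in>E. V x \<partial>N)"
  shows "(\<integral>\<^sup>+x\<in>X. W x (S T x) \<partial>N) \<le> (\<integral>\<^sup>+x\<in>X. V x \<partial>N)"
proof -
  define \<kappa> where "\<kappa> x = principal_index (\<lambda>j. m j x) T" for x
  \<comment> \<open>A principal cell is recorded together with its generation, because one set may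
    be a cell of several generations.\<close>
  define I where "I = (\<lambda>x. (\<kappa> x, c (\<kappa> x) x)) ` X"
  define E where "E iP = {y \<in> X. \<kappa> y = fst iP \<and> c (fst iP) y = snd iP}" for iP
  have finI: "finite I"
  proof (rule finite_subset)
    show "I \<subseteq> (SIGMA i:{..T}. c i ` X)"
      using principal_index_le by (auto simp: I_def \<kappa>_def)
  qed (use finite_cells in auto)
  have Eprop: "E iP \<in> sets N \<and> (\<integral>\<^sup>+x\<in>E iP. W x (2 * mean N h (snd iP)) \<partial>N) \<le> (\<integral>\<^sup>+x\<in>E iP. V x \<partial>N)"
    if "iP \<in> I" for iP
  proof -
    obtain x0 where x0: "x0 \<in> X" "iP = (\<kappa> x0, c (\<kappa> x0) x0)" using \<open>iP \<in> I\<close> by (auto simp: I_def)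
    have Eq: "E iP = {y \<in> X. principal_index (\<lambda>j. m j y) T = \<kappa> x0 \<and> c (\<kappa> x0) y = c (\<kappa> x0) x0}"
      by (auto simp: E_def x0 \<kappa>_def)
    note pl = principal_large[OF x0(1) pos[OF x0(1)] \<kappa>_def[symmetric]]
    have "\<kappa> x0 \<le> T" by (simp add: \<kappa>_def principal_index_le)
    from pl(1) step[OF x0(1) this pl]
    show ?thesis unfolding Eq unfolding x0(2) snd_conv by (intro conjI)
  qed
  have one: "(\<Sum>iP\<in>I. u iP * indicator (E iP) x) = u (\<kappa> x, c (\<kappa> x) x) * indicator X x"
    for u :: "_ \<Rightarrow> ennreal" and x
  proof (cases "x \<in> X")
    case True
    have "(\<Sum>iP\<in>I. u iP * indicator (E iP) x) = (\<Sum>iP\<in>{(\<kappa> x, c (\<kappa> x) x)}. u iP * indicator (E iP) x)"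
      by (rule sum.mono_neutral_right)
        (use finI True in \<open>auto simp: I_def E_def indicator_def split: if_splits\<close>)
    then show ?thesis using True by (simp add: E_def)
  next
    case False
    then show ?thesis by (simp add: E_def sum.neutral)
  qed
  have "(\<integral>\<^sup>+x\<in>X. W x (S T x) \<partial>N) \<le> (\<integral>\<^sup>+x. (\<Sum>iP\<in>I. W x (2 * mean N h (snd iP)) * indicator (E iP) x) \<partial>N)"
  proof (rule nn_integral_mono)
    fix x
    have "S T x \<le> 2 * m (\<kappa> x) x"
      unfolding \<kappa>_def by (intro running_max_le le_principal_index mean_nonneg)
    then show "W x (S T x) * indicator X x \<le> (\<Sum>iP\<in>I. W x (2 * mean N h (snd iP)) * indicator (E iP) x)"
      unfolding one by (auto intro!: mult_right_mono W_mono S_nonneg)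
  qed
  also have "\<dots> = (\<Sum>iP\<in>I. \<integral>\<^sup>+x\<in>E iP. W x (2 * mean N h (snd iP)) \<partial>N)"
    by (rule nn_integral_sum, rule borel_measurable_times_ennreal[OF W_meas])
      (use Eprop in \<open>blast intro: borel_measurable_indicator\<close>)
  also have "\<dots> \<le> (\<Sum>iP\<in>I. \<integral>\<^sup>+x\<in>E iP. V x \<partial>N)"
    by (rule sum_mono) (use Eprop in auto)
  also have "\<dots> = (\<integral>\<^sup>+x. (\<Sum>iP\<in>I. V x * indicator (E iP) x) \<partial>N)"
    by (rule nn_integral_sum[symmetric], rule borel_measurable_times_ennreal[OF V_meas])
      (use Eprop in \<open>blast intro: borel_measurable_indicator\<close>)
  also have "\<dots> = (\<integral>\<^sup>+x\<in>X. V x \<partial>N)" by (simp add: one)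
  finally show ?thesis .
qed

end

section \<open>Dyadic cells\<close>

text \<open>The half-open cube of side 2^-k containing x in the grid with origin a. Comparing
  integer parts makes membership an equivalence relation by construction.\<close>

definition dcell :: "real^'n \<Rightarrow> nat \<Rightarrow> real^'n \<Rightarrow> (real^'n) set" where
  "dcell a k x = {y. \<forall>i. \<lfloor>2^k * (y$i - a$i)\<rfloor> = \<lfloor>2^k * (x$i - a$i)\<rfloor>}"

definition dcorner :: "real^'n \<Rightarrow> nat \<Rightarrow> real^'n \<Rightarrow> real^'n" where
  "dcorner a k x = (\<chi> i. a$i + of_int \<lfloor>2^k * (x$i - a$i)\<rfloor> / 2^k)"

lemma dcell_iff:
  "y \<in> dcell a k x \<longleftrightarrow> (\<forall>i. dcorner a k x $ i \<le> y$i \<and> y$i < dcorner a k x $ i + 1 / 2^k)"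
  unfolding dcell_def dcorner_def floor_eq_iff
  by (auto simp: field_simps)

lemma dcell_self: "x \<in> dcell a k x"
  by (simp add: dcell_def)

lemma dcell_eq: "y \<in> dcell a k x \<Longrightarrow> dcell a k y = dcell a k x"
  by (auto simp: dcell_def)

lemma dcell_subset_cbox: "dcell a k x \<subseteq> cbox (dcorner a k x) (\<chi> i. dcorner a k x $ i + 1 / 2^k)"
  by (auto simp: dcell_iff mem_box_cart less_imp_le)

lemma box_subset_dcell: "box (dcorner a k x) (\<chi> i. dcorner a k x $ i + 1 / 2^k) \<subseteq> dcell a k x"
  by (auto simp: dcell_iff mem_box_cart less_imp_le)

lemma dcell_borel[measurable]: "dcell a k x \<in> sets borel"
proof -
  have "dcell a k x = (\<Inter>i. {y. dcorner a k x $ i \<le> y$i} \<inter> {y. y$i < dcorner a k x $ i + 1 / 2^k})"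
    by (auto simp: dcell_iff)
  also have "\<dots> \<in> sets borel"
    by (intro sets.countable_INT' sets.Int borel_closed borel_open closed_halfspace_component_ge_cart
        open_halfspace_component_lt_cart) auto
  finally show ?thesis .
qed

lemma dcell_lebesgue[measurable]: "dcell a k x \<in> sets lebesgue"
  using dcell_borel by (simp add: lborelD)

lemma emeasure_cube:
  fixes b :: "real^'n"
  assumes "0 \<le> l"
  shows "emeasure lebesgue (cbox b (\<chi> i. b$i + l)) = ennreal (l ^ CARD('n))"
    and "emeasure lebesgue (box b (\<chi> i. b$i + l)) = ennreal (l ^ CARD('n))"
proof -
  have *: "(\<Prod>e\<in>(Basis::(real^'n) set). ((\<chi> i. b$i + l) - b) \<bullet> e) = l ^ CARD('n)"
  proof -
    have "(\<Prod>e\<in>(Basis::(real^'n) set). ((\<chi> i. b$i + l) - b) \<bullet> e) = (\<Prod>e\<in>(Basis::(real^'n) set). l)"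
      by (rule prod.cong) (auto simp: Basis_vec_def inner_axis)
    then show ?thesis by simp
  qed
  have le: "\<And>e. e \<in> Basis \<Longrightarrow> b \<bullet> e \<le> (\<chi> i. b$i + l) \<bullet> e"
    using assms by (auto simp: Basis_vec_def inner_axis)
  show "emeasure lebesgue (cbox b (\<chi> i. b$i + l)) = ennreal (l ^ CARD('n))"
    using le * by (simp add: emeasure_lborel_cbox)
  show "emeasure lebesgue (box b (\<chi> i. b$i + l)) = ennreal (l ^ CARD('n))"
    using le * by (simp add: emeasure_lborel_box)
qed

lemma emeasure_dcell: "emeasure lebesgue (dcell a k (x::real^'n)) = ennreal ((1 / 2^k) ^ CARD('n))"
proof (rule antisym)
  show "emeasure lebesgue (dcell a k x) \<le> ennreal ((1 / 2^k) ^ CARD('n))"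
    by (subst emeasure_cube(1)[symmetric, of _ "dcorner a k x"])
      (auto intro!: emeasure_mono dcell_subset_cbox)
  show "ennreal ((1 / 2^k) ^ CARD('n)) \<le> emeasure lebesgue (dcell a k x)"
    by (subst emeasure_cube(2)[symmetric, of _ "dcorner a k x"])
      (auto intro!: emeasure_mono box_subset_dcell)
qed

lemma measure_dcell: "measure lebesgue (dcell a k (x::real^'n)) = (1 / 2^k) ^ CARD('n)"
  by (simp add: measure_def emeasure_dcell)

lemma dcell_tree: "dyadic_tree (dcell a) (dcell a 0 (x0::real^'n))"
proof
  fix x y :: "real^'n" and k :: nat
  show "x \<in> dcell a 0 x0 \<Longrightarrow> dcell a 0 x = dcell a 0 x0" by (rule dcell_eq)
  show "x \<in> dcell a k x" by (rule dcell_self)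
  show "y \<in> dcell a k x \<Longrightarrow> dcell a k y = dcell a k x" by (rule dcell_eq)
  \<comment> \<open>The integer part at scale k is determined by the one at scale k + 1, through
    integer division by 2; this is the nesting of the cells.\<close>
  have fl: "\<lfloor>2 ^ k * t\<rfloor> = \<lfloor>2 ^ Suc k * t\<rfloor> div 2" for t :: real
    using floor_divide_real_eq_div[of 2 "2 ^ Suc k * t"] by simp
  show "dcell a (Suc k) x \<subseteq> dcell a k x"
    unfolding dcell_def fl by auto
  define F where "F v = {y::real^'n. \<forall>i. \<lfloor>2^k * (y$i - a$i)\<rfloor> = v$i}" for v :: "int^'n"
  define B where "B = (\<lambda>f. \<chi> i. f i) ` (PiE (UNIV::'n set)
    (\<lambda>i. {2^k * \<lfloor>x0$i - a$i\<rfloor> .. 2^k * (\<lfloor>x0$i - a$i\<rfloor> + 1)}))"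
  have "finite B" unfolding B_def by (intro finite_imageI finite_PiE) auto
  moreover have "dcell a k ` dcell a 0 x0 \<subseteq> F ` B"
  proof
    fix Q assume "Q \<in> dcell a k ` dcell a 0 x0"
    then obtain x where x: "x \<in> dcell a 0 x0" "Q = dcell a k x" by auto
    define f where "f i = \<lfloor>2^k * (x$i - a$i)\<rfloor>" for i
    have "f i \<in> {2^k * \<lfloor>x0$i - a$i\<rfloor> .. 2^k * (\<lfloor>x0$i - a$i\<rfloor> + 1)}" for i
    proof -
      have fx: "\<lfloor>x$i - a$i\<rfloor> = \<lfloor>x0$i - a$i\<rfloor>" using x(1) by (simp add: dcell_def)
      have 1: "of_int \<lfloor>x0$i - a$i\<rfloor> \<le> x$i - a$i" "x$i - a$i < of_int \<lfloor>x0$i - a$i\<rfloor> + 1"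
        using fx by linarith+
      have "2^k * of_int \<lfloor>x0$i - a$i\<rfloor> \<le> 2^k * (x$i - a$i)"
        "2^k * (x$i - a$i) \<le> 2^k * (of_int \<lfloor>x0$i - a$i\<rfloor> + 1)"
        using 1 by (intro mult_left_mono; simp)+
      then have "2^k * of_int \<lfloor>x0$i - a$i\<rfloor> \<le> 2^k * (x$i - a$i)"
        "2^k * (x$i - a$i) < 2^k * (of_int \<lfloor>x0$i - a$i\<rfloor> + 1) + 1"
        by linarith+
      then have "of_int (2^k * \<lfloor>x0$i - a$i\<rfloor>) \<le> 2^k * (x$i - a$i)"
        "2^k * (x$i - a$i) < of_int (2^k * (\<lfloor>x0$i - a$i\<rfloor> + 1)) + 1"
        by (simp_all only: of_int_mult of_int_power of_int_numeral of_int_add of_int_1)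
      then show ?thesis unfolding atLeastAtMost_iff f_def le_floor_iff floor_le_iff by blast
    qed
    then have "(\<chi> i. f i) \<in> B" unfolding B_def by (intro imageI) auto
    moreover have "Q = F (\<chi> i. f i)" by (simp add: x(2) F_def dcell_def f_def)
    ultimately show "Q \<in> F ` B" by auto
  qed
  ultimately show "finite (dcell a k ` dcell a 0 x0)" by (meson finite_imageI finite_subset)
qed

lemma dist_dcell:
  assumes "y \<in> dcell a k x" "z \<in> dcell a k (x::real^'n)"
  shows "norm (y - z) \<le> real CARD('n) / 2^k"
proof -
  have "norm (y - z) \<le> (\<Sum>i\<in>UNIV. \<bar>(y - z)$i\<bar>)" by (rule norm_le_l1_cart)
  also have "\<dots> \<le> (\<Sum>i\<in>(UNIV::'n set). 1 / 2^k)"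
  proof (rule sum_mono)
    fix i :: 'n
    show "\<bar>(y - z)$i\<bar> \<le> 1 / 2^k"
      using assms unfolding dcell_iff by (simp add: abs_le_iff) (smt (verit))
  qed
  finally show ?thesis by simp
qed

lemma dcell_small_cube:
  "cbox (dcorner a k x) (\<chi> i. dcorner a k x $ i + 1 / 2^k) \<in> small_cubes"
  unfolding small_cubes_def
proof (intro CollectI conjI exI)
  show "emeasure lebesgue (cbox (dcorner a k x) (\<chi> i. dcorner a k x $ i + 1 / 2^k)) \<le> 1"
    by (subst emeasure_cube) (simp_all add: power_le_one)
qed (auto intro: refl)

section \<open>Elementary inequalities\<close>

text \<open>The form in which log-Hoelder continuity enters. V is a power of the reciprocal volume
  of a cell, d is a difference of exponents up to a bounded factor, and t is a quantity known to lie
  between 1 / (D V) and D V.\<close>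

lemma powr_le_powr_exp:
  fixes t D V d e c :: real
  assumes "0 < t" "t \<le> D * V" "1 / t \<le> D * V" "1 \<le> D" "1 \<le> V" "\<bar>d\<bar> \<le> e" "\<bar>d\<bar> * ln V \<le> c"
  shows "t powr d \<le> D powr e * exp c"
proof -
  have "ln t \<le> ln (D * V)" using assms by (subst ln_le_cancel_iff) auto
  moreover have "ln (1 / t) \<le> ln (D * V)" using assms by (subst ln_le_cancel_iff) auto
  ultimately have "\<bar>ln t\<bar> \<le> ln D + ln V" using assms by (simp add: ln_mult ln_div abs_le_iff)
  then have "\<bar>d\<bar> * \<bar>ln t\<bar> \<le> \<bar>d\<bar> * (ln D + ln V)" by (intro mult_left_mono) auto
  also have "\<dots> \<le> e * ln D + c" using assms by (auto simp: distrib_left intro!: add_mono mult_right_mono)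
  finally have "d * ln t \<le> e * ln D + c" by (metis abs_mult abs_le_D1)
  then show ?thesis using assms by (simp add: powr_def exp_add[symmetric])
qed

text \<open>Jensen's inequality for the power \<theta>, where b bounds the mean of v^\<theta>. It
  follows pointwise from the tangent to y^\<theta> at the point m with m^\<theta> = b, so that t = 0
  is allowed.\<close>

lemma nn_integral_powr_mean:
  fixes v :: "'a \<Rightarrow> real"
  assumes [measurable]: "Q \<in> sets N" "v \<in> borel_measurable N"
    and t: "emeasure N Q = ennreal t" "0 \<le> t" and v: "\<And>x. x \<in> Q \<Longrightarrow> 0 \<le> v x" and \<theta>: "1 \<le> \<theta>" and b: "0 < b"
    and int: "(\<integral>\<^sup>+x\<in>Q. ennreal (v x powr \<theta>) \<partial>N) \<le> ennreal (t * b)"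
  shows "(\<integral>\<^sup>+x\<in>Q. ennreal (v x) \<partial>N) \<le> ennreal (t * b powr (1 / \<theta>))"
proof -
  define m where "m = b powr (1 / \<theta>)"
  have m: "m > 0" "m powr \<theta> = b" using b \<theta> by (auto simp: m_def powr_powr)
  have pt: "y \<le> m powr (1 - \<theta>) / \<theta> * y powr \<theta> + (1 - 1 / \<theta>) * m" if "y \<ge> 0" for y
  proof (cases "\<theta> = 1")
    case True then show ?thesis using that m by simp
  next
    case False
    then have \<theta>': "\<theta> > 1" using \<theta> by simp
    have "y * m powr (\<theta> - 1) \<le> y powr \<theta> / \<theta> + (m powr (\<theta> - 1)) powr (\<theta> / (\<theta> - 1)) / (\<theta> / (\<theta> - 1))"
      by (rule Youngs_inequality) (use \<theta>' that in \<open>auto simp: field_simps\<close>)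
    also have "(m powr (\<theta> - 1)) powr (\<theta> / (\<theta> - 1)) = m powr \<theta>"
      using \<theta>' by (simp only: powr_powr) simp
    also have "m powr \<theta> = m powr (\<theta> - 1) * m"
      using m(1) by (simp add: powr_diff)
    finally have "m powr (1 - \<theta>) * (y * m powr (\<theta> - 1)) \<le> m powr (1 - \<theta>) * (y powr \<theta> / \<theta> + m powr (\<theta> - 1) * m / (\<theta> / (\<theta> - 1)))"
      by (intro mult_left_mono) auto
    moreover have e: "m powr (1 - \<theta>) * m powr (\<theta> - 1) = 1" using m by (simp flip: powr_add)
    have "m powr (1 - \<theta>) * (y * m powr (\<theta> - 1)) = y"
      using e by (metis mult.left_commute mult.right_neutral)
    moreover have "m powr (1 - \<theta>) * (y powr \<theta> / \<theta> + m powr (\<theta> - 1) * m / (\<theta> / (\<theta> - 1)))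
        = m powr (1 - \<theta>) / \<theta> * y powr \<theta> + (m powr (1 - \<theta>) * m powr (\<theta> - 1)) * m * ((\<theta> - 1) / \<theta>)"
      by (simp add: distrib_left)
    moreover have "1 * m * ((\<theta> - 1) / \<theta>) = (1 - 1 / \<theta>) * m" using \<theta>' by (simp add: field_simps)
    ultimately show ?thesis unfolding e by linarith
  qed
  have "(\<integral>\<^sup>+x\<in>Q. ennreal (v x) \<partial>N) \<le> (\<integral>\<^sup>+x. ennreal (m powr (1 - \<theta>) / \<theta>) * (ennreal (v x powr \<theta>) * indicator Q x) + ennreal ((1 - 1 / \<theta>) * m) * indicator Q x \<partial>N)"
  proof (rule nn_integral_mono)
    fix x
    show "ennreal (v x) * indicator Q x \<le> ennreal (m powr (1 - \<theta>) / \<theta>) * (ennreal (v x powr \<theta>) * indicator Q x) + ennreal ((1 - 1 / \<theta>) * m) * indicator Q x"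
    proof (cases "x \<in> Q")
      case True
      have "ennreal (v x) \<le> ennreal (m powr (1 - \<theta>) / \<theta> * v x powr \<theta> + (1 - 1 / \<theta>) * m)"
        using pt[OF v[OF True]] by (rule ennreal_leI)
      also have "\<dots> = ennreal (m powr (1 - \<theta>) / \<theta>) * ennreal (v x powr \<theta>) + ennreal ((1 - 1 / \<theta>) * m)"
        using \<theta> m by (subst ennreal_plus) (auto simp: ennreal_mult[symmetric])
      finally show ?thesis using True by simp
    qed simp
  qed
  also have "\<dots> = ennreal (m powr (1 - \<theta>) / \<theta>) * (\<integral>\<^sup>+x\<in>Q. ennreal (v x powr \<theta>) \<partial>N) + ennreal ((1 - 1 / \<theta>) * m) * ennreal t"
    by (subst nn_integral_add) (auto simp: nn_integral_cmult nn_integral_cmult_indicator t)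
  also have "\<dots> \<le> ennreal (m powr (1 - \<theta>) / \<theta>) * ennreal (t * b) + ennreal ((1 - 1 / \<theta>) * m) * ennreal t"
    by (intro add_right_mono mult_left_mono int) simp
  also have "\<dots> = ennreal (m powr (1 - \<theta>) / \<theta> * (t * b) + (1 - 1 / \<theta>) * m * t)"
    using \<theta> m t b by (simp add: ennreal_mult[symmetric] ennreal_plus[symmetric] del: ennreal_plus)
  also have "m powr (1 - \<theta>) / \<theta> * (t * b) + (1 - 1 / \<theta>) * m * t = t * m"
    using m \<theta> by (simp add: powr_diff m(2)[symmetric] field_simps)
  finally show ?thesis by (simp add: m_def)
qed

section \<open>The maximal theorem on a single cell\<close>

definition dual_weight :: "(real^'n \<Rightarrow> real) \<Rightarrow> (real^'n \<Rightarrow> real) \<Rightarrow> real^'n \<Rightarrow> real" where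
  "dual_weight p w x = w x powr (- 1 / (p x - 1))"

text \<open>r and s are admissible in the infima that define the norms of the indicator of Q in
  L^p(w) and in L^p'(\<sigma>), and A bounds their normalised product. This turns the A_p condition
  into a statement about integrals.\<close>

definition ap_pair :: "(real^'n \<Rightarrow> real) \<Rightarrow> (real^'n \<Rightarrow> real) \<Rightarrow> real \<Rightarrow> (real^'n) set \<Rightarrow> real \<Rightarrow> real \<Rightarrow> bool" where
  "ap_pair p w A Q r s \<longleftrightarrow> 0 < r \<and> 0 < s
     \<and> (\<integral>\<^sup>+x\<in>Q. ennreal ((1 / r) powr p x * w x) \<partial>lebesgue) \<le> 1
     \<and> (\<integral>\<^sup>+x\<in>Q. ennreal ((1 / s) powr conj_exponent p x * dual_weight p w x) \<partial>lebesgue) \<le> 1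
     \<and> r * s \<le> A * measure lebesgue Q"

text \<open>Young's inequality for b / l * w^(1/p) and w^(-1/p) / u: the weight cancels in the
  product, and the dual weight appears in the second power.\<close>

lemma weighted_young:
  fixes p w b l u :: real
  assumes "1 < p" "0 < w" "0 \<le> b" "0 < l" "0 < u"
  shows "b \<le> l * u * ((b / l) powr p * w + (1 / u) powr (p / (p - 1)) * w powr (- 1 / (p - 1)))"
proof -
  define a d where "a = b / l * w powr (1 / p)" and "d = w powr (- 1 / p) / u"
  have "a * d \<le> a powr p + d powr (p / (p - 1))"
    by (rule Youngs_inequality_simple) (use assms in \<open>auto simp: a_def d_def\<close>)
  moreover have "a powr p = (b / l) powr p * w"
    unfolding a_def using assms by (subst powr_mult) (auto simp: powr_powr)
  moreover have "d powr (p / (p - 1)) = (1 / u) powr (p / (p - 1)) * w powr (- 1 / (p - 1))"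
    using assms by (simp add: d_def powr_divide powr_powr)
  moreover have "l * u * (a * d) = b"
  proof -
    have "w powr (1 / p) * w powr (- 1 / p) = 1" using assms by (simp flip: powr_add)
    moreover have "l * u * (a * d) = b * (w powr (1 / p) * w powr (- 1 / p))"
      using assms by (simp add: a_def d_def)
    ultimately show ?thesis by simp
  qed
  ultimately show ?thesis
    using assms mult_left_mono[of "a * d" _ "l * u"] by (metis mult_nonneg_nonneg less_imp_le)
qed

text \<open>The bounds on p hold at every point. \<open>osc\<close> is log-Hoelder continuity as it
  is used on cells: the oscillation of p times the logarithm of the reciprocal volume is bounded,
  for all grids and scales.\<close>

locale exponent =
  fixes p :: "real^'n \<Rightarrow> real" and q P L :: real
  assumes p_meas[measurable]: "p \<in> borel_measurable lebesgue"
    and q: "1 < q" and p_ge: "q \<le> p x" and p_le: "p x \<le> P"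
    and osc: "y \<in> dcell a k x \<Longrightarrow> z \<in> dcell a k x \<Longrightarrow> \<bar>p y - p z\<bar> * ln (2 ^ (k * CARD('n))) \<le> L"
begin

abbreviation "p' \<equiv> conj_exponent p"

definition "Q' = q / (q - 1)"

lemma p_gt_1: "1 < p x" using p_ge[of x] q by simp

lemma p_pos: "0 < p x" using p_gt_1[of x] by simp

lemma p_ne_1: "p x \<noteq> 1" using p_gt_1[of x] by simp

lemma P: "1 < P" using p_ge[of 0] p_le[of 0] q by simp

lemma conj_meas[measurable]: "p' \<in> borel_measurable lebesgue"
  unfolding conj_exponent_def[abs_def] by measurable

lemma conj_gt_1: "1 < p' x"
  using p_gt_1[of x] by (simp add: conj_exponent_def field_simps)

lemma conj_le: "p' x \<le> Q'"
  using p_ge[of x] q unfolding conj_exponent_def Q'_def by (simp add: field_simps)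

lemma conj_diff: "\<bar>p' x - p' y\<bar> \<le> \<bar>p x - p y\<bar> / (q - 1)\<^sup>2"
proof -
  have "p' x - p' y = (p y - p x) / ((p x - 1) * (p y - 1))"
    using p_gt_1[of x] p_gt_1[of y] by (simp add: conj_exponent_def field_simps)
  then have "\<bar>p' x - p' y\<bar> = \<bar>p x - p y\<bar> / ((p x - 1) * (p y - 1))"
    using p_gt_1[of x] p_gt_1[of y] by (simp add: abs_minus_commute abs_mult)
  also have "\<dots> \<le> \<bar>p x - p y\<bar> / (q - 1)\<^sup>2"
    using p_ge[of x] p_ge[of y] q
    by (intro divide_left_mono) (auto simp: power2_eq_square intro!: mult_mono mult_pos_pos)
  finally show ?thesis .
qed

lemma L_nonneg: "0 \<le> L"
  using osc[of 0 0 0 0 0] dcell_self[of 0 0 0] by simp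

end

locale weighted = exponent p q P L for p :: "real^'n \<Rightarrow> real" and q P L +
  fixes w :: "real^'n \<Rightarrow> real"
  assumes w_meas[measurable]: "w \<in> borel_measurable lebesgue" and w_pos: "0 < w x"
begin

abbreviation "\<sigma> \<equiv> dual_weight p w"

lemma dual_meas[measurable]: "\<sigma> \<in> borel_measurable lebesgue"
  unfolding dual_weight_def[abs_def] by measurable

lemma dual_pos: "0 < \<sigma> x"
  using w_pos[of x] by (simp add: dual_weight_def)

text \<open>Hoelder's inequality in modular form: a sum of two modulars replaces the product of two
  norms. If both modulars are at most 1, the integral is at most 2 l u.\<close>

lemma holder:
  assumes [measurable]: "E \<in> sets lebesgue" "b \<in> borel_measurable lebesgue"
    and b: "\<And>x. 0 \<le> b x" and l: "0 < l" and u: "0 < u"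
  shows "(\<integral>\<^sup>+x\<in>E. ennreal (b x) \<partial>lebesgue) \<le> ennreal (l * u) *
    ((\<integral>\<^sup>+x\<in>E. ennreal ((b x / l) powr p x * w x) \<partial>lebesgue)
     + (\<integral>\<^sup>+x\<in>E. ennreal ((1 / u) powr p' x * \<sigma> x) \<partial>lebesgue))"
proof -
  have "(\<integral>\<^sup>+x\<in>E. ennreal (b x) \<partial>lebesgue) \<le>
    (\<integral>\<^sup>+x. ennreal (l * u) * (ennreal ((b x / l) powr p x * w x) * indicator E x
       + ennreal ((1 / u) powr p' x * \<sigma> x) * indicator E x) \<partial>lebesgue)"
  proof (rule nn_integral_mono)
    fix x
    have "ennreal (b x) \<le> ennreal (l * u * ((b x / l) powr p x * w x + (1 / u) powr p' x * \<sigma> x))"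
      using weighted_young[OF p_gt_1 w_pos b l u, of x x x]
      unfolding conj_exponent_def dual_weight_def by (rule ennreal_leI)
    also have "\<dots> = ennreal (l * u) * (ennreal ((b x / l) powr p x * w x) + ennreal ((1 / u) powr p' x * \<sigma> x))"
      using l u w_pos[of x] dual_pos[of x] by (simp add: ennreal_mult)
    finally show "ennreal (b x) * indicator E x \<le> ennreal (l * u) * (ennreal ((b x / l) powr p x * w x) * indicator E x
       + ennreal ((1 / u) powr p' x * \<sigma> x) * indicator E x)"
      by (simp add: indicator_def)
  qed
  also have "\<dots> = ennreal (l * u) * ((\<integral>\<^sup>+x\<in>E. ennreal ((b x / l) powr p x * w x) \<partial>lebesgue)
     + (\<integral>\<^sup>+x\<in>E. ennreal ((1 / u) powr p' x * \<sigma> x) \<partial>lebesgue))"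
    by (subst nn_integral_cmult, measurable, subst nn_integral_add) auto
  finally show ?thesis .
qed

lemma holder_set:
  assumes "E \<in> sets lebesgue" "0 < l" "0 < u"
  shows "emeasure lebesgue E \<le> ennreal (l * u) *
    ((\<integral>\<^sup>+x\<in>E. ennreal ((1 / l) powr p x * w x) \<partial>lebesgue)
     + (\<integral>\<^sup>+x\<in>E. ennreal ((1 / u) powr p' x * \<sigma> x) \<partial>lebesgue))"
  using holder[OF assms(1) _ _ assms(2,3), of "\<lambda>_. 1"] assms(1) by simp

end

text \<open>The dual number of the unit cell X is 1. Thus \<sigma> has mass at most 1 on X, r0 is at
  most A, and the dual numbers s of the subcells lie between a power of the volume and a constant
  (\<open>s_lower\<close>, \<open>s_upper\<close>).\<close>

locale normalised = weighted p q P L w for p :: "real^'n \<Rightarrow> real" and q P L w +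
  fixes a x0 :: "real^'n" and A r0 :: real
  assumes A: "1 \<le> A"
    and pairs: "x \<in> dcell a 0 x0 \<Longrightarrow> \<exists>r s. ap_pair p w A (dcell a k x) r s"
    and norm: "ap_pair p w A (dcell a 0 x0) r0 1"
begin

abbreviation "X \<equiv> dcell a 0 x0"

text \<open>c1 is the share of the dual modular that half of a cell must carry. D is the factor in
  the two bounds of s. K is the loss when the exponent \<open>p'\<close> of s is moved within a
  cell; (q - 1)^2 in it comes from the passage from p to \<open>p'\<close> in
  \<open>conj_diff\<close>.\<close>

definition "c1 = (1 / (4 * A)) powr Q'"
definition "D = 2 * A / c1"
definition "K = D powr Q' * exp (L / (q - 1)\<^sup>2)"

lemma c1: "0 < c1" "c1 \<le> 1"
  using A q by (auto simp: c1_def Q'_def intro!: powr_le1)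

lemma D: "1 \<le> D" "2 * A \<le> D" "1 / c1 \<le> D"
proof -
  show "2 * A \<le> D" unfolding D_def using c1 A by (simp add: le_divide_eq mult_left_le)
  then show "1 \<le> D" using A by simp
  show "1 / c1 \<le> D" unfolding D_def using c1 A by (intro divide_right_mono) auto
qed

lemma K: "1 \<le> K"
proof -
  have "1 * 1 \<le> D powr Q' * exp (L / (q - 1)\<^sup>2)"
    using D q L_nonneg by (intro mult_mono) (auto simp: Q'_def intro!: ge_one_powr_ge_zero)
  then show ?thesis by (simp add: K_def)
qed

context
  fixes x k r s
  assumes x: "x \<in> X" and rs: "ap_pair p w A (dcell a k x) r s"
begin

abbreviation "R \<equiv> dcell a k x"

lemma r: "0 < r" and s: "0 < s" and rsA: "r * s \<le> A * (1 / 2^k) ^ CARD('n)"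
  using rs by (auto simp: ap_pair_def measure_dcell)

text \<open>An A_infinity property of the dual weight in modular form. With u = s / (4 A), a dual
  modular below 1 on E would give |E| < |R| / 2 by Hoelder's inequality and the A_p condition.
  Returning from u to s costs at most the factor (4 A)^Q'.\<close>

lemma large_subset:
  assumes E: "E \<in> sets lebesgue" "E \<subseteq> R" "emeasure lebesgue R \<le> 2 * emeasure lebesgue E"
  shows "ennreal c1 \<le> (\<integral>\<^sup>+y\<in>E. ennreal ((1 / s) powr p' y * \<sigma> y) \<partial>lebesgue)"
proof -
  define J where "J = (\<integral>\<^sup>+y\<in>E. ennreal ((1 / s) powr p' y * \<sigma> y) \<partial>lebesgue)"
  define I where "I = (\<integral>\<^sup>+y\<in>E. ennreal ((1 / (s / (4 * A))) powr p' y * \<sigma> y) \<partial>lebesgue)"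
  define v where "v = (1 / 2^k :: real) ^ CARD('n)"
  have v: "v > 0" by (simp add: v_def)
  have Ev: "emeasure lebesgue R = ennreal v" by (simp add: emeasure_dcell v_def)
  have Efin: "emeasure lebesgue E \<le> ennreal v" using emeasure_mono[OF E(2), of lebesgue] Ev by simp
  then obtain e where e: "emeasure lebesgue E = ennreal e" "e \<ge> 0"
    by (metis ennreal_cases ennreal_less_top infinity_ennreal_def leD)
  have ve: "v \<le> 2 * e" using E(3) e v unfolding Ev by (simp add: ennreal_mult'' [symmetric] flip: ennreal_numeral ennreal_mult)
  have I1: "1 \<le> I"
  proof (rule ccontr)
    assume "\<not> 1 \<le> I"
    then obtain i where i: "I = ennreal i" "i \<ge> 0" "i < 1"
      by (metis ennreal_cases ennreal_less_one_iff not_le top_greatest)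
    have "emeasure lebesgue E \<le> ennreal (r * (s / (4 * A))) *
      ((\<integral>\<^sup>+x\<in>E. ennreal ((1 / r) powr p x * w x) \<partial>lebesgue) + I)"
      unfolding I_def by (rule holder_set[OF E(1)]) (use r s A in auto)
    also have "\<dots> \<le> ennreal (r * (s / (4 * A))) * (1 + I)"
    proof (intro mult_left_mono add_right_mono)
      have "(\<integral>\<^sup>+x\<in>E. ennreal ((1 / r) powr p x * w x) \<partial>lebesgue) \<le> (\<integral>\<^sup>+x\<in>R. ennreal ((1 / r) powr p x * w x) \<partial>lebesgue)"
        using E(2) by (intro nn_integral_mono) (auto simp: indicator_def)
      then show "(\<integral>\<^sup>+x\<in>E. ennreal ((1 / r) powr p x * w x) \<partial>lebesgue) \<le> 1"
        using rs by (auto simp: ap_pair_def)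
    qed auto
    finally have "e \<le> r * (s / (4 * A)) * (1 + i)"
      using i e r s A by (simp flip: ennreal_1 ennreal_plus ennreal_mult)
    also have "\<dots> = (r * s) * (1 + i) / (4 * A)" by simp
    also have "\<dots> \<le> (A * v) * (1 + i) / (4 * A)"
      using rsA i A by (intro divide_right_mono mult_right_mono) (auto simp: v_def)
    also have "\<dots> = v * (1 + i) / 4" using A by simp
    also have "\<dots> < v * 2 / 4" using v i by (intro divide_strict_right_mono mult_strict_left_mono) auto
    also have "\<dots> \<le> e" using ve by simp
    finally show False by simp
  qed
  have "I \<le> (\<integral>\<^sup>+y. ennreal ((4 * A) powr Q') * (ennreal ((1 / s) powr p' y * \<sigma> y) * indicator E y) \<partial>lebesgue)"
    unfolding I_def
  proof (rule nn_integral_mono)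
    fix y
    have "(1 / (s / (4 * A))) powr p' y = (4 * A) powr p' y * (1 / s) powr p' y"
      using A s by (simp add: powr_mult[symmetric])
    also have "\<dots> \<le> (4 * A) powr Q' * (1 / s) powr p' y"
      using A conj_le by (intro mult_right_mono powr_mono) auto
    finally have "(1 / (s / (4 * A))) powr p' y * \<sigma> y \<le> (4 * A) powr Q' * ((1 / s) powr p' y * \<sigma> y)"
      using dual_pos[of y] by (simp add: mult_right_mono flip: mult.assoc)
    then have "ennreal ((1 / (s / (4 * A))) powr p' y * \<sigma> y) \<le> ennreal ((4 * A) powr Q' * ((1 / s) powr p' y * \<sigma> y))"
      by (rule ennreal_leI)
    then show "ennreal ((1 / (s / (4 * A))) powr p' y * \<sigma> y) * indicator E y
      \<le> ennreal ((4 * A) powr Q') * (ennreal ((1 / s) powr p' y * \<sigma> y) * indicator E y)"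
      by (simp add: ennreal_mult' indicator_def)
  qed
  also have "\<dots> = ennreal ((4 * A) powr Q') * J"
    unfolding J_def using E(1) by (subst nn_integral_cmult) auto
  finally have "1 \<le> ennreal ((4 * A) powr Q') * J" using I1 by simp
  then have "ennreal c1 * 1 \<le> ennreal c1 * (ennreal ((4 * A) powr Q') * J)" by (intro mult_left_mono) auto
  also have "\<dots> = J"
  proof -
    have "c1 * (4 * A) powr Q' = 1" using A by (simp add: c1_def powr_mult[symmetric])
    then show ?thesis using c1 by (simp add: mult.assoc[symmetric] flip: ennreal_mult)
  qed
  finally show ?thesis by (simp add: J_def)
qed

text \<open>Hoelder's inequality on R combines the dual number s of R with the number r0 of the
  whole cell X; r0 \<le> A because its partner is 1 and X has volume 1.\<close>

lemma s_lower: "1 / s \<le> 2 * A * 2 ^ (k * CARD('n))"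
proof -
  define v where "v = (1 / 2^k :: real) ^ CARD('n)"
  have v: "v > 0" "1 / v = 2 ^ (k * CARD('n))" by (auto simp: v_def power_divide power_mult)
  have r0: "0 < r0" "r0 \<le> A" "(\<integral>\<^sup>+x\<in>X. ennreal ((1 / r0) powr p x * w x) \<partial>lebesgue) \<le> 1"
    using norm measure_dcell[of a 0 x0] by (auto simp: ap_pair_def)
  have "ennreal v = emeasure lebesgue R" by (simp add: emeasure_dcell v_def)
  also have "\<dots> \<le> ennreal (r0 * s) * ((\<integral>\<^sup>+x\<in>R. ennreal ((1 / r0) powr p x * w x) \<partial>lebesgue)
     + (\<integral>\<^sup>+x\<in>R. ennreal ((1 / s) powr p' x * \<sigma> x) \<partial>lebesgue))"
    by (rule holder_set) (use r0 s in auto)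
  also have "\<dots> \<le> ennreal (r0 * s) * (1 + 1)"
  proof (intro mult_left_mono add_mono)
    have "R \<subseteq> X" using dyadic_tree.cell_subset[OF dcell_tree x] .
    then have "(\<integral>\<^sup>+x\<in>R. ennreal ((1 / r0) powr p x * w x) \<partial>lebesgue) \<le> (\<integral>\<^sup>+x\<in>X. ennreal ((1 / r0) powr p x * w x) \<partial>lebesgue)"
      by (intro nn_integral_mono) (auto simp: indicator_def)
    then show "(\<integral>\<^sup>+x\<in>R. ennreal ((1 / r0) powr p x * w x) \<partial>lebesgue) \<le> 1" using r0(3) by simp
    show "(\<integral>\<^sup>+x\<in>R. ennreal ((1 / s) powr p' x * \<sigma> x) \<partial>lebesgue) \<le> 1"
      using rs by (auto simp: ap_pair_def)
  qed auto
  also have "\<dots> = ennreal (r0 * s * 2)"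
    using r0 s by (simp add: ennreal_mult)
  finally have "v \<le> r0 * s * 2" using r0 s by simp
  also have "\<dots> \<le> A * s * 2" using r0 s by simp
  finally have "1 / s \<le> 2 * A * (1 / v)" using v s by (simp add: field_simps)
  then show ?thesis using v by simp
qed

text \<open>If s > 1, the dual modular of R is at most 1 / s times the mass of \<sigma> on X, while
  \<open>large_subset\<close> with E = R keeps it above c1.\<close>

lemma s_upper: "s \<le> 1 / c1"
proof (cases "s \<le> 1")
  case True
  then have "s * c1 \<le> 1" using c1 s by (intro mult_le_one) auto
  then show ?thesis using c1 by (simp add: field_simps)
next
  case False
  have RX: "R \<subseteq> X" using dyadic_tree.cell_subset[OF dcell_tree x] .
  have "ennreal c1 \<le> (\<integral>\<^sup>+y\<in>R. ennreal ((1 / s) powr p' y * \<sigma> y) \<partial>lebesgue)"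
    by (rule large_subset) (auto simp: mult_2)
  also have "\<dots> \<le> (\<integral>\<^sup>+y. ennreal (1 / s) * (ennreal (1 powr p' y * \<sigma> y) * indicator X y) \<partial>lebesgue)"
  proof (rule nn_integral_mono)
    fix y
    have "(1 / s) powr p' y \<le> (1 / s) powr 1"
      using False conj_gt_1[of y] by (intro powr_mono') auto
    then have "(1 / s) powr p' y * \<sigma> y \<le> 1 / s * \<sigma> y"
      using False dual_pos[of y] by (intro mult_right_mono) auto
    then have "ennreal ((1 / s) powr p' y * \<sigma> y) \<le> ennreal (1 / s) * ennreal (\<sigma> y)"
      using False dual_pos[of y] by (simp flip: ennreal_mult)
    then show "ennreal ((1 / s) powr p' y * \<sigma> y) * indicator R y \<le> ennreal (1 / s) * (ennreal (1 powr p' y * \<sigma> y) * indicator X y)"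
      using RX by (auto simp: indicator_def)
  qed
  also have "\<dots> = ennreal (1 / s) * (\<integral>\<^sup>+y\<in>X. ennreal (1 powr p' y * \<sigma> y) \<partial>lebesgue)"
    by (subst nn_integral_cmult) auto
  also have "\<dots> \<le> ennreal (1 / s) * 1"
    using norm by (intro mult_left_mono) (auto simp: ap_pair_def)
  finally show ?thesis using s c1 by (simp add: field_simps)
qed

lemma s_comparable:
  assumes "y \<in> R" "z \<in> R"
  shows "s powr p' y \<le> K * s powr p' z"
proof -
  have "s powr (p' y - p' z) \<le> K"
    unfolding K_def
  proof (rule powr_le_powr_exp[where V = "2 ^ (k * CARD('n))"])
    have "s \<le> D * 1" using s_upper D by simp
    also have "\<dots> \<le> D * 2 ^ (k * CARD('n))" using D by (intro mult_left_mono) auto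
    finally show "s \<le> D * 2 ^ (k * CARD('n))" .
    have "1 / s \<le> 2 * A * 2 ^ (k * CARD('n))" by (rule s_lower)
    also have "\<dots> \<le> D * 2 ^ (k * CARD('n))" using D by (intro mult_right_mono) auto
    finally show "1 / s \<le> D * 2 ^ (k * CARD('n))" .
    show "\<bar>p' y - p' z\<bar> \<le> Q'"
      using conj_le[of y] conj_le[of z] conj_gt_1[of y] conj_gt_1[of z] by (auto simp: abs_le_iff)
    have "\<bar>p' y - p' z\<bar> * ln (2 ^ (k * CARD('n))) \<le> \<bar>p y - p z\<bar> / (q - 1)\<^sup>2 * ln (2 ^ (k * CARD('n)))"
      by (intro mult_right_mono conj_diff) auto
    also have "\<dots> = \<bar>p y - p z\<bar> * ln (2 ^ (k * CARD('n))) / (q - 1)\<^sup>2" by simp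
    also have "\<dots> \<le> L / (q - 1)\<^sup>2" by (intro divide_right_mono osc[OF assms]) auto
    finally show "\<bar>p' y - p' z\<bar> * ln (2 ^ (k * CARD('n))) \<le> L / (q - 1)\<^sup>2" .
  qed (use s D in auto)
  then have "s powr (p' y - p' z) * s powr p' z \<le> K * s powr p' z" by (intro mult_right_mono) auto
  then show ?thesis using s by (simp flip: powr_add)
qed

text \<open>As \<open>s powr p'\<close> is constant on R up to the factor K, it can be taken out of
  the modular at any point y of R; a modular bound becomes a bound for the mass of \<sigma>.\<close>

lemma dual_le:
  assumes "y \<in> R"
  shows "(\<integral>\<^sup>+z\<in>R. ennreal (\<sigma> z) \<partial>lebesgue) \<le> ennreal (K * s powr p' y)"
proof -
  have "(\<integral>\<^sup>+z\<in>R. ennreal (\<sigma> z) \<partial>lebesgue) \<le> (\<integral>\<^sup>+z. ennreal (K * s powr p' y) * (ennreal ((1 / s) powr p' z * \<sigma> z) * indicator R z) \<partial>lebesgue)"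
  proof (rule nn_integral_mono)
    fix z
    show "ennreal (\<sigma> z) * indicator R z \<le> ennreal (K * s powr p' y) * (ennreal ((1 / s) powr p' z * \<sigma> z) * indicator R z)"
    proof (cases "z \<in> R")
      case True
      have "\<sigma> z = s powr p' z * ((1 / s) powr p' z * \<sigma> z)"
        using s by (simp add: powr_mult[symmetric] flip: mult.assoc)
      also have "\<dots> \<le> K * s powr p' y * ((1 / s) powr p' z * \<sigma> z)"
        using s_comparable[OF True assms] dual_pos[of z] by (intro mult_right_mono) auto
      finally show ?thesis using True K dual_pos[of z] by (simp flip: ennreal_mult)
    qed simp
  qed
  also have "\<dots> = ennreal (K * s powr p' y) * (\<integral>\<^sup>+z\<in>R. ennreal ((1 / s) powr p' z * \<sigma> z) \<partial>lebesgue)"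
    by (subst nn_integral_cmult) auto
  also have "\<dots> \<le> ennreal (K * s powr p' y) * 1"
    using rs by (intro mult_left_mono) (auto simp: ap_pair_def)
  finally show ?thesis by simp
qed

text \<open>The counterpart of \<open>dual_le\<close> for every large part E of R. Through it a
  principal cell is charged to the part of it that meets no later principal cell, and these parts
  are disjoint.\<close>

lemma le_dual:
  assumes "y \<in> R" and E: "E \<in> sets lebesgue" "E \<subseteq> R" "emeasure lebesgue R \<le> 2 * emeasure lebesgue E"
  shows "ennreal (c1 / K * s powr p' y) \<le> (\<integral>\<^sup>+z\<in>E. ennreal (\<sigma> z) \<partial>lebesgue)"
proof -
  have "ennreal c1 \<le> (\<integral>\<^sup>+z\<in>E. ennreal ((1 / s) powr p' z * \<sigma> z) \<partial>lebesgue)"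
    by (rule large_subset[OF E])
  also have "\<dots> \<le> (\<integral>\<^sup>+z. ennreal (K * (1 / s) powr p' y) * (ennreal (\<sigma> z) * indicator E z) \<partial>lebesgue)"
  proof (rule nn_integral_mono)
    fix z
    show "ennreal ((1 / s) powr p' z * \<sigma> z) * indicator E z \<le> ennreal (K * (1 / s) powr p' y) * (ennreal (\<sigma> z) * indicator E z)"
    proof (cases "z \<in> E")
      case True
      then have "s powr p' y \<le> K * s powr p' z" using s_comparable[OF assms(1)] E by auto
      then have "(1 / s) powr p' z \<le> K * (1 / s) powr p' y"
        using s by (simp add: powr_divide field_simps)
      then have "(1 / s) powr p' z * \<sigma> z \<le> K * (1 / s) powr p' y * \<sigma> z"
        using dual_pos[of z] by (intro mult_right_mono) auto
      then show ?thesis using True K dual_pos[of z] by (simp flip: ennreal_mult)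
    qed simp
  qed
  also have "\<dots> = ennreal (K * (1 / s) powr p' y) * (\<integral>\<^sup>+z\<in>E. ennreal (\<sigma> z) \<partial>lebesgue)"
    using E(1) by (subst nn_integral_cmult) auto
  finally have "ennreal (s powr p' y / K) * ennreal c1 \<le> ennreal (s powr p' y / K) * (ennreal (K * (1 / s) powr p' y) * (\<integral>\<^sup>+z\<in>E. ennreal (\<sigma> z) \<partial>lebesgue))"
    by (rule mult_left_mono) simp
  also have "\<dots> = (\<integral>\<^sup>+z\<in>E. ennreal (\<sigma> z) \<partial>lebesgue)"
  proof -
    have "s powr p' y / K * (K * (1 / s) powr p' y) = 1"
      using s K by (simp add: powr_divide)
    then have "ennreal (s powr p' y / K) * ennreal (K * (1 / s) powr p' y) = 1"
      using K by (subst ennreal_mult[symmetric]) auto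
    then show ?thesis by (simp add: mult.assoc[symmetric])
  qed
  finally show ?thesis using K c1 by (simp add: mult.commute flip: ennreal_mult)
qed

end

end

context normalised
begin

text \<open>D2 is the factor in the bound of \<mu>^q by V^Q', K2 the resulting loss when the
  exponent of the mean is moved to p(y), and C0 the product of all losses in
  \<open>cell_step\<close>.\<close>

definition "D2 = 2 * K / c1 * D powr Q'"
definition "K2 = D2 powr P * exp (Q' * L)"
definition "C0 = 2 powr P * (K * A) powr P * K2 * (K / c1)"

lemma C0: "0 \<le> C0"
  using c1 K D by (auto simp: C0_def K2_def D2_def)

lemma Q'_gt_1: "1 < Q'"
  using q by (simp add: Q'_def field_simps)

lemma D2: "1 \<le> D2"
proof -
  have "1 \<le> K / c1" using c1 K by (simp add: field_simps)
  then have "2 * (K / c1) * D powr Q' \<ge> 2 * 1 * 1"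
    using D Q'_gt_1 by (intro mult_mono) (auto intro!: ge_one_powr_ge_zero)
  then show ?thesis by (simp add: D2_def)
qed

text \<open>By the choice of g and h, h^q \<sigma> is at most \<sigma> + f^p w. The mean of f over a
  cell R is at most \<sigma>(R) / |R| times the \<sigma>-mean of g, and Jensen's inequality with
  exponent pR / q bounds the latter by a power of the \<sigma>-mean of h. The A_p condition turns
  the power p(y) of \<sigma>(R) / |R| into a multiple of \<sigma>(E) r^(-p(y)), and integration
  against w removes r.\<close>

lemma cell_step:
  assumes f_meas[measurable]: "f \<in> borel_measurable lebesgue" and f_nonneg: "\<And>x. 0 \<le> f x"
    and f_int: "(\<integral>\<^sup>+x\<in>X. ennreal (f x powr p x * w x) \<partial>lebesgue) \<le> 1"
  defines "g \<equiv> \<lambda>x. max 1 (f x / \<sigma> x)"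
  defines "h \<equiv> \<lambda>x. g x powr (p x / q)"
  defines "N \<equiv> density lebesgue (\<lambda>x. ennreal (\<sigma> x))"
  assumes x: "x \<in> X"
    and E: "E \<in> sets lebesgue" "E \<subseteq> dcell a k x"
      "emeasure lebesgue (dcell a k x) \<le> 2 * emeasure lebesgue E"
  shows "(\<integral>\<^sup>+x\<in>X. ennreal (h x powr q) \<partial>N) \<le> 2"
    and "(\<integral>\<^sup>+y\<in>E. ennreal ((2 * mean lebesgue f (dcell a k x)) powr p y * w y) \<partial>lebesgue)
      \<le> (\<integral>\<^sup>+y\<in>E. ennreal (C0 * mean N h (dcell a k x) powr q) * ennreal (\<sigma> y) \<partial>lebesgue)"
proof -
  obtain r s where rs: "ap_pair p w A (dcell a k x) r s" using pairs[OF x] by blast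
  define R where "R = dcell a k x"
  have Rm[measurable]: "R \<in> sets lebesgue" by (simp add: R_def)
  have [measurable]: "E \<in> sets lebesgue" by (rule E(1))
  have RX: "R \<subseteq> X" unfolding R_def using dyadic_tree.cell_subset[OF dcell_tree x] .
  note [measurable] = dcell_lebesgue
  have xR: "x \<in> R" by (simp add: R_def dcell_self)
  have r: "0 < r" and s: "0 < s" using rs by (auto simp: ap_pair_def)
  have gm[measurable]: "g \<in> borel_measurable lebesgue" by (simp add: g_def)
  have hm[measurable]: "h \<in> borel_measurable lebesgue" by (simp add: h_def)
  have setsN[simp, measurable_cong]: "sets N = sets lebesgue" by (simp add: N_def)
  have g1: "1 \<le> g y" for y by (simp add: g_def)
  have h1: "1 \<le> h y" for y
    using g1[of y] p_pos[of y] q by (auto simp: h_def intro!: ge_one_powr_ge_zero)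
  have densN: "(\<integral>\<^sup>+y. u y \<partial>N) = (\<integral>\<^sup>+y. ennreal (\<sigma> y) * u y \<partial>lebesgue)" if "u \<in> borel_measurable lebesgue" for u
    unfolding N_def by (rule nn_integral_density) (use that in auto)
  \<comment> \<open>The dual weight satisfies \<sigma>^(1 - p) = w.\<close>
  have f_dual: "(f y / \<sigma> y) powr p y * \<sigma> y = f y powr p y * w y" for y
  proof -
    have "\<sigma> y powr p y = \<sigma> y * \<sigma> y powr (p y - 1)"
      using dual_pos[of y] by (simp add: powr_diff)
    also have "\<sigma> y powr (p y - 1) = 1 / w y"
    proof -
      have "- 1 / (p y - 1) * (p y - 1) = - 1" using p_ne_1[of y] by simp
      then have "\<sigma> y powr (p y - 1) = w y powr (- 1)" unfolding dual_weight_def powr_powr by simp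
      then show ?thesis using w_pos[of y] by (simp add: powr_minus_divide)
    qed
    finally show ?thesis using dual_pos[of y] w_pos[of y] f_nonneg[of y] by (simp add: powr_divide)
  qed
  have hq: "h y powr q = g y powr p y" for y
    using q by (simp add: h_def powr_powr)
  have gp: "g y powr p y \<le> 1 + (f y / \<sigma> y) powr p y" for y
    by (auto simp: g_def max_def)
  have X1: "(\<integral>\<^sup>+y\<in>X. ennreal (\<sigma> y) \<partial>lebesgue) \<le> 1"
    using norm by (auto simp: ap_pair_def)
  show hq2: "(\<integral>\<^sup>+y\<in>X. ennreal (h y powr q) \<partial>N) \<le> 2"
  proof -
    have "(\<integral>\<^sup>+y\<in>X. ennreal (h y powr q) \<partial>N) = (\<integral>\<^sup>+y. ennreal (\<sigma> y) * (ennreal (h y powr q) * indicator X y) \<partial>lebesgue)"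
      by (rule densN) measurable
    also have "\<dots> \<le> (\<integral>\<^sup>+y. ennreal (\<sigma> y) * indicator X y + ennreal (f y powr p y * w y) * indicator X y \<partial>lebesgue)"
    proof (rule nn_integral_mono)
      fix y
      have "\<sigma> y * h y powr q \<le> \<sigma> y * (1 + (f y / \<sigma> y) powr p y)"
        unfolding hq using gp dual_pos[of y] by (intro mult_left_mono) auto
      also have "\<dots> = \<sigma> y + f y powr p y * w y" using f_dual[of y] by (simp add: algebra_simps)
      finally have "ennreal (\<sigma> y) * ennreal (h y powr q) \<le> ennreal (\<sigma> y) + ennreal (f y powr p y * w y)"
        using dual_pos[of y] w_pos[of y] by (simp flip: ennreal_mult ennreal_plus)
      then show "ennreal (\<sigma> y) * (ennreal (h y powr q) * indicator X y) \<le> ennreal (\<sigma> y) * indicator X y + ennreal (f y powr p y * w y) * indicator X y"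
        by (auto simp: indicator_def)
    qed
    also have "\<dots> = (\<integral>\<^sup>+y\<in>X. ennreal (\<sigma> y) \<partial>lebesgue) + (\<integral>\<^sup>+y\<in>X. ennreal (f y powr p y * w y) \<partial>lebesgue)"
      by (rule nn_integral_add) auto
    also have "\<dots> \<le> 1 + 1" by (rule add_mono[OF X1 f_int])
    finally show ?thesis by simp
  qed
  have NR: "emeasure N R = (\<integral>\<^sup>+y\<in>R. ennreal (\<sigma> y) \<partial>lebesgue)"
    unfolding N_def by (rule emeasure_density) auto
  have NRle: "emeasure N R \<le> 1"
    unfolding NR using RX by (intro order_trans[OF nn_integral_mono X1]) (auto simp: indicator_def)
  define t where "t = enn2real (emeasure N R)"
  have t: "emeasure N R = ennreal t" "t \<ge> 0"
    using NRle by (auto simp: t_def enn2real_nonneg less_top[symmetric] top_unique intro!: ennreal_enn2real[symmetric])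
  have t_pos: "t > 0"
  proof -
    have "ennreal (c1 / K * s powr p' x) \<le> ennreal t"
      using le_dual[OF x rs xR[unfolded R_def], of R] t(1) NR by (simp add: R_def mult_2)
    moreover have "c1 / K * s powr p' x > 0" using c1 K s by simp
    ultimately show ?thesis using t(2) by (auto simp: ennreal_le_iff)
  qed
  have hR: "(\<integral>\<^sup>+y\<in>R. ennreal (h y powr q) \<partial>N) \<le> ennreal (t * (2 / t))"
  proof -
    have "(\<integral>\<^sup>+y\<in>R. ennreal (h y powr q) \<partial>N) \<le> (\<integral>\<^sup>+y\<in>X. ennreal (h y powr q) \<partial>N)"
      using RX by (intro nn_integral_mono) (auto simp: indicator_def)
    also have "\<dots> \<le> 2" by (rule hq2)
    also have "2 = ennreal (t * (2 / t))" using t_pos by simp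
    finally show ?thesis .
  qed
  have hR2: "(\<integral>\<^sup>+y\<in>R. ennreal (h y) \<partial>N) \<le> ennreal (t * (2 / t) powr (1 / q))"
    using h1 q t t_pos by (intro nn_integral_powr_mean[OF _ _ t _ _ _ hR]) (auto intro: order_trans[OF zero_le_one])
  define \<mu> where "\<mu> = mean N h R"
  have \<mu>: "ennreal \<mu> * ennreal t = (\<integral>\<^sup>+y\<in>R. ennreal (h y) \<partial>N)"
    unfolding \<mu>_def t(1)[symmetric]
    by (rule ennreal_mean_mult) (use t hR2 in \<open>auto intro: le_less_trans\<close>)
  have \<mu>0: "\<mu> \<ge> 0" by (simp add: \<mu>_def mean_nonneg)
  \<comment> \<open>The purpose of the maximum with 1 in g: once \<mu> \<ge> 1, an upper bound of
    \<mu> suffices for changing its exponent.\<close>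
  have \<mu>1: "1 \<le> \<mu>"
  proof -
    have "ennreal t = (\<integral>\<^sup>+y\<in>R. 1 \<partial>N)" using t by simp
    also have "\<dots> \<le> (\<integral>\<^sup>+y\<in>R. ennreal (h y) \<partial>N)"
    proof (rule nn_integral_mono)
      fix y
      have "1 \<le> ennreal (h y)" using ennreal_leI[OF h1[of y]] by simp
      then show "1 * indicator R y \<le> ennreal (h y) * indicator R y" by (rule mult_right_mono) simp
    qed
    also have "\<dots> = ennreal (\<mu> * t)" using \<mu> \<mu>0 t by (simp add: ennreal_mult)
    finally show ?thesis using t_pos \<mu>0 by simp
  qed
  have \<mu>q: "\<mu> powr q \<le> 2 / t"
  proof -
    have "ennreal (\<mu> * t) \<le> ennreal (t * (2 / t) powr (1 / q))" using hR2 \<mu> \<mu>0 t by (simp add: ennreal_mult)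
    then have "\<mu> \<le> (2 / t) powr (1 / q)" using t_pos by simp
    then have "\<mu> powr q \<le> ((2 / t) powr (1 / q)) powr q" using \<mu>0 q by (intro powr_mono2) auto
    then show ?thesis using q t_pos by (simp add: powr_powr)
  qed
  \<comment> \<open>The infimum of p is an exponent for which Jensen's inequality works on all of R:
    since g \<ge> 1, the power pR / q of g is at most h.\<close>
  define pR where "pR = (INF y\<in>R. p y)"
  have bb: "bdd_below (p ` R)" using p_ge by (auto intro!: bdd_belowI)
  have pR_le: "pR \<le> p y" if "y \<in> R" for y unfolding pR_def using bb that by (rule cINF_lower)
  have pR_ge: "q \<le> pR" unfolding pR_def using xR p_ge by (intro cINF_greatest) auto
  define V where "V = (2::real) ^ (k * CARD('n))"
  have V: "V \<ge> 1" by (simp add: V_def)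
  have pR_osc: "\<bar>p y - pR\<bar> * ln V \<le> L" if "y \<in> R" for y
  proof (cases "ln V > 0")
    case True
    have "p y - L / ln V \<le> pR"
      unfolding pR_def
    proof (rule cINF_greatest)
      fix z assume "z \<in> R"
      then have "\<bar>p y - p z\<bar> * ln V \<le> L" using osc[of y a k x z] that by (simp add: R_def V_def)
      then have "\<bar>p y - p z\<bar> \<le> L / ln V" using True by (simp add: field_simps)
      then show "p y - L / ln V \<le> p z" by (simp add: abs_le_iff)
    qed (use xR in auto)
    then show ?thesis using True pR_le[OF that] by (simp add: field_simps)
  next
    case False
    then have "ln V = 0" using V by (metis ln_ge_zero antisym_conv2)
    then show ?thesis using L_nonneg by simp
  qed
  have F: "(\<integral>\<^sup>+y\<in>R. ennreal (f y) \<partial>lebesgue) \<le> ennreal (t * \<mu> powr (q / pR))"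
  proof -
    have "(\<integral>\<^sup>+y\<in>R. ennreal (f y) \<partial>lebesgue) \<le> (\<integral>\<^sup>+y. ennreal (\<sigma> y) * (ennreal (g y) * indicator R y) \<partial>lebesgue)"
    proof (rule nn_integral_mono)
      fix y
      have "f y = \<sigma> y * (f y / \<sigma> y)" using dual_pos[of y] by simp
      also have "\<dots> \<le> \<sigma> y * g y" using dual_pos[of y] by (intro mult_left_mono) (auto simp: g_def)
      finally have "ennreal (f y) \<le> ennreal (\<sigma> y) * ennreal (g y)"
        using dual_pos[of y] g1[of y] by (simp flip: ennreal_mult)
      then show "ennreal (f y) * indicator R y \<le> ennreal (\<sigma> y) * (ennreal (g y) * indicator R y)"
        by (auto simp: indicator_def)
    qed
    also have "\<dots> = (\<integral>\<^sup>+y\<in>R. ennreal (g y) \<partial>N)" by (rule densN[symmetric]) measurable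
    also have "\<dots> \<le> ennreal (t * \<mu> powr (1 / (pR / q)))"
    proof (rule nn_integral_powr_mean[OF _ _ t])
      have "(\<integral>\<^sup>+y\<in>R. ennreal (g y powr (pR / q)) \<partial>N) \<le> (\<integral>\<^sup>+y\<in>R. ennreal (h y) \<partial>N)"
      proof (rule nn_integral_mono)
        fix y
        show "ennreal (g y powr (pR / q)) * indicator R y \<le> ennreal (h y) * indicator R y"
          using pR_le[of y] g1[of y] q unfolding h_def
          by (cases "y \<in> R") (auto intro!: ennreal_leI powr_mono divide_right_mono)
      qed
      then show "(\<integral>\<^sup>+y\<in>R. ennreal (g y powr (pR / q)) \<partial>N) \<le> ennreal (t * \<mu>)"
        using \<mu> \<mu>0 t by (simp add: ennreal_mult mult.commute)
    qed (use pR_ge q \<mu>1 g1 in \<open>auto intro: order_trans[OF zero_le_one]\<close>)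
    finally show ?thesis by simp
  qed
  define v where "v = (1 / 2^k :: real) ^ CARD('n)"
  have v: "v > 0" "measure lebesgue R = v" by (auto simp: v_def R_def measure_dcell)
  have rsA: "r * s \<le> A * v" using rs v by (auto simp: ap_pair_def R_def)
  have mf: "mean lebesgue f R \<le> t * \<mu> powr (q / pR) / v"
    unfolding mean_def v(2) using F t_pos v by (intro divide_right_mono enn2real_leI) auto
  define e where "e = enn2real (\<integral>\<^sup>+y\<in>E. ennreal (\<sigma> y) \<partial>lebesgue)"
  have e: "(\<integral>\<^sup>+y\<in>E. ennreal (\<sigma> y) \<partial>lebesgue) = ennreal e" "e \<ge> 0"
  proof -
    have "(\<integral>\<^sup>+y\<in>E. ennreal (\<sigma> y) \<partial>lebesgue) \<le> 1"
      using E RX by (intro order_trans[OF nn_integral_mono X1]) (auto simp: indicator_def R_def)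
    then show "(\<integral>\<^sup>+y\<in>E. ennreal (\<sigma> y) \<partial>lebesgue) = ennreal e" "e \<ge> 0"
      by (auto simp: e_def enn2real_nonneg less_top[symmetric] top_unique intro!: ennreal_enn2real[symmetric])
  qed
  have pt: "(2 * mean lebesgue f R) powr p y \<le> C0 * \<mu> powr q * e * (1 / r) powr p y" if y: "y \<in> R" for y
  proof -
    note cmp = dual_le[OF x rs y[unfolded R_def]] le_dual[OF x rs y[unfolded R_def] E]
    have "ennreal t \<le> ennreal (K * s powr p' y)" unfolding t(1)[symmetric] NR unfolding R_def by (rule cmp(1))
    then have t_le: "t \<le> K * s powr p' y" using K by (subst (asm) ennreal_le_iff) auto
    have e_ge: "s powr p' y \<le> K / c1 * e"
      using cmp(2) e K c1 by (simp add: field_simps)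
    have e_le: "e \<le> t"
    proof -
      have "ennreal e \<le> ennreal t"
        unfolding e(1)[symmetric] t(1)[symmetric] NR using E by (intro nn_integral_mono) (auto simp: indicator_def R_def)
      then show ?thesis using t by simp
    qed
    have KA: "1 \<le> K * A" using mult_mono[of 1 K 1 A] K A by simp
    \<comment> \<open>The A_p condition enters here as 1 / v \<le> A / (r s). The remaining power of
      s becomes comparable to \<sigma>(E), because (p' - 1) p = p'.\<close>
    have tv: "(t / v) powr p y \<le> (K * A) powr P * (K / c1 * e) * (1 / r) powr p y"
    proof -
      have "1 / v \<le> A / (r * s)" using rsA v r s by (simp add: field_simps)
      then have "t / v \<le> (K * s powr p' y) * (A / (r * s))"
        using mult_mono[OF t_le, of "1 / v" "A / (r * s)"] v K by simp
      also have "\<dots> = K * A * (s powr (p' y - 1)) * (1 / r)"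
        using s r by (simp add: powr_diff mult_ac)
      finally have "(t / v) powr p y \<le> (K * A * (s powr (p' y - 1)) * (1 / r)) powr p y"
        using t_pos v p_pos[of y] by (intro powr_mono2) auto
      also have "\<dots> = (K * A) powr p y * s powr ((p' y - 1) * p y) * (1 / r) powr p y"
        by (simp only: powr_mult powr_powr)
      also have "(p' y - 1) * p y = p' y"
        using p_gt_1[of y] by (simp add: conj_exponent_def field_simps)
      also have "(K * A) powr p y * s powr p' y * (1 / r) powr p y \<le> (K * A) powr P * (K / c1 * e) * (1 / r) powr p y"
        using KA p_le[of y] e_ge by (intro mult_right_mono mult_mono powr_mono) auto
      finally show ?thesis .
    qed
    have \<mu>p: "(\<mu> powr (q / pR)) powr p y \<le> K2 * \<mu> powr q"
    proof -
      \<comment> \<open>The exponent q p(y) / pR equals q + q d. The excess d times log V is bounded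
        by the oscillation of p, and \<mu>^q \<le> 2 / t is at most a multiple of V^Q' because t has
        a lower bound of this form.\<close>
      define d where "d = (p y - pR) / pR"
      have d0: "d \<ge> 0" using pR_le[OF y] pR_ge q by (simp add: d_def)
      have d1: "d \<le> p y - pR"
        using pR_le[OF y] pR_ge q mult_left_mono[of 1 pR "p y - pR"] by (simp add: d_def divide_le_eq)
      have "q / pR * p y = q + q * d" using pR_ge q by (simp add: d_def field_simps)
      then have "(\<mu> powr (q / pR)) powr p y = (\<mu> powr q) powr d * \<mu> powr q"
        by (simp add: powr_powr powr_add)
      also have "(\<mu> powr q) powr d \<le> K2"
        unfolding K2_def
      proof (rule powr_le_powr_exp[where V = "V powr Q'"])
        have \<mu>q1: "1 \<le> \<mu> powr q" using \<mu>1 q by (intro ge_one_powr_ge_zero) auto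
        then show \<mu>qp: "0 < \<mu> powr q" by linarith
        have V1: "1 \<le> V powr Q'" using V Q'_gt_1 by (intro ge_one_powr_ge_zero) auto
        then show "1 \<le> V powr Q'" .
        have "1 * 1 \<le> D2 * V powr Q'" using D2 V1 by (intro mult_mono) auto
        moreover have "1 / \<mu> powr q \<le> 1" by (rule divide_le_eq_1_pos[THEN iffD2, OF \<mu>qp \<mu>q1])
        ultimately show "1 / \<mu> powr q \<le> D2 * V powr Q'" by linarith
        have "(1 / s) powr p' y \<le> (D * V) powr p' y"
        proof (rule powr_mono2)
          have "1 / s \<le> 2 * A * V" using s_lower[OF x rs] by (simp add: V_def)
          also have "\<dots> \<le> D * V" using D V by (intro mult_right_mono) auto
          finally show "1 / s \<le> D * V" .
        qed (use s conj_gt_1[of y] in auto)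
        also have "(D * V) powr p' y \<le> (D * V) powr Q'"
          using D V mult_mono[of 1 D 1 V] by (intro powr_mono conj_le) auto
        also have "(D * V) powr Q' = D powr Q' * V powr Q'" by (rule powr_mult)
        finally have s_le: "(1 / s) powr p' y \<le> D powr Q' * V powr Q'" .
        have "\<mu> powr q \<le> 2 / t" by (rule \<mu>q)
        also have "\<dots> \<le> 2 / (c1 / K * s powr p' y)"
        proof (rule divide_left_mono)
          have "c1 / K * s powr p' y \<le> c1 / K * (K / c1 * e)"
            using e_ge c1 K by (intro mult_left_mono) auto
          then show "c1 / K * s powr p' y \<le> t" using e_le c1 K by simp
        qed (use t_pos c1 K s in auto)
        also have "\<dots> = 2 * K / c1 * (1 / s) powr p' y" using s by (simp add: powr_divide)
        also have "\<dots> \<le> 2 * K / c1 * (D powr Q' * V powr Q')"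
          using c1 K by (intro mult_left_mono s_le) auto
        finally show "\<mu> powr q \<le> D2 * V powr Q'" by (simp add: D2_def mult.assoc)
        show "\<bar>d\<bar> \<le> P" using d0 d1 p_le[of y] pR_ge q by simp
        have "\<bar>d\<bar> * ln (V powr Q') = Q' * (d * ln V)" using d0 V by (simp add: ln_powr)
        also have "\<dots> \<le> Q' * (\<bar>p y - pR\<bar> * ln V)"
          using d1 d0 V Q'_gt_1 by (intro mult_left_mono mult_right_mono) auto
        also have "\<dots> \<le> Q' * L" using pR_osc[OF y] Q'_gt_1 by (intro mult_left_mono) auto
        finally show "\<bar>d\<bar> * ln (V powr Q') \<le> Q' * L" .
      qed (use D2 in auto)
      finally show ?thesis by (simp add: mult_right_mono)
    qed
    have "(2 * mean lebesgue f R) powr p y \<le> (2 * (t / v) * \<mu> powr (q / pR)) powr p y"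
      using mf p_pos[of y] mean_nonneg[of lebesgue f R] by (intro powr_mono2) auto
    also have "\<dots> = 2 powr p y * (t / v) powr p y * (\<mu> powr (q / pR)) powr p y"
      by (simp only: powr_mult)
    also have "\<dots> \<le> 2 powr P * ((K * A) powr P * (K / c1 * e) * (1 / r) powr p y) * (K2 * \<mu> powr q)"
      using tv \<mu>p p_le[of y] e K c1 by (intro mult_mono powr_mono) auto
    also have "\<dots> = C0 * \<mu> powr q * e * (1 / r) powr p y" by (simp add: C0_def mult_ac)
    finally show ?thesis .
  qed
  have "(\<integral>\<^sup>+y\<in>E. ennreal ((2 * mean lebesgue f R) powr p y * w y) \<partial>lebesgue)
    \<le> (\<integral>\<^sup>+y. ennreal (C0 * \<mu> powr q * e) * (ennreal ((1 / r) powr p y * w y) * indicator R y) \<partial>lebesgue)"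
  proof (rule nn_integral_mono)
    fix y
    show "ennreal ((2 * mean lebesgue f R) powr p y * w y) * indicator E y \<le> ennreal (C0 * \<mu> powr q * e) * (ennreal ((1 / r) powr p y * w y) * indicator R y)"
    proof (cases "y \<in> E")
      case True
      then have y: "y \<in> R" using E by (auto simp: R_def)
      have "(2 * mean lebesgue f R) powr p y * w y \<le> C0 * \<mu> powr q * e * (1 / r) powr p y * w y"
        using pt[OF y] w_pos[of y] by (intro mult_right_mono) auto
      then show ?thesis using True y C0 e w_pos[of y]
        by (simp flip: ennreal_mult add: mult.assoc)
    qed simp
  qed
  also have "\<dots> = ennreal (C0 * \<mu> powr q * e) * (\<integral>\<^sup>+y\<in>R. ennreal ((1 / r) powr p y * w y) \<partial>lebesgue)"
    by (subst nn_integral_cmult) auto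
  also have "\<dots> \<le> ennreal (C0 * \<mu> powr q * e) * 1"
    using rs by (intro mult_left_mono) (auto simp: ap_pair_def R_def)
  also have "\<dots> = ennreal (C0 * \<mu> powr q) * (\<integral>\<^sup>+y\<in>E. ennreal (\<sigma> y) \<partial>lebesgue)"
    using e C0 by (simp add: ennreal_mult)
  also have "\<dots> = (\<integral>\<^sup>+y\<in>E. ennreal (C0 * \<mu> powr q) * ennreal (\<sigma> y) \<partial>lebesgue)"
    by (subst nn_integral_cmult[symmetric]) (auto simp: mult.assoc)
  finally show "(\<integral>\<^sup>+y\<in>E. ennreal ((2 * mean lebesgue f (dcell a k x)) powr p y * w y) \<partial>lebesgue)
      \<le> (\<integral>\<^sup>+y\<in>E. ennreal (C0 * mean N h (dcell a k x) powr q) * ennreal (\<sigma> y) \<partial>lebesgue)"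
    by (simp add: R_def \<mu>_def)
qed

definition "C1 = C0 * (2 powr q / (q - 1)) * 2"

text \<open>Two measures live on the same tree: principal cells are formed with the Lebesgue means
  of f, whereas Doob's inequality is applied to h and the measure with density \<sigma>.
  \<open>cell_step\<close> passes from one to the other, and the mean of h over a principal cell is
  at most the running maximum of h at each of its points.\<close>

lemma normalised_maximal:
  assumes f_meas[measurable]: "f \<in> borel_measurable lebesgue" and f_nonneg: "\<And>x. 0 \<le> f x"
    and f_int: "(\<integral>\<^sup>+x\<in>X. ennreal (f x powr p x * w x) \<partial>lebesgue) \<le> 1"
  shows "(\<integral>\<^sup>+x\<in>X. ennreal (running_max (\<lambda>j. mean lebesgue f (dcell a j x)) T powr p x * w x) \<partial>lebesgue) \<le> ennreal C1"
proof -
  define g where "g = (\<lambda>x. max 1 (f x / \<sigma> x))"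
  define h where "h = (\<lambda>x. g x powr (p x / q))"
  define N where "N = density lebesgue (\<lambda>x. ennreal (\<sigma> x))"
  have [measurable]: "g \<in> borel_measurable lebesgue" by (simp add: g_def)
  have hm[measurable]: "h \<in> borel_measurable lebesgue" by (simp add: h_def)
  have setsN[simp, measurable_cong]: "sets N = sets lebesgue" by (simp add: N_def)
  note [measurable] = dcell_lebesgue
  have X1: "emeasure lebesgue X = 1" by (simp add: emeasure_dcell)
  have xX: "x0 \<in> X" by (rule dcell_self)
  have step: "(\<integral>\<^sup>+y\<in>E. ennreal ((2 * mean lebesgue f (dcell a k x)) powr p y * w y) \<partial>lebesgue)
      \<le> (\<integral>\<^sup>+y\<in>E. ennreal (C0 * mean N h (dcell a k x) powr q) * ennreal (\<sigma> y) \<partial>lebesgue)"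
    if "x \<in> X" "E \<in> sets lebesgue" "E \<subseteq> dcell a k x" "emeasure lebesgue (dcell a k x) \<le> 2 * emeasure lebesgue E" for x E k
    using cell_step(2)[OF f_meas f_nonneg f_int that] by (simp add: g_def h_def N_def)
  have hq2: "(\<integral>\<^sup>+x\<in>X. ennreal (h x powr q) \<partial>N) \<le> 2"
    using cell_step(1)[OF f_meas f_nonneg f_int xX dcell_lebesgue[of a 0 x0] subset_refl] 
    by (simp add: g_def h_def N_def mult_2)
  have fX: "(\<integral>\<^sup>+x\<in>X. ennreal (f x) \<partial>lebesgue) < \<infinity>"
  proof -
    have "(\<integral>\<^sup>+x\<in>X. ennreal (f x) \<partial>lebesgue) \<le> ennreal (1 * 1) * ((\<integral>\<^sup>+x\<in>X. ennreal ((f x / 1) powr p x * w x) \<partial>lebesgue)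
     + (\<integral>\<^sup>+x\<in>X. ennreal ((1 / 1) powr p' x * \<sigma> x) \<partial>lebesgue))"
      by (rule holder) (use f_nonneg in auto)
    also have "\<dots> \<le> ennreal (1 * 1) * (1 + 1)"
      using f_int norm by (intro mult_left_mono add_mono) (auto simp: ap_pair_def)
    finally show ?thesis by (auto intro: le_less_trans)
  qed
  have h1: "1 \<le> h y" for y
  proof -
    have "1 \<le> g y" by (simp add: g_def)
    then show ?thesis using p_pos[of y] q by (auto simp: h_def intro!: ge_one_powr_ge_zero)
  qed
  interpret T: dyadic_tree "dcell a" X by (rule dcell_tree)
  interpret TL: dyadic_tree_measure "dcell a" X lebesgue f
    by unfold_locales (use f_nonneg fX in \<open>auto simp: emeasure_dcell\<close>)
  have NX: "emeasure N X \<le> 1"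
  proof -
    have "emeasure N X = (\<integral>\<^sup>+y\<in>X. ennreal (\<sigma> y) \<partial>lebesgue)"
      unfolding N_def by (rule emeasure_density) auto
    then show ?thesis using norm by (auto simp: ap_pair_def)
  qed
  interpret TN: dyadic_tree_measure "dcell a" X N h
  proof unfold_locales
    show "emeasure N X < \<infinity>" using NX by (auto intro: le_less_trans)
    show "0 \<le> h y" for y using h1[of y] by simp
    have "(\<integral>\<^sup>+x\<in>X. ennreal (h x) \<partial>N) \<le> (\<integral>\<^sup>+x\<in>X. ennreal (h x powr q) \<partial>N)"
    proof (rule nn_integral_mono)
      fix y
      have "h y powr 1 \<le> h y powr q" using h1[of y] q by (intro powr_mono) auto
      then have "ennreal (h y) \<le> ennreal (h y powr q)" using h1[of y] by (intro ennreal_leI) auto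
      then show "ennreal (h y) * indicator X y \<le> ennreal (h y powr q) * indicator X y" by (rule mult_right_mono) simp
    qed
    also have "\<dots> < \<infinity>" using hq2 by (auto intro: le_less_trans)
    finally show "(\<integral>\<^sup>+x\<in>X. ennreal (h x) \<partial>N) < \<infinity>" .
  qed auto
  have m0: "mean lebesgue f (dcell a 0 x) = mean lebesgue f X" if "x \<in> X" for x
    using T.cell_0[OF that] by simp
  show ?thesis
  proof (cases "mean lebesgue f X > 0")
    \<comment> \<open>The stopping-time argument needs a positive mean over X; if this mean
      vanishes, all means over subcells vanish.\<close>
    case False
    then have "mean lebesgue f X = 0" using mean_nonneg[of lebesgue f X] by simp
    then have "(\<integral>\<^sup>+x\<in>X. ennreal (f x) \<partial>lebesgue) = 0"
      using TL.mean_mult_cell[OF xX, of 0] by simp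
    then have z: "mean lebesgue f (dcell a j x) = 0" if "x \<in> X" for x j
    proof -
      have "(\<integral>\<^sup>+y\<in>dcell a j x. ennreal (f y) \<partial>lebesgue) \<le> (\<integral>\<^sup>+x\<in>X. ennreal (f x) \<partial>lebesgue)"
        using T.cell_subset[OF that] by (intro nn_integral_mono) (auto simp: indicator_def)
      then show ?thesis using \<open>(\<integral>\<^sup>+x\<in>X. ennreal (f x) \<partial>lebesgue) = 0\<close> by (simp add: mean_def)
    qed
    have z2: "running_max (\<lambda>j. mean lebesgue f (dcell a j x)) T = 0" if "x \<in> X" for x
      using running_max_le[of T "\<lambda>j. mean lebesgue f (dcell a j x)" 0] TL.S_nonneg[of x T] z[OF that] by simp
    have "(\<integral>\<^sup>+x\<in>X. ennreal (running_max (\<lambda>j. mean lebesgue f (dcell a j x)) T powr p x * w x) \<partial>lebesgue)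
      = nn_integral lebesgue (\<lambda>_::real^'n. 0)"
      by (rule nn_integral_cong) (auto simp: z2 split: split_indicator)
    then show ?thesis by simp
  next
    case True
    define V where "V y = ennreal C0 * (ennreal (\<sigma> y) * (ennreal (TN.S T y powr q) * indicator X y))" for y
    have SXe[measurable]: "(\<lambda>y. ennreal (TN.S T y powr q) * indicator X y) \<in> borel_measurable lebesgue"
    proof -
      have "(\<lambda>x. indicator X x * (TN.S T x powr q)) \<in> borel_measurable lebesgue"
        by (rule T.measurable_cellwise[where k=T]) (use TN.S_cong in auto)
      then have "(\<lambda>x. ennreal (indicator X x * (TN.S T x powr q))) \<in> borel_measurable lebesgue"
        by measurable
      moreover have "ennreal (indicator X x * (TN.S T x powr q)) = ennreal (TN.S T x powr q) * indicator X x" for x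
        by (auto simp: indicator_def)
      ultimately show ?thesis by simp
    qed
    have "(\<integral>\<^sup>+x\<in>X. ennreal (TL.S T x powr p x * w x) \<partial>lebesgue) \<le> (\<integral>\<^sup>+x\<in>X. V x \<partial>lebesgue)"
    proof (rule TL.principal_bound[where W = "\<lambda>x b. ennreal (b powr p x * w x)"])
      show "0 < mean lebesgue f (dcell a 0 x)" if "x \<in> X" for x using True m0[OF that] by simp
      show "ennreal (b powr p x * w x) \<le> ennreal (c powr p x * w x)" if "0 \<le> b" "b \<le> c" for b c x
        using that w_pos[of x] p_pos[of x] by (intro ennreal_leI mult_right_mono powr_mono2) auto
      show "V \<in> borel_measurable lebesgue" unfolding V_def[abs_def] by measurable
      fix x i E
      assume as: "x \<in> X" "i \<le> T" "E \<in> sets lebesgue" "E \<subseteq> dcell a i x"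
        "emeasure lebesgue (dcell a i x) \<le> 2 * emeasure lebesgue E"
      have "(\<integral>\<^sup>+y\<in>E. ennreal ((2 * mean lebesgue f (dcell a i x)) powr p y * w y) \<partial>lebesgue)
        \<le> (\<integral>\<^sup>+y\<in>E. ennreal (C0 * mean N h (dcell a i x) powr q) * ennreal (\<sigma> y) \<partial>lebesgue)"
        by (rule step[OF as(1,3-5)])
      also have "\<dots> \<le> (\<integral>\<^sup>+y\<in>E. V y \<partial>lebesgue)"
      proof (rule nn_integral_mono)
        fix y
        show "ennreal (C0 * mean N h (dcell a i x) powr q) * ennreal (\<sigma> y) * indicator E y \<le> V y * indicator E y"
        proof (cases "y \<in> E")
          case True
          then have y: "y \<in> dcell a i x" using as by auto
          have yX: "y \<in> X" using y T.cell_subset[OF as(1)] by auto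
          have "mean N h (dcell a i x) = mean N h (dcell a i y)" using T.cell_eq[OF y] by simp
          also have "\<dots> \<le> TN.S T y" by (rule le_running_max[OF as(2), of "\<lambda>j. mean N h (dcell a j y)"])
          finally have "C0 * mean N h (dcell a i x) powr q * \<sigma> y \<le> C0 * TN.S T y powr q * \<sigma> y"
            using C0 dual_pos[of y] q mean_nonneg[of N h "dcell a i x"]
            by (intro mult_right_mono mult_left_mono powr_mono2) auto
          then have "ennreal (C0 * mean N h (dcell a i x) powr q * \<sigma> y) \<le> ennreal (C0 * TN.S T y powr q * \<sigma> y)"
            by (rule ennreal_leI)
          then show ?thesis using True yX C0 dual_pos[of y]
            by (simp add: V_def ennreal_mult mult_ac)
        qed simp
      qed
      finally show "(\<integral>\<^sup>+y\<in>E. ennreal ((2 * mean lebesgue f (dcell a i x)) powr p y * w y) \<partial>lebesgue) \<le> (\<integral>\<^sup>+y\<in>E. V y \<partial>lebesgue)" .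
    qed measurable
    also have "\<dots> = (\<integral>\<^sup>+y. ennreal C0 * (ennreal (\<sigma> y) * (ennreal (TN.S T y powr q) * indicator X y)) \<partial>lebesgue)"
      by (rule nn_integral_cong) (simp add: V_def indicator_def)
    also have "\<dots> = ennreal C0 * (\<integral>\<^sup>+y\<in>X. ennreal (TN.S T y powr q) \<partial>N)"
    proof -
      have "(\<integral>\<^sup>+y\<in>X. ennreal (TN.S T y powr q) \<partial>N) = (\<integral>\<^sup>+y. ennreal (\<sigma> y) * (ennreal (TN.S T y powr q) * indicator X y) \<partial>lebesgue)"
        by (subst (1) N_def) (rule nn_integral_density, measurable)
      then show ?thesis by (simp only:) (rule nn_integral_cmult, measurable)
    qed
    also have "\<dots> \<le> ennreal C0 * (ennreal (2 powr q / (q - 1)) * (\<integral>\<^sup>+y\<in>X. ennreal (h y powr q) \<partial>N))"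
      by (intro mult_left_mono TN.doob q) simp
    also have "\<dots> \<le> ennreal C0 * (ennreal (2 powr q / (q - 1)) * 2)"
      by (intro mult_left_mono hq2) auto
    also have "\<dots> = ennreal C0 * (ennreal (2 powr q / (q - 1)) * ennreal 2)" by simp
    also have "\<dots> = ennreal C1"
      using C0 q unfolding C1_def mult.assoc by (simp only: ennreal_mult[symmetric] divide_nonneg_nonneg powr_ge_zero less_imp_le diff_ge_0_iff_ge mult_nonneg_nonneg zero_le_numeral)
    finally show ?thesis .
  qed
qed

end

section \<open>The global dyadic maximal theorem\<close>

lemma mean_cmult:
  assumes "f \<in> borel_measurable N" "Q \<in> sets N" "0 \<le> c"
  shows "mean N (\<lambda>x. c * f x) Q = c * mean N f Q"
proof -
  have "(\<integral>\<^sup>+x\<in>Q. ennreal (c * f x) \<partial>N) = ennreal c * (\<integral>\<^sup>+x\<in>Q. ennreal (f x) \<partial>N)"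
    using assms by (subst nn_integral_cmult[symmetric]) (auto simp: ennreal_mult' mult.assoc)
  then show ?thesis using assms by (simp add: mean_def enn2real_mult)
qed

lemma ap_pair_subset:
  assumes "ap_pair p w A Q r s" "R \<subseteq> Q" "measure lebesgue R = measure lebesgue Q"
  shows "ap_pair p w A R r s"
proof -
  have "(\<integral>\<^sup>+x\<in>R. u x \<partial>lebesgue) \<le> (\<integral>\<^sup>+x\<in>Q. u x \<partial>lebesgue)" for u :: "_ \<Rightarrow> ennreal"
    using assms(2) by (intro nn_integral_mono) (auto simp: indicator_def)
  from order_trans[OF this] show ?thesis using assms(1) by (simp add: ap_pair_def assms(3))
qed

text \<open>The exponent n + 2 leaves a summable 1 / (i + 1)^2 after multiplication by the volume of
  a ball of radius i + 1.\<close>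

lemma decay_integral:
  "(\<integral>\<^sup>+x. ennreal ((exp 1 + norm (x::real^'n)) powr (- real (CARD('n) + 2))) \<partial>lebesgue) < \<infinity>"
proof -
  let ?n = "CARD('n)"
  define u where "u i x = ennreal (1 / real (Suc i) ^ (?n + 2)) * indicator (cball 0 (real (Suc i))) x" for i and x :: "real^'n"
  have "(\<integral>\<^sup>+x. ennreal ((exp 1 + norm (x::real^'n)) powr (- real (?n + 2))) \<partial>lebesgue) \<le> (\<integral>\<^sup>+x. (\<Sum>i. u i x) \<partial>lebesgue)"
  proof (rule nn_integral_mono)
    fix x :: "real^'n"
    define i where "i = nat \<lceil>norm x\<rceil>"
    have i: "norm x \<le> real i" "real i \<le> norm x + 1" unfolding i_def using norm_ge_zero[of x] by linarith+
    have "(exp 1 + norm x) powr (- real (?n + 2)) \<le> 1 / real (Suc i) ^ (?n + 2)"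
    proof -
      have "(2::real) \<le> exp 1" using exp_ge_add_one_self[of 1] by simp
      then have "real (Suc i) \<le> exp 1 + norm x" using i by simp
      then have "real (Suc i) ^ (?n + 2) \<le> (exp 1 + norm x) ^ (?n + 2)" by (intro power_mono) auto
      moreover have "(exp 1 + norm x) powr (- real (?n + 2)) = 1 / (exp 1 + norm x) ^ (?n + 2)"
        using norm_ge_zero[of x] by (subst powr_minus_divide, subst powr_realpow) (auto intro: add_pos_nonneg)
      ultimately show ?thesis by (simp only:) (intro divide_left_mono mult_pos_pos zero_less_power add_pos_nonneg; simp)
    qed
    then have "ennreal ((exp 1 + norm x) powr (- real (?n + 2))) \<le> u i x"
      using i by (auto simp: u_def intro!: ennreal_leI)
    also have "\<dots> = (\<Sum>j\<in>{i}. u j x)" by simp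
    also have "\<dots> \<le> (\<Sum>i. u i x)" by (rule sum_le_suminf) auto
    finally show "ennreal ((exp 1 + norm x) powr (- real (?n + 2))) \<le> (\<Sum>i. u i x)" .
  qed
  also have "\<dots> = (\<Sum>i. \<integral>\<^sup>+x. u i x \<partial>lebesgue)"
    unfolding u_def
    by (intro nn_integral_suminf borel_measurable_times_ennreal borel_measurable_const
        borel_measurable_indicator fmeasurableD lmeasurable_cball)
  also have "\<dots> \<le> (\<Sum>i. ennreal (2 ^ ?n * (1 / real (Suc i) ^ 2)))"
  proof (rule suminf_le)
    fix i
    have sub: "cball 0 (real (Suc i)) \<subseteq> cbox (\<chi> i'. - real (Suc i)) (\<chi> i'. (\<chi> i'. - real (Suc i)) $ i' + 2 * real (Suc i) :: real^'n)"
    proof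
      fix x :: "real^'n" assume x: "x \<in> cball 0 (real (Suc i))"
      show "x \<in> cbox (\<chi> i'. - real (Suc i)) (\<chi> i'. (\<chi> i'. - real (Suc i)) $ i' + 2 * real (Suc i))"
        unfolding mem_box_cart
      proof
        fix j
        have "\<bar>x$j\<bar> \<le> real (Suc i)" using component_le_norm_cart[of x j] x by simp
        then show "(\<chi> i'. - real (Suc i)) $ j \<le> x $ j \<and> x $ j \<le> (\<chi> i'. (\<chi> i'. - real (Suc i)) $ i' + 2 * real (Suc i)) $ j"
          by (simp add: abs_le_iff)
      qed
    qed
    have "(\<integral>\<^sup>+x. u i x \<partial>lebesgue) = ennreal (1 / real (Suc i) ^ (?n + 2)) * emeasure lebesgue (cball (0::real^'n) (real (Suc i)))"
      unfolding u_def by (subst nn_integral_cmult_indicator) auto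
    also have "\<dots> \<le> ennreal (1 / real (Suc i) ^ (?n + 2)) * ennreal ((2 * real (Suc i)) ^ ?n)"
    proof (rule mult_left_mono)
      have "emeasure lebesgue (cball (0::real^'n) (real (Suc i))) \<le> emeasure lebesgue (cbox (\<chi> i'. - real (Suc i)) (\<chi> i'. (\<chi> i'. - real (Suc i)) $ i' + 2 * real (Suc i) :: real^'n))"
        by (rule emeasure_mono[OF sub]) simp
      also have "\<dots> = ennreal ((2 * real (Suc i)) ^ ?n)" by (rule emeasure_cube(1)) simp
      finally show "emeasure lebesgue (cball (0::real^'n) (real (Suc i))) \<le> ennreal ((2 * real (Suc i)) ^ ?n)" .
    qed simp
    also have "\<dots> = ennreal (1 / real (Suc i) ^ (?n + 2) * (2 * real (Suc i)) ^ ?n)"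
      by (rule ennreal_mult[symmetric]) simp_all
    also have "1 / real (Suc i) ^ (?n + 2) * (2 * real (Suc i)) ^ ?n = 2 ^ ?n * (1 / real (Suc i) ^ 2)"
      by (simp add: power_add power_mult_distrib power2_eq_square del: of_nat_Suc)
    finally show "(\<integral>\<^sup>+x. u i x \<partial>lebesgue) \<le> ennreal (2 ^ ?n * (1 / real (Suc i) ^ 2))" .
  qed auto
  also have "\<dots> < \<infinity>"
  proof -
    have "summable (\<lambda>i. 1 / real i ^ 2)"
      using inverse_power_summable[of 2, where 'a = real] by (simp add: field_simps)
    then have "summable (\<lambda>i. 2 ^ ?n * (1 / real (Suc i) ^ 2))"
      by (intro summable_mult) (subst summable_Suc_iff)
    then show ?thesis by (subst suminf_ennreal2) auto
  qed
  finally show ?thesis .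
qed

section \<open>From unit cells to the whole space\<close>

definition lattice_pt :: "real^'n \<Rightarrow> int^'n \<Rightarrow> real^'n" where
  "lattice_pt a k = (\<chi> i. a$i + of_int (k$i))"

lemma mem_lattice_cell: "x \<in> dcell a 0 (lattice_pt a k) \<longleftrightarrow> k = (\<chi> i. \<lfloor>x$i - a$i\<rfloor>)"
  by (auto simp: dcell_def lattice_pt_def vec_eq_iff)

lemma nn_integral_lattice:
  fixes u :: "real^'n \<Rightarrow> ennreal"
  assumes [measurable]: "u \<in> borel_measurable lebesgue"
  shows "(\<integral>\<^sup>+x. u x \<partial>lebesgue) = (\<integral>\<^sup>+k. (\<integral>\<^sup>+x\<in>dcell a 0 (lattice_pt a k). u x \<partial>lebesgue) \<partial>count_space UNIV)"
proof -
  have "(\<integral>\<^sup>+k. (\<integral>\<^sup>+x\<in>dcell a 0 (lattice_pt a k). u x \<partial>lebesgue) \<partial>count_space UNIV)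
    = (\<integral>\<^sup>+x. (\<integral>\<^sup>+k. u x * indicator (dcell a 0 (lattice_pt a k)) x \<partial>count_space UNIV) \<partial>lebesgue)"
    by (rule nn_integral_count_space_nn_integral[symmetric]) auto
  also have "\<dots> = (\<integral>\<^sup>+x. u x \<partial>lebesgue)"
  proof (rule nn_integral_cong)
    fix x :: "real^'n"
    have "(\<integral>\<^sup>+k. u x * indicator (dcell a 0 (lattice_pt a k)) x \<partial>count_space UNIV)
      = (\<integral>\<^sup>+k. u x * indicator {\<chi> i. \<lfloor>x$i - a$i\<rfloor>} k \<partial>count_space UNIV)"
      by (rule nn_integral_cong) (simp add: indicator_def mem_lattice_cell)
    also have "\<dots> = u x" by (subst nn_integral_cmult_indicator) auto
    finally show "(\<integral>\<^sup>+k. u x * indicator (dcell a 0 (lattice_pt a k)) x \<partial>count_space UNIV) = u x" .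
  qed
  finally show ?thesis by simp
qed

text \<open>The standing assumptions after reduction: a weight positive everywhere, admissible pairs
  with one constant A on all cubes of volume at most 1, and the decay of p at infinity.\<close>

locale ap_weight = weighted p q P L w for p :: "real^'n \<Rightarrow> real" and q P L w +
  fixes A c pinf :: real
  assumes A: "1 \<le> A" and c: "0 < c"
    and cube_pairs: "Q \<in> small_cubes \<Longrightarrow> \<exists>r s. ap_pair p w A Q r s"
    and LHinf: "\<bar>p x - pinf\<bar> \<le> c / ln (exp 1 + norm x)"
begin

lemma cell_pairs: "\<exists>r s. ap_pair p w A (dcell a k x) r s"
proof -
  obtain r s where "ap_pair p w A (cbox (dcorner a k x) (\<chi> i. dcorner a k x $ i + 1 / 2^k)) r s"
    using cube_pairs[OF dcell_small_cube] by blast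
  then have "ap_pair p w A (dcell a k x) r s"
    by (rule ap_pair_subset) (auto simp: dcell_subset_cbox measure_def emeasure_dcell emeasure_cube simp del: emeasure_lborel_cbox measure_completion emeasure_completion)
  then show ?thesis by blast
qed

text \<open>Replacing \<open>w\<close> by \<open>\<lambda>x. s powr p x * w x\<close> leaves the \<open>A\<^sub>p\<close> constant unchanged; on a fixed
  unit cell this reduces the claim to the normalised situation.\<close>

lemma cell_maximal:
  assumes f_meas[measurable]: "f \<in> borel_measurable lebesgue" and f_nonneg: "\<And>x. 0 \<le> f x"
    and f_int: "(\<integral>\<^sup>+x\<in>dcell a 0 x0. ennreal (f x powr p x * w x) \<partial>lebesgue) \<le> 1"
  shows "(\<integral>\<^sup>+x\<in>dcell a 0 x0. ennreal (running_max (\<lambda>j. mean lebesgue f (dcell a j x)) T powr p x * w x) \<partial>lebesgue)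
    \<le> ennreal (normalised.C1 q P L A)"
proof -
  obtain r0 s0 where rs0: "ap_pair p w A (dcell a 0 x0) r0 s0" using cell_pairs by blast
  then have s0: "s0 > 0" by (simp add: ap_pair_def)
  define w' where "w' x = s0 powr p x * w x" for x
  have w'_pos: "0 < w' x" for x using s0 w_pos by (simp add: w'_def)
  have dual': "dual_weight p w' x = (1 / s0) powr p' x * \<sigma> x" for x
  proof -
    have "p x * (- 1 / (p x - 1)) = - p' x" by (simp add: conj_exponent_def)
    moreover have "s0 powr (- p' x) = (1 / s0) powr p' x"
      using s0 by (simp add: powr_minus powr_divide inverse_eq_divide)
    ultimately show ?thesis unfolding dual_weight_def w'_def powr_mult powr_powr by simp
  qed
  have pair': "ap_pair p w' A Q (r * s0) (s / s0)" if "ap_pair p w A Q r s" for Q r s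
  proof -
    have r: "r > 0" and s: "s > 0" using that by (auto simp: ap_pair_def)
    have "(1 / (r * s0)) powr p x * w' x = (1 / r) powr p x * w x" for x
    proof -
      have "(1 / (r * s0)) powr p x * w' x = ((1 / (r * s0)) * s0) powr p x * w x"
        by (simp only: w'_def powr_mult mult.assoc)
      also have "(1 / (r * s0)) * s0 = 1 / r" using s0 by simp
      finally show ?thesis .
    qed
    moreover have "(1 / (s / s0)) powr p' x * dual_weight p w' x = (1 / s) powr p' x * \<sigma> x" for x
    proof -
      have "(1 / (s / s0)) powr p' x * dual_weight p w' x = ((1 / (s / s0)) * (1 / s0)) powr p' x * \<sigma> x"
        unfolding dual' powr_mult by simp
      also have "(1 / (s / s0)) * (1 / s0) = 1 / s" using s0 by simp
      finally show ?thesis .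
    qed
    ultimately show ?thesis using that r s s0 by (simp add: ap_pair_def)
  qed
  interpret N: normalised p q P L w' a x0 A "r0 * s0"
  proof unfold_locales
    show "w' \<in> borel_measurable lebesgue" unfolding w'_def[abs_def] by measurable
    show "\<exists>r s. ap_pair p w' A (dcell a k x) r s" for x k
      using cell_pairs[of a k x] pair' by blast
    show "ap_pair p w' A (dcell a 0 x0) (r0 * s0) 1" using pair'[OF rs0] s0 by simp
  qed (use w'_pos A in auto)
  have eq: "(1 / s0 * b) powr p x * w' x = b powr p x * w x" for b x
  proof -
    have "(1 / s0 * b) powr p x * w' x = (1 / s0 * b * s0) powr p x * w x"
      by (simp only: w'_def powr_mult mult.assoc)
    also have "1 / s0 * b * s0 = b" using s0 by simp
    finally show ?thesis .
  qed
  have "(\<integral>\<^sup>+x\<in>dcell a 0 x0. ennreal (running_max (\<lambda>j. mean lebesgue (\<lambda>x. 1 / s0 * f x) (dcell a j x)) T powr p x * w' x) \<partial>lebesgue)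
    \<le> ennreal (normalised.C1 q P L A)"
    by (rule N.normalised_maximal) (use s0 f_nonneg f_int eq in auto)
  moreover have "running_max (\<lambda>j. mean lebesgue (\<lambda>x. 1 / s0 * f x) (dcell a j x)) T
     = 1 / s0 * running_max (\<lambda>j. mean lebesgue f (dcell a j x)) T" for x
    using s0 running_max_scale[of "1 / s0" "\<lambda>j. mean lebesgue f (dcell a j x)" T]
    by (subst mean_cmult) auto
  ultimately show ?thesis by (simp only: eq)
qed

abbreviation "modular f \<equiv> (\<integral>\<^sup>+x. ennreal (f x powr p x * w x) \<partial>lebesgue)"

text \<open>On each unit cell \<open>f\<close> is normalised by \<open>t\<close>, where \<open>t\<close> to the power of the largest exponent
  is the modular of \<open>f\<close> on the cell, but at least \<open>(e + \<bar>x\<bar>) powr (- (n + 2))\<close>.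
  The decay condition then bounds the loss caused by the variation of \<open>p\<close>.\<close>

lemma summation:
  assumes R: "0 \<le> R"
  obtains C where "0 < C"
    "\<And>a v f Z B \<rho>. \<lbrakk>norm v \<le> R; Z \<in> borel_measurable lebesgue; 1 \<le> B;
       (\<integral>\<^sup>+k. \<rho> k \<partial>count_space UNIV) \<le> 1;
       \<And>k. (\<integral>\<^sup>+x\<in>dcell a 0 (lattice_pt a k + v). ennreal (f x powr p x * w x) \<partial>lebesgue) \<le> \<rho> k;
       f \<in> borel_measurable lebesgue; \<And>x. 0 \<le> f x;
       \<And>k t. 0 < t \<Longrightarrow> t \<le> 1 \<Longrightarrow>
         (\<integral>\<^sup>+x\<in>dcell a 0 (lattice_pt a k + v). ennreal ((f x / t) powr p x * w x) \<partial>lebesgue) \<le> 1 \<Longrightarrow>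
         (\<integral>\<^sup>+x\<in>dcell a 0 (lattice_pt a k). ennreal ((1 / t) powr p x) * Z x \<partial>lebesgue) \<le> ennreal B\<rbrakk>
     \<Longrightarrow> (\<integral>\<^sup>+x. Z x \<partial>lebesgue) \<le> ennreal (C * B)"
proof -
  let ?n = "CARD('n)"
  \<comment> \<open>Bounds the distance from a lattice point to the points of its unit cell and to
    those of the cell translated by v.\<close>
  define D where "D = real ?n + R"
  have "1 \<le> real ?n" using zero_less_card_finite[where 'a = 'n] by linarith
  then have D: "D \<ge> 1" unfolding D_def using R by linarith
  define c' where "c' = c * (1 + ln (1 + D))"
  have c': "c' > 0" using c D by (auto simp: c'_def intro!: mult_pos_pos add_pos_nonneg)
  define m where "m = real (?n + 2)"
  define I where "I = enn2real (\<integral>\<^sup>+x. ennreal ((exp 1 + norm (x::real^'n)) powr (- m)) \<partial>lebesgue)"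
  have I: "(\<integral>\<^sup>+x. ennreal ((exp 1 + norm (x::real^'n)) powr (- m)) \<partial>lebesgue) = ennreal I"
    using decay_integral[where 'n = 'n] unfolding I_def m_def by (intro ennreal_enn2real[symmetric]) simp
  have I0: "I \<ge> 0" by (simp add: I_def)
  \<comment> \<open>The exponents involved differ by at most 2 c' / ln (e + |y|), and the
    normalising quantity z is at least (e + |y|)^(-m). Therefore z to the power of minus the
    difference is at most this constant.\<close>
  define E where "E = exp (m * (2 * c'))"
  define C where "C = E * (1 + (1 + D) powr m * I)"
  have C: "C > 0" unfolding C_def E_def using I0 by (intro mult_pos_pos add_pos_nonneg) auto
  have e1: "1 \<le> ln (exp 1 + norm (x::real^'n))" for x
  proof -
    have "ln (exp 1) \<le> ln (exp 1 + norm x)" by (subst ln_le_cancel_iff) (auto intro: add_pos_nonneg)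
    then show ?thesis by simp
  qed
  have shift: "exp 1 + norm y \<le> (1 + D) * (exp 1 + norm x)" if "norm (x - y) \<le> D" for x y :: "real^'n"
  proof -
    have "norm y \<le> norm x + D" using norm_triangle_ineq2[of y x] that by (simp add: norm_minus_commute)
    moreover have "D * 1 \<le> D * (exp 1 + norm x)"
      using D exp_ge_add_one_self[of 1] by (intro mult_left_mono) (auto intro: order_trans[of 1 2] add_increasing2)
    ultimately show ?thesis by (simp add: algebra_simps)
  qed
  have pclose: "\<bar>p x - pinf\<bar> \<le> c' / ln (exp 1 + norm y)" if "norm (x - y) \<le> D" for x y
  proof -
    have "ln (exp 1 + norm y) \<le> ln ((1 + D) * (exp 1 + norm x))"
      using shift[OF that] D by (subst ln_le_cancel_iff) (auto intro!: mult_pos_pos add_pos_nonneg)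
    also have "\<dots> = ln (1 + D) + ln (exp 1 + norm x)"
    proof -
      have "0 < 1 + D" "0 < exp 1 + norm x" using D by (auto intro: add_pos_nonneg)
      then show ?thesis by (simp add: ln_mult)
    qed
    also have "\<dots> \<le> ln (1 + D) * ln (exp 1 + norm x) + ln (exp 1 + norm x)"
      using e1[of x] D mult_left_mono[OF e1[of x], of "ln (1 + D)"] by simp
    finally have "ln (exp 1 + norm y) \<le> (1 + ln (1 + D)) * ln (exp 1 + norm x)" by (simp add: algebra_simps)
    then have "c * ln (exp 1 + norm y) \<le> c' * ln (exp 1 + norm x)"
      using c unfolding c'_def by (simp add: mult.assoc mult_left_mono)
    then have "c / ln (exp 1 + norm x) \<le> c' / ln (exp 1 + norm y)"
      using e1[of x] e1[of y] by (simp add: field_simps)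
    then show ?thesis using LHinf[of x] by simp
  qed
  have key: "(\<integral>\<^sup>+x. Z x \<partial>lebesgue) \<le> ennreal (C * B)"
    if v: "norm v \<le> R" and Z[measurable]: "Z \<in> borel_measurable lebesgue" and B: "1 \<le> B"
      and \<rho>1: "(\<integral>\<^sup>+k. \<rho> k \<partial>count_space UNIV) \<le> 1"
      and \<rho>: "\<And>k. (\<integral>\<^sup>+x\<in>dcell a 0 (lattice_pt a k + v). ennreal (f x powr p x * w x) \<partial>lebesgue) \<le> \<rho> k"
      and f[measurable]: "f \<in> borel_measurable lebesgue" and f0: "\<And>x. 0 \<le> f x"
      and loc: "\<And>k t. 0 < t \<Longrightarrow> t \<le> 1 \<Longrightarrow>
         (\<integral>\<^sup>+x\<in>dcell a 0 (lattice_pt a k + v). ennreal ((f x / t) powr p x * w x) \<partial>lebesgue) \<le> 1 \<Longrightarrow>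
         (\<integral>\<^sup>+x\<in>dcell a 0 (lattice_pt a k). ennreal ((1 / t) powr p x) * Z x \<partial>lebesgue) \<le> ennreal B"
    for a v f Z B \<rho>
  proof -
    define b where "b k = (exp 1 + norm (lattice_pt a k)) powr (- m)" for k
    have cell: "(\<integral>\<^sup>+x\<in>dcell a 0 (lattice_pt a k). Z x \<partial>lebesgue) \<le> ennreal (B * E) * (\<rho> k + ennreal (b k))" for k
    proof -
      define y where "y = lattice_pt a k"
      define \<epsilon> where "\<epsilon> = c' / ln (exp 1 + norm y)"
      have \<epsilon>: "\<epsilon> > 0" unfolding \<epsilon>_def using c' e1[of y] by (intro divide_pos_pos) auto
      have near: "\<bar>p x - pinf\<bar> \<le> \<epsilon>" if "x \<in> dcell a 0 y \<or> x \<in> dcell a 0 (y + v)" for x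
      proof -
        have "norm (x - y) \<le> D"
          using that
        proof
          assume "x \<in> dcell a 0 y"
          then show ?thesis using dist_dcell[of x a 0 y y] R by (simp add: D_def dcell_self)
        next
          assume "x \<in> dcell a 0 (y + v)"
          then have "norm (x - (y + v)) \<le> real ?n" using dist_dcell[of x a 0 "y + v" "y + v"] by (simp add: dcell_self)
          then show ?thesis using v norm_triangle_ineq[of "x - (y + v)" v] by (simp add: D_def)
        qed
        then show ?thesis unfolding \<epsilon>_def by (rule pclose)
      qed
      \<comment> \<open>pu bounds p from above on the cell that carries f, pl from below on the cell
        where Z is integrated. Both are compared with pinf, so it does not matter that the cells may
        differ.\<close>
      define pu pl where "pu = pinf + \<epsilon>" and "pl = max 1 (pinf - \<epsilon>)"
      have pu: "p x \<le> pu" if "x \<in> dcell a 0 (y + v)" for x using near[of x] that by (simp add: pu_def abs_le_iff)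
      have pl: "pl \<le> p x" if "x \<in> dcell a 0 y" for x
        using near[of x] that p_gt_1[of x] by (simp add: pl_def abs_le_iff)
      have pu1: "pu \<ge> 1"
        using pu[of "y + v"] p_gt_1[of "y + v"] dcell_self by force
      have diff: "pu - pl \<le> 2 * \<epsilon>" by (simp add: pu_def pl_def)
      have plu: "pl \<le> pu" using pl[of y] near[of y] dcell_self[of y a 0] by (simp add: pu_def abs_le_iff)
      have \<rho>k1: "\<rho> k \<le> 1"
      proof -
        have "(\<integral>\<^sup>+j. \<rho> j * indicator {k} j \<partial>count_space UNIV) \<le> (\<integral>\<^sup>+j. \<rho> j \<partial>count_space UNIV)"
          by (intro nn_integral_mono) (auto simp: indicator_def)
        then show ?thesis using \<rho>1 by (simp add: nn_integral_indicator_singleton one_ennreal_def[symmetric])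
      qed
      obtain h where h: "\<rho> k = ennreal h" "0 \<le> h" "h \<le> 1"
        using \<rho>k1 by (metis ennreal_1 ennreal_cases ennreal_le_1 top.extremum_unique ennreal_one_neq_top)
      have bk: "0 < b k" "b k \<le> 1"
      proof -
        have g2: "1 \<le> exp 1 + norm y" using exp_ge_add_one_self[of 1] norm_ge_zero[of y] by linarith
        then show "0 < b k" unfolding b_def y_def[symmetric] by simp
        show "b k \<le> 1" unfolding b_def y_def[symmetric]
          using g2 powr_mono[of "- m" 0 "exp 1 + norm y"] by (simp add: m_def)
      qed
      define z where "z = max h (b k)"
      have z: "0 < z" "z \<le> 1" "h \<le> z" "b k \<le> z" using bk h by (auto simp: z_def)
      define t where "t = z powr (1 / pu)"
      have t: "0 < t" "t \<le> 1" "t powr pu = z"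
        using z pu1 by (auto simp: t_def powr_powr intro!: powr_le1)
      have "(\<integral>\<^sup>+x\<in>dcell a 0 (y + v). ennreal ((f x / t) powr p x * w x) \<partial>lebesgue)
        \<le> (\<integral>\<^sup>+x. ennreal (1 / z) * (ennreal (f x powr p x * w x) * indicator (dcell a 0 (y + v)) x) \<partial>lebesgue)"
      proof (rule nn_integral_mono)
        fix x
        show "ennreal ((f x / t) powr p x * w x) * indicator (dcell a 0 (y + v)) x
          \<le> ennreal (1 / z) * (ennreal (f x powr p x * w x) * indicator (dcell a 0 (y + v)) x)"
        proof (cases "x \<in> dcell a 0 (y + v)")
          case True
          have "t powr pu \<le> t powr p x" using t pu[OF True] by (intro powr_mono') auto
          then have "1 / t powr p x \<le> 1 / z" using t z by (simp add: frac_le)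
          then have "f x powr p x * w x * (1 / t powr p x) \<le> f x powr p x * w x * (1 / z)"
            using w_pos[of x] by (intro mult_left_mono) auto
          then have "(f x / t) powr p x * w x \<le> 1 / z * (f x powr p x * w x)"
            using t f0[of x] by (simp add: powr_divide mult_ac)
          then show ?thesis using True z w_pos[of x] by (simp flip: ennreal_mult)
        qed simp
      qed
      also have "\<dots> = ennreal (1 / z) * (\<integral>\<^sup>+x\<in>dcell a 0 (y + v). ennreal (f x powr p x * w x) \<partial>lebesgue)"
        using dcell_lebesgue by (subst nn_integral_cmult) auto
      also have "\<dots> \<le> ennreal (1 / z) * ennreal h"
        using \<rho>[of k] h by (intro mult_left_mono) (auto simp: y_def)
      also have "\<dots> = ennreal (h / z)" using z h by (simp flip: ennreal_mult)
      also have "\<dots> \<le> ennreal 1" using z h by (intro ennreal_leI) simp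
      finally have "(\<integral>\<^sup>+x\<in>dcell a 0 (y + v). ennreal ((f x / t) powr p x * w x) \<partial>lebesgue) \<le> 1" by simp
      then have L: "(\<integral>\<^sup>+x\<in>dcell a 0 y. ennreal ((1 / t) powr p x) * Z x \<partial>lebesgue) \<le> ennreal B"
        using loc[OF t(1,2)] by (simp add: y_def)
      have "(\<integral>\<^sup>+x\<in>dcell a 0 y. Z x \<partial>lebesgue) \<le> (\<integral>\<^sup>+x. ennreal (t powr pl) * (ennreal ((1 / t) powr p x) * Z x * indicator (dcell a 0 y) x) \<partial>lebesgue)"
      proof (rule nn_integral_mono)
        fix x
        show "Z x * indicator (dcell a 0 y) x \<le> ennreal (t powr pl) * (ennreal ((1 / t) powr p x) * Z x * indicator (dcell a 0 y) x)"
        proof (cases "x \<in> dcell a 0 y")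
          case True
          have "1 \<le> t powr pl * (1 / t) powr p x"
          proof -
            have "t powr p x \<le> t powr pl" using t pl[OF True] by (intro powr_mono') auto
            then show ?thesis using t by (simp add: powr_divide)
          qed
          then have "1 \<le> ennreal (t powr pl) * ennreal ((1 / t) powr p x)"
            by (simp flip: ennreal_mult ennreal_1)
          then have "1 * Z x \<le> (ennreal (t powr pl) * ennreal ((1 / t) powr p x)) * Z x"
            by (rule mult_right_mono) simp
          then show ?thesis using True by (simp add: mult.assoc)
        qed simp
      qed
      also have "\<dots> = ennreal (t powr pl) * (\<integral>\<^sup>+x\<in>dcell a 0 y. ennreal ((1 / t) powr p x) * Z x \<partial>lebesgue)"
        using dcell_lebesgue by (subst nn_integral_cmult) auto
      also have "\<dots> \<le> ennreal (t powr pl) * ennreal B" by (intro mult_left_mono L) simp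
      also have "\<dots> = ennreal (t powr pl * B)" using B by (simp add: ennreal_mult)
      also have "\<dots> \<le> ennreal (B * E * (h + b k))"
      proof (rule ennreal_leI)
        have "t powr pl = z powr (1 + (pl - pu) / pu)"
          using pu1 by (simp add: t_def powr_powr field_simps)
        also have "\<dots> = z * z powr ((pl - pu) / pu)" using z by (simp add: powr_add)
        also have "z powr ((pl - pu) / pu) \<le> E"
        proof -
          define d where "d = (pu - pl) / pu"
          have d: "0 \<le> d" "d \<le> 2 * \<epsilon>"
          proof -
            show "0 \<le> d" using plu pu1 by (simp add: d_def)
            have "d \<le> pu - pl" using plu pu1 mult_left_mono[of 1 pu "pu - pl"] by (simp add: d_def divide_le_eq)
            then show "d \<le> 2 * \<epsilon>" using diff by simp
          qed
          have "z powr ((pl - pu) / pu) = z powr (- d)" by (simp add: d_def minus_divide_left)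
          also have "\<dots> \<le> b k powr (- d)" using z bk d by (intro powr_mono2') auto
          also have "\<dots> = (exp 1 + norm y) powr (m * d)" by (simp add: b_def y_def powr_powr)
          also have "\<dots> = exp (m * (d * ln (exp 1 + norm y)))"
            using norm_ge_zero[of y] by (simp add: powr_def add_pos_nonneg mult.assoc) (metis add_pos_nonneg exp_gt_zero less_irrefl norm_ge_zero)
          also have "\<dots> \<le> exp (m * (2 * c'))"
          proof -
            have "d * ln (exp 1 + norm y) \<le> 2 * \<epsilon> * ln (exp 1 + norm y)" using d e1[of y] by (intro mult_right_mono) auto
            also have "\<dots> = 2 * c'" using e1[of y] by (simp add: \<epsilon>_def)
            finally show ?thesis by (simp add: m_def mult_left_mono)
          qed
          finally show ?thesis by (simp add: E_def)
        qed
        finally have "t powr pl \<le> z * E" using z by (simp add: mult_left_mono)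
        also have "\<dots> \<le> (h + b k) * E" using h bk by (intro mult_right_mono) (auto simp: z_def E_def)
        finally have "t powr pl * B \<le> (h + b k) * E * B" using B by (intro mult_right_mono) auto
        then show "t powr pl * B \<le> B * E * (h + b k)" by (simp add: mult_ac)
      qed
      also have "\<dots> = ennreal (B * E) * (\<rho> k + ennreal (b k))"
        using h bk B by (simp add: E_def ennreal_mult ennreal_plus del: ennreal_plus) (simp add: ennreal_plus)
      finally show ?thesis by (simp add: y_def)
    qed
    have nm: "(\<lambda>x::real^'n. ennreal ((exp 1 + norm x) powr (- m))) \<in> borel_measurable lebesgue"
    proof -
      have "(\<lambda>x::real^'n. (exp 1 + norm x) powr (- m)) \<in> borel_measurable borel"
      proof (intro borel_measurable_continuous_onI continuous_intros ballI)
        fix x :: "real^'n"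
        have "0 < exp 1 + norm x" by (auto intro: add_pos_nonneg)
        then show "exp 1 + norm x \<noteq> 0" by simp
      qed
      then have "(\<lambda>x::real^'n. ennreal ((exp 1 + norm x) powr (- m))) \<in> borel_measurable borel"
        by measurable
      then show ?thesis by (intro measurable_completion) simp
    qed
    have sum_b: "(\<integral>\<^sup>+k. ennreal (b k) \<partial>count_space UNIV) \<le> ennreal ((1 + D) powr m * I)"
    proof -
      have "ennreal (b k) \<le> (\<integral>\<^sup>+x\<in>dcell a 0 (lattice_pt a k). ennreal ((1 + D) powr m) * ennreal ((exp 1 + norm x) powr (- m)) \<partial>lebesgue)" for k
      proof -
        have "ennreal (b k) = (\<integral>\<^sup>+x\<in>dcell a 0 (lattice_pt a k). ennreal (b k) \<partial>lebesgue)"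
          using dcell_lebesgue by (subst nn_integral_cmult_indicator) (auto simp: emeasure_dcell)
        also have "\<dots> \<le> (\<integral>\<^sup>+x\<in>dcell a 0 (lattice_pt a k). ennreal ((1 + D) powr m) * ennreal ((exp 1 + norm x) powr (- m)) \<partial>lebesgue)"
        proof (rule nn_integral_mono)
          fix x
          show "ennreal (b k) * indicator (dcell a 0 (lattice_pt a k)) x \<le> ennreal ((1 + D) powr m) * ennreal ((exp 1 + norm x) powr (- m)) * indicator (dcell a 0 (lattice_pt a k)) x"
          proof (cases "x \<in> dcell a 0 (lattice_pt a k)")
            case True
            then have "norm (lattice_pt a k - x) \<le> D"
              using dist_dcell[of "lattice_pt a k" a 0 "lattice_pt a k" x] R by (simp add: D_def dcell_self)
            then have s: "exp 1 + norm x \<le> (1 + D) * (exp 1 + norm (lattice_pt a k))" by (rule shift)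
            have pos: "0 < exp 1 + norm x" "0 < exp 1 + norm (lattice_pt a k)" by (auto intro: add_pos_nonneg)
            have "((1 + D) * (exp 1 + norm (lattice_pt a k))) powr (- m) \<le> (exp 1 + norm x) powr (- m)"
              using s pos by (intro powr_mono2') (auto simp: m_def)
            then have "(1 + D) powr m * ((1 + D) powr (- m) * b k) \<le> (1 + D) powr m * (exp 1 + norm x) powr (- m)"
              unfolding powr_mult b_def by (intro mult_left_mono) auto
            moreover have "(1 + D) powr m * (1 + D) powr (- m) = 1" using D by (simp flip: powr_add)
            ultimately have "b k \<le> (1 + D) powr m * (exp 1 + norm x) powr (- m)"
              by (simp only: mult.assoc[symmetric] mult_1_left)
            then have "ennreal (b k) \<le> ennreal ((1 + D) powr m) * ennreal ((exp 1 + norm x) powr (- m))"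
              by (subst ennreal_mult[symmetric]) (auto intro: ennreal_leI)
            then show ?thesis using True by simp
          qed simp
        qed
        finally show ?thesis .
      qed
      then have "(\<integral>\<^sup>+k. ennreal (b k) \<partial>count_space UNIV) \<le> (\<integral>\<^sup>+k. (\<integral>\<^sup>+x\<in>dcell a 0 (lattice_pt a k). ennreal ((1 + D) powr m) * ennreal ((exp 1 + norm x) powr (- m)) \<partial>lebesgue) \<partial>count_space UNIV)"
        by (intro nn_integral_mono) auto
      also have "\<dots> = (\<integral>\<^sup>+x. ennreal ((1 + D) powr m) * ennreal ((exp 1 + norm (x::real^'n)) powr (- m)) \<partial>lebesgue)"
        by (rule nn_integral_lattice[symmetric], rule borel_measurable_times_ennreal[OF borel_measurable_const nm])
      also have "\<dots> = ennreal ((1 + D) powr m) * ennreal I"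
        unfolding I[symmetric] by (rule nn_integral_cmult[OF nm])
      finally show ?thesis using I0 by (simp add: ennreal_mult)
    qed
    have "(\<integral>\<^sup>+x. Z x \<partial>lebesgue) = (\<integral>\<^sup>+k. (\<integral>\<^sup>+x\<in>dcell a 0 (lattice_pt a k). Z x \<partial>lebesgue) \<partial>count_space UNIV)"
      by (rule nn_integral_lattice) measurable
    also have "\<dots> \<le> (\<integral>\<^sup>+k. ennreal (B * E) * (\<rho> k + ennreal (b k)) \<partial>count_space UNIV)"
      by (intro nn_integral_mono cell)
    also have "\<dots> = ennreal (B * E) * ((\<integral>\<^sup>+k. \<rho> k \<partial>count_space UNIV) + (\<integral>\<^sup>+k. ennreal (b k) \<partial>count_space UNIV))"
      by (subst nn_integral_cmult, simp, subst nn_integral_add) auto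
    also have "\<dots> \<le> ennreal (B * E) * (1 + ennreal ((1 + D) powr m * I))"
      by (intro mult_left_mono add_mono \<rho>1 sum_b) simp
    also have "\<dots> = ennreal (B * E * (1 + (1 + D) powr m * I))"
      using I0 B by (subst ennreal_mult) (auto simp: E_def)
    also have "B * E * (1 + (1 + D) powr m * I) = C * B" by (simp add: C_def mult_ac)
    finally show ?thesis .
  qed
  show thesis by (rule that[OF C key])
qed

end

lemma measurable_dcellwise:
  fixes u :: "real^'n \<Rightarrow> real"
  assumes "\<And>x y. y \<in> dcell a k x \<Longrightarrow> u y = u x"
  shows "u \<in> borel_measurable lebesgue"
proof (rule borel_measurableI_greater)
  fix c
  define pt where "pt v = (\<chi> i. a$i + of_int (v$i) / 2^k)" for v :: "int^'n"
  have mem: "x \<in> dcell a k (pt v)" if "v = (\<chi> i. \<lfloor>2^k * (x$i - a$i)\<rfloor>)" for x v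
    using that by (simp add: dcell_def pt_def)
  have "{x \<in> space lebesgue. c < u x} = (\<Union>v\<in>{v. c < u (pt v)}. dcell a k (pt v))"
  proof (intro set_eqI iffI)
    fix x assume x: "x \<in> {x \<in> space lebesgue. c < u x}"
    have "x \<in> dcell a k (pt (\<chi> i. \<lfloor>2^k * (x$i - a$i)\<rfloor>))" by (rule mem) simp
    moreover from assms[OF this] x have "c < u (pt (\<chi> i. \<lfloor>2^k * (x$i - a$i)\<rfloor>))" by simp
    ultimately show "x \<in> (\<Union>v\<in>{v. c < u (pt v)}. dcell a k (pt v))" by blast
  next
    fix x assume "x \<in> (\<Union>v\<in>{v. c < u (pt v)}. dcell a k (pt v))"
    then show "x \<in> {x \<in> space lebesgue. c < u x}" using assms by fastforce
  qed
  also have "\<dots> \<in> sets lebesgue"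
    by (intro sets.countable_UN' countableI_type) auto
  finally show "{x \<in> space lebesgue. c < u x} \<in> sets lebesgue" .
qed

lemma dcell_lattice_translate:
  assumes "\<And>i. v$i \<in> \<int>" "y \<in> dcell a 0 x"
  shows "dcell a 0 (y + v) = dcell a 0 (x + v)"
proof -
  have "\<lfloor>(z + v)$i - a$i\<rfloor> = \<lfloor>z$i - a$i\<rfloor> + \<lfloor>v$i\<rfloor>" for z i
  proof -
    obtain m where m: "v$i = of_int m" using assms(1)[of i] by (auto elim: Ints_cases)
    have "(z + v)$i - a$i = (z$i - a$i) + of_int m" by (simp add: m)
    then show ?thesis by (simp only: floor_add_int m floor_of_int)
  qed
  then show ?thesis using assms(2) unfolding dcell_def by auto
qed

context ap_weight
begin

lemma running_max_mean_measurable: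
  "(\<lambda>x. running_max (\<lambda>j. mean lebesgue f (dcell a j x)) T) \<in> borel_measurable lebesgue"
proof (rule measurable_dcellwise[where k=T and a=a])
  fix x y assume y: "y \<in> dcell a T x"
  interpret D: dyadic_tree "dcell a" "dcell a 0 x" by (rule dcell_tree)
  show "running_max (\<lambda>j. mean lebesgue f (dcell a j y)) T = running_max (\<lambda>j. mean lebesgue f (dcell a j x)) T"
    by (rule running_max_cong) (simp add: D.cell_eq'[OF y])
qed

text \<open>\<open>summation\<close> with v = 0. The constant for a single cell does not depend on
  T, so monotone convergence gives the supremum over all generations, and homogeneity of the means
  lets \<open>cell_maximal\<close> be used for f / t.\<close>

lemma dyadic_global:
  obtains C where "0 < C"
    "\<And>a f. f \<in> borel_measurable lebesgue \<Longrightarrow> (\<And>x. 0 \<le> f x) \<Longrightarrow> modular f \<le> 1 \<Longrightarrow>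
      (\<integral>\<^sup>+x. (SUP T. ennreal (running_max (\<lambda>j. mean lebesgue f (dcell a j x)) T powr p x * w x)) \<partial>lebesgue) \<le> ennreal C"
proof -
  obtain C where C: "0 < C" "\<And>a v f Z B \<rho>. \<lbrakk>norm v \<le> 0; Z \<in> borel_measurable lebesgue; 1 \<le> B;
       (\<integral>\<^sup>+k. \<rho> k \<partial>count_space UNIV) \<le> 1;
       \<And>k. (\<integral>\<^sup>+x\<in>dcell a 0 (lattice_pt a k + v). ennreal (f x powr p x * w x) \<partial>lebesgue) \<le> \<rho> k;
       f \<in> borel_measurable lebesgue; \<And>x. 0 \<le> f x;
       \<And>k t. 0 < t \<Longrightarrow> t \<le> 1 \<Longrightarrow>
         (\<integral>\<^sup>+x\<in>dcell a 0 (lattice_pt a k + v). ennreal ((f x / t) powr p x * w x) \<partial>lebesgue) \<le> 1 \<Longrightarrow>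
         (\<integral>\<^sup>+x\<in>dcell a 0 (lattice_pt a k). ennreal ((1 / t) powr p x) * Z x \<partial>lebesgue) \<le> ennreal B\<rbrakk>
     \<Longrightarrow> (\<integral>\<^sup>+x. Z x \<partial>lebesgue) \<le> ennreal (C * B)"
    using summation[of 0] by blast
  define B where "B = max 1 (normalised.C1 q P L A)"
  show thesis
  proof (rule that[of "C * B"])
    show "0 < C * B" using C by (simp add: B_def)
    fix a :: "real^'n" and f :: "real^'n \<Rightarrow> real"
    assume f[measurable]: "f \<in> borel_measurable lebesgue" and f0: "\<And>x. 0 \<le> f x" and f1: "modular f \<le> 1"
    define S where "S T x = running_max (\<lambda>j. mean lebesgue f (dcell a j x)) T" for T x
    have [measurable]: "S T \<in> borel_measurable lebesgue" for T
      unfolding S_def[abs_def] by (rule running_max_mean_measurable)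
    have S0: "0 \<le> S T x" for T x unfolding S_def by (intro running_max_nonneg mean_nonneg)
    have S_inc: "incseq (\<lambda>T. S T x)" for x by (rule incseq_SucI) (simp add: S_def)
    have inc: "incseq (\<lambda>T x. u x * ennreal (S T x powr p x * w x))" for u
    proof (rule incseq_SucI, rule le_funI)
      fix T x
      show "u x * ennreal (S T x powr p x * w x) \<le> u x * ennreal (S (Suc T) x powr p x * w x)"
        using S0[of T x] incseq_SucD[OF S_inc[of x], of T] w_pos[of x] p_pos[of x]
        by (intro mult_left_mono ennreal_leI mult_right_mono powr_mono2) auto
    qed
    have "(\<integral>\<^sup>+x. (SUP T. ennreal (S T x powr p x * w x)) \<partial>lebesgue) \<le> ennreal (C * B)"
    proof (rule C(2)[where v = 0 and f = f and \<rho> = "\<lambda>k. \<integral>\<^sup>+x\<in>dcell a 0 (lattice_pt a k). ennreal (f x powr p x * w x) \<partial>lebesgue" and a = a])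
      show "(\<integral>\<^sup>+ k. (\<integral>\<^sup>+x\<in>dcell a 0 (lattice_pt a k). ennreal (f x powr p x * w x) \<partial>lebesgue) \<partial>count_space UNIV) \<le> 1"
        using f1 by (subst nn_integral_lattice[symmetric]) auto
      fix k t assume t: "0 < t" "t \<le> 1"
        and l: "(\<integral>\<^sup>+x\<in>dcell a 0 (lattice_pt a k + 0). ennreal ((f x / t) powr p x * w x) \<partial>lebesgue) \<le> 1"
      have tS: "ennreal ((1 / t) powr p x) * ennreal (S T x powr p x * w x)
        = ennreal (running_max (\<lambda>j. mean lebesgue (\<lambda>x. 1 / t * f x) (dcell a j x)) T powr p x * w x)" for T x
      proof -
        have "running_max (\<lambda>j. mean lebesgue (\<lambda>x. 1 / t * f x) (dcell a j x)) T = 1 / t * S T x"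
          using t running_max_scale[of "1 / t" "\<lambda>j. mean lebesgue f (dcell a j x)" T]
          by (subst mean_cmult) (auto simp: S_def)
        then show ?thesis using w_pos[of x] by (simp only: powr_mult) (simp add: ennreal_mult mult.assoc)
      qed
      have "(\<integral>\<^sup>+x\<in>dcell a 0 (lattice_pt a k). ennreal ((1 / t) powr p x) * (SUP T. ennreal (S T x powr p x * w x)) \<partial>lebesgue)
        = (\<integral>\<^sup>+x. (SUP T. (ennreal ((1 / t) powr p x) * indicator (dcell a 0 (lattice_pt a k)) x) * ennreal (S T x powr p x * w x)) \<partial>lebesgue)"
        by (simp add: SUP_mult_left_ennreal mult_ac)
      also have "\<dots> = (SUP T. \<integral>\<^sup>+x. (ennreal ((1 / t) powr p x) * indicator (dcell a 0 (lattice_pt a k)) x) * ennreal (S T x powr p x * w x) \<partial>lebesgue)"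
        using dcell_lebesgue by (intro nn_integral_monotone_convergence_SUP inc) auto
      also have "\<dots> \<le> ennreal B"
      proof (rule SUP_least)
        fix T
        have "(\<integral>\<^sup>+x. (ennreal ((1 / t) powr p x) * indicator (dcell a 0 (lattice_pt a k)) x) * ennreal (S T x powr p x * w x) \<partial>lebesgue)
          = (\<integral>\<^sup>+x\<in>dcell a 0 (lattice_pt a k). ennreal (running_max (\<lambda>j. mean lebesgue (\<lambda>x. 1 / t * f x) (dcell a j x)) T powr p x * w x) \<partial>lebesgue)"
          unfolding tS[symmetric] by (rule nn_integral_cong) (simp only: mult_ac)
        also have "\<dots> \<le> ennreal (normalised.C1 q P L A)"
          by (rule cell_maximal) (use t f0 l in auto)
        also have "\<dots> \<le> ennreal B" by (intro ennreal_leI) (simp add: B_def)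
        finally show "(\<integral>\<^sup>+x. (ennreal ((1 / t) powr p x) * indicator (dcell a 0 (lattice_pt a k)) x) * ennreal (S T x powr p x * w x) \<partial>lebesgue) \<le> ennreal B" .
      qed
      finally show "(\<integral>\<^sup>+x\<in>dcell a 0 (lattice_pt a k). ennreal ((1 / t) powr p x) * (SUP T. ennreal (S T x powr p x * w x)) \<partial>lebesgue) \<le> ennreal B" .
    qed (use f0 in \<open>auto simp: B_def\<close>)
    then show "(\<integral>\<^sup>+x. (SUP T. ennreal (running_max (\<lambda>j. mean lebesgue f (dcell a j x)) T powr p x * w x)) \<partial>lebesgue) \<le> ennreal (C * B)"
      by (simp add: S_def)
  qed
qed

section \<open>Comparison of unit cubes and means over translated cells\<close>

definition unit_cube :: "real^'n \<Rightarrow> (real^'n) set" where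
  "unit_cube y = cbox y (\<chi> i. y$i + 1)"

lemma unit_cube_small: "unit_cube y \<in> small_cubes"
  unfolding small_cubes_def unit_cube_def
proof (intro CollectI conjI exI)
  show "emeasure lebesgue (cbox y (\<chi> i. y$i + 1)) \<le> 1" by (subst emeasure_cube) simp_all
qed (auto intro: refl)

lemma measure_unit_cube: "measure lebesgue (unit_cube y) = 1"
  unfolding unit_cube_def measure_def by (subst emeasure_cube) simp_all

text \<open>Two unit cubes that overlap in at least half of their volume have comparable norms, and any
  two unit cubes are joined by a chain of such cubes.\<close>

lemma cube_overlap:
  assumes ru: "ap_pair p w A (unit_cube y) r s" "ap_pair p w A (unit_cube (y + u)) r' s'"
    and u: "\<And>i. \<bar>u$i\<bar> \<le> 1 / (2 * real CARD('n))"
  shows "r' \<le> 4 * A * r"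
proof -
  let ?n = "real CARD('n)"
  have n1: "?n \<ge> 1" using zero_less_card_finite[where 'a = 'n] by linarith
  \<comment> \<open>The side of a cube E common to both unit cubes; by Bernoulli's inequality its
    volume is at least 1/2.\<close>
  define l where "l = 1 - 1 / (2 * ?n)"
  have n2: "1 / (2 * ?n) \<le> 1" using n1 by (subst divide_le_eq_1_pos) linarith+
  then have l0: "l \<ge> 0" by (simp add: l_def)
  define b where "b = (\<chi> i. y$i + max 0 (u$i))"
  define E where "E = cbox b (\<chi> i. b$i + l)"
  have E: "E \<in> sets lebesgue" "E \<subseteq> unit_cube y" "E \<subseteq> unit_cube (y + u)"
  proof -
    show "E \<in> sets lebesgue" by (simp add: E_def)
    have k: "0 \<le> max 0 (u$i)" "max 0 (u$i) + l \<le> 1" "u$i \<le> max 0 (u$i)" "max 0 (u$i) + l \<le> u$i + 1" for i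
      using u[of i] unfolding l_def by (auto simp: abs_le_iff max_def)
    show "E \<subseteq> unit_cube y"
    proof
      fix x assume "x \<in> E"
      then have "y$i + max 0 (u$i) \<le> x$i \<and> x$i \<le> y$i + max 0 (u$i) + l" for i
        by (simp add: E_def b_def mem_box_cart)
      then show "x \<in> unit_cube y" unfolding unit_cube_def mem_box_cart using k by (simp) (smt (verit))
    qed
    show "E \<subseteq> unit_cube (y + u)"
    proof
      fix x assume "x \<in> E"
      then have "y$i + max 0 (u$i) \<le> x$i \<and> x$i \<le> y$i + max 0 (u$i) + l" for i
        by (simp add: E_def b_def mem_box_cart)
      then show "x \<in> unit_cube (y + u)" unfolding unit_cube_def mem_box_cart using k by (simp) (smt (verit))
    qed
  qed
  have half: "1 / 2 \<le> l ^ CARD('n)"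
  proof -
    have "1 + real CARD('n) * (- (1 / (2 * ?n))) \<le> (1 + - (1 / (2 * ?n))) ^ CARD('n)"
      by (rule Bernoulli_inequality) (use n2 in simp)
    moreover have "real CARD('n) * (- (1 / (2 * ?n))) = - (1 / 2)" using n1 by simp
    ultimately show ?thesis unfolding l_def by (simp only: diff_conv_add_uminus)
  qed
  have r: "r > 0" "s' > 0" "r' > 0" using ru by (auto simp: ap_pair_def)
  have le1: "(\<integral>\<^sup>+x\<in>E. v x \<partial>lebesgue) \<le> (\<integral>\<^sup>+x\<in>Q. v x \<partial>lebesgue)" if "E \<subseteq> Q" for Q and v :: "real^'n \<Rightarrow> ennreal"
    using that by (intro nn_integral_mono) (auto simp: indicator_def)
  have "ennreal (1 / 2) \<le> ennreal (l ^ CARD('n))" by (rule ennreal_leI[OF half])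
  also have "\<dots> = emeasure lebesgue E" unfolding E_def by (rule emeasure_cube(1)[OF l0, symmetric])
  also have "\<dots> \<le> ennreal (r * s') * ((\<integral>\<^sup>+x\<in>E. ennreal ((1 / r) powr p x * w x) \<partial>lebesgue)
     + (\<integral>\<^sup>+x\<in>E. ennreal ((1 / s') powr p' x * \<sigma> x) \<partial>lebesgue))"
    by (rule holder_set[OF E(1)]) (use r in auto)
  also have "\<dots> \<le> ennreal (r * s') * (1 + 1)"
    using ru by (intro mult_left_mono add_mono order_trans[OF le1[OF E(2)]] order_trans[OF le1[OF E(3)]])
      (auto simp: ap_pair_def)
  also have "\<dots> = ennreal (r * s' * 2)" using r by (simp add: ennreal_mult)
  finally have "1 / 2 \<le> r * s' * 2" using r by (subst (asm) ennreal_le_iff) auto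
  then have "r' * 1 \<le> r' * (4 * r * s')" using r by (intro mult_left_mono) auto
  also have "\<dots> = 4 * r * (r' * s')" by simp
  also have "\<dots> \<le> 4 * r * A"
    using ru r by (intro mult_left_mono) (auto simp: ap_pair_def measure_unit_cube)
  finally show ?thesis by (simp add: mult_ac)
qed

lemma cube_chain:
  assumes ap: "\<And>y. ap_pair p w A (unit_cube y) (r y) (s y)"
    and u: "\<And>i. \<bar>u$i\<bar> \<le> 1 / (2 * real CARD('n))"
  shows "r (y + real m *\<^sub>R u) \<le> (4 * A) ^ m * r y"
proof (induction m)
  case (Suc m)
  have e: "y + real (Suc m) *\<^sub>R u = (y + real m *\<^sub>R u) + u" by (simp add: algebra_simps)
  have "r (y + real (Suc m) *\<^sub>R u) \<le> 4 * A * r (y + real m *\<^sub>R u)"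
    unfolding e by (rule cube_overlap[OF ap ap u])
  also have "\<dots> \<le> 4 * A * ((4 * A) ^ m * r y)" using Suc A by (intro mult_left_mono) auto
  finally show ?case by (simp add: mult_ac)
qed simp

lemma cube_translate:
  obtains B where "1 \<le> B" "\<And>r s y. (\<And>y. ap_pair p w A (unit_cube y) (r y) (s y)) \<Longrightarrow> r y \<le> B * r (y + v)"
proof -
  let ?n = "real CARD('n)"
  have n1: "?n \<ge> 1" using zero_less_card_finite[where 'a = 'n] by linarith
  \<comment> \<open>So many equal steps lead from y + v back to y, each changing a coordinate by at
    most 1 / (2 n). The number depends on v only, hence so does the constant.\<close>
  define m where "m = nat \<lceil>2 * ?n * norm v\<rceil> + 1"
  have m: "2 * ?n * norm v \<le> real m" "m > 0" unfolding m_def by linarith+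
  define u where "u = (- 1 / real m) *\<^sub>R v"
  have u: "\<bar>u$i\<bar> \<le> 1 / (2 * ?n)" for i
  proof -
    have "\<bar>v$i\<bar> \<le> norm v" by (rule component_le_norm_cart)
    then have "2 * ?n * \<bar>v$i\<bar> \<le> real m" using m n1 by (smt (verit) mult_left_mono)
    then show ?thesis using m n1 by (simp add: u_def abs_mult field_simps)
  qed
  show thesis
  proof (rule that[of "(4 * A) ^ m"])
    show "1 \<le> (4 * A) ^ m" using A by (intro one_le_power) simp
    fix r s y assume ap: "\<And>y. ap_pair p w A (unit_cube y) (r y) (s y)"
    have "y + v + real m *\<^sub>R u = y" using m by (simp add: u_def)
    with cube_chain[OF ap u, of "y + v" m] show "r y \<le> (4 * A) ^ m * r (y + v)"
      by (simp only:)
  qed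
qed

lemma cell_subset_unit_cube: "dcell a 0 (lattice_pt a k) \<subseteq> unit_cube (lattice_pt a k)"
proof
  fix x assume "x \<in> dcell a 0 (lattice_pt a k)"
  then have "\<lfloor>x$i - a$i\<rfloor> = k$i" for i by (simp add: mem_lattice_cell)
  then have "of_int (k$i) \<le> x$i - a$i \<and> x$i - a$i < of_int (k$i) + 1" for i using floor_eq_iff by blast
  then show "x \<in> unit_cube (lattice_pt a k)"
    unfolding unit_cube_def mem_box_cart lattice_pt_def by (simp) (smt (verit))
qed

lemma cell_int_finite:
  assumes [measurable]: "f \<in> borel_measurable lebesgue" and "\<And>x. 0 \<le> f x" and "modular f \<le> 1"
  shows "(\<integral>\<^sup>+x\<in>dcell a k x0. ennreal (f x) \<partial>lebesgue) < \<infinity>"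
proof -
  obtain r s where rs: "ap_pair p w A (dcell a k x0) r s" using cell_pairs by blast
  have "(\<integral>\<^sup>+x\<in>dcell a k x0. ennreal (f x) \<partial>lebesgue) \<le> ennreal (1 * s) *
    ((\<integral>\<^sup>+x\<in>dcell a k x0. ennreal ((f x / 1) powr p x * w x) \<partial>lebesgue)
     + (\<integral>\<^sup>+x\<in>dcell a k x0. ennreal ((1 / s) powr p' x * \<sigma> x) \<partial>lebesgue))"
    by (rule holder) (use assms rs in \<open>auto simp: ap_pair_def\<close>)
  also have "\<dots> \<le> ennreal (1 * s) * (1 + 1)"
  proof (intro mult_left_mono add_mono)
    show "(\<integral>\<^sup>+x\<in>dcell a k x0. ennreal ((f x / 1) powr p x * w x) \<partial>lebesgue) \<le> 1"
      by (rule order_trans[OF _ assms(3)]) (auto intro!: nn_integral_mono simp: indicator_def)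
  qed (use rs in \<open>auto simp: ap_pair_def\<close>)
  also have "\<dots> < \<infinity>" by (simp add: ennreal_mult_less_top)
  finally show ?thesis .
qed

text \<open>Serves balls too large for a single small cell. Hoelder's inequality bounds the mean
  over the translated cell by the dual number s of the cube at y + v; as r at y and r at y + v are
  comparable, s is at most a multiple of 1 / r(y), and the modular of 1 / r(y) on the original cell
  is at most 1.\<close>

lemma neighbour_global:
  fixes v :: "real^'n"
  assumes v: "\<And>i. v$i \<in> \<int>"
  obtains C where "0 < C"
    "\<And>f. f \<in> borel_measurable lebesgue \<Longrightarrow> (\<And>x. 0 \<le> f x) \<Longrightarrow> modular f \<le> 1 \<Longrightarrow>
      (\<integral>\<^sup>+x. ennreal (mean lebesgue f (dcell 0 0 (x + v)) powr p x * w x) \<partial>lebesgue) \<le> ennreal C"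
proof -
  obtain C where C: "0 < C" "\<And>a v' f Z B \<rho>. \<lbrakk>norm v' \<le> norm v; Z \<in> borel_measurable lebesgue; 1 \<le> B;
       (\<integral>\<^sup>+k. \<rho> k \<partial>count_space UNIV) \<le> 1;
       \<And>k. (\<integral>\<^sup>+x\<in>dcell a 0 (lattice_pt a k + v'). ennreal (f x powr p x * w x) \<partial>lebesgue) \<le> \<rho> k;
       f \<in> borel_measurable lebesgue; \<And>x. 0 \<le> f x;
       \<And>k t. 0 < t \<Longrightarrow> t \<le> 1 \<Longrightarrow>
         (\<integral>\<^sup>+x\<in>dcell a 0 (lattice_pt a k + v'). ennreal ((f x / t) powr p x * w x) \<partial>lebesgue) \<le> 1 \<Longrightarrow>
         (\<integral>\<^sup>+x\<in>dcell a 0 (lattice_pt a k). ennreal ((1 / t) powr p x) * Z x \<partial>lebesgue) \<le> ennreal B\<rbrakk>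
     \<Longrightarrow> (\<integral>\<^sup>+x. Z x \<partial>lebesgue) \<le> ennreal (C * B)"
    using summation[of "norm v"] norm_ge_zero[of v] by blast
  obtain M where M: "1 \<le> M" "\<And>r s y. (\<And>y. ap_pair p w A (unit_cube y) (r y) (s y)) \<Longrightarrow> r y \<le> M * r (y + v)"
    using cube_translate[of v] by blast
  have "\<forall>y. \<exists>r s. ap_pair p w A (unit_cube y) r s" using cube_pairs[OF unit_cube_small] by blast
  then obtain r s where ap: "\<And>y. ap_pair p w A (unit_cube y) (r y) (s y)" by metis
  have rs: "r y > 0" "s y > 0" "r y * s y \<le> A" for y using ap[of y] by (auto simp: ap_pair_def measure_unit_cube)
  define B where "B = (2 * A * M) powr P"
  have AM: "1 \<le> 2 * A * M" using mult_mono[of 1 "2 * A" 1 M] A M(1) by simp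
  have B: "1 \<le> B" unfolding B_def using AM P by (intro ge_one_powr_ge_zero) auto
  show thesis
  proof (rule that[of "C * B"])
    show "0 < C * B" using C B by simp
    fix f :: "real^'n \<Rightarrow> real"
    assume f[measurable]: "f \<in> borel_measurable lebesgue" and f0: "\<And>x. 0 \<le> f x" and f1: "modular f \<le> 1"
    define H where "H x = mean lebesgue f (dcell 0 0 (x + v))" for x
    have H_const: "H x = H y" if "x \<in> dcell 0 0 y" for x y
      using dcell_lattice_translate[OF v that] by (simp add: H_def)
    have [measurable]: "H \<in> borel_measurable lebesgue"
      by (rule measurable_dcellwise[where a = 0 and k = 0]) (rule H_const)
    obtain kv where kv: "v = lattice_pt 0 kv"
    proof -
      have "v = lattice_pt 0 (\<chi> i. \<lfloor>v$i\<rfloor>)" using v by (simp add: lattice_pt_def vec_eq_iff)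
      then show thesis by (rule that)
    qed
    have shift: "lattice_pt 0 k + v = lattice_pt 0 (k + kv)" for k
      by (simp add: kv lattice_pt_def vec_eq_iff)
    define \<rho>0 where "\<rho>0 k = (\<integral>\<^sup>+x\<in>dcell 0 0 (lattice_pt 0 k). ennreal (f x powr p x * w x) \<partial>lebesgue)" for k
    have "(\<integral>\<^sup>+x. ennreal (H x powr p x * w x) \<partial>lebesgue) \<le> ennreal (C * B)"
    proof (rule C(2)[where v' = v and f = f and a = 0 and \<rho> = "\<lambda>k. \<rho>0 (k + kv)"])
      have "(\<integral>\<^sup>+k. \<rho>0 (k + kv) \<partial>count_space UNIV) = (\<integral>\<^sup>+k. \<rho>0 k \<partial>count_space UNIV)"
        by (rule nn_integral_bij_count_space) (rule bij_plus_right)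
      also have "\<dots> = modular f" unfolding \<rho>0_def by (rule nn_integral_lattice[symmetric]) measurable
      finally show "(\<integral>\<^sup>+k. \<rho>0 (k + kv) \<partial>count_space UNIV) \<le> 1" using f1 by simp
      fix k :: "int^'n"
      show "(\<integral>\<^sup>+x\<in>dcell 0 0 (lattice_pt 0 k + v). ennreal (f x powr p x * w x) \<partial>lebesgue) \<le> \<rho>0 (k + kv)"
        by (simp add: shift \<rho>0_def)
      fix t :: real assume t: "0 < t" "t \<le> 1"
        and l: "(\<integral>\<^sup>+x\<in>dcell 0 0 (lattice_pt 0 k + v). ennreal ((f x / t) powr p x * w x) \<partial>lebesgue) \<le> 1"
      define y where "y = lattice_pt 0 k"
      have Hy: "H y \<le> 2 * t * s (y + v)"
      proof -
        have sub: "dcell 0 0 (y + v) \<subseteq> unit_cube (y + v)"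
          unfolding y_def shift by (rule cell_subset_unit_cube)
        have ms: "(\<integral>\<^sup>+x\<in>dcell 0 0 (y + v). ennreal ((1 / s (y + v)) powr p' x * \<sigma> x) \<partial>lebesgue) \<le> 1"
          using ap_pair_subset[OF ap sub] measure_dcell[of 0 0 "y + v"] measure_unit_cube[of "y + v"]
          by (auto simp: ap_pair_def)
        have "(\<integral>\<^sup>+x\<in>dcell 0 0 (y + v). ennreal (f x) \<partial>lebesgue) \<le> ennreal (t * s (y + v)) *
          ((\<integral>\<^sup>+x\<in>dcell 0 0 (y + v). ennreal ((f x / t) powr p x * w x) \<partial>lebesgue)
           + (\<integral>\<^sup>+x\<in>dcell 0 0 (y + v). ennreal ((1 / s (y + v)) powr p' x * \<sigma> x) \<partial>lebesgue))"
          by (rule holder) (use f0 t rs in auto)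
        also have "\<dots> \<le> ennreal (t * s (y + v)) * (1 + 1)"
          using l ms by (intro mult_left_mono add_mono) (auto simp: y_def)
        also have "\<dots> = ennreal (2 * t * s (y + v))" using t rs(2)[of "y + v"] by (simp add: ennreal_mult mult_ac)
        finally have "enn2real (\<integral>\<^sup>+x\<in>dcell 0 0 (y + v). ennreal (f x) \<partial>lebesgue) \<le> 2 * t * s (y + v)"
          using t rs(2)[of "y + v"] by (intro enn2real_leI) auto
        then show ?thesis by (simp add: H_def mean_def measure_dcell)
      qed
      have s_le: "s (y + v) \<le> A * M / r y"
      proof -
        have "r y * s (y + v) \<le> M * r (y + v) * s (y + v)"
          using M(2)[OF ap, of y] rs(2)[of "y + v"] by (intro mult_right_mono) auto
        also have "\<dots> = M * (r (y + v) * s (y + v))" by simp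
        also have "\<dots> \<le> M * A" using rs(3) M(1) by (intro mult_left_mono) auto
        finally show ?thesis using rs(1)[of y] by (simp add: field_simps)
      qed
      have Hr: "1 / t * H y \<le> 2 * A * M * (1 / r y)"
      proof -
        have "1 / t * H y \<le> 1 / t * (2 * t * (A * M / r y))"
          using Hy s_le t by (intro mult_left_mono order_trans[OF Hy]) auto
        then show ?thesis using t by simp
      qed
      have "(\<integral>\<^sup>+x\<in>dcell 0 0 y. ennreal ((1 / t) powr p x) * ennreal (H x powr p x * w x) \<partial>lebesgue)
        \<le> (\<integral>\<^sup>+x. ennreal B * (ennreal ((1 / r y) powr p x * w x) * indicator (dcell 0 0 y) x) \<partial>lebesgue)"
      proof (rule nn_integral_mono)
        fix x
        show "ennreal ((1 / t) powr p x) * ennreal (H x powr p x * w x) * indicator (dcell 0 0 y) x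
          \<le> ennreal B * (ennreal ((1 / r y) powr p x * w x) * indicator (dcell 0 0 y) x)"
        proof (cases "x \<in> dcell 0 0 y")
          case True
          have "(1 / t) powr p x * H x powr p x = (1 / t * H y) powr p x"
            unfolding powr_mult H_const[OF True] ..
          also have "\<dots> \<le> (2 * A * M * (1 / r y)) powr p x"
            using Hr t p_pos[of x] mean_nonneg[of lebesgue f] by (intro powr_mono2) (auto simp: H_def)
          also have "\<dots> = (2 * A * M) powr p x * (1 / r y) powr p x" by (rule powr_mult)
          also have "\<dots> \<le> B * (1 / r y) powr p x"
            unfolding B_def using AM p_le by (intro mult_right_mono powr_mono) auto
          finally have "(1 / t) powr p x * (H x powr p x * w x) \<le> B * ((1 / r y) powr p x * w x)"
            using w_pos[of x] by (simp add: mult_right_mono flip: mult.assoc)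
          then show ?thesis using True B w_pos[of x] by (simp flip: ennreal_mult)
        qed simp
      qed
      also have "\<dots> = ennreal B * (\<integral>\<^sup>+x\<in>dcell 0 0 y. ennreal ((1 / r y) powr p x * w x) \<partial>lebesgue)"
        using dcell_lebesgue by (subst nn_integral_cmult) auto
      also have "\<dots> \<le> ennreal B * 1"
      proof (rule mult_left_mono)
        have sub: "dcell 0 0 y \<subseteq> unit_cube y"
          unfolding y_def by (rule cell_subset_unit_cube)
        show "(\<integral>\<^sup>+x\<in>dcell 0 0 y. ennreal ((1 / r y) powr p x * w x) \<partial>lebesgue) \<le> 1"
          using ap_pair_subset[OF ap sub] measure_dcell[of 0 0 y] measure_unit_cube[of y]
          by (auto simp: ap_pair_def)
      qed simp
      finally show "(\<integral>\<^sup>+x\<in>dcell 0 0 (lattice_pt 0 k). ennreal ((1 / t) powr p x) * ennreal (H x powr p x * w x) \<partial>lebesgue) \<le> ennreal B"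
        by (simp add: y_def)
    qed (use f0 B in auto)
    then show "(\<integral>\<^sup>+x. ennreal (mean lebesgue f (dcell 0 0 (x + v)) powr p x * w x) \<partial>lebesgue) \<le> ennreal (C * B)"
      by (simp add: H_def)
  qed
qed

end

section \<open>From balls to cells of shifted grids\<close>

definition third_shifts :: "(real^'n) set" where
  "third_shifts = {a. \<forall>i. a$i = 0 \<or> a$i = 1/3}"

text \<open>Among these are all integer vectors v for which the unit cell of x + v meets the ball of
  radius K around x; the additional 1 accounts for taking integer parts.\<close>

definition near_shifts :: "real \<Rightarrow> (real^'n) set" where
  "near_shifts K = {v. \<forall>i. v$i \<in> \<int> \<and> \<bar>v$i\<bar> \<le> K + 1}"

lemma finite_vec_set:
  assumes "\<And>i. finite (S i)"
  shows "finite {v::'a^'n. \<forall>i. v$i \<in> S i}"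
proof (rule finite_subset)
  show "{v::'a^'n. \<forall>i. v$i \<in> S i} \<subseteq> (\<lambda>f. \<chi> i. f i) ` (PiE UNIV S)"
  proof
    fix v :: "'a^'n" assume "v \<in> {v. \<forall>i. v$i \<in> S i}"
    then show "v \<in> (\<lambda>f. \<chi> i. f i) ` (PiE UNIV S)"
      by (intro image_eqI[of _ _ "\<lambda>i. v$i"]) auto
  qed
  show "finite ((\<lambda>f. \<chi> i. f i) ` (PiE UNIV S))" by (intro finite_imageI finite_PiE assms) auto
qed

lemma finite_third_shifts: "finite (third_shifts :: (real^'n) set)"
  using finite_vec_set[of "\<lambda>_. {0, 1/3::real}"] by (simp add: third_shifts_def)

lemma finite_near_shifts: "finite (near_shifts K :: (real^'n) set)"
proof -
  have "finite {z::real. z \<in> \<int> \<and> \<bar>z\<bar> \<le> K + 1}" by (rule finite_abs_int_segment)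
  then show ?thesis
    using finite_vec_set[of "\<lambda>_. {z::real. z \<in> \<int> \<and> \<bar>z\<bar> \<le> K + 1}"] by (simp add: near_shifts_def)
qed

text \<open>The points of \<open>2\<^sup>-\<^sup>j\<int>\<close> and of \<open>1/3 + 2\<^sup>-\<^sup>j\<int>\<close> are at distance at least \<open>2\<^sup>-\<^sup>j/3\<close> from each other.\<close>

lemma one_third_trick:
  fixes x r :: real
  assumes r: "2^j * r \<le> 1/6"
  shows "\<exists>a\<in>{0, 1/3}. \<forall>y. \<bar>y - x\<bar> < r \<longrightarrow> \<lfloor>2^j * (y - a)\<rfloor> = \<lfloor>2^j * (x - a)\<rfloor>"
proof (rule ccontr)
  assume neg: "\<not> ?thesis"
  have c: "\<exists>y. \<bar>y - x\<bar> < r \<and> \<lfloor>2^j * (y - a)\<rfloor> \<noteq> \<lfloor>2^j * (x - a)\<rfloor>" if "a \<in> {0, 1/3}" for a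
  proof (rule ccontr)
    assume "\<not> ?thesis"
    then have "\<forall>y. \<bar>y - x\<bar> < r \<longrightarrow> \<lfloor>2^j * (y - a)\<rfloor> = \<lfloor>2^j * (x - a)\<rfloor>" by blast
    with that have "\<exists>a\<in>{0, 1/3}. \<forall>y. \<bar>y - x\<bar> < r \<longrightarrow> \<lfloor>2^j * (y - a)\<rfloor> = \<lfloor>2^j * (x - a)\<rfloor>"
      by (intro bexI[of _ a])
    with neg show False by (rule notE)
  qed
  have strip: "\<exists>m::int. \<bar>X - of_int m\<bar> < d" if "\<bar>Y - X\<bar> < d" "\<lfloor>Y\<rfloor> \<noteq> \<lfloor>X\<rfloor>" for X Y d :: real
  proof (cases "\<lfloor>X\<rfloor> < \<lfloor>Y\<rfloor>")
    case True
    then have "X < of_int \<lfloor>Y\<rfloor>" by (simp add: floor_less_iff)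
    then have "\<bar>X - of_int \<lfloor>Y\<rfloor>\<bar> < d" using that(1) of_int_floor_le[of Y] unfolding abs_less_iff by argo
    then show ?thesis by blast
  next
    case False
    then have "\<lfloor>Y\<rfloor> < \<lfloor>X\<rfloor>" using that by simp
    then have "Y < of_int \<lfloor>X\<rfloor>" by (simp add: floor_less_iff)
    then have "\<bar>X - of_int \<lfloor>X\<rfloor>\<bar> < d" using that(1) of_int_floor_le[of X] unfolding abs_less_iff by argo
    then show ?thesis by blast
  qed
  have ex: "\<exists>m::int. \<bar>2^j * (x - a) - of_int m\<bar> < 1/6" if a: "a \<in> {0, 1/3}" for a
  proof -
    obtain y where y: "\<bar>y - x\<bar> < r" "\<lfloor>2^j * (y - a)\<rfloor> \<noteq> \<lfloor>2^j * (x - a)\<rfloor>"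
      using c[OF a] by (elim exE conjE)
    have "2^j * (y - a) - 2^j * (x - a) = 2^j * (y - x)" by (simp add: algebra_simps)
    then have "\<bar>2^j * (y - a) - 2^j * (x - a)\<bar> = 2^j * \<bar>y - x\<bar>" by (simp add: abs_mult)
    also have "\<dots> < 2^j * r" using y by simp
    also have "\<dots> \<le> 1/6" by (rule r)
    finally show ?thesis using y(2) by (rule strip)
  qed
  \<comment> \<open>If both shifts fail, 2^j x and 2^j x - 2^j / 3 are both within 1/6 of an
    integer. Then 2^j is within 1 of a multiple of 3, hence equal to one, which is
    impossible.\<close>
  obtain m0 m1 :: int where m: "\<bar>2^j * (x - 0) - of_int m0\<bar> < 1/6" "\<bar>2^j * (x - 1/3) - of_int m1\<bar> < 1/6"
    using ex[of 0] ex[of "1/3"] by auto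
  moreover have "2^j * (x - 1/3) = 2^j * x - 2^j / 3" by (simp add: algebra_simps)
  moreover have "\<bar>z - 3 * (b - c)\<bar> < 1" if "\<bar>Z - b\<bar> < 1/6" "\<bar>Z - z / 3 - c\<bar> < 1/6" for z Z b c :: real
  proof -
    have "Z - b < 1/6" "- (Z - b) < 1/6" "Z - z / 3 - c < 1/6" "- (Z - z / 3 - c) < 1/6"
      using that unfolding abs_less_iff by blast+
    then show ?thesis unfolding abs_less_iff by argo
  qed
  ultimately have "\<bar>2^j - 3 * (of_int m0 - of_int m1)\<bar> < (1::real)"
    by (simp only: diff_zero)
  then have "\<bar>real_of_int (2^j - 3 * (m0 - m1))\<bar> < 1" by simp
  then have "(2::int)^j = 3 * (m0 - m1)" by linarith
  moreover have "(2::int)^j mod 3 \<noteq> 0" by (induction j) (auto, presburger)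
  ultimately show False by simp
qed

lemma dyadic_scale:
  fixes y :: real
  assumes "1 \<le> y" shows "\<exists>j. 2^j \<le> y \<and> y < 2^(Suc j)"
proof -
  define N where "N = (LEAST N. y < 2^N)"
  have ex: "\<exists>N. y < 2^N" using real_arch_pow[of 2 y] by auto
  then have N: "y < 2^N" unfolding N_def by (rule LeastI_ex)
  then have "N \<noteq> 0" using assms by (intro notI) simp
  then obtain j where j: "N = Suc j" by (cases N) auto
  have "\<not> y < 2^j" using not_less_Least[of j "\<lambda>N. y < 2^N"] j by (simp add: N_def)
  then show ?thesis using N j by (intro exI[of _ j]) simp
qed

text \<open>If 6 K t \<le> 1, the ball lies in one cell of side below 12 K t of a shifted grid; the
  shift is chosen in each coordinate separately, so the shift vectors range over all combinations of
  0 and 1/3. Otherwise 1 / t is below 6 K, and the ball is covered by the unit cells of the points x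
  + v with v in \<open>near_shifts\<close>.\<close>

lemma ball_control:
  fixes f :: "real^'n \<Rightarrow> real" and x :: "real^'n"
  assumes f[measurable]: "f \<in> borel_measurable lebesgue" and f0: "\<And>x. 0 \<le> f x"
    and fin: "\<And>a k x0. (\<integral>\<^sup>+y\<in>dcell a k x0. ennreal (f y) \<partial>lebesgue) < \<infinity>"
    and K: "1 \<le> K" and t: "0 < t" "t < 1"
  shows "(\<exists>a\<in>third_shifts. \<exists>j. enn2real (\<integral>\<^sup>+y\<in>ball x (K * t). ennreal (f y) \<partial>lebesgue) / t ^ CARD('n)
      \<le> (12 * K) ^ CARD('n) * mean lebesgue f (dcell a j x))
    \<or> enn2real (\<integral>\<^sup>+y\<in>ball x (K * t). ennreal (f y) \<partial>lebesgue) / t ^ CARD('n)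
      \<le> (12 * K) ^ CARD('n) * (\<Sum>v\<in>near_shifts K. mean lebesgue f (dcell 0 0 (x + v)))"
proof -
  let ?n = "CARD('n)"
  let ?I = "\<integral>\<^sup>+y\<in>ball x (K * t). ennreal (f y) \<partial>lebesgue"
  have comp: "\<bar>y$i - x$i\<bar> < K * t" if "y \<in> ball x (K * t)" for y i
    using component_le_norm_cart[of "y - x" i] that by (simp add: dist_norm norm_minus_commute)
  have Kt: "0 < K * t" using K t by simp
  have mean_int: "mean lebesgue f (dcell a j z) * (1 / 2^j)^?n = enn2real (\<integral>\<^sup>+y\<in>dcell a j z. ennreal (f y) \<partial>lebesgue)" for a j z
    by (simp add: mean_def measure_dcell power_divide)
  show ?thesis
  proof (cases "6 * (K * t) \<le> 1")
    case True
    have "1 \<le> 1 / (6 * (K * t))" using True Kt by (subst le_divide_eq_1_pos) auto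
    from dyadic_scale[OF this] obtain j where j: "2^j \<le> 1 / (6 * (K * t))" "1 / (6 * (K * t)) < 2^(Suc j)" by blast
    have j1: "2^j * (K * t) \<le> 1/6" using j(1) Kt by (simp add: field_simps)
    have "\<forall>i. \<exists>b\<in>{0, 1/3}. \<forall>y. \<bar>y - x$i\<bar> < K * t \<longrightarrow> \<lfloor>2^j * (y - b)\<rfloor> = \<lfloor>2^j * (x$i - b)\<rfloor>"
      using one_third_trick[OF j1] by blast
    then obtain b where b: "\<And>i. b i \<in> {0, 1/3}" "\<And>i y. \<bar>y - x$i\<bar> < K * t \<Longrightarrow> \<lfloor>2^j * (y - b i)\<rfloor> = \<lfloor>2^j * (x$i - b i)\<rfloor>"
      by metis
    define a where "a = (\<chi> i. b i)"
    have a: "a \<in> third_shifts" using b(1) by (auto simp: a_def third_shifts_def)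
    have sub: "ball x (K * t) \<subseteq> dcell a j x"
      using comp b(2) by (auto simp: dcell_def a_def)
    have "enn2real ?I \<le> mean lebesgue f (dcell a j x) * (1 / 2^j)^?n"
      unfolding mean_int using fin[of a j x] sub
      by (intro enn2real_mono nn_integral_mono) (auto simp: indicator_def)
    moreover have "(1 / 2^j)^?n \<le> (12 * K * t)^?n"
    proof (rule power_mono)
      have "1 < 2^(Suc j) * (6 * (K * t))" using j(2) Kt by (simp add: field_simps)
      then show "1 / 2^j \<le> 12 * K * t" by (simp add: field_simps)
    qed simp
    ultimately have "enn2real ?I \<le> mean lebesgue f (dcell a j x) * (12 * K * t)^?n"
      using mean_nonneg[of lebesgue f "dcell a j x"] by (meson mult_left_mono order_trans)
    then have "enn2real ?I / t ^ ?n \<le> mean lebesgue f (dcell a j x) * (12 * K * t)^?n / t^?n"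
      using t by (intro divide_right_mono) auto
    also have "\<dots> = (12 * K) ^ ?n * mean lebesgue f (dcell a j x)"
      using t by (simp add: power_mult_distrib)
    finally show ?thesis using a by blast
  next
    case False
    have sub: "ball x (K * t) \<subseteq> (\<Union>v\<in>near_shifts K. dcell 0 0 (x + v))"
    proof
      fix y assume y: "y \<in> ball x (K * t)"
      define v :: "real^'n" where "v = (\<chi> i. of_int (\<lfloor>y$i\<rfloor> - \<lfloor>x$i\<rfloor>))"
      have "\<bar>v$i\<bar> \<le> K + 1" for i
      proof -
        have "\<bar>y$i - x$i\<bar> < K" using comp[OF y, of i] t K mult_left_le[of t K] by linarith
        then show ?thesis unfolding v_def by simp linarith
      qed
      then have "v \<in> near_shifts K" by (simp add: near_shifts_def v_def)
      moreover have "y \<in> dcell 0 0 (x + v)"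
      proof -
        have "\<lfloor>(x + v)$i\<rfloor> = \<lfloor>y$i\<rfloor>" for i
          by (simp only: vector_add_component v_def vec_lambda_beta floor_add_int) simp
        then show ?thesis by (simp add: dcell_def)
      qed
      ultimately show "y \<in> (\<Union>v\<in>near_shifts K. dcell 0 0 (x + v))" by blast
    qed
    have "?I \<le> (\<integral>\<^sup>+y. (\<Sum>v\<in>near_shifts K. ennreal (f y) * indicator (dcell 0 0 (x + v)) y) \<partial>lebesgue)"
    proof (rule nn_integral_mono)
      fix y
      show "ennreal (f y) * indicator (ball x (K * t)) y \<le> (\<Sum>v\<in>near_shifts K. ennreal (f y) * indicator (dcell 0 0 (x + v)) y)"
      proof (cases "y \<in> ball x (K * t)")
        case True
        then obtain v where v: "v \<in> near_shifts K" "y \<in> dcell 0 0 (x + v)" using sub by blast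
        have "ennreal (f y) * indicator (dcell 0 0 (x + v)) y \<le> (\<Sum>v\<in>near_shifts K. ennreal (f y) * indicator (dcell 0 0 (x + v)) y)"
          by (rule member_le_sum[OF v(1)]) (auto simp: finite_near_shifts)
        then show ?thesis using v True by simp
      qed simp
    qed
    also have "\<dots> = (\<Sum>v\<in>near_shifts K. \<integral>\<^sup>+y\<in>dcell 0 0 (x + v). ennreal (f y) \<partial>lebesgue)"
      by (rule nn_integral_sum) auto
    also have "\<dots> = (\<Sum>v\<in>near_shifts K. ennreal (mean lebesgue f (dcell 0 0 (x + v))))"
    proof (rule sum.cong[OF refl])
      fix v :: "real^'n"
      show "(\<integral>\<^sup>+y\<in>dcell 0 0 (x + v). ennreal (f y) \<partial>lebesgue) = ennreal (mean lebesgue f (dcell 0 0 (x + v)))"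
        using mean_int[of 0 0 "x + v"] fin[of 0 0 "x + v"] by simp
    qed
    also have "\<dots> = ennreal (\<Sum>v\<in>near_shifts K. mean lebesgue f (dcell 0 0 (x + v)))"
      by (rule sum_ennreal) (rule mean_nonneg)
    finally have le: "enn2real ?I \<le> (\<Sum>v\<in>near_shifts K. mean lebesgue f (dcell 0 0 (x + v)))"
      by (intro enn2real_leI sum_nonneg mean_nonneg)
    have "1 / t \<le> 12 * K" using False t K by (simp add: field_simps)
    then have "(1 / t)^?n \<le> (12 * K)^?n" using t by (intro power_mono) auto
    then have "enn2real ?I * (1 / t)^?n \<le> (\<Sum>v\<in>near_shifts K. mean lebesgue f (dcell 0 0 (x + v))) * (12 * K)^?n"
      using le t by (intro mult_mono sum_nonneg mean_nonneg) auto
    then show ?thesis by (intro disjI2) (simp add: power_divide mult.commute)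
  qed
qed

context ap_weight
begin

text \<open>G adds up, over the finitely many shifted grids and neighbouring cells, the functions
  integrated in \<open>dyadic_global\<close> and \<open>neighbour_global\<close>. One measurable G
  serves all t at once, so the supremum over t need not itself be shown measurable.\<close>

lemma maximal_bound:
  assumes K: "1 \<le> K"
  obtains C where "1 \<le> C"
    "\<And>f. f \<in> borel_measurable lebesgue \<Longrightarrow> (\<And>x. 0 \<le> f x) \<Longrightarrow> modular f \<le> 1 \<Longrightarrow>
      \<exists>G. G \<in> borel_measurable lebesgue \<and> (\<integral>\<^sup>+x. G x \<partial>lebesgue) \<le> ennreal C \<and>
        (\<forall>x t. 0 < t \<longrightarrow> t < 1 \<longrightarrow>
          ennreal ((enn2real (\<integral>\<^sup>+y\<in>ball x (K * t). ennreal (f y) \<partial>lebesgue) / t ^ CARD('n)) powr p x * w x) \<le> G x)"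
proof -
  obtain C1 where C1: "0 < C1" "\<And>a f. f \<in> borel_measurable lebesgue \<Longrightarrow> (\<And>x. 0 \<le> f x) \<Longrightarrow> modular f \<le> 1 \<Longrightarrow>
      (\<integral>\<^sup>+x. (SUP T. ennreal (running_max (\<lambda>j. mean lebesgue f (dcell a j x)) T powr p x * w x)) \<partial>lebesgue) \<le> ennreal C1"
    using dyadic_global by blast
  have "\<forall>v\<in>near_shifts K. \<exists>C>0. \<forall>f. f \<in> borel_measurable lebesgue \<longrightarrow> (\<forall>x. 0 \<le> f x) \<longrightarrow> modular f \<le> 1 \<longrightarrow>
      (\<integral>\<^sup>+x. ennreal (mean lebesgue f (dcell 0 0 (x + v)) powr p x * w x) \<partial>lebesgue) \<le> ennreal C"
  proof
    fix v :: "real^'n" assume "v \<in> near_shifts K"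
    then have vi: "v$i \<in> \<int>" for i by (simp add: near_shifts_def)
    show "\<exists>C>0. \<forall>f. f \<in> borel_measurable lebesgue \<longrightarrow> (\<forall>x. 0 \<le> f x) \<longrightarrow> modular f \<le> 1 \<longrightarrow>
      (\<integral>\<^sup>+x. ennreal (mean lebesgue f (dcell 0 0 (x + v)) powr p x * w x) \<partial>lebesgue) \<le> ennreal C"
    proof (rule neighbour_global[of v])
      show "v$i \<in> \<int>" for i by (rule vi)
      fix C assume C: "0 < C" "\<And>f. f \<in> borel_measurable lebesgue \<Longrightarrow> (\<And>x. 0 \<le> f x) \<Longrightarrow> modular f \<le> 1 \<Longrightarrow>
        (\<integral>\<^sup>+x. ennreal (mean lebesgue f (dcell 0 0 (x + v)) powr p x * w x) \<partial>lebesgue) \<le> ennreal C"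
      show ?thesis
        by (intro exI[of _ C] conjI allI impI C) auto
    qed
  qed
  from bchoice[OF this] obtain C2 where C2: "\<And>v. v \<in> near_shifts K \<Longrightarrow> 0 < C2 v"
    "\<And>v f. v \<in> near_shifts K \<Longrightarrow> f \<in> borel_measurable lebesgue \<Longrightarrow> (\<And>x. 0 \<le> f x) \<Longrightarrow> modular f \<le> 1 \<Longrightarrow>
      (\<integral>\<^sup>+x. ennreal (mean lebesgue f (dcell 0 0 (x + v)) powr p x * w x) \<partial>lebesgue) \<le> ennreal (C2 v)"
    by blast
  define V where "V = (near_shifts K :: (real^'n) set)"
  define Sh where "Sh = (third_shifts :: (real^'n) set)"
  have fins: "finite V" "finite Sh" by (simp_all add: V_def Sh_def finite_near_shifts finite_third_shifts)
  define M where "M = (12 * K) ^ CARD('n) * (real (card V) + 1)"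
  have M: "1 \<le> M" "(12 * K) ^ CARD('n) \<le> M" "(12 * K) ^ CARD('n) * real (card V) \<le> M"
  proof -
    have "1 \<le> (12 * K) ^ CARD('n)" using K by (intro one_le_power) simp
    then show "1 \<le> M" "(12 * K) ^ CARD('n) \<le> M" "(12 * K) ^ CARD('n) * real (card V) \<le> M"
      unfolding M_def using mult_mono[of 1 "(12 * K) ^ CARD('n)" 1 "real (card V) + 1"]
      by (auto simp: distrib_left)
  qed
  define C where "C = M powr P * (real (card Sh) * C1 + (\<Sum>v\<in>V. C2 v)) + 1"
  have C: "1 \<le> C"
  proof -
    have "0 \<le> (\<Sum>v\<in>V. C2 v)" by (rule sum_nonneg) (simp add: V_def C2(1) less_imp_le)
    then have "0 \<le> M powr P * (real (card Sh) * C1 + (\<Sum>v\<in>V. C2 v))"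
      using C1(1) by (intro mult_nonneg_nonneg add_nonneg_nonneg) auto
    then show ?thesis unfolding C_def by linarith
  qed
  show thesis
  proof (rule that[OF C])
    fix f :: "real^'n \<Rightarrow> real"
    assume f[measurable]: "f \<in> borel_measurable lebesgue" and f0: "\<And>x. 0 \<le> f x" and f1: "modular f \<le> 1"
    define S where "S a T x = running_max (\<lambda>j. mean lebesgue f (dcell a j x)) T" for a T x
    define H where "H v x = mean lebesgue f (dcell 0 0 (x + v))" for v x
    have [measurable]: "S a T \<in> borel_measurable lebesgue" for a T
      unfolding S_def[abs_def] by (rule running_max_mean_measurable)
    have Hm[measurable]: "H v \<in> borel_measurable lebesgue" if "v \<in> V" for v
    proof (rule measurable_dcellwise[where a = 0 and k = 0])
      fix x y :: "real^'n" assume "y \<in> dcell 0 0 x"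
      then show "H v y = H v x"
        using dcell_lattice_translate[of v y 0 x] that by (simp add: H_def V_def near_shifts_def)
    qed
    have S0: "0 \<le> S a T x" for a T x unfolding S_def by (intro running_max_nonneg mean_nonneg)
    have H0: "0 \<le> H v x" for v x unfolding H_def by (rule mean_nonneg)
    define G where "G x = ennreal (M powr P) * ((\<Sum>a\<in>Sh. SUP T. ennreal (S a T x powr p x * w x)) + (\<Sum>v\<in>V. ennreal (H v x powr p x * w x)))" for x
    have Gm: "G \<in> borel_measurable lebesgue" unfolding G_def[abs_def]
      by (intro borel_measurable_times_ennreal borel_measurable_add borel_measurable_sum borel_measurable_const borel_measurable_SUP) auto
    have "(\<integral>\<^sup>+x. G x \<partial>lebesgue) = ennreal (M powr P) * ((\<Sum>a\<in>Sh. \<integral>\<^sup>+x. (SUP T. ennreal (S a T x powr p x * w x)) \<partial>lebesgue) + (\<Sum>v\<in>V. \<integral>\<^sup>+x. ennreal (H v x powr p x * w x) \<partial>lebesgue))"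
      unfolding G_def
      by (subst nn_integral_cmult, (intro borel_measurable_add borel_measurable_sum borel_measurable_SUP; auto; fail),
          subst nn_integral_add, (intro borel_measurable_add borel_measurable_sum borel_measurable_SUP; auto; fail),
          (intro borel_measurable_add borel_measurable_sum borel_measurable_SUP; auto; fail),
          subst nn_integral_sum, (intro borel_measurable_SUP; auto; fail), subst nn_integral_sum) auto
    also have "\<dots> \<le> ennreal (M powr P) * ((\<Sum>a\<in>Sh. ennreal C1) + (\<Sum>v\<in>V. ennreal (C2 v)))"
      using C1(2)[OF f f0 f1] C2(2)[OF _ f f0 f1]
      by (intro mult_left_mono add_mono sum_mono) (auto simp: S_def H_def V_def)
    also have "(\<Sum>a\<in>Sh. ennreal C1) = ennreal (real (card Sh) * C1)"
      using C1 by (simp add: ennreal_mult ennreal_of_nat_eq_real_of_nat)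
    also have "(\<Sum>v\<in>V. ennreal (C2 v)) = ennreal (\<Sum>v\<in>V. C2 v)"
      by (rule sum_ennreal) (use C2(1) in \<open>auto simp: V_def less_imp_le\<close>)
    also have "ennreal (M powr P) * (ennreal (real (card Sh) * C1) + ennreal (\<Sum>v\<in>V. C2 v)) = ennreal (M powr P * (real (card Sh) * C1 + (\<Sum>v\<in>V. C2 v)))"
      using C1 C2(1) by (subst ennreal_plus[symmetric], simp, simp add: V_def sum_nonneg less_imp_le, subst ennreal_mult[symmetric])
        (auto simp: V_def sum_nonneg less_imp_le)
    also have "\<dots> \<le> ennreal C" by (rule ennreal_leI) (simp add: C_def)
    finally have Gint: "(\<integral>\<^sup>+x. G x \<partial>lebesgue) \<le> ennreal C" .
    have pt: "ennreal (b powr p x * w x) \<le> G x"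
      if ab: "(\<exists>a\<in>Sh. \<exists>j. b \<le> (12 * K) ^ CARD('n) * mean lebesgue f (dcell a j x)) \<or> b \<le> (12 * K) ^ CARD('n) * (\<Sum>v\<in>V. H v x)"
        and b0: "0 \<le> b" for b x
    proof -
      have *: "ennreal (b powr p x * w x) \<le> ennreal (M powr P) * ennreal (u powr p x * w x)" if "b \<le> M * u" "0 \<le> u" for u
      proof -
        have "b powr p x \<le> (M * u) powr p x" using that b0 p_pos[of x] by (intro powr_mono2) auto
        also have "\<dots> = M powr p x * u powr p x" by (rule powr_mult)
        also have "\<dots> \<le> M powr P * u powr p x" using M p_le[of x] by (intro mult_right_mono powr_mono) auto
        finally have "b powr p x * w x \<le> M powr P * (u powr p x * w x)"
          using w_pos[of x] by (simp add: mult_right_mono flip: mult.assoc)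
        then show ?thesis using w_pos[of x] by (simp flip: ennreal_mult add: ennreal_leI)
      qed
      from ab show ?thesis
      proof
        assume "\<exists>a\<in>Sh. \<exists>j. b \<le> (12 * K) ^ CARD('n) * mean lebesgue f (dcell a j x)"
        then obtain a j where a: "a \<in> Sh" and j: "b \<le> (12 * K) ^ CARD('n) * mean lebesgue f (dcell a j x)" by blast
        have "mean lebesgue f (dcell a j x) \<le> S a j x"
          unfolding S_def by (rule le_running_max[of j j "\<lambda>j. mean lebesgue f (dcell a j x)"]) simp
        then have "(12 * K) ^ CARD('n) * mean lebesgue f (dcell a j x) \<le> M * S a j x"
          using M K S0 mean_nonneg[of lebesgue f "dcell a j x"] by (intro mult_mono) auto
        then have "ennreal (b powr p x * w x) \<le> ennreal (M powr P) * ennreal (S a j x powr p x * w x)"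
          using j S0 by (intro *) auto
        also have "\<dots> \<le> ennreal (M powr P) * (SUP T. ennreal (S a T x powr p x * w x))"
          by (intro mult_left_mono SUP_upper) auto
        also have "\<dots> \<le> ennreal (M powr P) * (\<Sum>a\<in>Sh. SUP T. ennreal (S a T x powr p x * w x))"
          using member_le_sum[OF a, of "\<lambda>a. SUP T. ennreal (S a T x powr p x * w x)"] fins
          by (intro mult_left_mono) auto
        also have "\<dots> \<le> G x" unfolding G_def by (intro mult_left_mono) (auto intro: add_increasing2)
        finally show ?thesis .
      next
        assume b: "b \<le> (12 * K) ^ CARD('n) * (\<Sum>v\<in>V. H v x)"
        show ?thesis
        proof (cases "V = {}")
          case True
          then have "b = 0" using b b0 by simp
          then show ?thesis by simp
        next
          case False
          \<comment> \<open>The sum is replaced by its largest term before the power is taken; the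
            number of terms goes into M.\<close>
          have "Max ((\<lambda>v. H v x) ` V) \<in> (\<lambda>v. H v x) ` V" using fins False by (intro Max_in) auto
          then obtain v where v: "v \<in> V" "H v x = Max ((\<lambda>v. H v x) ` V)" by auto
          have "(\<Sum>v\<in>V. H v x) \<le> (\<Sum>u\<in>V. H v x)" unfolding v(2) using fins by (intro sum_mono Max_ge) auto
          also have "\<dots> = real (card V) * H v x" by simp
          finally have "b \<le> (12 * K) ^ CARD('n) * (real (card V) * H v x)"
            using K by (intro order_trans[OF b] mult_left_mono) auto
          also have "\<dots> \<le> M * H v x" unfolding mult.assoc[symmetric] using M H0 by (intro mult_right_mono) auto
          finally have "ennreal (b powr p x * w x) \<le> ennreal (M powr P) * ennreal (H v x powr p x * w x)"
            using H0 by (intro *) auto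
          also have "\<dots> \<le> ennreal (M powr P) * (\<Sum>v\<in>V. ennreal (H v x powr p x * w x))"
            using member_le_sum[OF v(1), of "\<lambda>v. ennreal (H v x powr p x * w x)"] fins
            by (intro mult_left_mono) auto
          also have "\<dots> \<le> G x" unfolding G_def by (intro mult_left_mono) (auto intro: add_increasing)
          finally show ?thesis .
        qed
      qed
    qed
    show "\<exists>G. G \<in> borel_measurable lebesgue \<and> (\<integral>\<^sup>+x. G x \<partial>lebesgue) \<le> ennreal C \<and>
        (\<forall>x t. 0 < t \<longrightarrow> t < 1 \<longrightarrow>
          ennreal ((enn2real (\<integral>\<^sup>+y\<in>ball x (K * t). ennreal (f y) \<partial>lebesgue) / t ^ CARD('n)) powr p x * w x) \<le> G x)"
    proof (intro exI[of _ G] conjI allI impI Gm Gint)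
      fix x :: "real^'n" and t :: real assume t: "0 < t" "t < 1"
      show "ennreal ((enn2real (\<integral>\<^sup>+y\<in>ball x (K * t). ennreal (f y) \<partial>lebesgue) / t ^ CARD('n)) powr p x * w x) \<le> G x"
        using ball_control[OF f f0 cell_int_finite[OF f f0 f1] K t, of x] t
        by (intro pt) (auto simp: Sh_def V_def H_def)
    qed
  qed
qed

end

section \<open>Smooth functions\<close>

lemma partial_eq: "(f has_derivative f') (at x) \<Longrightarrow> partial i f x = f' (axis i 1)"
  by (simp add: partial_def frechet_derivative_at[symmetric])

lemma has_derivative_partials:
  fixes f :: "real^'n \<Rightarrow> complex"
  assumes "f differentiable (at x)"
  shows "(f has_derivative (\<lambda>h. \<Sum>i\<in>UNIV. h$i *\<^sub>R partial i f x)) (at x)"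
proof -
  have D: "(f has_derivative frechet_derivative f (at x)) (at x)"
    using assms by (simp add: frechet_derivative_works)
  then interpret B: bounded_linear "frechet_derivative f (at x)" by (rule has_derivative_bounded_linear)
  have "frechet_derivative f (at x) h = (\<Sum>i\<in>UNIV. h$i *\<^sub>R partial i f x)" for h
  proof -
    have "h = (\<Sum>i\<in>UNIV. h$i *\<^sub>R axis i 1)"
      using basis_expansion[of h] by (simp add: scalar_mult_eq_scaleR)
    then have "frechet_derivative f (at x) h = frechet_derivative f (at x) (\<Sum>i\<in>UNIV. h$i *\<^sub>R axis i 1)" by simp
    also have "\<dots> = (\<Sum>i\<in>UNIV. h$i *\<^sub>R partial i f x)" by (simp add: B.sum B.scaleR partial_def)
    finally show ?thesis .
  qed
  then show ?thesis using D by (metis (no_types, lifting) ext)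
qed

text \<open>Smoothness quantifies over all iterated partial derivatives. Exhibiting a class closed
  under one derivative avoids formulas for the higher ones.\<close>

lemma smooth_coinduct:
  assumes "f \<in> S" "\<And>g x. g \<in> S \<Longrightarrow> g differentiable (at x)" "\<And>g i. g \<in> S \<Longrightarrow> partial i g \<in> S"
  shows "smooth f"
proof -
  have "partials \<alpha> f \<in> S" for \<alpha> by (induction \<alpha>) (auto intro: assms)
  then show ?thesis using assms(2) by (auto simp: smooth_def)
qed

lemma partials_append: "partials (\<alpha> @ \<beta>) f = partials \<alpha> (partials \<beta> f)"
  by (induction \<alpha>) auto

lemma smooth_partials: "smooth f \<Longrightarrow> smooth (partials \<beta> f)"
  by (auto simp: smooth_def partials_append[symmetric])

lemma smooth_partial: "smooth f \<Longrightarrow> smooth (partial i f)"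
  using smooth_partials[of f "[i]"] by simp

lemma smooth_differentiable: "smooth f \<Longrightarrow> f differentiable (at x)"
  unfolding smooth_def by (metis partials.simps(1))

lemma smooth_continuous: "smooth f \<Longrightarrow> continuous_on A f"
  by (meson continuous_at_imp_continuous_on differentiable_imp_continuous_within smooth_differentiable)

lemma smooth_has_derivative:
  "smooth f \<Longrightarrow> (f has_derivative (\<lambda>h. \<Sum>i\<in>UNIV. h$i *\<^sub>R partial i f x)) (at x)"
  by (rule has_derivative_partials[OF smooth_differentiable])

lemma sum_axis_scaleR: "(\<Sum>i\<in>UNIV. (axis j 1 :: real^'n)$i *\<^sub>R g i) = (g j :: complex)"
proof -
  have "(\<Sum>i\<in>UNIV. (axis j 1 :: real^'n)$i *\<^sub>R g i) = (\<Sum>i\<in>UNIV. if i = j then g i else 0)"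
    by (rule sum.cong) (auto simp: axis_def)
  then show ?thesis by simp
qed

text \<open>The product and chain rules turn a function of a given shape into a linear combination
  of such functions; taking spans restores the closure under derivatives that
  \<open>smooth_coinduct\<close> asks for.\<close>

inductive_set fun_span :: "(real^'n \<Rightarrow> complex) set \<Rightarrow> (real^'n \<Rightarrow> complex) set" for B where
  base: "b \<in> B \<Longrightarrow> b \<in> fun_span B"
| add: "f \<in> fun_span B \<Longrightarrow> g \<in> fun_span B \<Longrightarrow> (\<lambda>x. f x + g x) \<in> fun_span B"
| scale: "f \<in> fun_span B \<Longrightarrow> (\<lambda>x. c * f x) \<in> fun_span B"

lemma partial_add:
  assumes "f differentiable (at x)" "g differentiable (at x)"
  shows "partial i (\<lambda>x. f x + g x) x = partial i f x + partial i g x"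
  by (subst partial_eq[OF has_derivative_add[OF has_derivative_partials[OF assms(1)] has_derivative_partials[OF assms(2)]]])
    (simp add: sum_axis_scaleR)

lemma partial_cmult:
  assumes "f differentiable (at x)"
  shows "partial i (\<lambda>x. c * f x) x = c * partial i f x"
  by (subst partial_eq[OF has_derivative_mult_right[OF has_derivative_partials[OF assms]]])
    (simp add: sum_axis_scaleR)

lemma smooth_fun_span:
  assumes d: "\<And>b x. b \<in> B \<Longrightarrow> b differentiable (at x)" and p: "\<And>b i. b \<in> B \<Longrightarrow> partial i b \<in> fun_span B"
    and f: "f \<in> fun_span B"
  shows "smooth f"
proof -
  have *: "(\<forall>x. g differentiable (at x)) \<and> (\<forall>i. partial i g \<in> fun_span B)" if "g \<in> fun_span B" for g
    using that
  proof induction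
    case (base b)
    then show ?case using d p by auto
  next
    case (add f g)
    have "partial i (\<lambda>x. f x + g x) = (\<lambda>x. partial i f x + partial i g x)" for i
      by (rule ext, rule partial_add) (use add.IH in auto)
    then show ?case using add.IH by (auto intro: fun_span.add differentiable_add)
  next
    case (scale f c)
    have "partial i (\<lambda>x. c * f x) = (\<lambda>x. c * partial i f x)" for i
      by (rule ext, rule partial_cmult) (use scale.IH in auto)
    then show ?case using scale.IH by (auto intro: fun_span.scale differentiable_mult)
  qed
  show ?thesis by (rule smooth_coinduct[OF f]) (use * in auto)
qed

lemma smooth_add: "smooth f \<Longrightarrow> smooth g \<Longrightarrow> smooth (\<lambda>x. f x + g x)"
  by (rule smooth_fun_span[where B = "{f. smooth f}"])
    (auto intro: fun_span.intros smooth_differentiable smooth_partial)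

lemma smooth_cmult: "smooth f \<Longrightarrow> smooth (\<lambda>x. c * f x)"
  by (rule smooth_fun_span[where B = "{f. smooth f}"])
    (auto intro: fun_span.intros smooth_differentiable smooth_partial)

lemma partials_add:
  assumes "smooth f" "smooth g"
  shows "partials \<alpha> (\<lambda>x. f x + g x) = (\<lambda>x. partials \<alpha> f x + partials \<alpha> g x)"
  by (induction \<alpha>) (auto intro!: ext partial_add simp: assms smooth_differentiable smooth_partials)

lemma partials_cmult:
  assumes "smooth f"
  shows "partials \<alpha> (\<lambda>x. c * f x) = (\<lambda>x. c * partials \<alpha> f x)"
  by (induction \<alpha>) (auto intro!: ext partial_cmult simp: assms smooth_differentiable smooth_partials)

lemma smooth_const: "smooth (\<lambda>_. c)"
proof (rule smooth_coinduct[where S = "range (\<lambda>c _. c)"])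
  fix g :: "real^'n \<Rightarrow> complex" and i assume "g \<in> range (\<lambda>c _. c)"
  then obtain c where "g = (\<lambda>_. c)" by auto
  moreover have "partial i (\<lambda>_. c) x = 0" for x :: "real^'n"
    by (subst partial_eq[OF has_derivative_const]) simp
  ultimately show "partial i g \<in> range (\<lambda>c _. c)" by auto
qed auto

lemma smooth_mult:
  assumes "smooth f" "smooth g" shows "smooth (\<lambda>x. f x * g x)"
proof (rule smooth_fun_span[where B = "{\<lambda>x. f x * g x | f g. smooth f \<and> smooth g}"])
  fix b i assume "b \<in> {\<lambda>x. f x * g x | f g. smooth f \<and> smooth g}"
  then obtain f g where b: "b = (\<lambda>x. f x * g x)" "smooth f" "smooth g" by auto
  have "partial i b x = f x * partial i g x + partial i f x * g x" for x
    unfolding b(1)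
    by (subst partial_eq[OF has_derivative_mult[OF smooth_has_derivative[OF b(2)] smooth_has_derivative[OF b(3)]]])
      (simp add: sum_axis_scaleR)
  then have "partial i b = (\<lambda>x. f x * partial i g x + partial i f x * g x)" by auto
  also have "\<dots> \<in> fun_span {\<lambda>x. f x * g x | f g. smooth f \<and> smooth g}"
    using b smooth_partial by (intro fun_span.add fun_span.base) blast+
  finally show "partial i b \<in> fun_span {\<lambda>x. f x * g x | f g. smooth f \<and> smooth g}" .
next
  show "b differentiable (at x)" if "b \<in> {\<lambda>x. f x * g x | f g. smooth f \<and> smooth g}" for b x
    using that by (elim CollectE exE conjE) (simp add: differentiable_mult smooth_differentiable)
  show "(\<lambda>x. f x * g x) \<in> fun_span {\<lambda>x. f x * g x | f g. smooth f \<and> smooth g}"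
    using assms by (intro fun_span.base) blast
qed

lemma smooth_prod: "finite I \<Longrightarrow> (\<And>i. i \<in> I \<Longrightarrow> smooth (f i)) \<Longrightarrow> smooth (\<lambda>x. \<Prod>i\<in>I. f i x)"
  by (induction I rule: finite_induct) (auto intro: smooth_const smooth_mult)

lemma partial_affine:
  fixes f :: "real^'n \<Rightarrow> complex"
  assumes "smooth f"
  shows "(\<lambda>y. f (z + c *\<^sub>R y)) differentiable (at x)"
    and "partial i (\<lambda>y. f (z + c *\<^sub>R y)) x = of_real c * partial i f (z + c *\<^sub>R x)"
proof -
  have "((\<lambda>y. f (z + c *\<^sub>R y)) has_derivative (\<lambda>h. \<Sum>i\<in>UNIV. (c *\<^sub>R h)$i *\<^sub>R partial i f (z + c *\<^sub>R x))) (at x)"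
    by (rule has_derivative_compose[OF _ smooth_has_derivative[OF assms], where f = "\<lambda>y. z + c *\<^sub>R y"])
      (auto intro!: derivative_eq_intros)
  then show "(\<lambda>y. f (z + c *\<^sub>R y)) differentiable (at x)"
    and "partial i (\<lambda>y. f (z + c *\<^sub>R y)) x = of_real c * partial i f (z + c *\<^sub>R x)"
    by (auto simp: differentiable_def partial_eq scaleR_sum_right[symmetric] sum_axis_scaleR
        scaleR_conv_of_real[symmetric] scaleR_scaleR[symmetric] simp del: scaleR_scaleR)
qed

lemma smooth_affine:
  assumes "smooth f" shows "smooth (\<lambda>y. f (z + c *\<^sub>R y))"
proof (rule smooth_fun_span[where B = "{\<lambda>y. f (z + c *\<^sub>R y) | f. smooth f}"])
  fix b i assume "b \<in> {\<lambda>y. f (z + c *\<^sub>R y) | f. smooth f}"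
  then obtain f where b: "b = (\<lambda>y. f (z + c *\<^sub>R y))" "smooth f" by auto
  have "partial i b = (\<lambda>y. of_real c * partial i f (z + c *\<^sub>R y))"
    unfolding b(1) by (rule ext) (rule partial_affine(2)[OF b(2)])
  then show "partial i b \<in> fun_span {\<lambda>y. f (z + c *\<^sub>R y) | f. smooth f}"
    using smooth_partial[OF b(2), of i] by (simp only:) (intro fun_span.scale fun_span.base, blast)
next
  show "b differentiable (at x)" if "b \<in> {\<lambda>y. f (z + c *\<^sub>R y) | f. smooth f}" for b x
    using that by (elim CollectE exE conjE) (simp add: partial_affine(1))
  show "(\<lambda>y. f (z + c *\<^sub>R y)) \<in> fun_span {\<lambda>y. f (z + c *\<^sub>R y) | f. smooth f}"
    using assms by (intro fun_span.base) blast
qed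

lemma partials_affine:
  assumes "smooth f"
  shows "partials \<alpha> (\<lambda>y. f (z + c *\<^sub>R y)) = (\<lambda>y. of_real (c ^ length \<alpha>) * partials \<alpha> f (z + c *\<^sub>R y))"
proof (induction \<alpha>)
  case (Cons i \<alpha>)
  show ?case
    by (rule ext, simp only: partials.simps Cons list.size power_Suc)
      (subst partial_cmult, (intro smooth_differentiable smooth_affine smooth_partials assms),
       simp add: partial_affine(2) smooth_partials assms)
qed simp

lemma partials_outside:
  assumes "open U" "\<And>x. x \<in> U \<Longrightarrow> f x = 0" "x \<in> U"
  shows "partials \<alpha> f x = (0::complex)"
  using assms(3)
proof (induction \<alpha> arbitrary: x)
  case (Cons i \<alpha>)
  have "(partials \<alpha> f has_derivative (\<lambda>h. 0)) (at x)"
    by (rule has_derivative_transform_within_open[OF has_derivative_const[of 0] assms(1) Cons.prems])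
      (simp add: Cons.IH)
  then show ?case by (simp add: partial_eq)
qed (use assms in auto)

lemma test_functions_iff: "f \<in> test_functions \<longleftrightarrow> smooth f \<and> bounded {x. f x \<noteq> 0}"
  by (auto simp: test_functions_def compact_closure)

lemma test_function_smooth: "f \<in> test_functions \<Longrightarrow> smooth f"
  by (simp add: test_functions_iff)

lemma in_support: "f x \<noteq> 0 \<Longrightarrow> x \<in> closure {x. f x \<noteq> 0}"
  by (rule subsetD[OF closure_subset]) simp

lemma partials_support: "x \<notin> closure {x. f x \<noteq> 0} \<Longrightarrow> partials \<alpha> f x = 0"
  by (rule partials_outside[of "- closure {x. f x \<noteq> 0}"]) (use in_support in \<open>auto simp: open_Compl\<close>)

lemma test_functions_partials:
  assumes "f \<in> test_functions" shows "partials \<alpha> f \<in> test_functions"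
proof -
  have "{x. partials \<alpha> f x \<noteq> 0} \<subseteq> closure {x. f x \<noteq> 0}" 
  proof
    fix x assume "x \<in> {x. partials \<alpha> f x \<noteq> 0}"
    then show "x \<in> closure {x. f x \<noteq> 0}"
      by (intro ccontr[of "x \<in> closure {x. f x \<noteq> 0}"]) (use partials_support[of x f \<alpha>] in simp)
  qed
  then show ?thesis using assms smooth_partials
    by (auto simp: test_functions_iff bounded_closure intro: bounded_subset)
qed

lemma test_functions_add:
  assumes "f \<in> test_functions" "g \<in> test_functions" shows "(\<lambda>x. f x + g x) \<in> test_functions"
proof -
  have "{x. f x + g x \<noteq> 0} \<subseteq> {x. f x \<noteq> 0} \<union> {x. g x \<noteq> 0}" by auto
  moreover have "bounded ({x. f x \<noteq> 0} \<union> {x. g x \<noteq> 0})" using assms by (simp add: test_functions_iff)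
  ultimately have "bounded {x. f x + g x \<noteq> 0}" by (rule bounded_subset[rotated])
  then show ?thesis using assms by (simp add: test_functions_iff smooth_add)
qed

lemma test_functions_cmult:
  assumes "f \<in> test_functions" shows "(\<lambda>x. c * f x) \<in> test_functions"
proof -
  have "{x. c * f x \<noteq> 0} \<subseteq> {x. f x \<noteq> 0}" by auto
  then show ?thesis using assms smooth_cmult by (auto simp: test_functions_iff intro: bounded_subset)
qed

lemma test_functions_affine:
  assumes "f \<in> test_functions" "c \<noteq> 0" shows "(\<lambda>y. f (z + c *\<^sub>R y)) \<in> test_functions"
proof -
  have "{y. f (z + c *\<^sub>R y) \<noteq> 0} \<subseteq> (\<lambda>x. (1 / c) *\<^sub>R (x - z)) ` {x. f x \<noteq> 0}"
  proof
    fix y assume "y \<in> {y. f (z + c *\<^sub>R y) \<noteq> 0}"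
    then show "y \<in> (\<lambda>x. (1 / c) *\<^sub>R (x - z)) ` {x. f x \<noteq> 0}"
      using assms(2) by (intro image_eqI[of _ _ "z + c *\<^sub>R y"]) auto
  qed
  moreover have "bounded ((\<lambda>x. (1 / c) *\<^sub>R (x - z)) ` {x. f x \<noteq> 0})"
    using assms(1) bounded_scaling[OF bounded_translation_minus[of "{x. f x \<noteq> 0}" z], of "1 / c"]
    by (simp add: test_functions_iff image_image)
  ultimately show ?thesis using assms(1) smooth_affine by (auto simp: test_functions_iff intro: bounded_subset)
qed

lemma test_function_bounded:
  assumes "f \<in> test_functions" shows "\<exists>M\<ge>0. \<forall>x. cmod (f x) \<le> M"
proof -
  have "compact (f ` closure {x. f x \<noteq> 0})"
    using assms by (intro compact_continuous_image smooth_continuous) (auto simp: test_functions_def)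
  then obtain M where M: "\<And>x. x \<in> closure {x. f x \<noteq> 0} \<Longrightarrow> cmod (f x) \<le> M"
    by (metis compact_imp_bounded bounded_iff imageI)
  have "cmod (f x) \<le> max 0 M" for x
  proof (cases "f x = 0")
    case False
    then have "x \<in> closure {x. f x \<noteq> 0}" by (rule in_support)
    then show ?thesis using M by (simp add: le_max_iff_disj)
  qed simp
  then show ?thesis by (intro exI[of _ "max 0 M"]) auto
qed

lemma test_function_uniform:
  fixes f :: "real^'n \<Rightarrow> complex"
  assumes "f \<in> test_functions" "0 < e" shows "\<exists>d>0. \<forall>x y. norm (x - y) < d \<longrightarrow> cmod (f x - f y) < e"
proof -
  define K where "K = closure {x. f x \<noteq> 0}"
  have K: "compact K" using assms by (simp add: K_def test_functions_def)
  \<comment> \<open>The closed 1-neighbourhood of the support: two points at distance below 1 either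
    both belong to it, or f vanishes at both.\<close>
  define K1 where "K1 = {x + y | x y. x \<in> K \<and> y \<in> cball 0 1}"
  have K1: "compact K1" unfolding K1_def using K by (intro compact_sums) auto
  have "uniformly_continuous_on K1 f"
    using assms by (intro compact_uniformly_continuous K1 smooth_continuous) (auto simp: test_functions_iff)
  then obtain d where d: "d > 0" "\<And>x y. x \<in> K1 \<Longrightarrow> y \<in> K1 \<Longrightarrow> dist y x < d \<Longrightarrow> dist (f y) (f x) < e"
    using assms(2) unfolding uniformly_continuous_on_def by metis
  have inK: "x \<in> K" if "f x \<noteq> 0" for x unfolding K_def using that by (rule in_support)
  have in1: "y \<in> K1" if "x \<in> K" "norm (y - x) < 1" for x y
    unfolding K1_def using that by (intro CollectI exI[of _ x] exI[of _ "y - x"]) auto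
  have in0: "x \<in> K1" if "x \<in> K" for x using in1[OF that, of x] by simp
  show ?thesis
  proof (intro exI[of _ "min d 1"] conjI allI impI)
    fix x y :: "real^'n" assume xy: "norm (x - y) < min d 1"
    show "cmod (f x - f y) < e"
    proof (cases "f x = 0 \<and> f y = 0")
      case False
      then have "x \<in> K1 \<and> y \<in> K1" using inK in0 in1[of x y] in1[of y x] xy by (auto simp: norm_minus_commute)
      then show ?thesis using d(2)[of y x] xy by (simp add: dist_norm)
    qed (use assms in simp)
  qed (use d in auto)
qed

section \<open>Bump functions\<close>

text \<open>The span of these functions over k is closed under differentiation
  (\<open>flat_exp_deriv\<close>). That makes k = 0, the classical function flat at the origin,
  smooth without an explicit form of its derivatives.\<close>

definition flat_exp :: "nat \<Rightarrow> real \<Rightarrow> real" where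
  "flat_exp k t = (if t > 0 then exp (- 1 / t) / t ^ k else 0)"

lemma power_le_fact_exp: "0 \<le> x \<Longrightarrow> x ^ m \<le> fact m * exp (x::real)"
proof -
  assume x: "0 \<le> x"
  have "(\<Sum>n\<in>{m}. x ^ n /\<^sub>R fact n) \<le> (\<Sum>n. x ^ n /\<^sub>R fact n)"
    using x by (intro sum_le_suminf summable_exp_generic) auto
  then have "x ^ m / fact m \<le> exp x" by (simp add: exp_def divide_inverse mult.commute)
  then show ?thesis by (simp add: field_simps)
qed

text \<open>Exponential growth beats the power k + 2 at 1 / t. The square on the right is what
  forces the difference quotient at 0 to tend to 0.\<close>

lemma flat_exp_le: "\<bar>flat_exp k t\<bar> \<le> fact (k + 2) * t\<^sup>2"
proof (cases "t > 0")
  case True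
  have "(1 / t) ^ (k + 2) \<le> fact (k + 2) * exp (1 / t)" by (rule power_le_fact_exp) (use True in simp)
  then have "exp (- (1 / t)) * (1 / t) ^ (k + 2) * t\<^sup>2 \<le> exp (- (1 / t)) * (fact (k + 2) * exp (1 / t)) * t\<^sup>2"
    by (intro mult_right_mono mult_left_mono) auto
  also have "\<dots> = fact (k + 2) * (exp (- (1 / t)) * exp (1 / t)) * t\<^sup>2" by (simp add: mult_ac)
  also have "exp (- (1 / t)) * exp (1 / t) = 1" by (simp flip: exp_add)
  finally show ?thesis using True by (simp add: flat_exp_def power_divide power_add power2_eq_square field_simps)
qed (simp add: flat_exp_def)

lemma flat_exp_deriv:
  "(flat_exp k has_field_derivative (- real k * flat_exp (Suc k) t + flat_exp (k + 2) t)) (at t)"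
proof (cases t "0::real" rule: linorder_cases)
  case greater
  have "((\<lambda>t. exp (- 1 / t) / t ^ k) has_field_derivative (- real k * flat_exp (Suc k) t + flat_exp (k + 2) t)) (at t)"
  proof (cases k)
    case 0
    then show ?thesis using greater
      by (auto intro!: derivative_eq_intros simp: flat_exp_def power2_eq_square field_simps)
  next
    case (Suc l)
    have "t ^ l = t * t ^ (l - Suc 0)" if "l \<noteq> 0" using that power_minus_mult[of l t] by (simp add: mult.commute)
    with Suc show ?thesis using greater
      by (cases "l = 0") (auto intro!: derivative_eq_intros simp: flat_exp_def power2_eq_square field_simps)
  qed
  then show ?thesis
    by (rule has_field_derivative_transform_within_open[where S = "{0<..}"]) (use greater in \<open>auto simp: flat_exp_def\<close>)
next
  case less
  have "((\<lambda>t. 0) has_field_derivative (- real k * flat_exp (Suc k) t + flat_exp (k + 2) t)) (at t)"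
    using less by (simp add: flat_exp_def)
  then show ?thesis
    by (rule has_field_derivative_transform_within_open[where S = "{..<0}"]) (use less in \<open>auto simp: flat_exp_def\<close>)
next
  case equal
  have "(\<lambda>h. flat_exp k h / h) \<midarrow>0\<rightarrow> 0"
  proof (rule Lim_null_comparison[where g = "\<lambda>h. fact (k + 2) * \<bar>h\<bar>"])
    show "\<forall>\<^sub>F h in at 0. norm (flat_exp k h / h) \<le> fact (k + 2) * \<bar>h\<bar>"
    proof (rule eventually_at_ball'[of 1, THEN eventually_mono], simp, clarify)
      fix h :: real assume "h \<noteq> 0"
      then show "norm (flat_exp k h / h) \<le> fact (k + 2) * \<bar>h\<bar>"
      proof -
        have "\<bar>flat_exp k h\<bar> / \<bar>h\<bar> \<le> fact (k + 2) * (\<bar>h\<bar> * \<bar>h\<bar>) / \<bar>h\<bar>"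
          using flat_exp_le[of k h] by (intro divide_right_mono) (auto simp only: power2_eq_square abs_mult_self_eq abs_ge_zero)
        also have "\<dots> = fact (k + 2) * \<bar>h\<bar>" using \<open>h \<noteq> 0\<close> by (simp only: times_divide_eq_right[symmetric]) simp
        finally show ?thesis by (simp only: real_norm_def abs_divide)
      qed
    qed
    show "(\<lambda>h. fact (k + 2) * \<bar>h\<bar>) \<midarrow>0\<rightarrow> (0::real)" by (auto intro!: tendsto_eq_intros)
  qed
  then show ?thesis using equal by (simp add: has_field_derivative_iff flat_exp_def)
qed

lemma flat_exp_bounds: "0 \<le> flat_exp 0 t" "flat_exp 0 t \<le> 1"
  by (auto simp: flat_exp_def)

lemma smooth_flat_exp:
  fixes i :: "'n::finite"
  shows "smooth (\<lambda>x::real^'n. complex_of_real (flat_exp k (c + s * x$i)))"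
proof (rule smooth_fun_span[where B = "range (\<lambda>k (x::real^'n). complex_of_real (flat_exp k (c + s * x$i)))"])
  have D: "((\<lambda>x::real^'n. complex_of_real (flat_exp k (c + s * x$i))) has_derivative
     (\<lambda>h. complex_of_real (s * h$i * (- real k * flat_exp (Suc k) (c + s * x$i) + flat_exp (k + 2) (c + s * x$i))))) (at x)" for k x
  proof -
    have 1: "((\<lambda>x::real^'n. c + s * x$i) has_derivative (\<lambda>h. s * h$i)) (at x)"
      by (auto intro!: derivative_eq_intros bounded_linear_imp_has_derivative bounded_linear_vec_nth)
    have "((\<lambda>x. flat_exp k (c + s * x$i)) has_derivative
     (\<lambda>h. s * h$i * (- real k * flat_exp (Suc k) (c + s * x$i) + flat_exp (k + 2) (c + s * x$i)))) (at x)"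
      using has_derivative_compose[OF 1 flat_exp_deriv[unfolded has_field_derivative_def]]
      by (simp add: mult.commute)
    then show ?thesis by (rule bounded_linear.has_derivative[OF bounded_linear_of_real])
  qed
  show "b differentiable (at x)" if "b \<in> range (\<lambda>k (x::real^'n). complex_of_real (flat_exp k (c + s * x$i)))" for b x
    using that D by (auto simp: differentiable_def)
  fix b and j :: 'n assume "b \<in> range (\<lambda>k (x::real^'n). complex_of_real (flat_exp k (c + s * x$i)))"
  then obtain k where b: "b = (\<lambda>x. complex_of_real (flat_exp k (c + s * x$i)))" by auto
  have "partial j b = (\<lambda>x. complex_of_real (s * axis j 1 $ i) *
     (of_real (- real k) * complex_of_real (flat_exp (Suc k) (c + s * x$i)) + complex_of_real (flat_exp (k + 2) (c + s * x$i))))"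
    unfolding b by (rule ext) (simp add: partial_eq[OF D])
  also have "\<dots> \<in> fun_span (range (\<lambda>k (x::real^'n). complex_of_real (flat_exp k (c + s * x$i))))"
    by (intro fun_span.scale fun_span.add fun_span.base) auto
  finally show "partial j b \<in> fun_span (range (\<lambda>k (x::real^'n). complex_of_real (flat_exp k (c + s * x$i))))" .
qed (auto intro: fun_span.base)

text \<open>The box of support does not depend on m > 0, and the factors exp(-1 / (m u)) tend to 1
  as m grows, so these bumps approximate the indicator of the open box.\<close>

definition box_bump :: "real^'n \<Rightarrow> real^'n \<Rightarrow> real \<Rightarrow> real^'n \<Rightarrow> real" where
  "box_bump a b m x = (\<Prod>i\<in>UNIV. flat_exp 0 (m * (x$i - a$i)) * flat_exp 0 (m * (b$i - x$i)))"

lemma box_bump_bounds: "0 \<le> box_bump a b m x" "box_bump a b m x \<le> 1"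
  unfolding box_bump_def
  by (auto intro!: prod_nonneg prod_le_1 mult_nonneg_nonneg mult_le_one flat_exp_bounds)

lemma box_bump_pos_iff: "0 < m \<Longrightarrow> box_bump a b m x \<noteq> 0 \<longleftrightarrow> x \<in> box a b"
  by (auto simp: box_bump_def flat_exp_def mem_box_cart zero_less_mult_iff)

lemma box_bump_test:
  assumes "0 < m" shows "(\<lambda>x. complex_of_real (box_bump a b m x)) \<in> test_functions"
proof -
  have "smooth (\<lambda>x. \<Prod>i\<in>UNIV. complex_of_real (flat_exp 0 (- m * a$i + m * x$i)) * complex_of_real (flat_exp 0 (m * b$i + (- m) * x$i)))"
    by (intro smooth_prod smooth_mult smooth_flat_exp) auto
  moreover have "(\<lambda>x. \<Prod>i\<in>UNIV. complex_of_real (flat_exp 0 (- m * a$i + m * x$i)) * complex_of_real (flat_exp 0 (m * b$i + (- m) * x$i)))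
    = (\<lambda>x. complex_of_real (box_bump a b m x))"
    by (rule ext) (simp add: box_bump_def algebra_simps)
  moreover have "bounded {x. complex_of_real (box_bump a b m x) \<noteq> 0}"
    using box_bump_pos_iff[OF assms, of a b] by (auto intro: bounded_subset[OF bounded_box])
  ultimately show ?thesis by (simp add: test_functions_iff)
qed

lemma box_bump_tendsto: "(\<lambda>m. box_bump a b (real (Suc m)) x) \<longlonglongrightarrow> indicator (box a b) x"
proof (cases "x \<in> box a b")
  case True
  have "(\<lambda>m. flat_exp 0 (real (Suc m) * u)) \<longlonglongrightarrow> 1" if "u > 0" for u
  proof -
    have "(\<lambda>m. exp (- ((1 / u) * (1 / real (Suc m))))) \<longlonglongrightarrow> exp (- ((1 / u) * 0))"
      by (intro tendsto_exp tendsto_minus tendsto_mult tendsto_const LIMSEQ_Suc lim_const_over_n)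
    moreover have "flat_exp 0 (real (Suc m) * u) = exp (- ((1 / u) * (1 / real (Suc m))))" for m
      using that by (simp add: flat_exp_def zero_less_mult_iff mult.commute del: of_nat_Suc)
    ultimately show ?thesis by simp
  qed
  then have "(\<lambda>m. box_bump a b (real (Suc m)) x) \<longlonglongrightarrow> (\<Prod>i\<in>(UNIV::'a set). 1 * 1)"
    unfolding box_bump_def using True by (intro tendsto_prod tendsto_mult) (auto simp: mem_box_cart)
  then show ?thesis using True by simp
next
  case False
  then have "box_bump a b (real (Suc m)) x = 0" for m using box_bump_pos_iff[of "real (Suc m)" a b x] by auto
  then show ?thesis using False by simp
qed

lemma finite_multiindices: "finite {\<alpha>::'n::finite list. length \<alpha> \<le> m}"
  using finite_lists_length_le[of "UNIV :: 'n set" m] by simp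

text \<open>A bump on the cube with coordinates between -1 and 1, divided by a common bound of its
  derivatives up to order N + 1. The prescribed ball contains the cube because n < 2^n. A member of
  the class is needed to bound a distribution by its grand maximal function.\<close>

lemma D_class_nonempty: "\<exists>\<phi> :: real^'n \<Rightarrow> complex. \<phi> \<in> D_class N"
proof -
  define a b :: "real^'n" where "a = (\<chi> i. -1)" and "b = (\<chi> i. 1)"
  define \<eta> where "\<eta> x = complex_of_real (box_bump a b 1 x)" for x :: "real^'n"
  have \<eta>: "\<eta> \<in> test_functions" unfolding \<eta>_def[abs_def] by (rule box_bump_test) simp
  have "\<forall>\<alpha>\<in>{\<alpha>::'n list. length \<alpha> \<le> N + 1}. \<exists>M\<ge>0. \<forall>x. cmod (partials \<alpha> \<eta> x) \<le> M"
    using test_function_bounded test_functions_partials \<eta> by blast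
  from bchoice[OF this] obtain M where M: "\<And>\<alpha> x. length \<alpha> \<le> N + 1 \<Longrightarrow> 0 \<le> M \<alpha> \<and> cmod (partials \<alpha> \<eta> x) \<le> M \<alpha>" by auto
  define S where "S = (\<Sum>\<alpha>\<in>{\<alpha>::'n list. length \<alpha> \<le> N + 1}. M \<alpha>) + 1"
  have S: "S > 0" "\<And>\<alpha> x. length \<alpha> \<le> N + 1 \<Longrightarrow> cmod (partials \<alpha> \<eta> x) \<le> S"
  proof -
    show "S > 0" unfolding S_def using M by (intro add_nonneg_pos sum_nonneg) auto
    fix \<alpha> :: "'n list" and x assume l: "length \<alpha> \<le> N + 1"
    have "M \<alpha> \<le> (\<Sum>\<alpha>\<in>{\<alpha>::'n list. length \<alpha> \<le> N + 1}. M \<alpha>)"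
      by (rule member_le_sum) (use l M finite_multiindices in auto)
    then show "cmod (partials \<alpha> \<eta> x) \<le> S" using M[OF l, of x] by (simp add: S_def)
  qed
  define \<phi> where "\<phi> x = complex_of_real (1 / S) * \<eta> x" for x
  have supp: "x \<in> ball 0 (2 ^ (3 * CARD('n) + 30))" if "partials \<alpha> \<eta> x \<noteq> 0" for \<alpha> x
  proof -
    have "x \<in> closure {x. \<eta> x \<noteq> 0}" by (rule ccontr) (use partials_support[of x \<eta> \<alpha>] that in simp)
    also have "{x. \<eta> x \<noteq> 0} \<subseteq> cbox a b"
      using box_bump_pos_iff[of 1 a b] box_subset_cbox by (auto simp: \<eta>_def)
    then have "closure {x. \<eta> x \<noteq> 0} \<subseteq> cbox a b" by (intro closure_minimal) auto
    finally have x: "\<bar>x$i\<bar> \<le> 1" for i by (auto simp: mem_box_cart a_def b_def abs_le_iff)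
    have "norm x \<le> (\<Sum>i\<in>UNIV. \<bar>x$i\<bar>)" by (rule norm_le_l1_cart)
    also have "\<dots> \<le> (\<Sum>i\<in>(UNIV::'n set). 1)" by (intro sum_mono x)
    also have "\<dots> = real CARD('n)" by simp
    also have "\<dots> < 2 ^ CARD('n)" by (rule of_nat_less_two_power)
    also have "\<dots> \<le> 2 ^ (3 * CARD('n) + 30)" by (intro power_increasing) auto
    finally show ?thesis by simp
  qed
  have "\<phi> \<in> D_class N"
    unfolding D_class_def
  proof (intro CollectI conjI allI impI)
    show "\<phi> \<in> test_functions" unfolding \<phi>_def[abs_def] by (rule test_functions_cmult[OF \<eta>])
    have cont: "continuous_on UNIV (box_bump a b 1)"
      using smooth_continuous[OF test_function_smooth[OF \<eta>], of UNIV] continuous_on_Re by (fastforce simp: \<eta>_def)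
    have ne: "box a b \<noteq> {}" by (auto simp: interval_ne_empty_cart a_def b_def)
    have "0 < (\<integral>x. box_bump a b 1 x \<partial>lebesgue)"
    proof -
      have bm: "box_bump a b 1 \<in> borel_measurable lebesgue"
        using borel_measurable_continuous_onI[OF cont] by (simp add: measurable_completion)
      have int: "integrable lebesgue (box_bump a b 1)"
      proof (rule Bochner_Integration.integrable_bound[of _ "indicator (box a b)"])
        show "integrable lebesgue (indicator (box a b) :: real^'n \<Rightarrow> real)"
          using emeasure_lborel_box_finite[of a b] by (intro integrable_real_indicator) auto
        show "AE x in lebesgue. norm (box_bump a b 1 x) \<le> norm (indicator (box a b) x :: real)"
        proof (rule AE_I2)
          fix x
          show "norm (box_bump a b 1 x) \<le> norm (indicator (box a b) x :: real)"
            using box_bump_bounds[of a b 1 x] box_bump_pos_iff[of 1 a b x] by (cases "x \<in> box a b") auto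
        qed
      qed (rule bm)
      have "(\<integral>x. box_bump a b 1 x \<partial>lebesgue) \<noteq> 0"
      proof
        assume "(\<integral>x. box_bump a b 1 x \<partial>lebesgue) = 0"
        then have "AE x in lebesgue. box_bump a b 1 x = 0"
          by (subst (asm) integral_nonneg_eq_0_iff_AE[OF int]) (simp_all add: box_bump_bounds)
        then have "AE x in lebesgue. x \<notin> box a b"
        proof eventually_elim
          case (elim x)
          then show ?case using box_bump_pos_iff[of 1 a b x] by simp
        qed
        then have "box a b \<in> null_sets lebesgue" by (subst AE_iff_null_sets) auto
        then have "emeasure lebesgue (box a b) = 0" by auto
        moreover have "emeasure lebesgue (box a b) = ennreal (2 ^ CARD('n))"
          using emeasure_cube(2)[of 2 a] by (simp add: a_def b_def)
        ultimately show False by simp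
      qed
      moreover have "0 \<le> (\<integral>x. box_bump a b 1 x \<partial>lebesgue)"
        by (rule Bochner_Integration.integral_nonneg) (rule box_bump_bounds)
      ultimately show ?thesis by simp
    qed
    then show "(\<integral>x. \<phi> x \<partial>lebesgue) \<noteq> 0" using S by (simp add: \<phi>_def \<eta>_def)
    fix \<alpha> :: "'n list" and x :: "real^'n" assume l: "length \<alpha> \<le> N + 1"
    have "cmod (partials \<alpha> \<phi> x) = cmod (partials \<alpha> \<eta> x) / S"
      unfolding \<phi>_def[abs_def] using S
      by (subst partials_cmult[OF test_function_smooth[OF \<eta>]]) (simp add: norm_mult norm_divide)
    moreover have "cmod (partials \<alpha> \<eta> x) / S \<le> 1" using S(1) S(2)[OF l, of x] by simp
    ultimately show "cmod (partials \<alpha> \<phi> x) \<le> indicator (ball 0 (2 ^ (3 * CARD('n) + 30))) x"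
      using supp[of \<alpha> x] by (cases "partials \<alpha> \<eta> x = 0") (auto simp: indicator_def)
  qed
  then show ?thesis by blast
qed

section \<open>Convolution with test functions\<close>

lemma partials_add_cmult:
  assumes "smooth g" "smooth h"
  shows "partials \<alpha> (\<lambda>y. g y + c * h y) y = partials \<alpha> g y + c * partials \<alpha> h y"
  by (simp only: partials_add[OF assms(1) smooth_cmult[OF assms(2)]] partials_cmult[OF assms(2)])

lemma integral_diff_const_mult:
  fixes g \<psi> :: "'a \<Rightarrow> complex"
  assumes "integrable M (\<lambda>x. g x * \<psi> x)" "integrable M \<psi>"
  shows "(\<integral>x. g x * \<psi> x \<partial>M) + (- (\<integral>x. \<psi> x \<partial>M)) * c = (\<integral>x. (g x - c) * \<psi> x \<partial>M)"
proof -
  have "(\<integral>x. (g x - c) * \<psi> x \<partial>M) = (\<integral>x. g x * \<psi> x \<partial>M) - (\<integral>x. c * \<psi> x \<partial>M)"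
    unfolding left_diff_distrib using assms by (intro Bochner_Integration.integral_diff) auto
  then show ?thesis using assms by simp
qed

lemma integral_cmod_bound:
  fixes f :: "'a \<Rightarrow> complex"
  assumes "integrable M f" "integrable M g" "\<And>x. cmod (f x) \<le> g x"
  shows "cmod (\<integral>x. f x \<partial>M) \<le> (\<integral>x. g x \<partial>M)"
  by (rule order_trans[OF integral_norm_bound Bochner_Integration.integral_mono]) (use assms in auto)

lemma integral_affine:
  fixes f :: "real^'n \<Rightarrow> 'b::{banach, second_countable_topology}"
  assumes [measurable]: "f \<in> borel_measurable borel" and c: "c \<noteq> 0"
  shows "(\<integral>x. f (z + c *\<^sub>R x) \<partial>lebesgue) = (1 / \<bar>c\<bar> ^ CARD('n)) *\<^sub>R (\<integral>x. f x \<partial>lebesgue)"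
proof -
  have "(\<integral>x. f x \<partial>lborel) = (\<integral>x. f x \<partial>density (distr lborel borel (\<lambda>x. z + c *\<^sub>R x)) (\<lambda>_. ennreal (\<bar>c\<bar> ^ DIM(real^'n))))"
    using lborel_affine[OF c, of z] by simp
  also have "\<dots> = (\<integral>x. (\<bar>c\<bar> ^ DIM(real^'n)) *\<^sub>R f x \<partial>distr lborel borel (\<lambda>x. z + c *\<^sub>R x))"
    by (rule integral_density) auto
  also have "\<dots> = (\<integral>x. (\<bar>c\<bar> ^ CARD('n)) *\<^sub>R f (z + c *\<^sub>R x) \<partial>lborel)"
    by (subst integral_distr) auto
  finally have "(\<integral>x. f x \<partial>lborel) = (\<bar>c\<bar> ^ CARD('n)) *\<^sub>R (\<integral>x. f (z + c *\<^sub>R x) \<partial>lborel)" by simp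
  then show ?thesis using c by (simp add: integral_completion)
qed

text \<open>Unlike test functions, these may be multiplied by indicators of Borel sets; the
  decomposition into small pieces in \<open>distribution_convol\<close> relies on that.\<close>

definition bounded_funs :: "(real^'n \<Rightarrow> complex) set" where
  "bounded_funs = {\<psi> \<in> borel_measurable borel. (\<exists>M. \<forall>x. cmod (\<psi> x) \<le> M) \<and> bounded {x. \<psi> x \<noteq> 0}}"

lemma bounded_funs_integrable:
  assumes "\<psi> \<in> bounded_funs" shows "integrable lebesgue \<psi>"
proof -
  obtain M B where M: "\<And>x. cmod (\<psi> x) \<le> M" and B: "\<And>x. \<psi> x \<noteq> 0 \<Longrightarrow> norm x \<le> B" and m: "\<psi> \<in> borel_measurable borel"
    using assms by (auto simp: bounded_funs_def bounded_iff)
  show ?thesis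
  proof (rule Bochner_Integration.integrable_bound[of _ "\<lambda>x. M * indicator (cball 0 B) x"])
    show "integrable lebesgue (\<lambda>x::real^'n. M * indicator (cball 0 B) x :: real)"
      using lmeasurable_cball[of "0::real^'n" B]
      by (intro integrable_mult_right integrable_real_indicator) (auto simp: fmeasurable_def)
    show "\<psi> \<in> borel_measurable lebesgue" using m by (simp add: measurable_completion)
    show "AE x in lebesgue. norm (\<psi> x) \<le> norm (M * indicator (cball 0 B) x)"
    proof (rule AE_I2)
      fix x
      show "norm (\<psi> x) \<le> norm (M * indicator (cball 0 B) x :: real)"
        using M[of x] B[of x] by (cases "\<psi> x = 0") (auto simp: abs_if intro: order_trans[OF norm_ge_zero])
    qed
  qed
qed

lemma test_borel: "\<psi> \<in> test_functions \<Longrightarrow> \<psi> \<in> borel_measurable borel"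
  by (intro borel_measurable_continuous_onI smooth_continuous test_function_smooth)

lemma test_bounded_funs:
  assumes "\<psi> \<in> test_functions" shows "\<psi> \<in> bounded_funs"
proof -
  have "\<exists>M. \<forall>x. cmod (\<psi> x) \<le> M" using test_function_bounded[OF assms] by blast
  then show ?thesis using test_borel[OF assms] assms by (simp add: bounded_funs_def test_functions_iff)
qed

lemma bounded_funs_mult:
  assumes "\<psi> \<in> bounded_funs" "g \<in> borel_measurable borel" "\<And>x. \<psi> x \<noteq> 0 \<Longrightarrow> cmod (g x) \<le> M"
  shows "(\<lambda>x. g x * \<psi> x) \<in> bounded_funs"
proof -
  obtain B where B: "\<And>x. cmod (\<psi> x) \<le> B" using assms(1) by (auto simp: bounded_funs_def)
  have B0: "0 \<le> B" using B[of 0] norm_ge_zero order_trans by blast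
  have "cmod (g x * \<psi> x) \<le> max 0 M * B" for x
  proof (cases "\<psi> x = 0")
    case True then show ?thesis using B0 by simp
  next
    case False
    then show ?thesis using assms(3)[OF False] B[of x] B0 by (auto simp: norm_mult intro!: mult_mono)
  qed
  moreover have "bounded {x. g x * \<psi> x \<noteq> 0}"
    by (rule bounded_subset[of "{x. \<psi> x \<noteq> 0}"]) (use assms(1) in \<open>auto simp: bounded_funs_def\<close>)
  moreover have "(\<lambda>x. g x * \<psi> x) \<in> borel_measurable borel"
    using assms by (intro borel_measurable_times) (auto simp: bounded_funs_def)
  ultimately show ?thesis by (auto simp: bounded_funs_def)
qed

section \<open>Differentiation of convolutions\<close>

definition convol :: "(real^'n \<Rightarrow> complex) \<Rightarrow> (real^'n \<Rightarrow> complex) \<Rightarrow> real^'n \<Rightarrow> complex" where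
  "convol \<Psi> \<psi> y = (\<integral>x. \<Psi> (y - x) * \<psi> x \<partial>lebesgue)"

lemma convol_integrable:
  assumes "\<Psi> \<in> test_functions" "\<psi> \<in> bounded_funs"
  shows "integrable lebesgue (\<lambda>x. \<Psi> (y - x) * \<psi> x)"
proof -
  obtain M where "\<And>x. cmod (\<Psi> x) \<le> M" using test_function_bounded[OF assms(1)] by blast
  moreover have "(\<lambda>x. \<Psi> (y - x)) \<in> borel_measurable borel"
    using test_borel[OF assms(1)] by measurable
  ultimately show ?thesis using assms by (intro bounded_funs_integrable bounded_funs_mult) auto
qed

text \<open>The first-order expansion is uniform in z because the partial derivatives are uniformly
  continuous: the mean value inequality is applied to \<Psi> minus its linear part at z.\<close>

lemma test_function_taylor:
  fixes \<Psi> :: "real^'n \<Rightarrow> complex"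
  assumes \<Psi>: "\<Psi> \<in> test_functions" and e: "0 < e"
  shows "\<exists>d>0. \<forall>z h. norm h < d \<longrightarrow> cmod (\<Psi> (z + h) - \<Psi> z - (\<Sum>i\<in>UNIV. h$i *\<^sub>R partial i \<Psi> z)) \<le> e * norm h"
proof -
  let ?n = "real CARD('n)"
  have n: "?n > 0" by simp
  have "\<forall>i. \<exists>d>0. \<forall>x y. norm (x - y) < d \<longrightarrow> cmod (partial i \<Psi> x - partial i \<Psi> y) < e / ?n"
    using test_function_uniform[OF test_functions_partials[OF \<Psi>, of "[i]" for i]] e n by auto
  then obtain D where D: "\<And>i. 0 < D i" "\<And>i x y. norm (x - y) < D i \<Longrightarrow> cmod (partial i \<Psi> x - partial i \<Psi> y) < e / ?n" by metis
  define d where "d = Min (range D)"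
  have d: "d > 0" "\<And>i. d \<le> D i" unfolding d_def using D(1) by (auto simp: Min_gr_iff)
  show ?thesis
  proof (intro exI[of _ d] conjI allI impI d(1))
    fix z h :: "real^'n" assume h: "norm h < d"
    define F where "F k = \<Psi> (z + k) - (\<Sum>i\<in>UNIV. k$i *\<^sub>R partial i \<Psi> z)" for k
    define F' where "F' k v = (\<Sum>i\<in>UNIV. v$i *\<^sub>R (partial i \<Psi> (z + k) - partial i \<Psi> z))" for k v
    have "norm (F h - F 0) \<le> e * norm (h - 0)"
    proof (rule differentiable_bound[where S = "ball 0 d" and f' = F'])
      fix k :: "real^'n" assume k: "k \<in> ball 0 d"
      have "(F has_derivative (\<lambda>v. (\<Sum>i\<in>UNIV. v$i *\<^sub>R partial i \<Psi> (z + k)) - (\<Sum>i\<in>UNIV. v$i *\<^sub>R partial i \<Psi> z))) (at k)"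
        unfolding F_def
      proof (intro has_derivative_diff has_derivative_sum)
        show "((\<lambda>k. \<Psi> (z + k)) has_derivative (\<lambda>v. \<Sum>i\<in>UNIV. v$i *\<^sub>R partial i \<Psi> (z + k))) (at k)"
          by (rule has_derivative_compose[OF _ smooth_has_derivative[OF test_function_smooth[OF \<Psi>]], where f = "\<lambda>k. z + k"])
            (auto intro!: derivative_eq_intros)
        show "((\<lambda>k. k$i *\<^sub>R partial i \<Psi> z) has_derivative (\<lambda>v. v$i *\<^sub>R partial i \<Psi> z)) (at k)" for i
          by (intro has_derivative_scaleR_left bounded_linear_imp_has_derivative bounded_linear_vec_nth)
      qed
      moreover have "(\<Sum>i\<in>UNIV. v$i *\<^sub>R partial i \<Psi> (z + k)) - (\<Sum>i\<in>UNIV. v$i *\<^sub>R partial i \<Psi> z) = F' k v" for v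
        by (simp add: F'_def scaleR_diff_right sum_subtractf)
      ultimately have "(F has_derivative F' k) (at k)" by (simp add: fun_eq_iff[symmetric])
      then show "(F has_derivative F' k) (at k within ball 0 d)" by (rule has_derivative_at_withinI)
      show "onorm (F' k) \<le> e"
      proof (rule onorm_bound)
        fix v :: "real^'n"
        have "norm (F' k v) \<le> (\<Sum>i\<in>(UNIV::'n set). norm v * (e / ?n))"
          unfolding F'_def
        proof (rule sum_norm_le)
          fix i
          have "cmod (partial i \<Psi> (z + k) - partial i \<Psi> z) \<le> e / ?n"
            using D(2)[of "z + k" z i] d(2)[of i] k by simp
          then show "norm (v$i *\<^sub>R (partial i \<Psi> (z + k) - partial i \<Psi> z)) \<le> norm v * (e / ?n)"
            using component_le_norm_cart[of v i] by (simp only: norm_scaleR) (intro mult_mono; simp)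
        qed
        also have "\<dots> = e * norm v" using n by simp
        finally show "norm (F' k v) \<le> e * norm v" .
      qed (use e in simp)
    qed (use h d in auto)
    then show "cmod (\<Psi> (z + h) - \<Psi> z - (\<Sum>i\<in>UNIV. h$i *\<^sub>R partial i \<Psi> z)) \<le> e * norm h"
      by (simp add: F_def algebra_simps)
  qed
qed

text \<open>Differentiation under the integral sign. The uniform Taylor estimate is integrated
  against |\<psi>|; the error is divided by I + 1, which is positive even when \<psi>
  vanishes.\<close>

lemma convol_has_derivative:
  fixes \<Psi> :: "real^'n \<Rightarrow> complex"
  assumes \<Psi>: "\<Psi> \<in> test_functions" and \<psi>: "\<psi> \<in> bounded_funs"
  shows "(convol \<Psi> \<psi> has_derivative (\<lambda>h. \<Sum>i\<in>UNIV. h$i *\<^sub>R convol (partial i \<Psi>) \<psi> y)) (at y)"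
  unfolding has_derivative_at_alt
proof (intro conjI allI impI)
  show "bounded_linear (\<lambda>h. \<Sum>i\<in>UNIV. h$i *\<^sub>R convol (partial i \<Psi>) \<psi> y)"
    by (intro bounded_linear_sum bounded_linear_scaleR_const bounded_linear_vec_nth)
  fix e :: real assume e: "0 < e"
  define I where "I = (\<integral>x. cmod (\<psi> x) \<partial>lebesgue)"
  have I0: "0 \<le> I" by (simp add: I_def)
  have P: "partial i \<Psi> \<in> test_functions" for i using test_functions_partials[OF \<Psi>, of "[i]"] by simp
  obtain d where d: "d > 0" "\<And>z h. norm h < d \<Longrightarrow> cmod (\<Psi> (z + h) - \<Psi> z - (\<Sum>i\<in>UNIV. h$i *\<^sub>R partial i \<Psi> z)) \<le> e / (I + 1) * norm h"
    using test_function_taylor[OF \<Psi>, of "e / (I + 1)"] e I0 by (auto simp: divide_pos_pos)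
  show "\<exists>d>0. \<forall>y'. norm (y' - y) < d \<longrightarrow> norm (convol \<Psi> \<psi> y' - convol \<Psi> \<psi> y - (\<Sum>i\<in>UNIV. (y' - y)$i *\<^sub>R convol (partial i \<Psi>) \<psi> y)) \<le> e * norm (y' - y)"
  proof (intro exI[of _ d] conjI allI impI d(1))
    fix y' assume y': "norm (y' - y) < d"
    define h where "h = y' - y"
    have "(\<Sum>i\<in>UNIV. h$i *\<^sub>R convol (partial i \<Psi>) \<psi> y) = (\<integral>x. (\<Sum>i\<in>UNIV. h$i *\<^sub>R (partial i \<Psi> (y - x) * \<psi> x)) \<partial>lebesgue)"
      unfolding convol_def using convol_integrable[OF P \<psi>]
      by (subst Bochner_Integration.integral_sum) auto
    then have "convol \<Psi> \<psi> y' - convol \<Psi> \<psi> y - (\<Sum>i\<in>UNIV. h$i *\<^sub>R convol (partial i \<Psi>) \<psi> y)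
      = (\<integral>x. \<Psi> (y' - x) * \<psi> x - \<Psi> (y - x) * \<psi> x - (\<Sum>i\<in>UNIV. h$i *\<^sub>R (partial i \<Psi> (y - x) * \<psi> x)) \<partial>lebesgue)"
      unfolding convol_def using convol_integrable[OF P \<psi>] convol_integrable[OF \<Psi> \<psi>]
      by (simp add: Bochner_Integration.integral_diff)
    also have "norm \<dots> \<le> (\<integral>x. e / (I + 1) * norm h * cmod (\<psi> x) \<partial>lebesgue)"
    proof (rule integral_cmod_bound)
      show "integrable lebesgue (\<lambda>x. \<Psi> (y' - x) * \<psi> x - \<Psi> (y - x) * \<psi> x - (\<Sum>i\<in>UNIV. h$i *\<^sub>R (partial i \<Psi> (y - x) * \<psi> x)))"
        using convol_integrable[OF P \<psi>] convol_integrable[OF \<Psi> \<psi>] by (intro Bochner_Integration.integrable_diff Bochner_Integration.integrable_sum) auto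
      show "integrable lebesgue (\<lambda>x. e / (I + 1) * norm h * cmod (\<psi> x))"
        using bounded_funs_integrable[OF \<psi>] by auto
      fix x
      have "\<Psi> (y' - x) * \<psi> x - \<Psi> (y - x) * \<psi> x - (\<Sum>i\<in>UNIV. h$i *\<^sub>R (partial i \<Psi> (y - x) * \<psi> x))
        = (\<Psi> ((y - x) + h) - \<Psi> (y - x) - (\<Sum>i\<in>UNIV. h$i *\<^sub>R partial i \<Psi> (y - x))) * \<psi> x"
      proof -
        have a: "(y - x) + h = y' - x" by (simp add: h_def)
        show ?thesis unfolding a left_diff_distrib sum_distrib_right mult_scaleR_left ..
      qed
      then show "norm (\<Psi> (y' - x) * \<psi> x - \<Psi> (y - x) * \<psi> x - (\<Sum>i\<in>UNIV. h$i *\<^sub>R (partial i \<Psi> (y - x) * \<psi> x)))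
        \<le> e / (I + 1) * norm h * cmod (\<psi> x)"
        using d(2)[of h "y - x"] y' by (simp only: norm_mult h_def) (intro mult_right_mono; simp)
    qed
    also have "\<dots> = e / (I + 1) * norm h * I" by (simp add: I_def)
    also have "\<dots> = e * norm h * (I / (I + 1))" by simp
    also have "\<dots> \<le> e * norm h * 1" using I0 e by (intro mult_left_mono) auto
    finally show "norm (convol \<Psi> \<psi> y' - convol \<Psi> \<psi> y - (\<Sum>i\<in>UNIV. (y' - y)$i *\<^sub>R convol (partial i \<Psi>) \<psi> y)) \<le> e * norm (y' - y)"
      by (simp add: h_def)
  qed
qed

lemma partial_convol:
  assumes "\<Psi> \<in> test_functions" "\<psi> \<in> bounded_funs"
  shows "partial i (convol \<Psi> \<psi>) = convol (partial i \<Psi>) \<psi>"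
  by (rule ext, subst partial_eq[OF convol_has_derivative[OF assms]]) (simp add: sum_axis_scaleR)

lemma partials_convol:
  assumes "\<Psi> \<in> test_functions" "\<psi> \<in> bounded_funs"
  shows "partials \<alpha> (convol \<Psi> \<psi>) = convol (partials \<alpha> \<Psi>) \<psi>"
  by (induction \<alpha>) (simp_all add: partial_convol assms test_functions_partials)

lemma convol_support:
  assumes "\<And>x. \<Psi> x \<noteq> 0 \<Longrightarrow> norm x \<le> B" "\<And>x. \<psi> x \<noteq> 0 \<Longrightarrow> norm x \<le> R" "convol \<Psi> \<psi> y \<noteq> 0"
  shows "norm y \<le> B + R"
proof (rule ccontr)
  assume n: "\<not> norm y \<le> B + R"
  have z: "(\<lambda>x. \<Psi> (y - x) * \<psi> x) = (\<lambda>x. 0)"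
  proof (rule ext, rule ccontr)
    fix x
    assume "\<Psi> (y - x) * \<psi> x \<noteq> 0"
    then have "norm (y - x) \<le> B" "norm x \<le> R" using assms(1,2) by auto
    then show False using n norm_triangle_ineq[of "y - x" x] by simp
  qed
  show False using assms(3) unfolding convol_def z by simp
qed

lemma test_functions_convol:
  assumes "\<Psi> \<in> test_functions" "\<psi> \<in> bounded_funs"
  shows "convol \<Psi> \<psi> \<in> test_functions"
proof -
  have "smooth (convol \<Psi> \<psi>)"
  proof (rule smooth_coinduct[where S = "(\<lambda>\<Psi>. convol \<Psi> \<psi>) ` test_functions"])
    show "convol \<Psi> \<psi> \<in> (\<lambda>\<Psi>. convol \<Psi> \<psi>) ` test_functions" using assms by simp
    show "g differentiable at x" if "g \<in> (\<lambda>\<Psi>. convol \<Psi> \<psi>) ` test_functions" for g x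
      using that convol_has_derivative[OF _ assms(2)] by (auto simp: differentiable_def)
    show "partial i g \<in> (\<lambda>\<Psi>. convol \<Psi> \<psi>) ` test_functions" if "g \<in> (\<lambda>\<Psi>. convol \<Psi> \<psi>) ` test_functions" for g i
      using that partial_convol[OF _ assms(2)] test_functions_partials[of _ "[i]"] by auto
  qed
  moreover obtain B R where "\<And>x. \<Psi> x \<noteq> 0 \<Longrightarrow> norm x \<le> B" "\<And>x. \<psi> x \<noteq> 0 \<Longrightarrow> norm x \<le> R"
    using assms by (auto simp: test_functions_iff bounded_funs_def bounded_iff)
  then have "bounded {y. convol \<Psi> \<psi> y \<noteq> 0}"
    using convol_support[of \<Psi> B \<psi> R] by (intro boundedI[of _ "B + R"]) auto
  ultimately show ?thesis by (simp add: test_functions_iff)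
qed

lemma convol_commute:
  fixes \<Psi> :: "real^'n \<Rightarrow> complex"
  assumes "\<Psi> \<in> borel_measurable borel" "\<psi> \<in> borel_measurable borel"
  shows "convol \<Psi> \<psi> = convol \<psi> \<Psi>"
proof
  fix y :: "real^'n"
  have m: "(\<lambda>x. \<Psi> (y - x) * \<psi> x) \<in> borel_measurable borel" using assms by measurable
  have "convol \<psi> \<Psi> y = (\<integral>x. \<Psi> (y - (y + (-1) *\<^sub>R x)) * \<psi> (y + (-1) *\<^sub>R x) \<partial>lebesgue)"
    by (simp add: convol_def mult.commute)
  also have "\<dots> = convol \<Psi> \<psi> y" using integral_affine[OF m, of "-1" y] by (simp add: convol_def)
  finally show "convol \<Psi> \<psi> y = convol \<psi> \<Psi> y" ..
qed

text \<open>Replaces the sum of suprema in the continuity estimate by a single number e that bounds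
  all derivatives up to order m, which is how smallness is established below.\<close>

lemma distribution_bound:
  fixes f :: "(real^'n \<Rightarrow> complex) \<Rightarrow> complex"
  assumes "f \<in> distributions"
  shows "\<exists>C\<ge>0. \<exists>m. \<forall>\<phi>\<in>test_functions. \<forall>e. (\<forall>x. \<phi> x \<noteq> 0 \<longrightarrow> norm x \<le> B) \<longrightarrow>
    (\<forall>\<alpha> x. length \<alpha> \<le> m \<longrightarrow> cmod (partials \<alpha> \<phi> x) \<le> e) \<longrightarrow> cmod (f \<phi>) \<le> C * e"
proof -
  have "\<forall>K. compact K \<longrightarrow> (\<exists>C m. \<forall>\<phi>\<in>test_functions. {x. \<phi> x \<noteq> 0} \<subseteq> K \<longrightarrow>
      cmod (f \<phi>) \<le> C * (\<Sum>\<alpha> | length \<alpha> \<le> m. SUP x. cmod (partials \<alpha> \<phi> x)))"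
    using assms unfolding distributions_def mem_Collect_eq by (elim conjE)
  from this[rule_format, OF compact_cball[of 0 B]] obtain C m where C: "\<And>\<phi>. \<phi> \<in> test_functions \<Longrightarrow> {x. \<phi> x \<noteq> 0} \<subseteq> cball 0 B \<Longrightarrow>
        cmod (f \<phi>) \<le> C * (\<Sum>\<alpha> | length \<alpha> \<le> m. SUP x. cmod (partials \<alpha> \<phi> x))"
    by (elim exE) (rule that, rule mp, erule bspec)
  define k where "k = real (card {\<alpha>::'n list. length \<alpha> \<le> m})"
  show ?thesis
  proof (intro exI[of _ "\<bar>C\<bar> * k"] conjI exI[of _ m] ballI allI impI)
    fix \<phi> :: "real^'n \<Rightarrow> complex" and e
    assume \<phi>: "\<phi> \<in> test_functions" and s: "\<forall>x. \<phi> x \<noteq> 0 \<longrightarrow> norm x \<le> B"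
      and le: "\<forall>\<alpha> x. length \<alpha> \<le> m \<longrightarrow> cmod (partials \<alpha> \<phi> x) \<le> e"
    have S: "(SUP x. cmod (partials \<alpha> \<phi> x)) \<le> e" if "length \<alpha> \<le> m" for \<alpha>
      using le that by (intro cSUP_least) auto
    have S0: "0 \<le> (SUP x. cmod (partials \<alpha> \<phi> x))" if "length \<alpha> \<le> m" for \<alpha>
      by (rule order_trans[OF norm_ge_zero[of "partials \<alpha> \<phi> 0"]], rule cSUP_upper)
        (use le that in \<open>auto intro!: bdd_aboveI2\<close>)
    have "cmod (f \<phi>) \<le> C * (\<Sum>\<alpha> | length \<alpha> \<le> m. SUP x. cmod (partials \<alpha> \<phi> x))"
      by (rule C[OF \<phi>]) (use s in auto)
    also have "\<dots> \<le> \<bar>C\<bar> * (\<Sum>\<alpha> | length \<alpha> \<le> m. SUP x. cmod (partials \<alpha> \<phi> x))"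
      using S0 by (intro mult_right_mono sum_nonneg) auto
    also have "\<dots> \<le> \<bar>C\<bar> * (\<Sum>\<alpha>::'n list | length \<alpha> \<le> m. e)"
      using S by (intro mult_left_mono sum_mono) auto
    also have "\<dots> = \<bar>C\<bar> * k * e" by (simp add: k_def)
    finally show "cmod (f \<phi>) \<le> \<bar>C\<bar> * k * e" .
  qed (simp add: k_def)
qed

lemma distribution_add:
  assumes "f \<in> distributions" "\<phi> \<in> test_functions" "\<psi> \<in> test_functions"
  shows "f (\<lambda>x. \<phi> x + \<psi> x) = f \<phi> + f \<psi>"
proof -
  have "\<forall>\<phi>\<in>test_functions. \<forall>\<psi>\<in>test_functions. f (\<lambda>x. \<phi> x + \<psi> x) = f \<phi> + f \<psi>"
    using assms(1) unfolding distributions_def mem_Collect_eq by (elim conjE)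
  from bspec[OF bspec[OF this assms(2)] assms(3)] show ?thesis .
qed

lemma distribution_cmult:
  assumes "f \<in> distributions" "\<phi> \<in> test_functions"
  shows "f (\<lambda>x. c * \<phi> x) = c * f \<phi>"
proof -
  have "\<forall>c. \<forall>\<phi>\<in>test_functions. f (\<lambda>x. c * \<phi> x) = c * f \<phi>"
    using assms(1) unfolding distributions_def mem_Collect_eq by (elim conjE)
  from bspec[OF spec[OF this, of c] assms(2)] show ?thesis .
qed

lemma uniform_partials:
  fixes \<Psi> :: "real^'n \<Rightarrow> complex"
  assumes "\<Psi> \<in> test_functions" "0 < e"
  shows "\<exists>d>0. \<forall>\<alpha> x y. length \<alpha> \<le> m \<longrightarrow> norm (x - y) < d \<longrightarrow> cmod (partials \<alpha> \<Psi> x - partials \<alpha> \<Psi> y) \<le> e"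
proof -
  have "\<forall>\<alpha>. \<exists>d>0. \<forall>x y. norm (x - y) < d \<longrightarrow> cmod (partials \<alpha> \<Psi> x - partials \<alpha> \<Psi> y) < e"
    using test_function_uniform[OF test_functions_partials[OF assms(1)] assms(2)] by blast
  then obtain D where D: "\<And>\<alpha>. 0 < D \<alpha>" "\<And>\<alpha> x y. norm (x - y) < D \<alpha> \<Longrightarrow> cmod (partials \<alpha> \<Psi> x - partials \<alpha> \<Psi> y) < e" by metis
  define d where "d = Min (D ` {\<alpha>::'n list. length \<alpha> \<le> m})"
  have fin: "finite (D ` {\<alpha>::'n list. length \<alpha> \<le> m})" using finite_multiindices by (rule finite_imageI)
  have ne: "D ` {\<alpha>::'n list. length \<alpha> \<le> m} \<noteq> {}" by (auto intro: exI[of _ "[]"])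
  have "d > 0" unfolding d_def using D(1) fin ne by (auto simp: Min_gr_iff)
  moreover have "d \<le> D \<alpha>" if "length \<alpha> \<le> m" for \<alpha> unfolding d_def using fin that by (intro Min_le) auto
  ultimately show ?thesis using D(2) by (intro exI[of _ d]) (meson less_le_trans less_imp_le)
qed

text \<open>The two sides are compared on functions \<open>\<psi>\<close> supported in small balls first, where both
  are close to \<open>f(\<Psi>(\<cdot> - c)) \<integral>\<psi>\<close>; the general case follows by cutting \<open>\<psi>\<close> into finitely many pieces.\<close>

lemma distribution_convol:
  fixes f :: "(real^'n \<Rightarrow> complex) \<Rightarrow> complex"
  assumes f: "f \<in> distributions" and \<Psi>: "\<Psi> \<in> test_functions"
  defines "u \<equiv> \<lambda>x. f (\<lambda>y. \<Psi> (y - x))"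
  shows "continuous_on UNIV u"
    and "\<psi> \<in> bounded_funs \<Longrightarrow> f (convol \<Psi> \<psi>) = (\<integral>x. u x * \<psi> x \<partial>lebesgue)"
proof -
  have \<Psi>t: "(\<lambda>y. \<Psi> (y - x)) \<in> test_functions" for x
    using test_functions_affine[OF \<Psi>, of 1 "- x"] by simp
  have pt: "partials \<alpha> (\<lambda>y. \<Psi> (y - x)) = (\<lambda>y. partials \<alpha> \<Psi> (y - x))" for \<alpha> x
    using partials_affine[OF test_function_smooth[OF \<Psi>], of \<alpha> "- x" 1] by simp
  obtain B where B: "\<And>x. \<Psi> x \<noteq> 0 \<Longrightarrow> norm x \<le> B" using \<Psi> by (auto simp: test_functions_iff bounded_iff)
  \<comment> \<open>d depends on e and R only, not on the centre c. Hence balls of one fixed radius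
    can be used in the cover of the support.\<close>
  have loc: "\<exists>d>0. \<forall>c \<psi>. norm c \<le> R \<longrightarrow> \<psi> \<in> bounded_funs \<longrightarrow> {x. \<psi> x \<noteq> 0} \<subseteq> ball c d \<longrightarrow>
      cmod (f (convol \<Psi> \<psi>) - u c * (\<integral>x. \<psi> x \<partial>lebesgue)) \<le> e * (\<integral>x. cmod (\<psi> x) \<partial>lebesgue)"
    "\<exists>d>0. \<forall>c x. norm c \<le> R \<longrightarrow> norm (x - c) < d \<longrightarrow> cmod (u x - u c) \<le> e" if e: "e > 0" for e R
  proof -
    obtain C m where C: "C \<ge> 0" "\<And>\<phi> e. \<phi> \<in> test_functions \<Longrightarrow> (\<And>x. \<phi> x \<noteq> 0 \<Longrightarrow> norm x \<le> B + (R + 1)) \<Longrightarrow>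
       (\<And>\<alpha> x. length \<alpha> \<le> m \<Longrightarrow> cmod (partials \<alpha> \<phi> x) \<le> e) \<Longrightarrow> cmod (f \<phi>) \<le> C * e"
      using distribution_bound[OF f, of "B + (R + 1)"] by blast
    have e': "e / (C + 1) > 0" using e C by simp
    have Ce: "C * (e / (C + 1) * I) \<le> e * I" if "I \<ge> 0" for I
    proof -
      have "C * (e / (C + 1) * I) = e * I * (C / (C + 1))" by simp
      also have "\<dots> \<le> e * I * 1" using e that C by (intro mult_left_mono) auto
      finally show ?thesis by simp
    qed
    obtain d where d: "d > 0" "\<And>\<alpha> x y. length \<alpha> \<le> m \<Longrightarrow> norm (x - y) < d \<Longrightarrow> cmod (partials \<alpha> \<Psi> x - partials \<alpha> \<Psi> y) \<le> e / (C + 1)"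
      using uniform_partials[OF \<Psi> e', of m] by blast
    have supp: "norm y \<le> B + (R + 1)" if "\<Psi> (y - x) \<noteq> 0" "norm c \<le> R" "norm (x - c) < min d 1" for x y c
      using B[OF that(1)] that(2,3) norm_triangle_ineq[of "y - x" "(x - c) + c"] norm_triangle_ineq[of "x - c" c] by simp
    show "\<exists>d>0. \<forall>c \<psi>. norm c \<le> R \<longrightarrow> \<psi> \<in> bounded_funs \<longrightarrow> {x. \<psi> x \<noteq> 0} \<subseteq> ball c d \<longrightarrow>
      cmod (f (convol \<Psi> \<psi>) - u c * (\<integral>x. \<psi> x \<partial>lebesgue)) \<le> e * (\<integral>x. cmod (\<psi> x) \<partial>lebesgue)"
    proof (intro exI[of _ "min d 1"] conjI allI impI)
      fix c and \<psi> :: "real^'n \<Rightarrow> complex" assume c: "norm c \<le> R" and \<psi>: "\<psi> \<in> bounded_funs" and s: "{x. \<psi> x \<noteq> 0} \<subseteq> ball c (min d 1)"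
      define J where "J = (\<integral>x. \<psi> x \<partial>lebesgue)"
      define I where "I = (\<integral>x. cmod (\<psi> x) \<partial>lebesgue)"
      \<comment> \<open>The quantity to be estimated is f applied to this one test function. Its
        derivatives are integrals of increments of derivatives of \<Psi> against \<psi>, and the
        increments are small on the support of \<psi>.\<close>
      define \<phi> where "\<phi> y = convol \<Psi> \<psi> y + (- J) * \<Psi> (y - c)" for y
      have \<phi>t: "\<phi> \<in> test_functions"
        unfolding \<phi>_def[abs_def] by (intro test_functions_add test_functions_cmult test_functions_convol \<Psi> \<psi> \<Psi>t)
      have s': "norm (x - c) < min d 1" if "\<psi> x \<noteq> 0" for x using s that by (auto simp: dist_norm norm_minus_commute)
      have "f \<phi> = f (convol \<Psi> \<psi>) + (- J) * u c"
        unfolding \<phi>_def[abs_def] u_def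
        by (subst distribution_add[OF f test_functions_convol[OF \<Psi> \<psi>] test_functions_cmult[OF \<Psi>t]])
          (subst distribution_cmult[OF f \<Psi>t], simp)
      moreover have "cmod (f \<phi>) \<le> C * (e / (C + 1) * I)"
      proof (rule C(2)[OF \<phi>t])
        fix y assume "\<phi> y \<noteq> 0"
        then consider "convol \<Psi> \<psi> y \<noteq> 0" | "\<Psi> (y - c) \<noteq> 0"
          by (cases "\<Psi> (y - c) = 0") (auto simp: \<phi>_def)
        then show "norm y \<le> B + (R + 1)"
        proof cases
          case 1
          show ?thesis
          proof (rule convol_support[OF B _ 1])
            fix x assume "\<psi> x \<noteq> 0"
            then show "norm x \<le> R + 1" using s' c norm_triangle_ineq[of "x - c" c] by fastforce
          qed
        next
          case 2
          then show ?thesis using supp[of y c c] c d by simp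
        qed
      next
        fix \<alpha> :: "'n list" and y assume l: "length \<alpha> \<le> m"
        have P: "partials \<alpha> \<Psi> \<in> test_functions" by (rule test_functions_partials[OF \<Psi>])
        have "partials \<alpha> \<phi> y = convol (partials \<alpha> \<Psi>) \<psi> y + (- J) * partials \<alpha> \<Psi> (y - c)"
          unfolding \<phi>_def[abs_def]
          by (simp only: partials_add_cmult[OF test_function_smooth[OF test_functions_convol[OF \<Psi> \<psi>]] test_function_smooth[OF \<Psi>t]]
              partials_convol[OF \<Psi> \<psi>] pt)
        also have "\<dots> = (\<integral>x. (partials \<alpha> \<Psi> (y - x) - partials \<alpha> \<Psi> (y - c)) * \<psi> x \<partial>lebesgue)"
          unfolding convol_def J_def
          by (rule integral_diff_const_mult[OF convol_integrable[OF P \<psi>] bounded_funs_integrable[OF \<psi>]])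
        also have "cmod \<dots> \<le> (\<integral>x. e / (C + 1) * cmod (\<psi> x) \<partial>lebesgue)"
        proof (rule integral_cmod_bound)
          show "integrable lebesgue (\<lambda>x. (partials \<alpha> \<Psi> (y - x) - partials \<alpha> \<Psi> (y - c)) * \<psi> x)"
            using convol_integrable[OF P \<psi>, of y] bounded_funs_integrable[OF \<psi>] by (simp add: left_diff_distrib)
          show "integrable lebesgue (\<lambda>x. e / (C + 1) * cmod (\<psi> x))" using bounded_funs_integrable[OF \<psi>] by simp
          fix x
          show "cmod ((partials \<alpha> \<Psi> (y - x) - partials \<alpha> \<Psi> (y - c)) * \<psi> x) \<le> e / (C + 1) * cmod (\<psi> x)"
          proof (cases "\<psi> x = 0")
            case False
            have "norm ((y - x) - (y - c)) < d" using s'[OF False] by (simp add: norm_minus_commute)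
            then show ?thesis using d(2)[OF l, of "y - x" "y - c"] by (simp only: norm_mult) (intro mult_right_mono; simp)
          qed simp
        qed
        finally show "cmod (partials \<alpha> \<phi> y) \<le> e / (C + 1) * I" by (simp add: I_def)
      qed
      ultimately show "cmod (f (convol \<Psi> \<psi>) - u c * (\<integral>x. \<psi> x \<partial>lebesgue)) \<le> e * (\<integral>x. cmod (\<psi> x) \<partial>lebesgue)"
        using Ce[of I] by (simp add: I_def J_def mult.commute)
    qed (use d in simp)
    show "\<exists>d>0. \<forall>c x. norm c \<le> R \<longrightarrow> norm (x - c) < d \<longrightarrow> cmod (u x - u c) \<le> e"
    proof (intro exI[of _ "min d 1"] conjI allI impI)
      fix c x :: "real^'n" assume c: "norm c \<le> R" and x: "norm (x - c) < min d 1"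
      define \<phi> where "\<phi> y = \<Psi> (y - x) + (- 1) * \<Psi> (y - c)" for y
      have \<phi>t: "\<phi> \<in> test_functions"
        unfolding \<phi>_def[abs_def] by (intro test_functions_add test_functions_cmult \<Psi>t)
      have "f \<phi> = u x + (- 1) * u c"
        unfolding \<phi>_def[abs_def] u_def
        by (subst distribution_add[OF f \<Psi>t test_functions_cmult[OF \<Psi>t]])
          (subst distribution_cmult[OF f \<Psi>t], simp)
      moreover have "cmod (f \<phi>) \<le> C * (e / (C + 1) * 1)"
      proof (rule C(2)[OF \<phi>t])
        fix y assume "\<phi> y \<noteq> 0"
        then consider "\<Psi> (y - x) \<noteq> 0" | "\<Psi> (y - c) \<noteq> 0"
          by (cases "\<Psi> (y - c) = 0") (auto simp: \<phi>_def)
        then show "norm y \<le> B + (R + 1)"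
          using supp[of y x c] supp[of y c c] c d x by cases auto
      next
        fix \<alpha> :: "'n list" and y assume l: "length \<alpha> \<le> m"
        have "partials \<alpha> \<phi> y = partials \<alpha> \<Psi> (y - x) + (- 1) * partials \<alpha> \<Psi> (y - c)"
          unfolding \<phi>_def[abs_def]
          by (simp only: partials_add_cmult[OF test_function_smooth[OF \<Psi>t] test_function_smooth[OF \<Psi>t]] pt)
        then show "cmod (partials \<alpha> \<phi> y) \<le> e / (C + 1) * 1"
          using d(2)[OF l, of "y - x" "y - c"] x by (simp add: norm_minus_commute)
      qed
      ultimately show "cmod (u x - u c) \<le> e" using Ce[of 1] by simp
    qed (use d in simp)
  qed
  show cont: "continuous_on UNIV u"
    unfolding continuous_on_iff
  proof (intro ballI allI impI)
    fix c :: "real^'n" and e :: real assume "0 < e"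
    then obtain d where "d > 0" "\<And>x. norm (x - c) < d \<Longrightarrow> cmod (u x - u c) \<le> e / 2"
      using loc(2)[of "e / 2" "norm c"] by auto
    then show "\<exists>d>0. \<forall>x'\<in>UNIV. dist x' c < d \<longrightarrow> dist (u x') (u c) < e"
      using \<open>0 < e\<close> by (intro exI[of _ d]) (force simp: dist_norm)
  qed
  assume \<psi>: "\<psi> \<in> bounded_funs"
  have ub: "u \<in> borel_measurable borel" by (rule borel_measurable_continuous_onI[OF cont])
  have u\<psi>: "(\<lambda>x. u x * \<psi> x) \<in> bounded_funs" if "\<psi> \<in> bounded_funs" for \<psi>
  proof -
    have "compact (u ` closure {x. \<psi> x \<noteq> 0})"
      using that by (intro compact_continuous_image continuous_on_subset[OF cont]) (auto simp: bounded_funs_def compact_closure)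
    then obtain M where M: "\<And>x. x \<in> closure {x. \<psi> x \<noteq> 0} \<Longrightarrow> cmod (u x) \<le> M"
      by (metis compact_imp_bounded bounded_iff imageI)
    show ?thesis by (rule bounded_funs_mult[OF that ub, of M]) (use M in_support in blast)
  qed
  have cut: "(\<lambda>x. indicator S x * \<psi> x) \<in> bounded_funs" if "\<psi> \<in> bounded_funs" "S \<in> sets borel" for \<psi> S
    by (rule bounded_funs_mult[OF that(1), of _ 1]) (use that(2) in \<open>auto simp: indicator_def\<close>)
  obtain R where R: "\<And>x. \<psi> x \<noteq> 0 \<Longrightarrow> norm x \<le> R" using \<psi> by (auto simp: bounded_funs_def bounded_iff)
  define I where "I = (\<integral>x. cmod (\<psi> x) \<partial>lebesgue)"
  have I0: "I \<ge> 0" by (simp add: I_def)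
  have bound: "cmod (f (convol \<Psi> \<psi>) - (\<integral>x. u x * \<psi> x \<partial>lebesgue)) \<le> e" if e: "e > 0" for e
  proof -
    define e' where "e' = e / 2 / (I + 1)"
    have e': "e' > 0" using e I0 by (simp add: e'_def)
    obtain d1 where d1: "d1 > 0" "\<And>c \<psi>. norm c \<le> R \<Longrightarrow> \<psi> \<in> bounded_funs \<Longrightarrow> {x. \<psi> x \<noteq> 0} \<subseteq> ball c d1 \<Longrightarrow>
      cmod (f (convol \<Psi> \<psi>) - u c * (\<integral>x. \<psi> x \<partial>lebesgue)) \<le> e' * (\<integral>x. cmod (\<psi> x) \<partial>lebesgue)"
      using loc(1)[OF e', of R] by blast
    obtain d2 where d2: "d2 > 0" "\<And>c x. norm c \<le> R \<Longrightarrow> norm (x - c) < d2 \<Longrightarrow> cmod (u x - u c) \<le> e'"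
      using loc(2)[OF e', of R] by blast
    define d where "d = min d1 d2"
    have d: "d > 0" using d1 d2 by (simp add: d_def)
    have small: "cmod (f (convol \<Psi> \<eta>) - (\<integral>x. u x * \<eta> x \<partial>lebesgue)) \<le> 2 * e' * (\<integral>x. cmod (\<eta> x) \<partial>lebesgue)"
      if c: "norm c \<le> R" and \<eta>: "\<eta> \<in> bounded_funs" and s: "{x. \<eta> x \<noteq> 0} \<subseteq> ball c d" for c \<eta>
    proof -
      have 1: "cmod (f (convol \<Psi> \<eta>) - u c * (\<integral>x. \<eta> x \<partial>lebesgue)) \<le> e' * (\<integral>x. cmod (\<eta> x) \<partial>lebesgue)"
        by (rule d1(2)[OF c \<eta>]) (use s in \<open>auto simp: d_def\<close>)
      have "u c * (\<integral>x. \<eta> x \<partial>lebesgue) - (\<integral>x. u x * \<eta> x \<partial>lebesgue) = (\<integral>x. u c * \<eta> x - u x * \<eta> x \<partial>lebesgue)"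
        using bounded_funs_integrable[OF \<eta>] bounded_funs_integrable[OF u\<psi>[OF \<eta>]] by simp
      also have "cmod \<dots> \<le> (\<integral>x. e' * cmod (\<eta> x) \<partial>lebesgue)"
      proof (rule integral_cmod_bound)
        show "integrable lebesgue (\<lambda>x. u c * \<eta> x - u x * \<eta> x)"
          using bounded_funs_integrable[OF \<eta>] bounded_funs_integrable[OF u\<psi>[OF \<eta>]] by auto
        show "integrable lebesgue (\<lambda>x. e' * cmod (\<eta> x))" using bounded_funs_integrable[OF \<eta>] by auto
        fix x
        show "cmod (u c * \<eta> x - u x * \<eta> x) \<le> e' * cmod (\<eta> x)"
        proof (cases "\<eta> x = 0")
          case False
          then have "norm (x - c) < d2" using s by (auto simp: d_def dist_norm norm_minus_commute)
          then have "cmod (u c - u x) \<le> e'" by (subst norm_minus_commute) (rule d2(2)[OF c])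
          then show ?thesis by (simp only: left_diff_distrib[symmetric] norm_mult) (intro mult_right_mono; simp)
        qed simp
      qed
      finally have 2: "cmod (u c * (\<integral>x. \<eta> x \<partial>lebesgue) - (\<integral>x. u x * \<eta> x \<partial>lebesgue)) \<le> e' * (\<integral>x. cmod (\<eta> x) \<partial>lebesgue)"
        by simp
      show ?thesis using norm_triangle_mono[OF 1 2] by simp
    qed
    \<comment> \<open>Induction over the centres of the cover: \<eta> is cut along the boundary of
      one ball. The pieces have disjoint supports, so the integrals of their absolute values add up
      and the error does not grow with the number of balls.\<close>
    have fin: "cmod (f (convol \<Psi> \<eta>) - (\<integral>x. u x * \<eta> x \<partial>lebesgue)) \<le> 2 * e' * (\<integral>x. cmod (\<eta> x) \<partial>lebesgue)"
      if "finite F" "F \<subseteq> cball 0 R" "\<eta> \<in> bounded_funs" "{x. \<eta> x \<noteq> 0} \<subseteq> (\<Union>c\<in>F. ball c d)" for F \<eta>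
      using that
    proof (induction F arbitrary: \<eta> rule: finite_induct)
      case empty
      then have z: "\<eta> x = 0" for x by auto
      have "convol \<Psi> \<eta> = (\<lambda>y. 0 * \<Psi> y)" by (rule ext) (simp add: convol_def z)
      then have "f (convol \<Psi> \<eta>) = 0" using distribution_cmult[OF f \<Psi>, of 0] by simp
      moreover have "(\<integral>x. u x * \<eta> x \<partial>lebesgue) = 0" "(\<integral>x. cmod (\<eta> x) \<partial>lebesgue) = 0" by (simp_all add: z)
      ultimately show ?case by (simp only:) simp
    next
      case (insert c F)
      define \<eta>1 \<eta>2 where "\<eta>1 x = indicator (ball c d) x * \<eta> x" and "\<eta>2 x = indicator (- ball c d) x * \<eta> x" for x
      have b: "\<eta>1 \<in> bounded_funs" "\<eta>2 \<in> bounded_funs"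
        unfolding \<eta>1_def[abs_def] \<eta>2_def[abs_def] using insert.prems(2) by (auto intro!: cut)
      have sum: "\<eta> x = \<eta>1 x + \<eta>2 x" for x by (simp add: \<eta>1_def \<eta>2_def indicator_def)
      have nsum: "cmod (\<eta> x) = cmod (\<eta>1 x) + cmod (\<eta>2 x)" for x by (simp add: \<eta>1_def \<eta>2_def indicator_def)
      note ints = bounded_funs_integrable[OF b(1)] bounded_funs_integrable[OF b(2)]
        bounded_funs_integrable[OF u\<psi>[OF b(1)]] bounded_funs_integrable[OF u\<psi>[OF b(2)]]
      have 1: "cmod (f (convol \<Psi> \<eta>1) - (\<integral>x. u x * \<eta>1 x \<partial>lebesgue)) \<le> 2 * e' * (\<integral>x. cmod (\<eta>1 x) \<partial>lebesgue)"
        by (rule small[of c, OF _ b(1)]) (use insert.prems in \<open>auto simp: \<eta>1_def indicator_def split: if_splits\<close>)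
      have 2: "cmod (f (convol \<Psi> \<eta>2) - (\<integral>x. u x * \<eta>2 x \<partial>lebesgue)) \<le> 2 * e' * (\<integral>x. cmod (\<eta>2 x) \<partial>lebesgue)"
        by (rule insert.IH[OF _ b(2)]) (use insert.prems in \<open>auto simp: \<eta>2_def indicator_def split: if_splits\<close>)
      have "convol \<Psi> \<eta> = (\<lambda>y. convol \<Psi> \<eta>1 y + convol \<Psi> \<eta>2 y)"
        using convol_integrable[OF \<Psi> b(1)] convol_integrable[OF \<Psi> b(2)]
        by (intro ext) (simp add: convol_def sum distrib_left)
      then have e1: "f (convol \<Psi> \<eta>) = f (convol \<Psi> \<eta>1) + f (convol \<Psi> \<eta>2)"
        using distribution_add[OF f test_functions_convol[OF \<Psi> b(1)] test_functions_convol[OF \<Psi> b(2)]] by simp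
      have e2: "(\<integral>x. u x * \<eta> x \<partial>lebesgue) = (\<integral>x. u x * \<eta>1 x \<partial>lebesgue) + (\<integral>x. u x * \<eta>2 x \<partial>lebesgue)"
        using ints by (simp add: sum distrib_left)
      have e3: "(\<integral>x. cmod (\<eta> x) \<partial>lebesgue) = (\<integral>x. cmod (\<eta>1 x) \<partial>lebesgue) + (\<integral>x. cmod (\<eta>2 x) \<partial>lebesgue)"
        using ints by (simp add: nsum)
      show ?case unfolding e1 e2 e3 using norm_triangle_mono[OF 1 2] by (simp add: algebra_simps)
    qed
    have "cball 0 R \<subseteq> (\<Union>c\<in>cball (0::real^'n) R. ball c d)" using d by auto
    then obtain F where F: "F \<subseteq> cball (0::real^'n) R" "finite F" "cball 0 R \<subseteq> (\<Union>c\<in>F. ball c d)"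
      by (rule compactE_image[OF compact_cball open_ball])
    have "cmod (f (convol \<Psi> \<psi>) - (\<integral>x. u x * \<psi> x \<partial>lebesgue)) \<le> 2 * e' * I"
      unfolding I_def by (rule fin[OF F(2,1) \<psi>]) (use F(3) R in \<open>auto simp: subset_iff\<close>)
    also have "\<dots> = e * (I / (I + 1))" unfolding e'_def using I0 by (simp add: divide_simps)
    also have "\<dots> \<le> e * 1" using I0 e by (intro mult_left_mono) auto
    finally show ?thesis by simp
  qed
  have "cmod (f (convol \<Psi> \<psi>) - (\<integral>x. u x * \<psi> x \<partial>lebesgue)) \<le> 0"
  proof (rule field_le_epsilon)
    fix e :: real assume "0 < e"
    from bound[OF this] show "cmod (f (convol \<Psi> \<psi>) - (\<integral>x. u x * \<psi> x \<partial>lebesgue)) \<le> 0 + e"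
      by (simp only: add_0_left)
  qed
  then show "f (convol \<Psi> \<psi>) = (\<integral>x. u x * \<psi> x \<partial>lebesgue)"
    by (simp only: norm_le_zero_iff right_minus_eq)
qed

lemma dilate_test: "\<phi> \<in> test_functions \<Longrightarrow> 0 < t \<Longrightarrow> dilate t \<phi> \<in> test_functions"
  using test_functions_cmult[OF test_functions_affine[of \<phi> "1 / t" 0], of "of_real (1 / t ^ CARD('n))"]
  by (simp add: dilate_def[abs_def] scaleR_conv_of_real)

text \<open>For small scales the mollified functions minus J \<psi> have small derivatives up to
  order m and supports in a common ball, so \<open>distribution_bound\<close> applies. The scales 1
  / (k + 2) stay below 1, as in the definition of the grand maximal function.\<close>

lemma convol_approx:
  fixes f :: "(real^'n \<Rightarrow> complex) \<Rightarrow> complex"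
  assumes f: "f \<in> distributions" and \<Psi>: "\<Psi> \<in> test_functions" and \<psi>: "\<psi> \<in> test_functions"
  shows "(\<lambda>k. f (convol (dilate (1 / real (k + 2)) \<Psi>) \<psi>)) \<longlonglongrightarrow> (\<integral>x. \<Psi> x \<partial>lebesgue) * f \<psi>"
proof -
  define J where "J = (\<integral>x. \<Psi> x \<partial>lebesgue)"
  define I where "I = (\<integral>x. cmod (\<Psi> x) \<partial>lebesgue)"
  have I0: "I \<ge> 0" by (simp add: I_def)
  obtain B where B: "\<And>x. \<Psi> x \<noteq> 0 \<Longrightarrow> norm x \<le> B" "B > 0"
  proof -
    obtain B where "\<And>x. \<Psi> x \<noteq> 0 \<Longrightarrow> norm x \<le> B" using \<Psi> by (auto simp: test_functions_iff bounded_iff)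
    then show thesis by (intro that[of "max 1 B"]) (auto simp: le_max_iff_disj)
  qed
  obtain R where R: "\<And>x. \<psi> x \<noteq> 0 \<Longrightarrow> norm x \<le> R" using \<psi> by (auto simp: test_functions_iff bounded_iff)
  obtain C m where C: "C \<ge> 0" "\<And>\<phi> e. \<phi> \<in> test_functions \<Longrightarrow> (\<And>x. \<phi> x \<noteq> 0 \<Longrightarrow> norm x \<le> B + R) \<Longrightarrow>
     (\<And>\<alpha> x. length \<alpha> \<le> m \<Longrightarrow> cmod (partials \<alpha> \<phi> x) \<le> e) \<Longrightarrow> cmod (f \<phi>) \<le> C * e"
    using distribution_bound[OF f, of "B + R"] by blast
  have main: "cmod (f (convol (dilate t \<Psi>) \<psi>) - J * f \<psi>) \<le> C * (e * I)"
    if t: "0 < t" "t < 1" "t * B < d" and d: "\<And>\<alpha> x y. length \<alpha> \<le> m \<Longrightarrow> norm (x - y) < d \<Longrightarrow> cmod (partials \<alpha> \<psi> x - partials \<alpha> \<psi> y) \<le> e"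
    for t d e
  proof -
    define \<Theta> where "\<Theta> = dilate t \<Psi>"
    have \<Theta>: "\<Theta> \<in> test_functions" unfolding \<Theta>_def using \<Psi> t by (intro dilate_test)
    have \<Theta>s: "norm x \<le> t * B" if "\<Theta> x \<noteq> 0" for x
    proof -
      have "norm ((1 / t) *\<^sub>R x) \<le> B" using that t by (intro B(1)) (auto simp: \<Theta>_def dilate_def)
      then show ?thesis using t by (simp add: field_simps)
    qed
    have \<Theta>J: "(\<integral>x. \<Theta> x \<partial>lebesgue) = J"
      using integral_affine[OF test_borel[OF \<Psi>], of "1 / t" 0] t
      by (simp add: \<Theta>_def dilate_def[abs_def] J_def power_divide scaleR_conv_of_real)
    have \<Theta>I: "(\<integral>x. cmod (\<Theta> x) \<partial>lebesgue) = I"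
    proof -
      have "(\<lambda>x. cmod (\<Psi> x)) \<in> borel_measurable borel" using test_borel[OF \<Psi>] by measurable
      from integral_affine[OF this, of "1 / t" 0] show ?thesis using t
        by (simp add: \<Theta>_def dilate_def[abs_def] I_def power_divide)
    qed
    define \<phi> where "\<phi> y = convol \<Theta> \<psi> y + (- J) * \<psi> y" for y
    have \<phi>t: "\<phi> \<in> test_functions"
      unfolding \<phi>_def[abs_def] by (intro test_functions_add test_functions_cmult test_functions_convol \<Theta> test_bounded_funs \<psi>)
    have "f \<phi> = f (convol \<Theta> \<psi>) + (- J) * f \<psi>"
      unfolding \<phi>_def[abs_def]
      by (subst distribution_add[OF f test_functions_convol[OF \<Theta> test_bounded_funs[OF \<psi>]] test_functions_cmult[OF \<psi>]])
        (subst distribution_cmult[OF f \<psi>], simp)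
    moreover have "cmod (f \<phi>) \<le> C * (e * I)"
    proof (rule C(2)[OF \<phi>t])
      fix y assume "\<phi> y \<noteq> 0"
      then consider "convol \<Theta> \<psi> y \<noteq> 0" | "\<psi> y \<noteq> 0" by (cases "\<psi> y = 0") (auto simp: \<phi>_def)
      then show "norm y \<le> B + R"
      proof cases
        case 1
        have "norm x \<le> B" if "\<Theta> x \<noteq> 0" for x
        proof -
          have "t * B \<le> 1 * B" using t B by (intro mult_right_mono) auto
          then show ?thesis using \<Theta>s[OF that] by linarith
        qed
        from convol_support[OF this R 1] show ?thesis .
      next
        case 2 then show ?thesis using R[of y] B by simp
      qed
    next
      fix \<alpha> :: "'n list" and y assume l: "length \<alpha> \<le> m"
      have P: "partials \<alpha> \<psi> \<in> test_functions" by (rule test_functions_partials[OF \<psi>])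
      \<comment> \<open>By commutativity the derivatives fall on \<psi>; those of the dilated kernel
        would grow as the scale decreases.\<close>
      have "partials \<alpha> (convol \<Theta> \<psi>) = convol (partials \<alpha> \<psi>) \<Theta>"
        using convol_commute[OF test_borel[OF \<Theta>] test_borel[OF \<psi>]] partials_convol[OF \<psi> test_bounded_funs[OF \<Theta>]] by simp
      then have "partials \<alpha> \<phi> y = convol (partials \<alpha> \<psi>) \<Theta> y + (- J) * partials \<alpha> \<psi> y"
        unfolding \<phi>_def[abs_def]
        by (simp only: partials_add_cmult[OF test_function_smooth[OF test_functions_convol[OF \<Theta> test_bounded_funs[OF \<psi>]]] test_function_smooth[OF \<psi>]])
      also have "\<dots> = (\<integral>x. (partials \<alpha> \<psi> (y - x) - partials \<alpha> \<psi> y) * \<Theta> x \<partial>lebesgue)"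
        unfolding convol_def \<Theta>J[symmetric]
        by (rule integral_diff_const_mult[OF convol_integrable[OF P test_bounded_funs[OF \<Theta>]] bounded_funs_integrable[OF test_bounded_funs[OF \<Theta>]]])
      also have "cmod \<dots> \<le> (\<integral>x. e * cmod (\<Theta> x) \<partial>lebesgue)"
      proof (rule integral_cmod_bound)
        show "integrable lebesgue (\<lambda>x. (partials \<alpha> \<psi> (y - x) - partials \<alpha> \<psi> y) * \<Theta> x)"
          using convol_integrable[OF P test_bounded_funs[OF \<Theta>], of y] bounded_funs_integrable[OF test_bounded_funs[OF \<Theta>]]
          by (simp add: left_diff_distrib)
        show "integrable lebesgue (\<lambda>x. e * cmod (\<Theta> x))" using bounded_funs_integrable[OF test_bounded_funs[OF \<Theta>]] by auto
        fix x
        show "cmod ((partials \<alpha> \<psi> (y - x) - partials \<alpha> \<psi> y) * \<Theta> x) \<le> e * cmod (\<Theta> x)"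
        proof (cases "\<Theta> x = 0")
          case False
          then have "norm ((y - x) - y) < d" using \<Theta>s[of x] t by simp
          then show ?thesis using d[OF l, of "y - x" y] by (simp only: norm_mult) (intro mult_right_mono; simp)
        qed simp
      qed
      finally show "cmod (partials \<alpha> \<phi> y) \<le> e * I" by (simp add: \<Theta>I)
    qed
    ultimately show ?thesis by (simp add: \<Theta>_def)
  qed
  show ?thesis
    unfolding J_def[symmetric]
  proof (rule LIMSEQ_I)
    fix r :: real assume r: "0 < r"
    define e where "e = r / 2 / (C * I + 1)"
    have CI: "0 \<le> C * I" using C I0 by simp
    have e: "e > 0" using r CI by (simp add: e_def)
    obtain d where d: "d > 0" "\<And>\<alpha> x y. length \<alpha> \<le> m \<Longrightarrow> norm (x - y) < d \<Longrightarrow> cmod (partials \<alpha> \<psi> x - partials \<alpha> \<psi> y) \<le> e"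
      using uniform_partials[OF \<psi> e, of m] by blast
    obtain k0 :: nat where k0: "B / d < real k0" using reals_Archimedean2 by blast
    show "\<exists>no. \<forall>k\<ge>no. norm (f (convol (dilate (1 / real (k + 2)) \<Psi>) \<psi>) - J * f \<psi>) < r"
    proof (intro exI[of _ k0] allI impI)
      fix k assume k: "k0 \<le> k"
      have "B / d < real (k + 2)" using k0 k by simp
      then have "1 / real (k + 2) * B < d" using d by (simp add: field_simps)
      then have "norm (f (convol (dilate (1 / real (k + 2)) \<Psi>) \<psi>) - J * f \<psi>) \<le> C * (e * I)"
        by (intro main[of _ d e] d(2)) auto
      also have "\<dots> = r / 2 * (C * I / (C * I + 1))" unfolding e_def using CI by (simp add: divide_simps)
      also have "\<dots> \<le> r / 2 * 1" using r CI by (intro mult_left_mono) auto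
      also have "\<dots> < r" using r by simp
      finally show "norm (f (convol (dilate (1 / real (k + 2)) \<Psi>) \<psi>) - J * f \<psi>) < r" .
    qed
  qed
qed

lemma distr_conv_weak:
  fixes f :: "(real^'n \<Rightarrow> complex) \<Rightarrow> complex"
  assumes f: "f \<in> distributions" and \<phi>: "\<phi> \<in> test_functions"
  shows "0 < t \<Longrightarrow> continuous_on UNIV (distr_conv (dilate t \<phi>) f)"
    and "\<psi> \<in> test_functions \<Longrightarrow>
      (\<lambda>k. \<integral>x. distr_conv (dilate (1 / real (k + 2)) \<phi>) f x * \<psi> x \<partial>lebesgue) \<longlonglongrightarrow> (\<integral>x. \<phi> x \<partial>lebesgue) * f \<psi>"
proof -
  \<comment> \<open>\<open>distr_conv\<close> evaluates f at \<phi>(z - y), whereas the convolution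
    lemmas use \<Psi>(y - x); reflection reconciles the two and preserves the integral.\<close>
  define \<Psi> where "\<Psi> z = \<phi> (- z)" for z
  have \<Psi>: "\<Psi> \<in> test_functions" using test_functions_affine[OF \<phi>, of "-1" 0] by (simp add: \<Psi>_def[abs_def])
  have eq: "distr_conv (dilate t \<phi>) f = (\<lambda>x. f (\<lambda>y. dilate t \<Psi> (y - x)))" for t
    by (rule ext) (simp add: distr_conv_def dilate_def \<Psi>_def minus_diff_eq flip: scaleR_minus_right)
  show "continuous_on UNIV (distr_conv (dilate t \<phi>) f)" if "0 < t"
    unfolding eq by (rule distribution_convol(1)[OF f dilate_test[OF \<Psi> that]])
  assume \<psi>: "\<psi> \<in> test_functions"
  have "(\<integral>x. \<Psi> x \<partial>lebesgue) = (\<integral>x. \<phi> x \<partial>lebesgue)"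
    using integral_affine[OF test_borel[OF \<phi>], of "-1" 0] by (simp add: \<Psi>_def)
  moreover have "(\<integral>x. distr_conv (dilate t \<phi>) f x * \<psi> x \<partial>lebesgue) = f (convol (dilate t \<Psi>) \<psi>)" if "0 < t" for t
    unfolding eq by (rule distribution_convol(2)[OF f dilate_test[OF \<Psi> that] test_bounded_funs[OF \<psi>], symmetric])
  ultimately show "(\<lambda>k. \<integral>x. distr_conv (dilate (1 / real (k + 2)) \<phi>) f x * \<psi> x \<partial>lebesgue) \<longlonglongrightarrow> (\<integral>x. \<phi> x \<partial>lebesgue) * f \<psi>"
    using convol_approx[OF f \<Psi> \<psi>] by simp
qed

section \<open>Weak limits and uniqueness\<close>

lemma sigma_finite_lebesgue: "sigma_finite_measure (lebesgue :: (real^'n) measure)"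
proof (unfold sigma_finite_measure_def, intro exI[of _ "range (\<lambda>n. cball 0 (real n))"] conjI)
  show "\<Union> (range (\<lambda>n. cball 0 (real n))) = space (lebesgue :: (real^'n) measure)"
    using real_arch_simple by auto
  show "range (\<lambda>n. cball (0::real^'n) (real n)) \<subseteq> sets lebesgue"
    by (auto intro: fmeasurableD lmeasurable_cball)
  show "\<forall>a\<in>range (\<lambda>n. cball (0::real^'n) (real n)). emeasure lebesgue a \<noteq> \<infinity>"
    using fmeasurableD2[OF lmeasurable_cball[of "0::real^'n"]] by auto
qed simp

lemma set_integral_Int_AE:
  fixes f :: "'a \<Rightarrow> complex"
  shows "set_integrable M B f \<Longrightarrow> A \<in> sets M \<Longrightarrow> set_integrable M (A \<inter> B) f"
  unfolding set_integrable_def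
  using integrable_mult_indicator[of A M "\<lambda>x. indicator B x *\<^sub>R f x"]
  by (simp add: indicator_inter_arith)

text \<open>Bumps converge to indicators of boxes, so all integrals over boxes vanish. Boxes are
  stable under intersection and generate the Borel sets, so Dynkin's argument extends this to all
  Borel subsets of a fixed large box.\<close>

lemma du_bois_reymond:
  fixes f :: "real^'n \<Rightarrow> complex"
  assumes int: "\<And>a b. set_integrable lebesgue (box a b) f"
    and zero: "\<And>\<psi>. \<psi> \<in> test_functions \<Longrightarrow> (\<integral>x. f x * \<psi> x \<partial>lebesgue) = 0"
  shows "AE x in lebesgue. f x = 0"
proof -
  have box0: "(LINT x:box a b|lebesgue. f x) = 0" for a b
  proof -
    have i: "integrable lebesgue (\<lambda>x. indicator (box a b) x *\<^sub>R f x)" using int[of a b] by (simp add: set_integrable_def)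
    have eq: "f x * complex_of_real (box_bump a b (real (Suc m)) x) = (indicator (box a b) x *\<^sub>R f x) * complex_of_real (box_bump a b (real (Suc m)) x)" for m x
      using box_bump_pos_iff[of "real (Suc m)" a b x] by (cases "x \<in> box a b") auto
    have bm: "(\<lambda>x. complex_of_real (box_bump a b (real (Suc m)) x)) \<in> borel_measurable lebesgue" for m
      using test_borel[OF box_bump_test[of "real (Suc m)" a b]] by (intro measurable_completion) simp
    have "(\<lambda>m. \<integral>x. f x * complex_of_real (box_bump a b (real (Suc m)) x) \<partial>lebesgue) \<longlonglongrightarrow> (\<integral>x. indicator (box a b) x *\<^sub>R f x \<partial>lebesgue)"
    proof (rule integral_dominated_convergence[where w = "\<lambda>x. norm (indicator (box a b) x *\<^sub>R f x)"])
      show "(\<lambda>x. indicator (box a b) x *\<^sub>R f x) \<in> borel_measurable lebesgue" using i by (rule borel_measurable_integrable)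
      then show "(\<lambda>x. f x * complex_of_real (box_bump a b (real (Suc m)) x)) \<in> borel_measurable lebesgue" for m
        unfolding eq using bm by (rule borel_measurable_times)
      show "integrable lebesgue (\<lambda>x. norm (indicator (box a b) x *\<^sub>R f x))" using i by (rule integrable_norm)
      show "AE x in lebesgue. (\<lambda>m. f x * complex_of_real (box_bump a b (real (Suc m)) x)) \<longlonglongrightarrow> indicator (box a b) x *\<^sub>R f x"
      proof (rule AE_I2)
        fix x
        have "(\<lambda>m. f x * complex_of_real (box_bump a b (real (Suc m)) x)) \<longlonglongrightarrow> f x * complex_of_real (indicator (box a b) x)"
          by (intro tendsto_mult tendsto_const tendsto_of_real box_bump_tendsto)
        then show "(\<lambda>m. f x * complex_of_real (box_bump a b (real (Suc m)) x)) \<longlonglongrightarrow> indicator (box a b) x *\<^sub>R f x"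
          by (simp add: scaleR_conv_of_real mult.commute)
      qed
      show "AE x in lebesgue. norm (f x * complex_of_real (box_bump a b (real (Suc m)) x)) \<le> norm (indicator (box a b) x *\<^sub>R f x)" for m
      proof (rule AE_I2)
        fix x
        show "norm (f x * complex_of_real (box_bump a b (real (Suc m)) x)) \<le> norm (indicator (box a b) x *\<^sub>R f x)"
          unfolding eq norm_mult[of _ "complex_of_real _"] norm_of_real
          using box_bump_bounds[of a b "real (Suc m)" x] by (intro mult_right_le_one_le) auto
      qed
    qed
    moreover have "(\<integral>x. f x * complex_of_real (box_bump a b (real (Suc m)) x) \<partial>lebesgue) = 0" for m
      by (rule zero[OF box_bump_test]) simp
    ultimately show ?thesis unfolding set_lebesgue_integral_def by (simp add: LIMSEQ_const_iff)
  qed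
  have ball0: "AE x in lebesgue. indicator (box (\<chi> i. - real n) (\<chi> i. real n)) x *\<^sub>R f x = 0" for n
  proof -
    define B where "B = box (\<chi> i. - real n) (\<chi> i. real n :: real^'n)"
    have iB: "set_integrable lebesgue B f" unfolding B_def by (rule int)
    have borel_sets: "(LINT x:A \<inter> B|lebesgue. f x) = 0" if "A \<in> sets borel" for A
    proof -
      have "Int_stable (range (\<lambda>(a, b). box a b :: (real^'n) set))" by (auto simp: Int_stable_def box_Int_box)
      moreover have "range (\<lambda>(a, b). box a b :: (real^'n) set) \<subseteq> Pow UNIV" by auto
      moreover have "A \<in> sigma_sets UNIV (range (\<lambda>(a, b). box a b))" using that unfolding borel_eq_box by simp
      ultimately show ?thesis
      proof (induction rule: sigma_sets_induct_disjoint)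
        case (basic A)
        then show ?case by (auto simp: B_def box_Int_box box0)
      next
        case empty
        then show ?case by (simp add: set_lebesgue_integral_def)
      next
        case (compl A)
        then have A: "A \<in> sets borel" by (simp add: borel_eq_box)
        then have Al: "A \<in> sets lebesgue" by (simp add: lborelD)
        have iA: "integrable lebesgue (\<lambda>x. indicator (A \<inter> B) x *\<^sub>R f x)"
          using set_integral_Int_AE[OF iB Al] by (simp add: set_integrable_def)
        have "(LINT x:(UNIV - A) \<inter> B|lebesgue. f x) = (\<integral>x. indicator B x *\<^sub>R f x - indicator (A \<inter> B) x *\<^sub>R f x \<partial>lebesgue)"
          unfolding set_lebesgue_integral_def by (rule Bochner_Integration.integral_cong) (auto simp: indicator_def)
        also have "\<dots> = (LINT x:B|lebesgue. f x) - (LINT x:A \<inter> B|lebesgue. f x)"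
          unfolding set_lebesgue_integral_def
          by (rule Bochner_Integration.integral_diff) (use iB iA in \<open>auto simp: set_integrable_def\<close>)
        finally show ?case using compl box0 by (simp add: B_def)
      next
        case (union F)
        then have F: "F i \<in> sets lebesgue" for i using lborelD[of "F i"] by (auto simp: borel_eq_box subset_eq)
        have BL: "B \<in> sets lebesgue" by (simp add: B_def)
        have "(LINT x:(\<Union>i. F i \<inter> B)|lebesgue. f x) = (\<Sum>i. (LINT x:F i \<inter> B|lebesgue. f x))"
        proof (rule lebesgue_integral_countable_add)
          show "F i \<inter> B \<in> sets lebesgue" for i using F BL by auto
          show "F i \<inter> B \<inter> (F j \<inter> B) = {}" if "i \<noteq> j" for i j
            using union(1) that by (auto simp: disjoint_family_on_def)
          have "set_integrable lebesgue ((\<Union>i. F i) \<inter> B) f"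
            by (rule set_integral_Int_AE[OF iB]) (use F in auto)
          then show "set_integrable lebesgue (\<Union>i. F i \<inter> B) f" by simp
        qed
        then show ?case using union by simp
      qed
    qed
    have "AE x in lebesgue. indicator B x *\<^sub>R f x = 0"
    proof (rule sigma_finite_measure.density_zero[OF sigma_finite_lebesgue])
      show "integrable lebesgue (\<lambda>x. indicator B x *\<^sub>R f x)" using iB by (simp add: set_integrable_def)
      fix A :: "(real^'n) set" assume "A \<in> sets lebesgue"
      \<comment> \<open>A Lebesgue measurable set is a Borel set up to a subset of a null set, so
        the Borel case is enough.\<close>
      then obtain S N N' where A: "A = S \<union> N" "N \<subseteq> N'" "N' \<in> null_sets lborel" "S \<in> sets lborel"
        by (rule sets_completionE)
      have N': "N' \<in> null_sets lebesgue" using A(3) by (rule null_sets_completionI)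
      have S: "S \<in> sets lebesgue" using A(4) by (simp add: lborelD)
      have "(LINT x:A|lebesgue. indicator B x *\<^sub>R f x) = (LINT x:S|lebesgue. indicator B x *\<^sub>R f x)"
        unfolding set_lebesgue_integral_def
      proof (rule integral_cong_AE)
        have m: "(\<lambda>x. indicator B x *\<^sub>R f x) \<in> borel_measurable lebesgue"
          using iB unfolding set_integrable_def by (rule borel_measurable_integrable)
        show "(\<lambda>x. indicator A x *\<^sub>R indicator B x *\<^sub>R f x) \<in> borel_measurable lebesgue"
          "(\<lambda>x. indicator S x *\<^sub>R indicator B x *\<^sub>R f x) \<in> borel_measurable lebesgue"
          by (intro borel_measurable_scaleR borel_measurable_indicator m S \<open>A \<in> sets lebesgue\<close>)+
        have "AE x in lebesgue. x \<notin> N'" using N' by (rule AE_not_in)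
        then show "AE x in lebesgue. indicator A x *\<^sub>R indicator B x *\<^sub>R f x = indicator S x *\<^sub>R indicator B x *\<^sub>R f x"
        proof eventually_elim
          case (elim x)
          then show ?case using A by (auto simp: indicator_def)
        qed
      qed
      also have "\<dots> = (LINT x:S \<inter> B|lebesgue. f x)"
        unfolding set_lebesgue_integral_def by (simp add: indicator_inter_arith)
      also have "\<dots> = 0" using A(4) by (intro borel_sets) simp
      finally show "(LINT x:A|lebesgue. indicator B x *\<^sub>R f x) = 0" .
    qed
    then show ?thesis by (simp add: B_def)
  qed
  then have "AE x in lebesgue. \<forall>n. indicator (box (\<chi> i. - real n) (\<chi> i. real n)) x *\<^sub>R f x = 0"
    unfolding AE_all_countable by (intro allI)
  then show ?thesis
  proof eventually_elim
    case (elim x)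
    obtain n where n: "norm x < real n" using reals_Archimedean2 by blast
    have "x \<in> box (\<chi> i. - real n) (\<chi> i. real n)"
      unfolding mem_box_cart
    proof
      fix i
      have "\<bar>x$i\<bar> < real n" using component_le_norm_cart[of x i] n by linarith
      then show "(\<chi> i. - real n) $ i < x $ i \<and> x $ i < (\<chi> i. real n) $ i" by (simp add: abs_less_iff)
    qed
    then show ?case using elim[rule_format, of n] by simp
  qed
qed

text \<open>Convex combinations of the tail from j that arise from repeated midpoints. Midpoints are
  all that the parallelogram law requires, and they save the bookkeeping of coefficients.\<close>

inductive_set mid_hull :: "(nat \<Rightarrow> 'a \<Rightarrow> complex) \<Rightarrow> nat \<Rightarrow> ('a \<Rightarrow> complex) set" for u j where
  base: "j \<le> k \<Longrightarrow> u k \<in> mid_hull u j"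
| mid: "v \<in> mid_hull u j \<Longrightarrow> v' \<in> mid_hull u j \<Longrightarrow> (\<lambda>x. (v x + v' x) / 2) \<in> mid_hull u j"

lemma mid_hull_mono: "v \<in> mid_hull u j \<Longrightarrow> i \<le> j \<Longrightarrow> v \<in> mid_hull u i"
  by (induction rule: mid_hull.induct) (auto intro: mid_hull.intros)

text \<open>Almost minimisers of a weighted \<open>L\<^sup>2\<close> norm over the convex hulls of the tails of the
  sequence form a Cauchy sequence by the parallelogram law.  This replaces weak compactness.\<close>

lemma dominated_weak_limit:
  fixes u :: "nat \<Rightarrow> real^'n \<Rightarrow> complex" and F :: "real^'n \<Rightarrow> real"
  assumes u[measurable]: "\<And>k. u k \<in> borel_measurable lebesgue" and F[measurable]: "F \<in> borel_measurable lebesgue"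
    and dom: "\<And>k x. cmod (u k x) \<le> F x"
    and int: "\<And>\<psi>. \<psi> \<in> test_functions \<Longrightarrow> integrable lebesgue (\<lambda>x. F x * cmod (\<psi> x))"
    and lim: "\<And>\<psi>. \<psi> \<in> test_functions \<Longrightarrow> (\<lambda>k. \<integral>x. u k x * \<psi> x \<partial>lebesgue) \<longlonglongrightarrow> T \<psi>"
  shows "\<exists>g\<in>borel_measurable lebesgue. (AE x in lebesgue. cmod (g x) \<le> F x) \<and>
    (\<forall>\<psi>\<in>test_functions. (\<integral>x. g x * \<psi> x \<partial>lebesgue) = T \<psi>)"
proof -
  have F0: "0 \<le> F x" for x using dom[of 0 x] norm_ge_zero order_trans by blast
  define b where "b x = (exp 1 + norm x) powr (- real (CARD('n) + 2))" for x :: "real^'n"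
  have bpos: "0 < b x" for x
  proof -
    have "0 < exp 1 + norm x" by (auto intro: add_pos_nonneg)
    then show ?thesis unfolding b_def by (metis less_irrefl powr_gt_zero)
  qed
  have bm[measurable]: "b \<in> borel_measurable lebesgue"
  proof -
    have "b \<in> borel_measurable borel"
      unfolding b_def[abs_def]
    proof (intro borel_measurable_continuous_onI continuous_intros ballI)
      fix x :: "real^'n"
      have "0 < exp 1 + norm x" by (auto intro: add_pos_nonneg)
      then show "exp 1 + norm x \<noteq> 0" by simp
    qed
    then show ?thesis by (intro measurable_completion) simp
  qed
  have bint: "integrable lebesgue b"
    by (rule integrableI_bounded) (use decay_integral[where 'n = 'n] bpos in \<open>auto simp: b_def abs_of_pos less_imp_le\<close>)
  \<comment> \<open>With this weight every function dominated by F has a squared norm at most the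
    integral of b, although F itself need not be square integrable.\<close>
  define \<omega> where "\<omega> x = b x / (1 + F x)\<^sup>2" for x
  have \<omega>m[measurable]: "\<omega> \<in> borel_measurable lebesgue" unfolding \<omega>_def[abs_def] by measurable
  have \<omega>pos: "0 < \<omega> x" for x
    using bpos[of x] F0[of x] by (auto simp: \<omega>_def intro!: divide_pos_pos zero_less_power)
  have \<omega>le: "r\<^sup>2 * \<omega> x \<le> b x" if "0 \<le> r" "r \<le> F x" for r x
  proof -
    have "r\<^sup>2 \<le> (1 + F x)\<^sup>2" using that by (intro power_mono) auto
    then have "r\<^sup>2 / (1 + F x)\<^sup>2 \<le> 1" using F0[of x] by (simp add: divide_le_eq_1)
    then have "b x * (r\<^sup>2 / (1 + F x)\<^sup>2) \<le> b x * 1" using bpos[of x] by (intro mult_left_mono) auto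
    then show ?thesis by (simp add: \<omega>_def mult.commute)
  qed
  have hull: "v \<in> borel_measurable lebesgue \<and> (\<forall>x. cmod (v x) \<le> F x)" if "v \<in> mid_hull u j" for v j
    using that
  proof induction
    case (mid v v')
    have "cmod ((v x + v' x) / 2) \<le> F x" for x
    proof -
      have "cmod (v x + v' x) \<le> F x + F x" using mid.IH by (intro norm_triangle_mono) auto
      then show ?thesis by (simp add: norm_divide)
    qed
    then show ?case using mid.IH by auto
  qed (use dom in auto)
  note hm = hull[THEN conjunct1] and hF = hull[THEN conjunct2, rule_format]
  have int\<psi>: "integrable lebesgue (\<lambda>x. v x * \<psi> x)" if "v \<in> borel_measurable lebesgue" "AE x in lebesgue. cmod (v x) \<le> F x" "\<psi> \<in> test_functions" for v \<psi>
  proof (rule Bochner_Integration.integrable_bound[OF int[OF that(3)]])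
    have "\<psi> \<in> borel_measurable lebesgue" using test_borel[OF that(3)] by (intro measurable_completion) simp
    then show "(\<lambda>x. v x * \<psi> x) \<in> borel_measurable lebesgue" using that(1) by measurable
    show "AE x in lebesgue. norm (v x * \<psi> x) \<le> norm (F x * cmod (\<psi> x))"
      using that(2) by eventually_elim (use F0 in \<open>auto simp: norm_mult abs_mult intro!: mult_right_mono\<close>)
  qed
  have close: "cmod ((\<integral>x. v x * \<psi> x \<partial>lebesgue) - T \<psi>) \<le> e"
    if "v \<in> mid_hull u j" "\<psi> \<in> test_functions" "\<And>k. j \<le> k \<Longrightarrow> cmod ((\<integral>x. u k x * \<psi> x \<partial>lebesgue) - T \<psi>) \<le> e" for v j \<psi> e
    using that(1)
  proof induction
    case (mid v v')
    have i: "integrable lebesgue (\<lambda>x. v x * \<psi> x)" "integrable lebesgue (\<lambda>x. v' x * \<psi> x)"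
      using mid.hyps hm hF that(2) by (auto intro!: int\<psi>)
    have "(\<integral>x. (v x + v' x) / 2 * \<psi> x \<partial>lebesgue) = (\<integral>x. (v x * \<psi> x + v' x * \<psi> x) / 2 \<partial>lebesgue)"
      by (simp add: distrib_right)
    also have "\<dots> = ((\<integral>x. v x * \<psi> x \<partial>lebesgue) + (\<integral>x. v' x * \<psi> x \<partial>lebesgue)) / 2"
      using i by simp
    finally have eq: "(\<integral>x. (v x + v' x) / 2 * \<psi> x \<partial>lebesgue) - T \<psi> = (((\<integral>x. v x * \<psi> x \<partial>lebesgue) - T \<psi>) + ((\<integral>x. v' x * \<psi> x \<partial>lebesgue) - T \<psi>)) / 2"
      by (simp add: field_simps)
    have "cmod (a / 2) \<le> e" if "cmod a \<le> e + e" for a using that by (simp add: norm_divide)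
    from this[OF norm_triangle_mono[OF mid.IH]] show ?case by (simp only: eq)
  qed (use that in auto)
  define N2 where "N2 v = (\<integral>x. (cmod (v x))\<^sup>2 * \<omega> x \<partial>lebesgue)" for v
  have N2int: "integrable lebesgue (\<lambda>x. (cmod (v x))\<^sup>2 * \<omega> x)" if "v \<in> borel_measurable lebesgue" "\<And>x. cmod (v x) \<le> F x" for v
    by (rule Bochner_Integration.integrable_bound[OF bint])
      (use that \<omega>le \<omega>pos bpos in \<open>auto simp: abs_mult abs_of_pos less_imp_le\<close>)
  define d where "d j = (INF v\<in>mid_hull u j. N2 v)" for j
  have N20: "0 \<le> N2 v" for v unfolding N2_def using \<omega>pos by (intro Bochner_Integration.integral_nonneg) (auto simp: less_imp_le)
  have bb: "bdd_below (N2 ` mid_hull u j)" for j using N20 by (auto intro!: bdd_belowI)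
  have ne: "mid_hull u j \<noteq> {}" for j using mid_hull.base[of j j u] by auto
  have d_le: "d j \<le> N2 v" if "v \<in> mid_hull u j" for v j unfolding d_def using bb that by (rule cINF_lower)
  have d_mono: "mono d"
  proof (rule monoI)
    fix i j :: nat assume "i \<le> j"
    then show "d i \<le> d j" unfolding d_def using mid_hull_mono
      by (intro cINF_superset_mono bb ne) auto
  qed
  have d_bd: "d j \<le> (\<integral>x. b x \<partial>lebesgue)" for j
  proof -
    have uj: "u j \<in> mid_hull u j" by (rule mid_hull.base) simp
    have "N2 (u j) \<le> (\<integral>x. b x \<partial>lebesgue)"
      unfolding N2_def using N2int[OF u dom] bint \<omega>le dom by (intro Bochner_Integration.integral_mono) auto
    then show ?thesis using d_le[OF uj] by simp
  qed
  obtain l where l: "d \<longlonglongrightarrow> l"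
    using incseq_convergent[OF d_mono, of "\<integral>x. b x \<partial>lebesgue"] d_bd by blast
  have d_l: "d j \<le> l" for j by (rule incseq_le[OF d_mono l])
  have "\<exists>J. \<forall>j\<ge>J. l - (1/4)^m \<le> d j" for m
  proof -
    have "\<forall>\<^sub>F j in sequentially. l - (1/4)^m < d j" using order_tendstoD(1)[OF l, of "l - (1/4)^m"] by simp
    then show ?thesis by (auto simp: eventually_sequentially intro: less_imp_le)
  qed
  then obtain J where J: "\<And>m j. J m \<le> j \<Longrightarrow> l - (1/4)^m \<le> d j" by metis
  \<comment> \<open>The partial sums of J give an increasing sequence of indices that dominates both
    m and J m: the first makes the hulls nested, the second makes hull elements tend weakly to T,
    the third bounds their norms from below.\<close>
  define jj where "jj m = m + (\<Sum>i\<le>m. J i)" for m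
  have jj: "m \<le> jj m" "J m \<le> jj m" "jj m \<le> jj (Suc m)" for m
    by (auto simp: jj_def intro!: trans_le_add2 member_le_sum)
  have "\<exists>v\<in>mid_hull u (jj m). N2 v < d (jj m) + (1/4)^m" for m
    using cInf_lessD[of "N2 ` mid_hull u (jj m)" "d (jj m) + (1/4)^m"] ne unfolding d_def by force
  then obtain v where v: "\<And>m. v m \<in> mid_hull u (jj m)" "\<And>m. N2 (v m) < d (jj m) + (1/4)^m" by metis
  note vm[measurable] = hm[OF v(1)]
  note vF = hF[OF v(1)]
  define \<Delta> where "\<Delta> m x = v m x - v (Suc m) x" for m x
  \<comment> \<open>Parallelogram law. The midpoint h is still in the hull from jj m, so its squared
    norm is at least l - (1/4)^m, while those of v m and v (Suc m) are at most l + (1/4)^m; the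
    factor 8 is 2 + 2 + 4.\<close>
  have \<Delta>N: "(\<integral>x. (cmod (\<Delta> m x))\<^sup>2 * \<omega> x \<partial>lebesgue) \<le> 8 * (1/4)^m" and \<Delta>int: "integrable lebesgue (\<lambda>x. (cmod (\<Delta> m x))\<^sup>2 * \<omega> x)" for m
  proof -
    define h where "h x = (v m x + v (Suc m) x) / 2" for x
    have hh: "h \<in> mid_hull u (jj m)"
      unfolding h_def[abs_def] using v(1) mid_hull_mono[OF v(1) jj(3)] by (rule mid_hull.mid)
    have par: "(cmod (\<Delta> m x))\<^sup>2 * \<omega> x = 2 * ((cmod (v m x))\<^sup>2 * \<omega> x) + 2 * ((cmod (v (Suc m) x))\<^sup>2 * \<omega> x) - 4 * ((cmod (h x))\<^sup>2 * \<omega> x)" for x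
    proof -
      have "(cmod (\<Delta> m x))\<^sup>2 = 2 * (cmod (v m x))\<^sup>2 + 2 * (cmod (v (Suc m) x))\<^sup>2 - 4 * (cmod (h x))\<^sup>2"
        unfolding \<Delta>_def h_def cmod_power2 by (simp add: power2_eq_square field_simps)
      then show ?thesis by (simp only: left_diff_distrib distrib_right mult.assoc)
    qed
    note ii = N2int[OF vm vF, of m] N2int[OF vm vF, of "Suc m"] N2int[OF hm[OF hh] hF[OF hh]]
    show "integrable lebesgue (\<lambda>x. (cmod (\<Delta> m x))\<^sup>2 * \<omega> x)" unfolding par using ii by auto
    have "(\<integral>x. (cmod (\<Delta> m x))\<^sup>2 * \<omega> x \<partial>lebesgue) = 2 * N2 (v m) + 2 * N2 (v (Suc m)) - 4 * N2 h"
      unfolding par N2_def using ii by simp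
    moreover have "N2 (v m) \<le> l + (1/4)^m" using v(2)[of m] d_l[of "jj m"] by simp
    moreover have "N2 (v (Suc m)) \<le> l + (1/4)^m"
    proof -
      have "(1/4::real)^Suc m \<le> (1/4)^m" by simp
      then show ?thesis using v(2)[of "Suc m"] d_l[of "jj (Suc m)"] by linarith
    qed
    moreover have "l - (1/4)^m \<le> N2 h" using J[OF jj(2)[of m]] d_le[OF hh] by linarith
    ultimately show "(\<integral>x. (cmod (\<Delta> m x))\<^sup>2 * \<omega> x \<partial>lebesgue) \<le> 8 * (1/4)^m" by linarith
  qed
  have \<Delta>m[measurable]: "\<Delta> m \<in> borel_measurable lebesgue" for m unfolding \<Delta>_def[abs_def] by measurable
  \<comment> \<open>The additional factor 2^m still leaves the summable bound 8 (1/2)^m. It yields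
    absolute summability of \<Delta> m x itself, since |\<Delta>| is at most 2^m |\<Delta>|^2 +
    (1/2)^m.\<close>
  have "AE x in lebesgue. (\<Sum>m. ennreal (2^m * ((cmod (\<Delta> m x))\<^sup>2 * \<omega> x))) \<noteq> \<infinity>"
  proof (rule nn_integral_PInf_AE)
    show "(\<lambda>x. \<Sum>m. ennreal (2^m * ((cmod (\<Delta> m x))\<^sup>2 * \<omega> x))) \<in> borel_measurable lebesgue" by measurable
    have "(\<integral>\<^sup>+x. (\<Sum>m. ennreal (2^m * ((cmod (\<Delta> m x))\<^sup>2 * \<omega> x))) \<partial>lebesgue) = (\<Sum>m. \<integral>\<^sup>+x. ennreal (2^m * ((cmod (\<Delta> m x))\<^sup>2 * \<omega> x)) \<partial>lebesgue)"
      by (rule nn_integral_suminf) measurable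
    also have "\<dots> \<le> (\<Sum>m. ennreal (8 * (1/2)^m))"
    proof (rule suminf_le)
      fix m
      have "(\<integral>\<^sup>+x. ennreal (2^m * ((cmod (\<Delta> m x))\<^sup>2 * \<omega> x)) \<partial>lebesgue) = ennreal (\<integral>x. 2^m * ((cmod (\<Delta> m x))\<^sup>2 * \<omega> x) \<partial>lebesgue)"
        using \<Delta>int[of m] \<omega>pos by (intro nn_integral_eq_integral integrable_mult_right) (auto simp: less_imp_le)
      also have "(\<integral>x. 2^m * ((cmod (\<Delta> m x))\<^sup>2 * \<omega> x) \<partial>lebesgue) \<le> 2^m * (8 * (1/4)^m)"
        using \<Delta>N[of m] by simp
      also have "(2::real)^m * (8 * (1/4)^m) = 8 * (1/2)^m" by (simp add: power_mult_distrib[symmetric] mult.left_commute flip: power_mult_distrib)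
      finally show "(\<integral>\<^sup>+x. ennreal (2^m * ((cmod (\<Delta> m x))\<^sup>2 * \<omega> x)) \<partial>lebesgue) \<le> ennreal (8 * (1/2)^m)"
        by (simp add: ennreal_leI)
    qed auto
    also have "\<dots> < \<infinity>" by (subst suminf_ennreal2) (auto intro!: summable_mult)
    finally show "(\<integral>\<^sup>+x. (\<Sum>m. ennreal (2^m * ((cmod (\<Delta> m x))\<^sup>2 * \<omega> x))) \<partial>lebesgue) \<noteq> \<infinity>" by simp
  qed
  then have conv: "AE x in lebesgue. convergent (\<lambda>m. v m x)"
  proof eventually_elim
    case (elim x)
    have "summable (\<lambda>m. 2^m * ((cmod (\<Delta> m x))\<^sup>2 * \<omega> x))"
      by (rule summable_suminf_not_top) (use elim \<omega>pos in \<open>auto simp: less_imp_le\<close>)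
    then have "summable (\<lambda>m. 1 / \<omega> x * (2^m * ((cmod (\<Delta> m x))\<^sup>2 * \<omega> x)))" by (rule summable_mult)
    moreover have "1 / \<omega> x * (2^m * ((cmod (\<Delta> m x))\<^sup>2 * \<omega> x)) = 2^m * (cmod (\<Delta> m x))\<^sup>2" for m
      using \<omega>pos[of x] by simp
    ultimately have s: "summable (\<lambda>m. 2^m * (cmod (\<Delta> m x))\<^sup>2 + (1/2)^m)" by (intro summable_add) auto
    have "summable (\<lambda>m. \<Delta> m x)"
    proof (rule summable_comparison_test'[OF s, of 0])
      fix m :: nat
      have "0 \<le> (2^m * cmod (\<Delta> m x) - 1)\<^sup>2 / 2^m" by simp
      also have "\<dots> = 2^m * (cmod (\<Delta> m x))\<^sup>2 - 2 * cmod (\<Delta> m x) + (1/2)^m"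
        by (simp add: power2_eq_square field_simps power_one_over)
      finally have "2 * cmod (\<Delta> m x) \<le> 2^m * (cmod (\<Delta> m x))\<^sup>2 + (1/2)^m" by linarith
      then show "norm (\<Delta> m x) \<le> 2^m * (cmod (\<Delta> m x))\<^sup>2 + (1/2)^m" using norm_ge_zero[of "\<Delta> m x"] by linarith
    qed
    then have "convergent (\<lambda>n. \<Sum>m<n. \<Delta> m x)" by (simp add: summable_iff_convergent)
    then have "convergent (\<lambda>n. v 0 x - (\<Sum>m<n. \<Delta> m x))" by (intro convergent_diff convergent_const)
    moreover have "v 0 x - (\<Sum>m<n. \<Delta> m x) = v n x" for n
    proof (induction n)
      case (Suc n)
      then show ?case unfolding sum.lessThan_Suc diff_diff_eq[symmetric] by (simp only: Suc) (simp add: \<Delta>_def)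
    qed simp
    ultimately show ?case by simp
  qed
  define g where "g x = lim (\<lambda>m. v m x)" for x
  have gm[measurable]: "g \<in> borel_measurable lebesgue" unfolding g_def[abs_def] by measurable
  have vg: "AE x in lebesgue. (\<lambda>m. v m x) \<longlonglongrightarrow> g x"
    using conv by eventually_elim (simp add: g_def convergent_LIMSEQ_iff)
  have gF: "AE x in lebesgue. cmod (g x) \<le> F x"
    using vg
  proof eventually_elim
    case (elim x)
    show ?case by (rule LIMSEQ_le_const2[OF tendsto_norm[OF elim]]) (use vF in auto)
  qed
  have "(\<integral>x. g x * \<psi> x \<partial>lebesgue) = T \<psi>" if \<psi>: "\<psi> \<in> test_functions" for \<psi>
  proof -
    have \<psi>m[measurable]: "\<psi> \<in> borel_measurable lebesgue" using test_borel[OF \<psi>] by (intro measurable_completion) simp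
    have 1: "(\<lambda>m. \<integral>x. v m x * \<psi> x \<partial>lebesgue) \<longlonglongrightarrow> (\<integral>x. g x * \<psi> x \<partial>lebesgue)"
    proof (rule integral_dominated_convergence[where w = "\<lambda>x. F x * cmod (\<psi> x)"])
      show "AE x in lebesgue. (\<lambda>m. v m x * \<psi> x) \<longlonglongrightarrow> g x * \<psi> x"
        using vg by eventually_elim (intro tendsto_mult tendsto_const)
      show "AE x in lebesgue. norm (v m x * \<psi> x) \<le> F x * cmod (\<psi> x)" for m
        using vF by (auto simp: norm_mult intro!: mult_right_mono)
    qed (use int[OF \<psi>] in auto)
    have 2: "(\<lambda>m. \<integral>x. v m x * \<psi> x \<partial>lebesgue) \<longlonglongrightarrow> T \<psi>"
    proof (rule LIMSEQ_I)
      fix r :: real assume "0 < r"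
      then obtain k0 where k0: "\<And>k. k0 \<le> k \<Longrightarrow> cmod ((\<integral>x. u k x * \<psi> x \<partial>lebesgue) - T \<psi>) < r / 2"
        using LIMSEQ_D[OF lim[OF \<psi>], of "r / 2"] by auto
      show "\<exists>no. \<forall>m\<ge>no. norm ((\<integral>x. v m x * \<psi> x \<partial>lebesgue) - T \<psi>) < r"
      proof (intro exI[of _ k0] allI impI)
        fix m assume m: "k0 \<le> m"
        have "cmod ((\<integral>x. v m x * \<psi> x \<partial>lebesgue) - T \<psi>) \<le> r / 2"
          by (rule close[OF v(1) \<psi>]) (use k0 m jj(1)[of m] in \<open>auto intro!: less_imp_le\<close>)
        then show "norm ((\<integral>x. v m x * \<psi> x \<partial>lebesgue) - T \<psi>) < r" using \<open>0 < r\<close> by simp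
      qed
    qed
    show ?thesis by (rule LIMSEQ_unique[OF 1 2])
  qed
  then show ?thesis using gm gF by (intro bexI[of _ g]) auto
qed

section \<open>Consequences of the hypotheses on the exponent and the weight\<close>

text \<open>The logarithmic modulus makes g continuous, so a violation at x0 would persist on a
  ball, which is not a null set. The lemma serves p and -p, turning essential bounds into bounds at
  every point.\<close>

lemma log_modulus_ge:
  fixes g :: "real^'n \<Rightarrow> real"
  assumes c: "0 < c" and g: "\<And>x y. norm (x - y) \<le> 1/2 \<Longrightarrow> \<bar>g x - g y\<bar> \<le> c / ln (1 / norm (x - y))"
    and ae: "AE x in lebesgue. q \<le> g x"
  shows "q \<le> g x0"
proof (rule ccontr)
  assume n: "\<not> q \<le> g x0"
  define \<eta> where "\<eta> = q - g x0"
  have \<eta>: "\<eta> > 0" using n by (simp add: \<eta>_def)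
  \<comment> \<open>Below this distance c / ln (1 / |x - x0|) is smaller than the gap
    \<eta>.\<close>
  define \<delta> where "\<delta> = min (1/2) (exp (- (c / \<eta>)))"
  have \<delta>: "\<delta> > 0" by (simp add: \<delta>_def)
  have lt: "g x < q" if "x \<in> ball x0 \<delta>" for x
  proof (cases "x = x0")
    case True then show ?thesis using n by simp
  next
    case False
    define r where "r = norm (x - x0)"
    have r: "0 < r" "r < 1/2" "r < exp (- (c / \<eta>))"
      using False that by (auto simp: r_def \<delta>_def dist_norm norm_minus_commute)
    have "ln r < - (c / \<eta>)" using r by (metis exp_less_cancel_iff exp_ln)
    then have L: "c / \<eta> < ln (1 / r)" using r by (simp add: ln_div)
    have "0 < c / \<eta>" using c \<eta> by simp
    then have "0 < ln (1 / r)" using L by linarith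
    then have "c / ln (1 / r) < \<eta>" using L \<eta> by (simp add: field_simps)
    then have "\<bar>g x - g x0\<bar> < \<eta>" using g[of x x0] r by (simp add: r_def)
    then show ?thesis by (simp add: \<eta>_def abs_less_iff)
  qed
  have "AE x in lebesgue. x \<notin> ball x0 \<delta>"
    using ae
  proof eventually_elim
    case (elim x)
    then show ?case using lt[of x] by auto
  qed
  then have "ball x0 \<delta> \<in> null_sets lebesgue" by (subst AE_iff_null_sets) auto
  then have "negligible (ball x0 \<delta>)" by (simp add: negligible_iff_null_sets)
  then show False using open_not_negligible[of "ball x0 \<delta>"] \<delta> by simp
qed

text \<open>Points of a cell of generation k are at distance at most n 2^(-k), hence at most
  2^(n-k). For k \<ge> 2 n + 2 this is at most 1/2 and at most 2^(-k/2), so the logarithm in the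
  modulus is comparable to k. For smaller k the oscillation is bounded by P and the logarithm by a
  constant.\<close>

lemma LH0_oscillation:
  fixes p :: "real^'n \<Rightarrow> real"
  assumes c: "0 < c" and LH: "\<And>x y. norm (x - y) \<le> 1/2 \<Longrightarrow> \<bar>p x - p y\<bar> \<le> c / ln (1 / norm (x - y))"
    and p: "\<And>x. 0 \<le> p x" "\<And>x. p x \<le> P"
  obtains L where "\<And>a k x y z. y \<in> dcell a k x \<Longrightarrow> z \<in> dcell a k x \<Longrightarrow> \<bar>p y - p z\<bar> * ln (2 ^ (k * CARD('n))) \<le> L"
proof -
  let ?n = "CARD('n)"
  have P0: "0 \<le> P" using p[of 0] by linarith
  have l2: "0 < ln (2::real)" by simp
  define L where "L = 2 * c * real ?n + P * (real ((2 * ?n + 2) * ?n) * ln 2)"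
  show thesis
  proof (rule that[of L])
    fix a k and x y z :: "real^'n"
    assume yz: "y \<in> dcell a k x" "z \<in> dcell a k x"
    have L0: "0 \<le> 2 * c * real ?n" "0 \<le> P * (real ((2 * ?n + 2) * ?n) * ln 2)" using c P0 by auto
    have lnp: "ln (2 ^ (k * ?n)) = real (k * ?n) * ln (2::real)" by (rule ln_realpow)
    show "\<bar>p y - p z\<bar> * ln (2 ^ (k * ?n)) \<le> L"
    proof (cases "k < 2 * ?n + 2")
      case True
      have "\<bar>p y - p z\<bar> \<le> P" using p(1)[of y] p(1)[of z] p(2)[of y] p(2)[of z] by (simp add: abs_le_iff)
      moreover have "real (k * ?n) * ln (2::real) \<le> real ((2 * ?n + 2) * ?n) * ln 2"
        using True by (intro mult_right_mono of_nat_mono mult_le_mono1) auto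
      ultimately have "\<bar>p y - p z\<bar> * ln (2 ^ (k * ?n)) \<le> P * (real ((2 * ?n + 2) * ?n) * ln 2)"
        unfolding lnp using P0 by (intro mult_mono) auto
      then show ?thesis using L0 by (simp add: L_def)
    next
      case False
      show ?thesis
      proof (cases "y = z")
        case True then show ?thesis using L0 by (simp add: L_def)
      next
        case ne: False
        define r where "r = norm (y - z)"
        have r0: "0 < r" using ne by (simp add: r_def)
        have "r \<le> real ?n / 2^k" unfolding r_def by (rule dist_dcell[OF yz])
        also have "\<dots> \<le> 2^?n / 2^k" using of_nat_less_two_power[of ?n, where 'a = real] by (intro divide_right_mono) auto
        also have "\<dots> = 1 / 2^(k - ?n)" using False by (simp add: power_diff)
        finally have r1: "r \<le> 1 / 2^(k - ?n)" .
        have "(2::real)^1 \<le> 2^(k - ?n)" using False by (intro power_increasing) auto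
        then have "1 / 2^(k - ?n) \<le> (1/2::real)" by (simp add: field_simps)
        then have rh: "r \<le> 1/2" by (rule order_trans[OF r1])
        have "2^(k - ?n) \<le> 1 / r" using r1 r0 by (simp add: field_simps)
        then have "ln (2^(k - ?n)) \<le> ln (1 / r)" using r0 by (subst ln_le_cancel_iff) auto
        then have l1: "real (k - ?n) * ln 2 \<le> ln (1 / r)" by (simp add: ln_realpow)
        have "real k / 2 * ln 2 \<le> real (k - ?n) * ln 2" using False by (intro mult_right_mono) auto
        then have l3: "real k / 2 * ln 2 \<le> ln (1 / r)" using l1 by (rule order_trans)
        have k0: "0 < k" using False by simp
        then have kp: "0 < real k / 2 * ln 2" by simp
        have "\<bar>p y - p z\<bar> \<le> c / ln (1 / r)" using LH[of y z] rh by (simp add: r_def)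
        also have "\<dots> \<le> c / (real k / 2 * ln 2)" by (rule divide_left_mono[OF l3 less_imp_le[OF c] mult_pos_pos[OF less_le_trans[OF kp l3] kp]])
        finally have "\<bar>p y - p z\<bar> * ln (2 ^ (k * ?n)) \<le> c / (real k / 2 * ln 2) * (real (k * ?n) * ln 2)"
          unfolding lnp by (intro mult_right_mono) auto
        also have "\<dots> = 2 * c * real ?n" using False by (simp add: field_simps)
        finally show ?thesis using L0 by (simp add: L_def)
      qed
    qed
  qed
qed

section \<open>Quasi-norms, modulars and the A_p condition\<close>

lemma epowr_ennreal: "0 \<le> a \<Longrightarrow> epowr (ennreal a) e = ennreal (a powr e)"
  by (simp add: epowr_def)

lemma epowr_divide: "0 \<le> a \<Longrightarrow> 0 < r \<Longrightarrow> epowr (ennreal a / ennreal r) e = ennreal ((a / r) powr e)"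
  by (simp add: divide_ennreal epowr_ennreal)

lemma epowr_mono: "a \<le> b \<Longrightarrow> 0 \<le> e \<Longrightarrow> epowr a e \<le> epowr b e"
  by (cases a; cases b) (auto simp: epowr_def top_unique intro!: ennreal_leI powr_mono2)

text \<open>Allows the weight to be changed on a null set, so that it may be taken positive
  everywhere.\<close>

lemma Lp_enorm_cong_AE:
  assumes "AE x in lebesgue. w x = w' x" "AE x in lebesgue. g x = g' x"
  shows "Lp_enorm p w g = Lp_enorm p w' g'"
proof -
  have "(\<integral>\<^sup>+x. epowr (g x / ennreal r) (p x) * ennreal (w x) \<partial>lebesgue) = (\<integral>\<^sup>+x. epowr (g' x / ennreal r) (p x) * ennreal (w' x) \<partial>lebesgue)" for r
    by (rule nn_integral_cong_AE) (use assms in eventually_elim, simp)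
  then show ?thesis by (simp add: Lp_enorm_def)
qed

text \<open>Reduces a norm inequality to each admissible r. If there is none, the infimum is
  infinite and the claim still holds.\<close>

lemma Lp_enorm_le_scale:
  assumes C: "0 < C" and le: "\<And>r. 0 < r \<Longrightarrow> (\<integral>\<^sup>+x. epowr (h x / ennreal r) (p x) * ennreal (w x) \<partial>lebesgue) \<le> 1 \<Longrightarrow> Y \<le> ennreal (C * r)"
  shows "Y \<le> ennreal C * Lp_enorm p w h"
proof -
  have one: "ennreal C * ennreal (1 / C) = 1" using C by (simp flip: ennreal_mult)
  have "ennreal (1 / C) * Y \<le> Lp_enorm p w h"
    unfolding Lp_enorm_def
  proof (rule Inf_greatest)
    fix z assume "z \<in> {ennreal r |r. 0 < r \<and> (\<integral>\<^sup>+x. epowr (h x / ennreal r) (p x) * ennreal (w x) \<partial>lebesgue) \<le> 1}"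
    then obtain r where r: "z = ennreal r" "0 < r" "(\<integral>\<^sup>+x. epowr (h x / ennreal r) (p x) * ennreal (w x) \<partial>lebesgue) \<le> 1" by auto
    have "ennreal (1 / C) * Y \<le> ennreal (1 / C) * ennreal (C * r)" by (intro mult_left_mono le r) simp
    also have "\<dots> = z" using C r by (simp flip: ennreal_mult)
    finally show "ennreal (1 / C) * Y \<le> z" .
  qed
  then have "ennreal C * (ennreal (1 / C) * Y) \<le> ennreal C * Lp_enorm p w h" by (rule mult_left_mono) simp
  then show ?thesis by (simp add: mult.assoc[symmetric] one)
qed

text \<open>As the exponent exceeds 1, the modular at r is at least 1 / r times the mass of Q when r
  < 1, and at most that when r \<ge> 1. This yields positivity and finiteness, without which the
  product of the two norms in the A_p condition gives no information about the factors.\<close>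

lemma Lp_enorm_indicator:
  fixes e v :: "real^'n \<Rightarrow> real"
  assumes [measurable]: "e \<in> borel_measurable lebesgue" "v \<in> borel_measurable lebesgue" "Q \<in> sets lebesgue"
    and e: "\<And>x. 1 < e x" and v: "\<And>x. 0 < v x" and Q: "0 < emeasure lebesgue Q"
  shows "0 < Lp_enorm e v (indicator Q)"
    and "(\<integral>\<^sup>+x\<in>Q. ennreal (v x) \<partial>lebesgue) < \<infinity> \<Longrightarrow> Lp_enorm e v (indicator Q) < \<infinity>"
    and "Lp_enorm e v (indicator Q) < M \<Longrightarrow> \<exists>r>0. ennreal r < M \<and> (\<integral>\<^sup>+x\<in>Q. ennreal ((1 / r) powr e x * v x) \<partial>lebesgue) \<le> 1"
proof -
  define W where "W = (\<integral>\<^sup>+x\<in>Q. ennreal (v x) \<partial>lebesgue)"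
  have eq: "(\<integral>\<^sup>+x. epowr (indicator Q x / ennreal r) (e x) * ennreal (v x) \<partial>lebesgue) = (\<integral>\<^sup>+x\<in>Q. ennreal ((1 / r) powr e x * v x) \<partial>lebesgue)"
    if "0 < r" for r
  proof (rule nn_integral_cong)
    fix x
    show "epowr (indicator Q x / ennreal r) (e x) * ennreal (v x) = ennreal ((1 / r) powr e x * v x) * indicator Q x"
      using epowr_divide[of 1 r "e x"] epowr_divide[of 0 r "e x"] that v[of x]
      by (cases "x \<in> Q") (auto simp: ennreal_mult)
  qed
  have Wpos: "0 < W"
  proof (rule ccontr)
    assume "\<not> 0 < W"
    then have "(\<integral>\<^sup>+x. ennreal (v x) * indicator Q x \<partial>lebesgue) = 0" by (simp add: W_def)
    then have "AE x in lebesgue. ennreal (v x) * indicator Q x = 0" by (subst (asm) nn_integral_0_iff_AE) auto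
    then have "AE x in lebesgue. x \<notin> Q"
    proof eventually_elim
      case (elim x)
      then show ?case using v[of x] by (auto simp: indicator_def split: if_splits)
    qed
    then have "Q \<in> null_sets lebesgue" by (subst AE_iff_null_sets) auto
    then show False using Q by auto
  qed
  have "min 1 W \<le> Lp_enorm e v (indicator Q)"
    unfolding Lp_enorm_def
  proof (rule Inf_greatest)
    fix z assume "z \<in> {ennreal r |r. 0 < r \<and> (\<integral>\<^sup>+x. epowr (indicator Q x / ennreal r) (e x) * ennreal (v x) \<partial>lebesgue) \<le> 1}"
    then obtain r where r: "z = ennreal r" "0 < r" "(\<integral>\<^sup>+x\<in>Q. ennreal ((1 / r) powr e x * v x) \<partial>lebesgue) \<le> 1"
      using eq by auto
    show "min 1 W \<le> z"
    proof (cases "1 \<le> r")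
      case True
      then have "1 \<le> z" unfolding r by simp
      then show ?thesis by (simp add: min_le_iff_disj)
    next
      case False
      have "ennreal (1 / r) * W = (\<integral>\<^sup>+x\<in>Q. ennreal (1 / r) * ennreal (v x) \<partial>lebesgue)"
        unfolding W_def by (subst nn_integral_cmult[symmetric]) (auto simp: mult.assoc)
      also have "\<dots> \<le> (\<integral>\<^sup>+x\<in>Q. ennreal ((1 / r) powr e x * v x) \<partial>lebesgue)"
      proof (rule nn_integral_mono)
        fix x
        have "(1 / r) powr 1 \<le> (1 / r) powr e x" using False r e[of x] by (intro powr_mono) auto
        then have "1 / r * v x \<le> (1 / r) powr e x * v x" using r v[of x] by (intro mult_right_mono) auto
        then have "ennreal (1 / r) * ennreal (v x) \<le> ennreal ((1 / r) powr e x * v x)"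
          using r v[of x] by (subst ennreal_mult[symmetric]) (auto intro: ennreal_leI)
        then show "ennreal (1 / r) * ennreal (v x) * indicator Q x \<le> ennreal ((1 / r) powr e x * v x) * indicator Q x"
          by (rule mult_right_mono) simp
      qed
      also have "\<dots> \<le> 1" by (rule r(3))
      finally have "ennreal r * (ennreal (1 / r) * W) \<le> ennreal r * 1" by (rule mult_left_mono) simp
      moreover have "ennreal r * ennreal (1 / r) = 1" using r by (simp flip: ennreal_mult)
      ultimately have "W \<le> z" by (simp add: mult.assoc[symmetric] r)
      then show ?thesis by (simp add: min_le_iff_disj)
    qed
  qed
  then show "0 < Lp_enorm e v (indicator Q)" by (rule less_le_trans[rotated]) (use Wpos in simp)
  show "Lp_enorm e v (indicator Q) < \<infinity>" if fin: "(\<integral>\<^sup>+x\<in>Q. ennreal (v x) \<partial>lebesgue) < \<infinity>"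
  proof -
    obtain b where b: "W = ennreal b" "0 \<le> b" using fin[folded W_def] by (cases W) auto
    define r where "r = max 1 b"
    have r: "1 \<le> r" "b \<le> r" by (auto simp: r_def)
    have "(\<integral>\<^sup>+x\<in>Q. ennreal ((1 / r) powr e x * v x) \<partial>lebesgue) \<le> (\<integral>\<^sup>+x\<in>Q. ennreal (1 / r) * ennreal (v x) \<partial>lebesgue)"
    proof (rule nn_integral_mono)
      fix x
      have "(1 / r) powr e x \<le> (1 / r) powr 1" using r e[of x] by (intro powr_mono') auto
      then have "(1 / r) powr e x * v x \<le> 1 / r * v x" using r v[of x] by (intro mult_right_mono) auto
      then have "ennreal ((1 / r) powr e x * v x) \<le> ennreal (1 / r) * ennreal (v x)"
        using r v[of x] by (subst ennreal_mult[symmetric]) (auto intro: ennreal_leI)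
      then show "ennreal ((1 / r) powr e x * v x) * indicator Q x \<le> ennreal (1 / r) * ennreal (v x) * indicator Q x"
        by (rule mult_right_mono) simp
    qed
    also have "\<dots> = ennreal (1 / r) * W"
      unfolding W_def by (subst nn_integral_cmult[symmetric]) (auto simp: mult.assoc)
    also have "\<dots> = ennreal (1 / r * b)" unfolding b(1) using b r by (intro ennreal_mult[symmetric]) auto
    also have "\<dots> \<le> 1" using r b by (simp add: divide_le_eq_1)
    finally have "Lp_enorm e v (indicator Q) \<le> ennreal r"
      unfolding Lp_enorm_def using r eq[of r] by (intro Inf_lower) auto
    then show ?thesis by (auto intro: le_less_trans)
  qed
  show "\<exists>r>0. ennreal r < M \<and> (\<integral>\<^sup>+x\<in>Q. ennreal ((1 / r) powr e x * v x) \<partial>lebesgue) \<le> 1"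
    if "Lp_enorm e v (indicator Q) < M"
    using that eq unfolding Lp_enorm_def Inf_less_iff by auto
qed

text \<open>The infima in the two norms need not be attained, so numbers below twice the norms are
  chosen; hence the factor 4 in front of the A_p constant.\<close>

lemma A_loc_var_pairs:
  fixes p w :: "real^'n \<Rightarrow> real"
  assumes pm[measurable]: "p \<in> borel_measurable lebesgue" and p: "\<And>x. 1 < p x"
    and w: "w \<in> A_loc_var p" and w'm[measurable]: "w' \<in> borel_measurable lebesgue" and w': "\<And>x. 0 < w' x"
    and ae: "AE x in lebesgue. w x = w' x"
  obtains A where "1 \<le> A" "\<And>Q. Q \<in> small_cubes \<Longrightarrow> \<exists>r s. ap_pair p w' A Q r s"
proof -
  let ?X = "\<lambda>Q. Lp_enorm p w' (indicator Q)" and ?Y = "\<lambda>Q. Lp_enorm (conj_exponent p) (dual_weight p w') (indicator Q)"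
  have cm[measurable]: "conj_exponent p \<in> borel_measurable lebesgue" and dm[measurable]: "dual_weight p w' \<in> borel_measurable lebesgue"
    unfolding conj_exponent_def[abs_def] dual_weight_def[abs_def] by measurable
  have c1: "1 < conj_exponent p x" for x using p[of x] by (simp add: conj_exponent_def field_simps)
  have dp: "0 < dual_weight p w' x" for x using w'[of x] by (simp add: dual_weight_def)
  have X: "Lp_enorm p w (indicator Q) = ?X Q" for Q by (rule Lp_enorm_cong_AE[OF ae]) simp
  have Y: "Lp_enorm (conj_exponent p) (\<lambda>x. w x powr (- 1 / (p x - 1))) (indicator Q) = ?Y Q" for Q
    by (rule Lp_enorm_cong_AE) (use ae in \<open>auto simp: dual_weight_def elim: eventually_mono\<close>)
  have li: "loc_integrable w" using w by (simp add: A_loc_var_def weight_def)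
  have "(SUP Q\<in>small_cubes. ?X Q * ?Y Q / emeasure lebesgue Q) < \<infinity>"
    using w unfolding A_loc_var_def mem_Collect_eq X Y by (elim conjE)
  then obtain S where S: "(SUP Q\<in>small_cubes. ?X Q * ?Y Q / emeasure lebesgue Q) = ennreal S" "0 \<le> S"
    by (cases "SUP Q\<in>small_cubes. ?X Q * ?Y Q / emeasure lebesgue Q") auto
  define A where "A = max 1 (4 * S)"
  show thesis
  proof (rule that[of A])
    fix Q :: "(real^'n) set" assume Qs: "Q \<in> small_cubes"
    then obtain a l where Q: "0 < l" "Q = cbox a (\<chi> i. a$i + l)" by (auto simp: small_cubes_def)
    define m where "m = l ^ CARD('n)"
    have m: "0 < m" "emeasure lebesgue Q = ennreal m"
      using Q emeasure_cube(1)[of l a] by (auto simp: m_def)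
    have mm: "measure lebesgue Q = m" using m by (simp add: measure_def)
    have Qset[measurable]: "Q \<in> sets lebesgue" by (simp add: Q)
    have Qp: "0 < emeasure lebesgue Q" using m by simp
    have "w absolutely_integrable_on Q" using li Q by (simp add: loc_integrable_def)
    then have "integrable lebesgue (\<lambda>x. indicator Q x *\<^sub>R w x)" by (simp add: set_integrable_def)
    then have "(\<integral>\<^sup>+x. ennreal (norm (indicator Q x *\<^sub>R w x)) \<partial>lebesgue) < \<infinity>" by (simp add: integrable_iff_bounded)
    also have "(\<integral>\<^sup>+x. ennreal (norm (indicator Q x *\<^sub>R w x)) \<partial>lebesgue) = (\<integral>\<^sup>+x\<in>Q. ennreal (w' x) \<partial>lebesgue)"
    proof (rule nn_integral_cong_AE)
      show "AE x in lebesgue. ennreal (norm (indicator Q x *\<^sub>R w x)) = ennreal (w' x) * indicator Q x"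
        using ae
      proof eventually_elim
        case (elim x)
        then show ?case using w'[of x] by (auto simp: indicator_def)
      qed
    qed
    finally have Wf: "(\<integral>\<^sup>+x\<in>Q. ennreal (w' x) \<partial>lebesgue) < \<infinity>" .
    note LX = Lp_enorm_indicator[OF pm w'm Qset p w' Qp] and LY = Lp_enorm_indicator[OF cm dm Qset c1 dp Qp]
    have X0: "0 < ?X Q" by (rule LX(1))
    have X1: "?X Q < \<infinity>" by (rule LX(2)[OF Wf])
    have Y0: "0 < ?Y Q" by (rule LY(1))
    obtain x where x: "?X Q = ennreal x" "0 < x" using X0 X1 by (cases "?X Q") auto
    have le: "?X Q * ?Y Q / emeasure lebesgue Q \<le> ennreal S" unfolding S(1)[symmetric] using Qs by (rule SUP_upper)
    \<comment> \<open>Positivity of \<open>?X Q\<close> matters, since 0 times infinity is 0 in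
      \<open>ennreal\<close>. With it, an infinite dual norm would make the A_p supremum
      infinite.\<close>
    have Y1: "?Y Q \<noteq> \<infinity>"
    proof
      assume "?Y Q = \<infinity>"
      then have "?X Q * ?Y Q / emeasure lebesgue Q = \<infinity>" using x m by (simp add: ennreal_mult_top ennreal_divide_eq_top_iff)
      then show False using le by (simp add: top_unique)
    qed
    then obtain y where y: "?Y Q = ennreal y" "0 < y" using Y0 by (cases "?Y Q") auto
    have "ennreal (x * y / m) \<le> ennreal S" using le x y m by (simp add: divide_ennreal flip: ennreal_mult)
    then have xy: "x * y \<le> S * m" using S m by (simp add: field_simps)
    have xl: "?X Q < ennreal (2 * x)" using x by (simp add: ennreal_lessI)
    then obtain r where r: "0 < r" "ennreal r < ennreal (2 * x)" "(\<integral>\<^sup>+x\<in>Q. ennreal ((1 / r) powr p x * w' x) \<partial>lebesgue) \<le> 1"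
      using LX(3)[OF xl] by (elim exE conjE)
    have yl: "?Y Q < ennreal (2 * y)" using y by (simp add: ennreal_lessI)
    then obtain s where s: "0 < s" "ennreal s < ennreal (2 * y)" "(\<integral>\<^sup>+x\<in>Q. ennreal ((1 / s) powr conj_exponent p x * dual_weight p w' x) \<partial>lebesgue) \<le> 1"
      using LY(3)[OF yl] by (elim exE conjE)
    have "r * s \<le> (2 * x) * (2 * y)" using r s x y by (intro mult_mono) (auto simp: ennreal_less_iff)
    also have "\<dots> = 4 * (x * y)" by simp
    also have "\<dots> \<le> 4 * (S * m)" using xy by simp
    also have "\<dots> \<le> A * m" using m by (simp add: A_def)
    finally have "ap_pair p w' A Q r s" using r s by (simp add: ap_pair_def mm)
    then show "\<exists>r s. ap_pair p w' A Q r s" by blast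
  qed (simp add: A_def)
qed

section \<open>Hardy spaces and Lebesgue spaces\<close>

text \<open>Lower semicontinuity: the condition |z - x| < t is open in x, so the superlevel sets are
  open even though the supremum is uncountable.\<close>

lemma grand_max_measurable[measurable]: "grand_max N f \<in> borel_measurable lebesgue"
proof -
  have "grand_max N f \<in> borel_measurable borel"
  proof (rule borel_measurableI_greater)
    fix c :: ennreal
    have "open {x. c < grand_max N f x}"
      unfolding open_contains_ball
    proof
      fix x assume "x \<in> {x. c < grand_max N f x}"
      then obtain \<phi> t z where a: "c < ennreal (cmod (distr_conv (dilate t \<phi>) f z))" "\<phi> \<in> D_class N" "norm (z - x) < t" "t < 1"
        unfolding grand_max_def mem_Collect_eq less_Sup_iff by blast
      have "ball x (t - norm (z - x)) \<subseteq> {x. c < grand_max N f x}"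
      proof
        fix y assume "y \<in> ball x (t - norm (z - x))"
        then have "norm (z - y) < t" using norm_triangle_ineq[of "z - x" "x - y"] by (simp add: dist_norm)
        then show "y \<in> {x. c < grand_max N f x}"
          unfolding grand_max_def mem_Collect_eq less_Sup_iff using a by blast
      qed
      then show "\<exists>e>0. ball x e \<subseteq> {x. c < grand_max N f x}" using a(3) by (intro exI[of _ "t - norm (z - x)"]) simp
    qed
    then show "{x \<in> space borel. c < grand_max N f x} \<in> sets borel" by simp
  qed
  then show ?thesis by (intro measurable_completion) simp
qed

context ap_weight
begin

section \<open>Functions of finite modular as distributions\<close>

lemma Lp_enorm_real_integral:
  assumes "\<And>x. 0 \<le> f x" "0 < r"
  shows "(\<integral>\<^sup>+x. epowr (ennreal (f x) / ennreal r) (p x) * ennreal (w x) \<partial>lebesgue) = modular (\<lambda>x. f x / r)"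
  by (rule nn_integral_cong) (use assms w_pos in \<open>simp add: epowr_divide ennreal_mult less_imp_le\<close>)

lemma bounded_int_finite:
  assumes f[measurable]: "f \<in> borel_measurable lebesgue" and f0: "\<And>x. 0 \<le> f x" and f1: "modular f \<le> 1" and S: "bounded S"
  shows "(\<integral>\<^sup>+x\<in>S. ennreal (f x) \<partial>lebesgue) < \<infinity>"
proof -
  obtain R where R: "\<And>x. x \<in> S \<Longrightarrow> norm x \<le> R" using S by (auto simp: bounded_iff)
  have "(\<integral>\<^sup>+x\<in>S. ennreal (f x) \<partial>lebesgue) \<le> (\<integral>\<^sup>+y. (\<Sum>v\<in>near_shifts R. ennreal (f y) * indicator (dcell 0 0 v) y) \<partial>lebesgue)"
  proof (rule nn_integral_mono)
    fix y
    show "ennreal (f y) * indicator S y \<le> (\<Sum>v\<in>near_shifts R. ennreal (f y) * indicator (dcell 0 0 v) y)"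
    proof (cases "y \<in> S")
      case True
      define v :: "real^'n" where "v = (\<chi> i. of_int \<lfloor>y$i\<rfloor>)"
      have "\<bar>v$i\<bar> \<le> R + 1" for i
      proof -
        have "\<bar>y$i\<bar> \<le> R" using component_le_norm_cart[of y i] R[OF True] by linarith
        then show ?thesis unfolding v_def by simp linarith
      qed
      then have v: "v \<in> near_shifts R" by (simp add: near_shifts_def v_def)
      have "y \<in> dcell 0 0 v" by (simp add: dcell_def v_def)
      moreover have "ennreal (f y) * indicator (dcell 0 0 v) y \<le> (\<Sum>v\<in>near_shifts R. ennreal (f y) * indicator (dcell 0 0 v) y)"
        by (rule member_le_sum[OF v]) (auto simp: finite_near_shifts)
      ultimately show ?thesis using True by simp
    qed simp
  qed
  also have "\<dots> = (\<Sum>v\<in>near_shifts R. \<integral>\<^sup>+y\<in>dcell 0 0 v. ennreal (f y) \<partial>lebesgue)"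
    by (rule nn_integral_sum) auto
  also have "\<dots> < \<infinity>" using cell_int_finite[OF f f0 f1] by (auto simp: finite_near_shifts)
  finally show ?thesis .
qed

lemma local_integrability:
  fixes g :: "real^'n \<Rightarrow> complex"
  assumes g: "g \<in> borel_measurable lebesgue" and r: "0 < r" and m: "modular (\<lambda>x. cmod (g x) / r) \<le> 1"
    and S: "bounded S"
  shows "(\<integral>\<^sup>+x\<in>S. ennreal (cmod (g x)) \<partial>lebesgue) < \<infinity>"
proof -
  have [measurable]: "(\<lambda>x. cmod (g x) / r) \<in> borel_measurable lebesgue" using g by measurable
  have "(\<integral>\<^sup>+x\<in>S. ennreal (cmod (g x) / r) \<partial>lebesgue) < \<infinity>"
    by (rule bounded_int_finite) (use r m S in auto)
  then have "ennreal r * (\<integral>\<^sup>+x\<in>S. ennreal (cmod (g x) / r) \<partial>lebesgue) < \<infinity>" by (simp add: ennreal_mult_less_top)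
  \<comment> \<open>S may fail to be measurable; its closure is measurable and still
    bounded.\<close>
  moreover have "(\<integral>\<^sup>+x\<in>S. ennreal (cmod (g x)) \<partial>lebesgue) \<le> ennreal r * (\<integral>\<^sup>+x\<in>closure S. ennreal (cmod (g x) / r) \<partial>lebesgue)"
  proof -
    have "(\<integral>\<^sup>+x\<in>S. ennreal (cmod (g x)) \<partial>lebesgue) \<le> (\<integral>\<^sup>+x. ennreal r * (ennreal (cmod (g x) / r) * indicator (closure S) x) \<partial>lebesgue)"
      using closure_subset[of S] r
      by (intro nn_integral_mono) (auto simp: indicator_def simp flip: ennreal_mult)
    also have "\<dots> = ennreal r * (\<integral>\<^sup>+x\<in>closure S. ennreal (cmod (g x) / r) \<partial>lebesgue)"
      by (rule nn_integral_cmult) (auto intro!: borel_measurable_times_ennreal borel_measurable_indicator lborelD)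
    finally show ?thesis .
  qed
  moreover have "(\<integral>\<^sup>+x\<in>closure S. ennreal (cmod (g x) / r) \<partial>lebesgue) < \<infinity>"
    by (rule bounded_int_finite) (use r m S in \<open>auto simp: bounded_closure\<close>)
  ultimately show ?thesis by (auto simp: ennreal_mult_less_top intro: le_less_trans)
qed

lemma set_integrable_bounded:
  fixes g :: "real^'n \<Rightarrow> complex"
  assumes g: "g \<in> borel_measurable lebesgue" and r: "0 < r" and m: "modular (\<lambda>x. cmod (g x) / r) \<le> 1"
    and S: "bounded S" "S \<in> sets lebesgue"
  shows "set_integrable lebesgue S g"
  unfolding set_integrable_def
proof (rule integrableI_bounded)
  show "(\<lambda>x. indicator S x *\<^sub>R g x) \<in> borel_measurable lebesgue" using g S by (intro borel_measurable_scaleR) auto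
  have "(\<integral>\<^sup>+x. ennreal (norm (indicator S x *\<^sub>R g x)) \<partial>lebesgue) = (\<integral>\<^sup>+x\<in>S. ennreal (cmod (g x)) \<partial>lebesgue)"
    by (rule nn_integral_cong) (auto simp: indicator_def)
  then show "(\<integral>\<^sup>+x. ennreal (norm (indicator S x *\<^sub>R g x)) \<partial>lebesgue) < \<infinity>" using local_integrability[OF g r m S(1)] by simp
qed

lemma integrable_times_test:
  fixes g :: "real^'n \<Rightarrow> complex"
  assumes g: "g \<in> borel_measurable lebesgue" and r: "0 < r" and m: "modular (\<lambda>x. cmod (g x) / r) \<le> 1"
    and \<phi>: "\<phi> \<in> test_functions"
  shows "integrable lebesgue (\<lambda>x. g x * \<phi> x)"
proof -
  obtain B where B: "\<And>x. \<phi> x \<noteq> 0 \<Longrightarrow> norm x \<le> B" using \<phi> by (auto simp: test_functions_iff bounded_iff)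
  obtain M where M: "0 \<le> M" "\<And>x. cmod (\<phi> x) \<le> M" using test_function_bounded[OF \<phi>] by blast
  have "set_integrable lebesgue (cball 0 B) g"
    by (rule set_integrable_bounded[OF g r m]) (auto intro: fmeasurableD lmeasurable_cball)
  then have i: "integrable lebesgue (\<lambda>x. M *\<^sub>R (indicator (cball 0 B) x *\<^sub>R g x))"
    unfolding set_integrable_def by (intro integrable_scaleR_right)
  show ?thesis
  proof (rule Bochner_Integration.integrable_bound[OF i])
    have "\<phi> \<in> borel_measurable lebesgue" using test_borel[OF \<phi>] by (intro measurable_completion) simp
    then show "(\<lambda>x. g x * \<phi> x) \<in> borel_measurable lebesgue" using g by measurable
    show "AE x in lebesgue. norm (g x * \<phi> x) \<le> norm (M *\<^sub>R (indicator (cball 0 B) x *\<^sub>R g x))"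
    proof (rule AE_I2)
      fix x
      show "norm (g x * \<phi> x) \<le> norm (M *\<^sub>R (indicator (cball 0 B) x *\<^sub>R g x))"
      proof (cases "\<phi> x = 0")
        case False
        then show ?thesis using B[OF False] M(1) M(2)[of x]
          by (simp add: norm_mult mult.commute[of "cmod (g x)"] mult_right_mono)
      qed simp
    qed
  qed
qed

lemma distr_of_distribution:
  assumes g: "g \<in> borel_measurable lebesgue" and r: "0 < r" and m: "modular (\<lambda>x. cmod (g x) / r) \<le> 1"
  shows "distr_of g \<in> distributions"
proof -
  note int = integrable_times_test[OF g r m]
  have ev: "distr_of g \<phi> = (\<integral>x. g x * \<phi> x \<partial>lebesgue)" if "\<phi> \<in> test_functions" for \<phi>
    using that by (simp add: distr_of_def)
  show ?thesis
    unfolding distributions_def mem_Collect_eq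
  proof (intro conjI ballI allI impI)
    show "distr_of g \<in> extensional test_functions" by (simp add: distr_of_def)
    show "distr_of g (\<lambda>x. \<phi> x + \<psi> x) = distr_of g \<phi> + distr_of g \<psi>" if "\<phi> \<in> test_functions" "\<psi> \<in> test_functions" for \<phi> \<psi>
      using int[OF that(1)] int[OF that(2)] by (simp add: ev that test_functions_add distrib_left)
    show "distr_of g (\<lambda>x. c * \<phi> x) = c * distr_of g \<phi>" if "\<phi> \<in> test_functions" for c \<phi>
    proof -
      have "(\<integral>x. g x * (c * \<phi> x) \<partial>lebesgue) = (\<integral>x. c * (g x * \<phi> x) \<partial>lebesgue)" by (simp add: mult.left_commute)
      then show ?thesis using int[OF that] by (simp add: ev that test_functions_cmult)
    qed
    fix K :: "(real^'n) set" assume K: "compact K"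
    have "set_integrable lebesgue K g"
      by (rule set_integrable_bounded[OF g r m]) (use K in \<open>auto intro: compact_imp_bounded fmeasurableD lmeasurable_compact\<close>)
    then have i: "integrable lebesgue (\<lambda>x. indicator K x *\<^sub>R g x)" by (simp add: set_integrable_def)
    define C where "C = (\<integral>x. norm (indicator K x *\<^sub>R g x) \<partial>lebesgue)"
    show "\<exists>C m. \<forall>\<phi>\<in>test_functions. {x. \<phi> x \<noteq> 0} \<subseteq> K \<longrightarrow>
        cmod (distr_of g \<phi>) \<le> C * (\<Sum>\<alpha> | length \<alpha> \<le> m. SUP x. cmod (partials \<alpha> \<phi> x))"
    proof (intro exI[of _ C] exI[of _ 0] ballI impI)
      fix \<phi> assume \<phi>: "\<phi> \<in> test_functions" and s: "{x. \<phi> x \<noteq> 0} \<subseteq> K"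
      \<comment> \<open>The distribution has order 0: only the supremum of the test function itself
        occurs.\<close>
      define M where "M = (SUP x. cmod (\<phi> x))"
      have "bdd_above (range (\<lambda>x. cmod (\<phi> x)))" using test_function_bounded[OF \<phi>] by (elim exE conjE) (rule bdd_aboveI2, erule spec)
      then have M: "cmod (\<phi> x) \<le> M" for x unfolding M_def by (rule cSUP_upper[OF UNIV_I])
      have "cmod (distr_of g \<phi>) \<le> (\<integral>x. norm (indicator K x *\<^sub>R g x) * M \<partial>lebesgue)"
        unfolding ev[OF \<phi>]
      proof (rule integral_cmod_bound[OF int[OF \<phi>]])
        show "integrable lebesgue (\<lambda>x. norm (indicator K x *\<^sub>R g x) * M)"
          by (rule integrable_mult_left[OF integrable_norm[OF i]])
        fix x
        show "cmod (g x * \<phi> x) \<le> norm (indicator K x *\<^sub>R g x) * M"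
          using s M[of x] by (cases "\<phi> x = 0") (auto simp: norm_mult intro!: mult_left_mono mult_nonneg_nonneg order_trans[OF norm_ge_zero])
      qed
      also have "\<dots> = C * M" by (simp add: C_def)
      finally show "cmod (distr_of g \<phi>) \<le> C * (\<Sum>\<alpha> | length \<alpha> \<le> 0. SUP x. cmod (partials \<alpha> \<phi> x))"
        by (simp add: M_def)
    qed
  qed
qed

text \<open>A kernel of the class at scale t, centred at z with |z - x| < t, is bounded by t^-n and
  supported in the ball of radius K t around x. Here K is the radius 2^(3n+30) plus 1, the latter
  for the displacement of z. The averages over these balls are controlled by
  \<open>maximal_bound\<close>.\<close>

lemma hardy_le_Lp:
  obtains C where "0 < C"
    "\<And>g r. g \<in> borel_measurable lebesgue \<Longrightarrow> 0 < r \<Longrightarrow> modular (\<lambda>x. cmod (g x) / r) \<le> 1 \<Longrightarrow>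
      Lp_enorm p w (grand_max N (distr_of g)) \<le> ennreal (C * r)"
proof -
  define K0 :: real where "K0 = 2 ^ (3 * CARD('n) + 30)"
  define K where "K = K0 + 1"
  have K: "1 \<le> K" by (simp add: K_def K0_def)
  obtain C where C: "1 \<le> C" "\<And>f. f \<in> borel_measurable lebesgue \<Longrightarrow> (\<And>x. 0 \<le> f x) \<Longrightarrow> modular f \<le> 1 \<Longrightarrow>
      \<exists>G. G \<in> borel_measurable lebesgue \<and> (\<integral>\<^sup>+x. G x \<partial>lebesgue) \<le> ennreal C \<and>
        (\<forall>x t. 0 < t \<longrightarrow> t < 1 \<longrightarrow>
          ennreal ((enn2real (\<integral>\<^sup>+y\<in>ball x (K * t). ennreal (f y) \<partial>lebesgue) / t ^ CARD('n)) powr p x * w x) \<le> G x)"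
    by (rule maximal_bound[OF K]) blast
  show thesis
  proof (rule that[of C])
    show "0 < C" using C by simp
    fix g r assume g[measurable]: "g \<in> borel_measurable lebesgue" and r: "0 < r" and m: "modular (\<lambda>x. cmod (g x) / r) \<le> 1"
    define f where "f x = cmod (g x) / r" for x
    have f[measurable]: "f \<in> borel_measurable lebesgue" unfolding f_def[abs_def] by measurable
    have f0: "0 \<le> f x" for x using r by (simp add: f_def)
    have f1: "modular f \<le> 1" using m by (simp add: f_def)
    obtain G where G[measurable]: "G \<in> borel_measurable lebesgue" and Gi: "(\<integral>\<^sup>+x. G x \<partial>lebesgue) \<le> ennreal C"
      and Gp: "\<And>x t. 0 < t \<Longrightarrow> t < 1 \<Longrightarrow>
          ennreal ((enn2real (\<integral>\<^sup>+y\<in>ball x (K * t). ennreal (f y) \<partial>lebesgue) / t ^ CARD('n)) powr p x * w x) \<le> G x"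
      using C(2)[OF f f0 f1] by blast
    have single: "cmod (distr_conv (dilate t \<phi>) (distr_of g) z) \<le> r * (enn2real (\<integral>\<^sup>+y\<in>ball x (K * t). ennreal (f y) \<partial>lebesgue) / t ^ CARD('n))"
      if \<phi>: "\<phi> \<in> D_class N" and zt: "norm (z - x) < t" "t < 1" for \<phi> t z x
    proof -
      have t: "0 < t" using zt norm_ge_zero[of "z - x"] by linarith
      have \<phi>t: "\<phi> \<in> test_functions" using \<phi> by (simp add: D_class_def)
      define \<theta> where "\<theta> y = dilate t \<phi> (z - y)" for y
      have \<theta>: "\<theta> \<in> test_functions"
        using test_functions_affine[OF dilate_test[OF \<phi>t t], of "-1" z] by (simp add: \<theta>_def[abs_def])
      have \<phi>b: "cmod (\<phi> y) \<le> indicator (ball 0 K0) y" for y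
        using \<phi> unfolding D_class_def K0_def by (auto dest!: spec[of _ "[]"])
      have \<theta>b: "cmod (\<theta> y) \<le> 1 / t ^ CARD('n) * indicator (ball x (K * t)) y" for y
      proof (cases "y \<in> ball x (K * t)")
        case True
        have "cmod (\<phi> ((1 / t) *\<^sub>R (z - y))) \<le> 1" by (rule order_trans[OF \<phi>b]) (simp add: indicator_def)
        then show ?thesis using True t by (simp add: \<theta>_def dilate_def divide_right_mono)
      next
        case False
        have nb: "\<not> norm (z - y) < K0 * t"
        proof
          assume a: "norm (z - y) < K0 * t"
          have "norm (x - y) \<le> norm (z - x) + norm (z - y)"
            using norm_triangle_ineq4[of "z - y" "z - x"] by simp
          also have "\<dots> < t + K0 * t" using a zt by simp
          finally show False using False by (simp add: K_def dist_norm algebra_simps)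
        qed
        have nn: "norm ((1 / t) *\<^sub>R (z - y)) = norm (z - y) / t" unfolding norm_scaleR using t by simp
        have "\<not> norm ((1 / t) *\<^sub>R (z - y)) < K0" unfolding nn using nb t by (simp add: field_simps)
        then have "(1 / t) *\<^sub>R (z - y) \<notin> ball 0 K0" unfolding mem_ball dist_0_norm .
        then have "\<phi> ((1 / t) *\<^sub>R (z - y)) = 0" using \<phi>b[of "(1 / t) *\<^sub>R (z - y)"] by simp
        then show ?thesis using False by (simp add: \<theta>_def dilate_def)
      qed
      have "distr_conv (dilate t \<phi>) (distr_of g) z = (\<integral>y. g y * \<theta> y \<partial>lebesgue)"
        unfolding distr_conv_def \<theta>_def[symmetric] using \<theta> by (simp add: distr_of_def)
      then have "ennreal (cmod (distr_conv (dilate t \<phi>) (distr_of g) z)) \<le> (\<integral>\<^sup>+y. ennreal (norm (g y * \<theta> y)) \<partial>lebesgue)"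
        using integral_norm_bound_ennreal[OF integrable_times_test[OF g r m \<theta>]] by simp
      also have "\<dots> \<le> (\<integral>\<^sup>+y. ennreal (r / t ^ CARD('n)) * (ennreal (f y) * indicator (ball x (K * t)) y) \<partial>lebesgue)"
      proof (rule nn_integral_mono)
        fix y
        have "cmod (g y * \<theta> y) \<le> cmod (g y) * (1 / t ^ CARD('n) * indicator (ball x (K * t)) y)"
          unfolding norm_mult by (intro mult_left_mono \<theta>b) simp
        also have "\<dots> = r / t ^ CARD('n) * (f y * indicator (ball x (K * t)) y)" using r by (simp add: f_def)
        finally have "ennreal (cmod (g y * \<theta> y)) \<le> ennreal (r / t ^ CARD('n) * (f y * indicator (ball x (K * t)) y))" by (rule ennreal_leI)
        then show "ennreal (cmod (g y * \<theta> y)) \<le> ennreal (r / t ^ CARD('n)) * (ennreal (f y) * indicator (ball x (K * t)) y)"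
          by (cases "y \<in> ball x (K * t)") (use r t f0[of y] in \<open>simp_all flip: ennreal_mult\<close>)
      qed
      also have "\<dots> = ennreal (r / t ^ CARD('n)) * (\<integral>\<^sup>+y\<in>ball x (K * t). ennreal (f y) \<partial>lebesgue)"
      proof (rule nn_integral_cmult)
        have [measurable]: "ball x (K * t) \<in> sets lebesgue" by (intro fmeasurableD lmeasurable_ball)
        show "(\<lambda>y. ennreal (f y) * indicator (ball x (K * t)) y) \<in> borel_measurable lebesgue" by measurable
      qed
      also have "(\<integral>\<^sup>+y\<in>ball x (K * t). ennreal (f y) \<partial>lebesgue) = ennreal (enn2real (\<integral>\<^sup>+y\<in>ball x (K * t). ennreal (f y) \<partial>lebesgue))"
        using bounded_int_finite[OF f f0 f1 bounded_ball, of x "K * t"] by simp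
      also have "ennreal (r / t ^ CARD('n)) * ennreal (enn2real (\<integral>\<^sup>+y\<in>ball x (K * t). ennreal (f y) \<partial>lebesgue)) = ennreal (r / t ^ CARD('n) * enn2real (\<integral>\<^sup>+y\<in>ball x (K * t). ennreal (f y) \<partial>lebesgue))"
        using r t by (intro ennreal_mult[symmetric]) auto
      finally have "ennreal (cmod (distr_conv (dilate t \<phi>) (distr_of g) z)) \<le> ennreal (r / t ^ CARD('n) * enn2real (\<integral>\<^sup>+y\<in>ball x (K * t). ennreal (f y) \<partial>lebesgue))" .
      then show ?thesis using r t by (subst (asm) ennreal_le_iff) auto
    qed
    have pt: "epowr (grand_max N (distr_of g) x / ennreal (C * r)) (p x) * ennreal (w x) \<le> ennreal (1 / C) * G x" for x
    proof (cases "G x")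
      case top
      then show ?thesis using C(1) by (simp add: ennreal_mult_top)
    next
      case (real b)
      \<comment> \<open>Solving the pointwise bound by G x = b for the average gives at most (b /
        w)^(1/p) for all t at once, hence a bound of the supremum; where G is infinite nothing is to
        be shown.\<close>
      define B where "B = r * (b / w x) powr (1 / p x)"
      have B0: "0 \<le> B" using r by (simp add: B_def)
      have "grand_max N (distr_of g) x \<le> ennreal B"
        unfolding grand_max_def
      proof (rule Sup_least)
        fix s assume "s \<in> {ennreal (cmod (distr_conv (dilate t \<phi>) (distr_of g) z)) |\<phi> t z. \<phi> \<in> D_class N \<and> norm (z - x) < t \<and> t < 1}"
        then obtain \<phi> t z where s: "s = ennreal (cmod (distr_conv (dilate t \<phi>) (distr_of g) z))" "\<phi> \<in> D_class N" "norm (z - x) < t" "t < 1" by auto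
        have t: "0 < t" using s(3) norm_ge_zero[of "z - x"] by linarith
        define \<beta> where "\<beta> = enn2real (\<integral>\<^sup>+y\<in>ball x (K * t). ennreal (f y) \<partial>lebesgue) / t ^ CARD('n)"
        have \<beta>0: "0 \<le> \<beta>" using t by (simp add: \<beta>_def)
        have "ennreal (\<beta> powr p x * w x) \<le> ennreal b" using Gp[OF t s(4), of x] real by (simp add: \<beta>_def)
        then have "\<beta> powr p x * w x \<le> b" using real by simp
        then have "\<beta> powr p x \<le> b / w x" using w_pos[of x] by (simp add: field_simps)
        then have "(\<beta> powr p x) powr (1 / p x) \<le> (b / w x) powr (1 / p x)" using p_pos[of x] by (intro powr_mono2) auto
        then have "\<beta> \<le> (b / w x) powr (1 / p x)" using \<beta>0 p_pos[of x] by (simp add: powr_powr)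
        then have "r * \<beta> \<le> B" unfolding B_def using r by (intro mult_left_mono) auto
        then show "s \<le> ennreal B" using single[OF s(2-4)] by (simp add: s(1) \<beta>_def ennreal_leI)
      qed
      then have "grand_max N (distr_of g) x / ennreal (C * r) \<le> ennreal B / ennreal (C * r)" by (rule divide_right_mono_ennreal)
      then have "epowr (grand_max N (distr_of g) x / ennreal (C * r)) (p x) \<le> epowr (ennreal B / ennreal (C * r)) (p x)"
        using p_pos[of x] by (intro epowr_mono) auto
      also have "\<dots> = ennreal ((B / (C * r)) powr p x)" using B0 C(1) r by (intro epowr_divide) auto
      also have "(B / (C * r)) powr p x \<le> 1 / C * (b / w x)"
      proof -
        have "B / (C * r) = 1 / C * (b / w x) powr (1 / p x)" using r by (simp add: B_def)
        then have "(B / (C * r)) powr p x = (1 / C) powr p x * ((b / w x) powr (1 / p x)) powr p x" by (simp only: powr_mult)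
        also have "((b / w x) powr (1 / p x)) powr p x = b / w x"
          using real w_pos[of x] p_pos[of x] by (simp add: powr_powr)
        \<comment> \<open>C \<ge> 1 and p > 1 give (1 / C)^p \<le> 1 / C. So the bound C of the
          modular becomes a bound of the norm with the same constant.\<close>
        also have "(1 / C) powr p x * (b / w x) \<le> (1 / C) powr 1 * (b / w x)"
          using real w_pos[of x] p_gt_1[of x] C(1) by (intro mult_right_mono powr_mono') auto
        finally show ?thesis using C(1) by simp
      qed
      finally have "epowr (grand_max N (distr_of g) x / ennreal (C * r)) (p x) \<le> ennreal (1 / C * (b / w x))"
        by (simp add: ennreal_leI)
      then have "epowr (grand_max N (distr_of g) x / ennreal (C * r)) (p x) * ennreal (w x) \<le> ennreal (1 / C * (b / w x)) * ennreal (w x)"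
        by (rule mult_right_mono) simp
      also have "\<dots> = ennreal (1 / C * (b / w x) * w x)"
        using real w_pos[of x] C(1) by (intro ennreal_mult[symmetric]) auto
      also have "1 / C * (b / w x) * w x = 1 / C * b" using w_pos[of x] by simp
      also have "ennreal (1 / C * b) = ennreal (1 / C) * G x" using real C(1) by (subst ennreal_mult) auto
      finally show ?thesis .
    qed
    have "(\<integral>\<^sup>+x. epowr (grand_max N (distr_of g) x / ennreal (C * r)) (p x) * ennreal (w x) \<partial>lebesgue) \<le> (\<integral>\<^sup>+x. ennreal (1 / C) * G x \<partial>lebesgue)"
      by (intro nn_integral_mono pt)
    also have "\<dots> = ennreal (1 / C) * (\<integral>\<^sup>+x. G x \<partial>lebesgue)" by (rule nn_integral_cmult) measurable
    also have "\<dots> \<le> ennreal (1 / C) * ennreal C" by (intro mult_left_mono Gi) simp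
    also have "\<dots> = 1" using C(1) by (simp flip: ennreal_mult)
    finally show "Lp_enorm p w (grand_max N (distr_of g)) \<le> ennreal (C * r)"
      unfolding Lp_enorm_def using C(1) r by (intro Inf_lower) auto
  qed
qed

text \<open>One kernel \<phi> of the class, used at the scales 1 / (k + 2), is enough. The constant
  is 1 / |J| with J the integral of \<phi>, because the mollifications converge weakly to J
  f.\<close>

lemma Lp_le_hardy:
  obtains C where "0 < C"
    "\<And>f. f \<in> distributions \<Longrightarrow> Lp_enorm p w (grand_max N f) < \<infinity> \<Longrightarrow>
      \<exists>g\<in>borel_measurable lebesgue. f = distr_of g \<and>
        Lp_enorm p w (\<lambda>x. ennreal (cmod (g x))) \<le> ennreal C * Lp_enorm p w (grand_max N f)"
proof -
  obtain \<phi> :: "real^'n \<Rightarrow> complex" where \<phi>: "\<phi> \<in> D_class N" using D_class_nonempty by blast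
  have \<phi>t: "\<phi> \<in> test_functions" using \<phi> by (simp add: D_class_def)
  define J where "J = (\<integral>x. \<phi> x \<partial>lebesgue)"
  have J: "J \<noteq> 0" using \<phi> by (simp add: D_class_def J_def)
  define C where "C = 1 / cmod J"
  have C: "0 < C" using J by (simp add: C_def)
  show thesis
  proof (rule that[OF C])
    fix f :: "(real^'n \<Rightarrow> complex) \<Rightarrow> complex"
    assume f: "f \<in> distributions" and fin: "Lp_enorm p w (grand_max N f) < \<infinity>"
    define Gm where "Gm = grand_max N f"
    have [measurable]: "Gm \<in> borel_measurable lebesgue" by (simp add: Gm_def grand_max_measurable)
    define F where "F x = enn2real (Gm x)" for x
    have Fm[measurable]: "F \<in> borel_measurable lebesgue" unfolding F_def[abs_def] by measurable
    have F0: "0 \<le> F x" for x by (simp add: F_def)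
    have Fmod: "modular (\<lambda>x. F x / r) \<le> 1 \<and> (AE x in lebesgue. Gm x \<noteq> \<infinity>)"
      if r: "0 < r" and m: "(\<integral>\<^sup>+x. epowr (Gm x / ennreal r) (p x) * ennreal (w x) \<partial>lebesgue) \<le> 1" for r
    proof
      have le: "ennreal ((F x / r) powr p x * w x) \<le> epowr (Gm x / ennreal r) (p x) * ennreal (w x)" for x
      proof (cases "Gm x")
        case (real b)
        then show ?thesis using r w_pos[of x] epowr_divide[of b r "p x"] by (simp add: F_def ennreal_mult less_imp_le)
      next
        case top
        then show ?thesis using w_pos[of x] p_pos[of x] by (simp add: F_def)
      qed
      then show "modular (\<lambda>x. F x / r) \<le> 1" by (rule order_trans[OF nn_integral_mono m])
      have [measurable]: "(\<lambda>x. epowr (Gm x / ennreal r) (p x) * ennreal (w x)) \<in> borel_measurable lebesgue"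
        unfolding epowr_def by measurable
      have "AE x in lebesgue. epowr (Gm x / ennreal r) (p x) * ennreal (w x) \<noteq> \<infinity>"
        using m by (intro nn_integral_PInf_AE) (auto simp: top_unique)
      then show "AE x in lebesgue. Gm x \<noteq> \<infinity>"
      proof eventually_elim
        case (elim x)
        then show ?case using w_pos[of x] r by (auto simp: epowr_def ennreal_top_divide ennreal_top_mult)
      qed
    qed
    obtain r0 where r0: "0 < r0" "(\<integral>\<^sup>+x. epowr (Gm x / ennreal r0) (p x) * ennreal (w x) \<partial>lebesgue) \<le> 1"
      using fin unfolding Lp_enorm_def Inf_less_iff Gm_def by auto
    have GF: "AE x in lebesgue. Gm x \<noteq> \<infinity>" and Fm1: "modular (\<lambda>x. F x / r0) \<le> 1" using Fmod[OF r0] by auto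
    \<comment> \<open>The value 0 where the maximal function is infinite, which happens on a null
      set only, makes the domination by C F hold at every point; there F is 0 by
      \<open>enn2real\<close>.\<close>
    define u where "u k x = (if Gm x = \<infinity> then 0 else 1 / J * distr_conv (dilate (1 / real (k + 2)) \<phi>) f x)" for k x
    have um: "u k \<in> borel_measurable lebesgue" for k
    proof -
      have "distr_conv (dilate (1 / real (k + 2)) \<phi>) f \<in> borel_measurable borel"
        by (intro borel_measurable_continuous_onI distr_conv_weak(1)[OF f \<phi>t]) simp
      then have [measurable]: "distr_conv (dilate (1 / real (k + 2)) \<phi>) f \<in> borel_measurable lebesgue"
        by (intro measurable_completion) simp
      show ?thesis unfolding u_def[abs_def] by measurable
    qed
    have dom: "cmod (u k x) \<le> C * F x" for k x
    proof (cases "Gm x = \<infinity>")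
      case False
      have "ennreal (cmod (distr_conv (dilate (1 / real (k + 2)) \<phi>) f x)) \<le> Gm x"
        unfolding Gm_def grand_max_def
        by (intro Sup_upper CollectI exI[of _ \<phi>] exI[of _ "1 / real (k + 2)"] exI[of _ x] conjI refl \<phi>) auto
      also have "Gm x = ennreal (F x)" using False by (simp add: F_def less_top)
      finally have "cmod (distr_conv (dilate (1 / real (k + 2)) \<phi>) f x) \<le> F x" using F0 by simp
      then have "C * cmod (distr_conv (dilate (1 / real (k + 2)) \<phi>) f x) \<le> C * F x" using C by (intro mult_left_mono) auto
      then show ?thesis using False by (simp add: u_def C_def norm_mult norm_divide)
    qed (use C F0 in \<open>simp add: u_def\<close>)
    have cF: "(\<lambda>x. complex_of_real (F x)) \<in> borel_measurable lebesgue" by measurable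
    have cF1: "modular (\<lambda>x. cmod (complex_of_real (F x)) / r0) \<le> 1" using Fm1 F0 by simp
    have int: "integrable lebesgue (\<lambda>x. C * F x * cmod (\<psi> x))" if "\<psi> \<in> test_functions" for \<psi>
    proof -
      have "integrable lebesgue (\<lambda>x. C * norm (complex_of_real (F x) * \<psi> x))"
        using integrable_times_test[OF cF r0(1) cF1 that] by auto
      then show ?thesis using F0 by (simp add: norm_mult mult.assoc)
    qed
    have lim: "(\<lambda>k. \<integral>x. u k x * \<psi> x \<partial>lebesgue) \<longlonglongrightarrow> f \<psi>" if \<psi>: "\<psi> \<in> test_functions" for \<psi>
    proof -
      have "(\<integral>x. u k x * \<psi> x \<partial>lebesgue) = 1 / J * (\<integral>x. distr_conv (dilate (1 / real (k + 2)) \<phi>) f x * \<psi> x \<partial>lebesgue)" for k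
      proof -
        have \<psi>m: "\<psi> \<in> borel_measurable lebesgue" using test_borel[OF \<psi>] by (intro measurable_completion) simp
        have "distr_conv (dilate (1 / real (k + 2)) \<phi>) f \<in> borel_measurable borel"
          by (intro borel_measurable_continuous_onI distr_conv_weak(1)[OF f \<phi>t]) simp
        then have dm: "distr_conv (dilate (1 / real (k + 2)) \<phi>) f \<in> borel_measurable lebesgue"
          by (intro measurable_completion) simp
        have "(\<integral>x. u k x * \<psi> x \<partial>lebesgue) = (\<integral>x. 1 / J * (distr_conv (dilate (1 / real (k + 2)) \<phi>) f x * \<psi> x) \<partial>lebesgue)"
        proof (rule integral_cong_AE)
          show "(\<lambda>x. u k x * \<psi> x) \<in> borel_measurable lebesgue" using um \<psi>m by (rule borel_measurable_times)
          show "(\<lambda>x. 1 / J * (distr_conv (dilate (1 / real (k + 2)) \<phi>) f x * \<psi> x)) \<in> borel_measurable lebesgue"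
            using dm \<psi>m by (intro borel_measurable_times borel_measurable_const)
          show "AE x in lebesgue. u k x * \<psi> x = 1 / J * (distr_conv (dilate (1 / real (k + 2)) \<phi>) f x * \<psi> x)"
            using GF by eventually_elim (simp add: u_def)
        qed
        then show ?thesis by simp
      qed
      moreover have "(\<lambda>k. 1 / J * (\<integral>x. distr_conv (dilate (1 / real (k + 2)) \<phi>) f x * \<psi> x \<partial>lebesgue)) \<longlonglongrightarrow> 1 / J * (J * f \<psi>)"
        unfolding J_def by (intro tendsto_mult_left distr_conv_weak(2)[OF f \<phi>t \<psi>])
      ultimately show ?thesis using J by simp
    qed
    have CFm: "(\<lambda>x. C * F x) \<in> borel_measurable lebesgue" by measurable
    obtain g where g[measurable]: "g \<in> borel_measurable lebesgue" and gF: "AE x in lebesgue. cmod (g x) \<le> C * F x"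
      and gT: "\<And>\<psi>. \<psi> \<in> test_functions \<Longrightarrow> (\<integral>x. g x * \<psi> x \<partial>lebesgue) = f \<psi>"
      using dominated_weak_limit[OF um CFm dom int lim] by blast
    have "f = distr_of g"
    proof
      fix \<psi>
      have "f \<in> extensional test_functions" using f unfolding distributions_def mem_Collect_eq by (elim conjE)
      then show "f \<psi> = distr_of g \<psi>"
        using gT[of \<psi>] by (cases "\<psi> \<in> test_functions") (auto simp: distr_of_def extensional_def)
    qed
    moreover have "Lp_enorm p w (\<lambda>x. ennreal (cmod (g x))) \<le> ennreal C * Lp_enorm p w Gm"
    proof (rule Lp_enorm_le_scale[OF C])
      fix r assume r: "0 < r" and m: "(\<integral>\<^sup>+x. epowr (Gm x / ennreal r) (p x) * ennreal (w x) \<partial>lebesgue) \<le> 1"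
      have Cr: "0 < C * r" using C r by simp
      have "modular (\<lambda>x. cmod (g x) / (C * r)) \<le> modular (\<lambda>x. F x / r)"
      proof (rule nn_integral_mono_AE)
        show "AE x in lebesgue. ennreal ((cmod (g x) / (C * r)) powr p x * w x) \<le> ennreal ((F x / r) powr p x * w x)"
          using gF
        proof eventually_elim
          case (elim x)
          have "cmod (g x) / (C * r) \<le> C * F x / (C * r)" using elim Cr by (intro divide_right_mono) auto
          also have "\<dots> = F x / r" using C by simp
          finally show ?case using Cr p_pos[of x] w_pos[of x]
            by (intro ennreal_leI mult_right_mono powr_mono2) auto
        qed
      qed
      also have "\<dots> \<le> 1" using Fmod[OF r m] by simp
      finally show "Lp_enorm p w (\<lambda>x. ennreal (cmod (g x))) \<le> ennreal (C * r)"
        unfolding Lp_enorm_def using Cr Lp_enorm_real_integral[of "\<lambda>x. cmod (g x)" "C * r"] by (intro Inf_lower) auto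
    qed
    ultimately show "\<exists>g\<in>borel_measurable lebesgue. f = distr_of g \<and>
        Lp_enorm p w (\<lambda>x. ennreal (cmod (g x))) \<le> ennreal C * Lp_enorm p w (grand_max N f)"
      using g by (intro bexI[of _ g]) (auto simp: Gm_def)
  qed
qed

lemma distr_of_inject:
  assumes "g \<in> borel_measurable lebesgue" "0 < r" "modular (\<lambda>x. cmod (g x) / r) \<le> 1"
    and "g' \<in> borel_measurable lebesgue" "0 < r'" "modular (\<lambda>x. cmod (g' x) / r') \<le> 1"
    and eq: "distr_of g = distr_of g'"
  shows "AE x in lebesgue. g x = g' x"
proof -
  have "AE x in lebesgue. g x - g' x = 0"
  proof (rule du_bois_reymond)
    fix a b :: "real^'n"
    show "set_integrable lebesgue (box a b) (\<lambda>x. g x - g' x)"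
      by (intro set_integral_diff set_integrable_bounded[OF assms(1-3)] set_integrable_bounded[OF assms(4-6)]) auto
  next
    fix \<psi> :: "real^'n \<Rightarrow> complex" assume \<psi>: "\<psi> \<in> test_functions"
    have "(\<integral>x. g x * \<psi> x \<partial>lebesgue) = (\<integral>x. g' x * \<psi> x \<partial>lebesgue)"
      using fun_cong[OF eq, of \<psi>] \<psi> by (simp add: distr_of_def)
    then show "(\<integral>x. (g x - g' x) * \<psi> x \<partial>lebesgue) = 0"
      using integrable_times_test[OF assms(1-3) \<psi>] integrable_times_test[OF assms(4-6) \<psi>]
      by (simp add: left_diff_distrib)
  qed
  then show ?thesis by simp
qed

lemma Lp_space_iff:
  "g \<in> Lp_space p w \<longleftrightarrow> g \<in> borel_measurable lebesgue \<and> (\<exists>r>0. modular (\<lambda>x. cmod (g x) / r) \<le> 1)"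
proof -
  have eq: "(\<integral>\<^sup>+x. epowr (ennreal (cmod (g x)) / ennreal r) (p x) * ennreal (w x) \<partial>lebesgue) = modular (\<lambda>x. cmod (g x) / r)"
    if "0 < r" for r using that by (intro Lp_enorm_real_integral) auto
  have "Lp_norm p w g < \<infinity> \<longleftrightarrow> (\<exists>r>0. modular (\<lambda>x. cmod (g x) / r) \<le> 1)"
    unfolding Lp_norm_def Lp_enorm_def Inf_less_iff
  proof
    assume "\<exists>r>0. modular (\<lambda>x. cmod (g x) / r) \<le> 1"
    then obtain r where r: "0 < r" "modular (\<lambda>x. cmod (g x) / r) \<le> 1" by (elim exE conjE)
    show "\<exists>s\<in>{ennreal r | r. 0 < r \<and> (\<integral>\<^sup>+x. epowr (ennreal (cmod (g x)) / ennreal r) (p x) * ennreal (w x) \<partial>lebesgue) \<le> 1}. s < \<infinity>"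
    proof (rule bexI[of _ "ennreal r"])
      show "ennreal r \<in> {ennreal r | r. 0 < r \<and> (\<integral>\<^sup>+x. epowr (ennreal (cmod (g x)) / ennreal r) (p x) * ennreal (w x) \<partial>lebesgue) \<le> 1}"
        unfolding mem_Collect_eq by (rule exI[of _ r]) (use r eq[of r] in auto)
    qed simp
  qed (auto simp: eq)
  then show ?thesis by (simp add: Lp_space_def)
qed

lemma hardy_space_eq_Lp_space:
  "(\<forall>g\<in>Lp_space p w. loc_integrable g)
    \<and> hardy_space N p w = distr_of ` Lp_space p w
    \<and> (\<exists>C::real. C > 0 \<and> (\<forall>g\<in>Lp_space p w.
          hardy_norm N p w (distr_of g) \<le> ennreal C * Lp_norm p w g
        \<and> Lp_norm p w g \<le> ennreal C * hardy_norm N p w (distr_of g)))"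
proof -
  obtain C1 where C1: "0 < C1" "\<And>g r. g \<in> borel_measurable lebesgue \<Longrightarrow> 0 < r \<Longrightarrow> modular (\<lambda>x. cmod (g x) / r) \<le> 1 \<Longrightarrow>
      Lp_enorm p w (grand_max N (distr_of g)) \<le> ennreal (C1 * r)"
    by (rule hardy_le_Lp[where N = N]) blast
  obtain C2 where C2: "0 < C2" "\<And>f. f \<in> distributions \<Longrightarrow> Lp_enorm p w (grand_max N f) < \<infinity> \<Longrightarrow>
      \<exists>g\<in>borel_measurable lebesgue. f = distr_of g \<and>
        Lp_enorm p w (\<lambda>x. ennreal (cmod (g x))) \<le> ennreal C2 * Lp_enorm p w (grand_max N f)"
    by (rule Lp_le_hardy[where N = N]) blast
  have up: "hardy_norm N p w (distr_of g) \<le> ennreal C1 * Lp_norm p w g" if g: "g \<in> Lp_space p w" for g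
    unfolding hardy_norm_def Lp_norm_def
  proof (rule Lp_enorm_le_scale[OF C1(1)])
    fix r assume r: "0 < r" and m: "(\<integral>\<^sup>+x. epowr (ennreal (cmod (g x)) / ennreal r) (p x) * ennreal (w x) \<partial>lebesgue) \<le> 1"
    have "modular (\<lambda>x. cmod (g x) / r) \<le> 1" using m Lp_enorm_real_integral[of "\<lambda>x. cmod (g x)" r] r by simp
    then show "Lp_enorm p w (grand_max N (distr_of g)) \<le> ennreal (C1 * r)"
      using C1(2) r g by (simp add: Lp_space_iff)
  qed
  have in_hardy: "distr_of g \<in> hardy_space N p w" if g: "g \<in> Lp_space p w" for g
  proof -
    obtain r where r: "0 < r" "modular (\<lambda>x. cmod (g x) / r) \<le> 1" using g by (auto simp: Lp_space_iff)
    have gm: "g \<in> borel_measurable lebesgue" using g by (simp add: Lp_space_iff)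
    have "hardy_norm N p w (distr_of g) \<le> ennreal (C1 * r)" unfolding hardy_norm_def by (rule C1(2)[OF gm r])
    then show ?thesis using distr_of_distribution[OF gm r] by (auto simp: hardy_space_def intro: le_less_trans)
  qed
  have from_hardy: "\<exists>g\<in>Lp_space p w. f = distr_of g \<and> Lp_norm p w g \<le> ennreal C2 * hardy_norm N p w f"
    if f: "f \<in> hardy_space N p w" for f
  proof -
    have f1: "f \<in> distributions" "Lp_enorm p w (grand_max N f) < \<infinity>" using f by (auto simp: hardy_space_def hardy_norm_def)
    obtain g where g: "g \<in> borel_measurable lebesgue" "f = distr_of g"
      "Lp_enorm p w (\<lambda>x. ennreal (cmod (g x))) \<le> ennreal C2 * Lp_enorm p w (grand_max N f)"
      using C2(2)[OF f1] by blast
    have "Lp_enorm p w (\<lambda>x. ennreal (cmod (g x))) < \<infinity>"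
      using g(3) f1(2) by (auto simp: ennreal_mult_less_top intro: le_less_trans)
    then have "g \<in> Lp_space p w" using g(1) by (simp add: Lp_space_def Lp_norm_def)
    then show ?thesis using g by (intro bexI[of _ g]) (auto simp: Lp_norm_def hardy_norm_def)
  qed
  \<comment> \<open>The function supplied by \<open>from_hardy\<close> represents the same
    distribution as g, hence agrees with g almost everywhere and has the same norm.\<close>
  have low: "Lp_norm p w g \<le> ennreal C2 * hardy_norm N p w (distr_of g)" if g: "g \<in> Lp_space p w" for g
  proof -
    obtain g' where g': "g' \<in> Lp_space p w" "distr_of g = distr_of g'" "Lp_norm p w g' \<le> ennreal C2 * hardy_norm N p w (distr_of g)"
      using from_hardy[OF in_hardy[OF g]] by blast
    have "AE x in lebesgue. g x = g' x"
      using g g' distr_of_inject by (auto simp: Lp_space_iff)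
    then have "AE x in lebesgue. ennreal (cmod (g x)) = ennreal (cmod (g' x))" by eventually_elim simp
    then have "Lp_norm p w g = Lp_norm p w g'"
      unfolding Lp_norm_def by (intro Lp_enorm_cong_AE) auto
    then show ?thesis using g'(3) by simp
  qed
  have li: "loc_integrable g" if g: "g \<in> Lp_space p w" for g
    unfolding loc_integrable_def
  proof (intro allI impI)
    fix K :: "(real^'n) set" assume K: "compact K"
    obtain r where r: "g \<in> borel_measurable lebesgue" "0 < r" "modular (\<lambda>x. cmod (g x) / r) \<le> 1" using g by (auto simp: Lp_space_iff)
    show "g absolutely_integrable_on K"
      by (rule set_integrable_bounded[OF r]) (use K in \<open>auto intro: compact_imp_bounded fmeasurableD lmeasurable_compact\<close>)
  qed
  have bound_max: "ennreal c * z \<le> ennreal (max C1 C2) * z" if "c \<le> max C1 C2" for c z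
    using that by (intro mult_right_mono ennreal_leI) auto
  show ?thesis
  proof (intro conjI ballI exI[of _ "max C1 C2"])
    show "hardy_space N p w = distr_of ` Lp_space p w" using in_hardy from_hardy by blast
    show "max C1 C2 > 0" using C1(1) by simp
    fix g assume g: "g \<in> Lp_space p w"
    show "loc_integrable g" by (rule li[OF g])
    show "hardy_norm N p w (distr_of g) \<le> ennreal (max C1 C2) * Lp_norm p w g"
      by (rule order_trans[OF up[OF g] bound_max]) simp
    show "Lp_norm p w g \<le> ennreal (max C1 C2) * hardy_norm N p w (distr_of g)"
      by (rule order_trans[OF low[OF g] bound_max]) simp
  qed
qed

end

theorem theorem1p6:
  fixes p w :: "real^'n \<Rightarrow> real" and N :: nat
  assumes "p \<in> exponents_P \<inter> LH0 \<inter> LHinf"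
    and "w \<in> A_loc_var p"
    and "int N \<ge> N_index p w"
  shows "(\<forall>g\<in>Lp_space p w. loc_integrable g)
    \<and> hardy_space N p w = distr_of ` Lp_space p w
    \<and> (\<exists>C::real. C > 0 \<and> (\<forall>g\<in>Lp_space p w.
          hardy_norm N p w (distr_of g) \<le> ennreal C * Lp_norm p w g
        \<and> Lp_norm p w g \<le> ennreal C * hardy_norm N p w (distr_of g)))"
proof -
  have pm[measurable]: "p \<in> borel_measurable lebesgue"
    using assms(1) by (simp add: exponents_P_def variable_exponent_def)
  have minus: "1 < exponent_minus p" and plus: "exponent_plus p < \<infinity>"
    using assms(1) by (simp_all add: exponents_P_def)
  obtain c where c: "0 < c" "\<And>x y. norm (x - y) \<le> 1/2 \<Longrightarrow> \<bar>p x - p y\<bar> \<le> c / ln (1 / norm (x - y))"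
    using assms(1) by (auto simp: LH0_def)
  obtain d pinf where d: "0 < d" "\<And>x. \<bar>p x - pinf\<bar> \<le> d / ln (exp 1 + norm x)"
    using assms(1) by (auto simp: LHinf_def)
  have "\<exists>q. (1::ereal) < ereal q \<and> ereal q < exponent_minus p" using minus by (rule ereal_dense2)
  then obtain q where q: "1 < q" "ereal q < exponent_minus p" by (auto simp: one_ereal_def)
  have "\<exists>P. exponent_plus p < ereal P \<and> ereal P < \<infinity>" using plus by (rule ereal_dense2)
  then obtain P where P: "exponent_plus p < ereal P" by blast
  \<comment> \<open>The essential bounds hold almost everywhere at first; the logarithmic modulus of
    p, shared by -p, extends them to every point.\<close>
  have "AE x in lebesgue. q \<le> p x"
  proof -
    have "AE x in lebesgue. - ereal (p x) \<le> esssup lebesgue (\<lambda>x. - ereal (p x))" by (rule esssup_AE) measurable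
    then show ?thesis
    proof eventually_elim
      case (elim x)
      then have "exponent_minus p \<le> ereal (p x)" by (simp add: exponent_minus_def ereal_uminus_le_reorder)
      then have "ereal q < ereal (p x)" using q(2) by (rule less_le_trans[rotated])
      then show ?case by simp
    qed
  qed
  from log_modulus_ge[OF c this] have p_ge: "q \<le> p x" for x .
  have "AE x in lebesgue. - P \<le> - p x"
  proof -
    have "AE x in lebesgue. ereal (p x) \<le> esssup lebesgue (\<lambda>x. ereal (p x))" by (rule esssup_AE) measurable
    then show ?thesis
    proof eventually_elim
      case (elim x)
      then have "ereal (p x) < ereal P" using P unfolding exponent_plus_def by (rule le_less_trans)
      then show ?case by simp
    qed
  qed
  moreover have "\<bar>- p x - - p y\<bar> \<le> c / ln (1 / norm (x - y))" if "norm (x - y) \<le> 1/2" for x y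
    using c(2)[OF that] by (simp add: abs_minus_commute)
  ultimately have "- P \<le> - p x" for x by (intro log_modulus_ge[OF c(1), of "\<lambda>x. - p x"])
  then have p_le: "p x \<le> P" for x by simp
  have p1: "1 < p x" for x using q(1) p_ge[of x] by linarith
  obtain L where L: "\<And>a k x y z. y \<in> dcell a k x \<Longrightarrow> z \<in> dcell a k x \<Longrightarrow> \<bar>p y - p z\<bar> * ln (2 ^ (k * CARD('n))) \<le> L"
    by (rule LH0_oscillation[OF c]) (use p1 p_le in \<open>auto intro: less_imp_le less_trans[OF zero_less_one]\<close>)
  have wt: "weight w" using assms(2) by (simp add: A_loc_var_def)
  have wm: "w \<in> borel_measurable lebesgue"
  proof -
    \<comment> \<open>Local integrability makes the truncations of w to balls measurable, and w is
      their pointwise limit.\<close>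
    have "(\<lambda>x. indicator (cball 0 (real n)) x *\<^sub>R w x) \<in> borel_measurable lebesgue" for n
      using wt by (intro borel_measurable_integrable) (auto simp: weight_def loc_integrable_def set_integrable_def)
    moreover have "(\<lambda>n. indicator (cball 0 (real n)) x *\<^sub>R w x) \<longlonglongrightarrow> w x" for x
    proof (rule tendsto_eventually)
      obtain n0 :: nat where "norm x \<le> real n0" using real_arch_simple by blast
      then show "\<forall>\<^sub>F n in sequentially. indicator (cball 0 (real n)) x *\<^sub>R w x = w x"
        by (intro eventually_sequentiallyI[of n0]) (auto simp: indicator_def)
    qed
    ultimately show ?thesis by (rule borel_measurable_LIMSEQ_metric)
  qed
  \<comment> \<open>w is positive only almost everywhere. The value 1 on the exceptional null set
    changes no norm and makes the powers in the dual weight well behaved at every point.\<close>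
  define w' where "w' x = (if 0 < w x then w x else 1)" for x
  have w'm: "w' \<in> borel_measurable lebesgue" unfolding w'_def[abs_def] using wm by measurable
  have w': "0 < w' x" for x by (simp add: w'_def)
  have ae: "AE x in lebesgue. w x = w' x"
  proof -
    have "AE x in lebesgue. 0 < w x" using wt by (simp add: weight_def)
    then show ?thesis by eventually_elim (simp add: w'_def)
  qed
  obtain A where A: "1 \<le> A" "\<And>Q. Q \<in> small_cubes \<Longrightarrow> \<exists>r s. ap_pair p w' A Q r s"
    by (rule A_loc_var_pairs[OF pm p1 assms(2) w'm w' ae]) blast
  interpret ap_weight p q P L w' A d pinf
    by unfold_locales (use pm q(1) p_ge p_le L w'm w' A d in auto)
  have eq: "Lp_enorm p w h = Lp_enorm p w' h" for h by (rule Lp_enorm_cong_AE[OF ae]) simp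
  have "Lp_space p w = Lp_space p w'" "hardy_space N p w = hardy_space N p w'"
    "\<And>g. Lp_norm p w g = Lp_norm p w' g" "\<And>f. hardy_norm N p w f = hardy_norm N p w' f"
    by (simp_all add: Lp_space_def Lp_norm_def hardy_space_def hardy_norm_def eq)
  then show ?thesis using hardy_space_eq_Lp_space[of N] by simp
qed

end
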